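(* (i) Case $d=2$. Let $k\ge 1$ and $0\le m\le k$ be integers and let $1\le p\le\infty$. Then there exists a constant $C_{k,m,p}$, depending only on $k,m,p$ (in particular independent of $\alpha$), such that for every $\alpha$ with $0<\alpha\le 1$, $$B_p^{m,k}(K_\alpha):=\sup_{v\in\mathcal{T}_p^k(K_\alpha)}\frac{|v|_{m,p,K_\alpha}}{|v|_{k+1,p,K_\alpha}}\le C_{k,m,p}.$$ (ii) Case $d=3$. Let $k\ge 1$ and $0\le m\le k$ be integers and let $p$ satisfy: $2<p\le\infty$ if $k-m=0$; $\frac32<p\le\infty$ if $k=1$ and $m=0$; $1\le p\le\infty$ if $k\ge2$ and $k-m\ge1$. Then there exists a constant $C_{k,m,p}$, depending only on $k,m,p$ (in particular independent of $\alpha,\beta$), such that for all $\alpha,\beta$ with $0<\alpha\le1$, $0<\beta\le 1$, $$B_p^{m,k}(K_{\alpha\beta}):=\sup_{v\in\mathcal{T}_p^k(K_{\alpha\beta})}\frac{|v|_{m,p,K_{\alpha\beta}}}{|v|_{k+1,p,K_{\alpha\beta}}}\le C_{k,m,p}.$$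
   Context: $K_\alpha\subset\mathbb{R}^2$ is the closed triangle with vertices $(0,0),(1,0),(0,\alpha)$. $K_{\alpha\beta}\subset\mathbb{R}^3$ is the closed tetrahedron with vertices $(0,0,0),(1,0,0),(0,\alpha,0),(0,0,\beta)$. Let $K\subset\mathbb{R}^d$ ($d=2$ or $3$) be a closed triangle or tetrahedron with vertices $\mathbf{x}_1,\dots,\mathbf{x}_{d+1}$. For an integer $k\ge1$, $\Sigma^k(K)$ is the finite set of points of $K$ whose barycentric coordinates with respect to the vertices are $(a_1/k,\dots,a_{d+1}/k)$ with $a_i$ nonnegative integers and $\sum_{i=1}^{d+1}a_i=k$. $W^{k+1,p}(K)$ is the usual Sobolev space (on the interior of $K$). For all $d,k,p$ allowed in the statement, $W^{k+1,p}(K)\subset C^0(K)$ continuously, so point values are those of the continuous representative. Define $$\mathcal{T}_p^k(K):=\{v\in W^{k+1,p}(K) : v(\mathbf{x})=0 \ \text{ for all } \mathbf{x}\in\Sigma^k(K)\}.$$ Seminorms: $|v|_{0,p,K}=\|v\|_{L^p(K)}$; for $1\le p<\infty$, $|v|_{m,p,K}=\big(\sum_{|\gamma|=m}\frac{m!}{\gamma!}\|\partial^\gamma v\|_{L^p(K)}^p\big)^{1/p}$; and $|v|_{m,\infty,K}=\max_{|\gamma|=m}\|\partial^\gamma v\|_{L^\infty(K)}$, where $\gamma\in\mathbb{N}_0^d$ are multi-indices. (Dropping the weights $m!/\gamma!$ changes the seminorms only up to factors depending on $m,d,p$.) The supremum is taken over $v\neq0$; any $v\in\mathcal{T}_p^k(K)$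 with $|v|_{k+1,p,K}=0$ is zero, being a polynomial of degree at most $k$ vanishing on $\Sigma^k(K)$. *)

theory Defs
  imports "HOL-Analysis.Analysis" "HOL-Probability.Essential_Supremum"
begin

section \<open>Lebesgue spaces\<close>

text \<open>The exponent is \<open>p :: ereal\<close> with \<open>1 \<le> p \<le> \<infinity>\<close>. \<open>Lp_norm\<close> is real valued and
  meaningful only for functions satisfying \<open>in_Lp\<close>.\<close>

definition in_Lp :: "ereal \<Rightarrow> 'a measure \<Rightarrow> ('a \<Rightarrow> real) \<Rightarrow> bool" where
  "in_Lp p M f \<longleftrightarrow> f \<in> borel_measurable M \<and>
     (if p = \<infinity> then esssup M (\<lambda>x. ereal \<bar>f x\<bar>) < \<infinity>
      else integrable M (\<lambda>x. \<bar>f x\<bar> powr real_of_ereal p))"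

definition Lp_norm :: "ereal \<Rightarrow> 'a measure \<Rightarrow> ('a \<Rightarrow> real) \<Rightarrow> real" where
  "Lp_norm p M f =
     (if p = \<infinity> then real_of_ereal (esssup M (\<lambda>x. ereal \<bar>f x\<bar>))
      else (LINT x|M. \<bar>f x\<bar> powr real_of_ereal p) powr (1 / real_of_ereal p))"

section \<open>Multi-indices and test functions\<close>

definition multi_indices :: "nat \<Rightarrow> ('n::finite \<Rightarrow> nat) set" where
  "multi_indices m = {\<gamma>. (\<Sum>i\<in>UNIV. \<gamma> i) = m}"

definition partial :: "'n::finite \<Rightarrow> (real^'n \<Rightarrow> real) \<Rightarrow> real^'n \<Rightarrow> real" where
  "partial i f x = frechet_derivative f (at x) (axis i 1)"

text \<open>\<open>C\<^sup>\<infinity>\<close> on the whole space: every iterated partial derivative is everywhere (Frechet)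
  differentiable, hence also continuous.\<close>

definition smooth :: "(real^'n::finite \<Rightarrow> real) \<Rightarrow> bool" where
  "smooth f \<longleftrightarrow> (\<forall>is. foldr partial is f differentiable_on UNIV)"

text \<open>The operators are composed in increasing order of the coordinates; for smooth functions the
  order is irrelevant.\<close>

definition mpartial ::
  "('n::{finite,linorder} \<Rightarrow> nat) \<Rightarrow> (real^'n::{finite,linorder} \<Rightarrow> real) \<Rightarrow> real^'n::{finite,linorder} \<Rightarrow> real" where
  "mpartial \<gamma> f = foldr (\<lambda>i. partial i ^^ \<gamma> i) (sorted_list_of_set UNIV) f"

definition test_functions :: "(real^'n::finite) set \<Rightarrow> (real^'n \<Rightarrow> real) set" where
  "test_functions U = {\<phi>. smooth \<phi> \<and> compact (closure {x. \<phi> x \<noteq> 0}) \<and> closure {x. \<phi> x \<noteq> 0} \<subseteq> U}"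

section \<open>Weak derivatives and Sobolev spaces on an open set\<close>

definition locally_integrable :: "(real^'n::finite) set \<Rightarrow> (real^'n \<Rightarrow> real) \<Rightarrow> bool" where
  "locally_integrable U f \<longleftrightarrow> (\<forall>C. compact C \<and> C \<subseteq> U \<longrightarrow> integrable (lebesgue_on C) f)"

definition has_weak_deriv ::
  "(real^'n::{finite,linorder}) set \<Rightarrow> ('n \<Rightarrow> nat) \<Rightarrow> 
     (real^'n::{finite,linorder} \<Rightarrow> real) \<Rightarrow> (real^'n::{finite,linorder} \<Rightarrow> real) \<Rightarrow> bool" where
  "has_weak_deriv U \<gamma> v g \<longleftrightarrow> locally_integrable U v \<and> locally_integrable U g \<and>
     (\<forall>\<phi>\<in>test_functions U.
        (LINT x|lebesgue_on U. v x * mpartial \<gamma> \<phi> x) =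
        (-1) ^ (\<Sum>i\<in>UNIV. \<gamma> i) * (LINT x|lebesgue_on U. g x * \<phi> x))"

text \<open>The weak derivative is unique up to a null set, so the norms below do not depend on the
  choice.\<close>

definition weak_deriv ::
  "(real^'n::{finite,linorder}) set \<Rightarrow> ('n \<Rightarrow> nat) \<Rightarrow> 
     (real^'n::{finite,linorder} \<Rightarrow> real) \<Rightarrow> real^'n::{finite,linorder} \<Rightarrow> real" where
  "weak_deriv U \<gamma> v = (SOME g. has_weak_deriv U \<gamma> v g)"

text \<open>Elements are functions rather than classes modulo null sets; only the values on \<open>U\<close> matter.\<close>

definition Sobolev ::
  "nat \<Rightarrow> ereal \<Rightarrow> (real^'n::{finite,linorder}) set \<Rightarrow> (real^'n::{finite,linorder} \<Rightarrow> real) set" where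
  "Sobolev l p U = {v. in_Lp p (lebesgue_on U) v \<and>
     (\<forall>j\<le>l. \<forall>\<gamma>\<in>multi_indices j. \<exists>g. has_weak_deriv U \<gamma> v g \<and> in_Lp p (lebesgue_on U) g)}"

definition Sobolev_seminorm ::
  "nat \<Rightarrow> ereal \<Rightarrow> (real^'n::{finite,linorder}) set \<Rightarrow> (real^'n::{finite,linorder} \<Rightarrow> real) \<Rightarrow> real" where
  "Sobolev_seminorm m p U v =
     (if m = 0 then Lp_norm p (lebesgue_on U) v
      else if p = \<infinity> then
        Max ((\<lambda>\<gamma>. Lp_norm p (lebesgue_on U) (weak_deriv U \<gamma> v)) ` multi_indices m)
      else
        (\<Sum>\<gamma>\<in>multi_indices m. fact m / (\<Prod>i\<in>UNIV. fact (\<gamma> i)) *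
            Lp_norm p (lebesgue_on U) (weak_deriv U \<gamma> v) powr real_of_ereal p)
          powr (1 / real_of_ereal p))"

lemma finite_multi_indices: "finite (multi_indices m :: ('n::finite \<Rightarrow> nat) set)"
proof (rule finite_subset)
  show "multi_indices m \<subseteq> (UNIV :: 'n set) \<rightarrow>\<^sub>E {..m}"
    by (auto simp: multi_indices_def intro: member_le_sum)
  show "finite ((UNIV :: 'n set) \<rightarrow>\<^sub>E {..m})"
    by (intro finite_PiE) auto
qed

lemma multi_indices_nonempty: "(multi_indices m :: ('n::finite \<Rightarrow> nat) set) \<noteq> {}"
proof -
  have "(\<lambda>i. if i = (undefined :: 'n) then m else 0) \<in> multi_indices m"
    by (simp add: multi_indices_def)
  then show ?thesis by blast
qed

section \<open>Lagrange interpolation errors on a simplex\<close>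

text \<open>A simplex \<open>K\<close> is given by its vertex set \<open>V\<close>, with \<open>K = convex hull V\<close>.\<close>

definition lagrange_points :: "nat \<Rightarrow> 'a::real_vector set \<Rightarrow> 'a set" where
  "lagrange_points k V =
     {(\<Sum>x\<in>V. (real (a x) / real k) *\<^sub>R x) | a :: 'a \<Rightarrow> nat. (\<Sum>x\<in>V. a x) = k}"

lemma lagrange_points_subset:
  assumes "finite V" "k \<ge> 1"
  shows "lagrange_points k V \<subseteq> convex hull V"
proof
  fix y assume "y \<in> lagrange_points k V"
  then obtain a where y: "y = (\<Sum>x\<in>V. (real (a x) / real k) *\<^sub>R x)" and a: "(\<Sum>x\<in>V. a x) = k"
    by (auto simp: lagrange_points_def)
  have "(\<Sum>x\<in>V. real (a x) / real k) = real (\<Sum>x\<in>V. a x) / real k"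
    by (simp add: sum_divide_distrib)
  then have "(\<Sum>x\<in>V. real (a x) / real k) = 1"
    using a assms(2) by simp
  then show "y \<in> convex hull V"
    unfolding convex_hull_finite[OF assms(1)] using y
    by (auto intro!: exI[of _ "\<lambda>x. real (a x) / real k"])
qed

text \<open>The function \<open>u\<close> is the continuous representative of \<open>v\<close>; it is unique on \<open>K\<close> when the
  simplex is nondegenerate, since then \<open>K\<close> is the closure of its interior.\<close>

definition vanishing_Sobolev ::
  "nat \<Rightarrow> ereal \<Rightarrow> (real^'n::{finite,linorder}) set \<Rightarrow> (real^'n::{finite,linorder} \<Rightarrow> real) set" where
  "vanishing_Sobolev k p V =
     {v \<in> Sobolev (k + 1) p (interior (convex hull V)).
        \<exists>u. continuous_on (convex hull V) u \<and>
            (AE x in lebesgue_on (interior (convex hull V)). u x = v x) \<and>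
            (\<forall>x\<in>lagrange_points k V. u x = 0)}"

text \<open>The condition \<open>v \<noteq> 0\<close> is understood modulo null sets. The quotient is taken in \<open>ereal\<close>, where
  a positive number divided by zero is \<open>\<infinity>\<close>.\<close>

definition interp_error_const ::
  "nat \<Rightarrow> nat \<Rightarrow> ereal \<Rightarrow> (real^'n::{finite,linorder}) set \<Rightarrow> ereal" where
  "interp_error_const m k p V =
     (let U = interior (convex hull V) in
      SUP v\<in>{v \<in> vanishing_Sobolev k p V. \<not> (AE x in lebesgue_on U. v x = 0)}.
        ereal (Sobolev_seminorm m p U v) / ereal (Sobolev_seminorm (k + 1) p U v))"

definition triangle_vertices :: "real \<Rightarrow> (real^2) set" where
  "triangle_vertices \<alpha> = {vector [0, 0], vector [1, 0], vector [0, \<alpha>]}"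

definition tetrahedron_vertices :: "real \<Rightarrow> real \<Rightarrow> (real^3) set" where
  "tetrahedron_vertices \<alpha> \<beta> =
     {vector [0, 0, 0], vector [1, 0, 0], vector [0, \<alpha>, 0], vector [0, 0, \<beta>]}"

end

theory Submission
  imports Defs "HOL-Probability.Probability_Measure"
begin

text \<open>
  A divided difference of order \<open>\<bar>\<gamma>\<bar>\<close> over the lattice is an iterated average of \<open>\<partial>\<^sup>\<gamma> u\<close> along a face
  of the simplex, so the interpolation conditions make this average vanish. Wherever a trace
  inequality shows the average to be a continuous functional, the Poincare inequality bounds
  \<open>\<partial>\<^sup>\<gamma> u\<close> in \<open>L\<^sup>p\<close> by derivatives \<open>\<partial>\<^sup>\<gamma>\<^sup>+\<^sup>\<eta> u\<close>, and a downward induction on the order leaves only those of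
  order \<open>k + 1\<close>. Every term on the right differentiates at least \<open>\<gamma>\<close>; hence under the scaling
  \<open>diag \<alpha>\<close> it gains the factor \<open>\<alpha>\<^sup>\<eta> \<le> 1\<close> relative to the left-hand side, and the constant on the
  reference simplex serves all \<open>\<alpha>\<close>. Averages are bounded by \<open>W\<^sup>r\<^sup>,\<^sup>p\<close> norms through face traces
  (\<open>r\<close> the codimension, \<open>p \<ge> 1\<close>), edge traces (\<open>r = 1\<close>, \<open>p > d - 1\<close>) or point values
  (\<open>r = 2\<close>, \<open>p > d / 2\<close>), which is where the restrictions on \<open>p\<close> come from; in dimension three with
  \<open>p\<close> small the two top orders are treated together, by subtracting affine functions.

  Sobolev functions are reduced to smooth ones by averaging over small contractions of the simplex
  towards an interior cube, \<open>x \<mapsto> (1 - \<epsilon>) x + \<epsilon> (q + r z)\<close>. This needs no extension operator, but it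
  perturbs the lattice values, so all estimates on smooth functions carry a bound \<open>E\<close> for these.
\<close>

section \<open>Powers and norms on the reference simplex\<close>

text \<open>Two numbers compete. Averaging \<open>\<partial>^\<gamma> u\<close> over the face
  spanned by the support of \<open>\<gamma>\<close> costs as many further derivatives as the face
  has codimension, while only \<open>k + 1 - |\<gamma>|\<close> are available. In dimension two the
  count always succeeds. In dimension three it fails exactly for pure derivatives of order
  \<open>k\<close> (an edge has codimension two, one derivative is left) and for
  \<open>\<gamma> = 0\<close> when \<open>k = 1\<close> (codimension three, two are left). A large
  exponent makes an edge or point trace cheaper; for orders below \<open>k\<close> a pure derivative
  of order \<open>k\<close> may instead be bounded by all second derivatives of one of order
  \<open>k - 1\<close>, which is enough lower down. For \<open>p = \<infinity>\<close> an average is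
  bounded by the supremum and nothing has to be paid, so that case is argued separately and the norm
  \<open>nmp\<close> takes real exponents. In the limit the lattice error \<open>E\<close> of the
  smooth approximants is divided by \<open>\<alpha>^\<gamma>\<close>, which has no uniform lower
  bound. This is harmless: \<open>\<alpha>\<close> stays fixed while \<open>E\<close> tends to 0,
  and \<open>E\<close> then disappears from the estimate.\<close>

lemma powr_tangent_le:
  fixes s a p :: real
  assumes "0 \<le> s" "0 < a" "1 \<le> p"
  shows "p * a powr (p - 1) * s - (p - 1) * a powr p \<le> s powr p"
proof (cases "p = 1")
  case True
  then show ?thesis using assms by simp
next
  case False
  then have p: "1 < p" using assms by simp
  define q where "q = p / (p - 1)"
  have q: "1 < q" and pq: "1 / p + 1 / q = 1" using p by (auto simp: q_def field_simps)
  \<comment> \<open>With the conjugate exponent \<open>q\<close> one has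
    \<open>(a powr (p - 1)) powr q = a powr p\<close>, so Young's inequality says exactly that the
    graph of \<open>s powr p\<close> lies above its tangent at \<open>a\<close>.\<close>
  have "s * a powr (p - 1) \<le> s powr p / p + (a powr (p - 1)) powr q / q"
    using Youngs_inequality[of p q s "a powr (p - 1)"] p q pq assms by simp
  also have "(a powr (p - 1)) powr q = a powr p"
    using p by (simp add: powr_powr q_def)
  finally have "p * (s * a powr (p - 1)) \<le> p * (s powr p / p + a powr p / q)"
    using p by (intro mult_left_mono) auto
  also have "\<dots> = s powr p + (p - 1) * a powr p"
    using p by (simp add: q_def field_simps)
  finally show ?thesis by (simp add: mult_ac)
qed

text \<open>Integrate the tangent inequality at the mean \<open>a\<close>. The constant term of the
  tangent is nonpositive, so total mass at most 1 is as good as a probability measure; this lets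
  Lebesgue measure on the simplex be used unnormalised. Without integrability of the power the
  right-hand side is infinite.\<close>

lemma jensen_powr_nn:
  fixes f :: "'a \<Rightarrow> real"
  assumes M: "emeasure M (space M) \<le> 1" and f: "integrable M f" "\<And>x. 0 \<le> f x" and p: "1 \<le> p"
  shows "ennreal ((\<integral>x. f x \<partial>M) powr p) \<le> (\<integral>\<^sup>+x. ennreal (f x powr p) \<partial>M)"
proof (cases "integrable M (\<lambda>x. f x powr p)")
  case False
  then have "(\<integral>\<^sup>+x. ennreal (f x powr p) \<partial>M) = \<infinity>"
    using f(1)[THEN borel_measurable_integrable]
    by (subst (asm) integrable_iff_bounded) (auto simp: less_top[symmetric])
  then show ?thesis by simp
next
  case True
  interpret finite_measure M
    by standard (use M in \<open>auto simp: top_unique\<close>)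
  define a where "a = (\<integral>x. f x \<partial>M)"
  have a0: "0 \<le> a" using f by (simp add: a_def)
  have "a powr p \<le> (\<integral>x. f x powr p \<partial>M)"
  proof (cases "a = 0")
    case False
    then have a: "0 < a" using a0 by simp
    have m1: "measure M (space M) \<le> 1"
      using M by (simp add: emeasure_eq_measure)
    have "a powr p = p * a powr (p - 1) * a - (p - 1) * a powr p * 1"
    proof -
      have "a powr (p - 1) * a = a powr p"
        using a by (simp add: powr_mult_base powr_diff)
      then show ?thesis by (simp add: algebra_simps)
    qed
    also have "\<dots> \<le> p * a powr (p - 1) * a - (p - 1) * a powr p * measure M (space M)"
      using m1 p by (intro diff_left_mono mult_left_mono) auto
    also have "\<dots> = (\<integral>x. p * a powr (p - 1) * f x - (p - 1) * a powr p \<partial>M)"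
      using f(1) by (subst Bochner_Integration.integral_diff) (auto simp: a_def)
    also have "\<dots> \<le> (\<integral>x. f x powr p \<partial>M)"
      using True f a p by (intro integral_mono powr_tangent_le) auto
    finally show ?thesis .
  qed simp
  then show ?thesis
    using True by (subst nn_integral_eq_integral) (auto simp: a_def intro: ennreal_leI)
qed

lemma sum_powr_le_powr_sum:
  fixes b :: "'i \<Rightarrow> real"
  assumes "finite A" "\<And>i. i \<in> A \<Longrightarrow> 0 \<le> b i" "1 \<le> p"
  shows "(\<Sum>i\<in>A. b i powr p) \<le> (\<Sum>i\<in>A. b i) powr p"
proof (cases "(\<Sum>i\<in>A. b i) = 0")
  case True
  then show ?thesis using assms by (simp add: sum_nonneg_eq_0_iff)
next
  case False
  define S where "S = (\<Sum>i\<in>A. b i)"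
  have S: "0 < S" using False assms by (simp add: S_def sum_nonneg less_le)
  have "b i powr p \<le> b i * S powr (p - 1)" if "i \<in> A" for i
  proof (cases "b i = 0")
    case False
    then have "b i powr p = b i * b i powr (p - 1)"
      using assms(2)[OF that] by (simp add: powr_diff)
    moreover have "b i \<le> S"
      unfolding S_def using assms that by (intro member_le_sum) auto
    ultimately show ?thesis
      using assms(2)[OF that] assms(3) by (auto intro!: mult_left_mono powr_mono2)
  qed simp
  then have "(\<Sum>i\<in>A. b i powr p) \<le> (\<Sum>i\<in>A. b i * S powr (p - 1))"
    by (rule sum_mono)
  also have "\<dots> = S * S powr (p - 1)"
    by (simp add: S_def sum_distrib_right)
  also have "\<dots> = S powr p" using S by (simp add: powr_diff)
  finally show ?thesis by (simp add: S_def)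
qed

lemma powr_sum_le_sum_powr:
  fixes b :: "'i \<Rightarrow> real"
  assumes "finite A" "\<And>i. i \<in> A \<Longrightarrow> 0 \<le> b i" "1 \<le> p"
  shows "(\<Sum>i\<in>A. b i) powr p \<le> real (card A) powr p * (\<Sum>i\<in>A. b i powr p)"
proof (cases "A = {}")
  case False
  define m where "m = Max (b ` A)"
  have "m \<in> b ` A" unfolding m_def using False assms by (intro Max_in) auto
  then obtain j where j: "j \<in> A" "m = b j" by auto
  have "(\<Sum>i\<in>A. b i) \<le> real (card A) * m"
    using assms by (intro sum_bounded_above) (auto simp: m_def)
  then have "(\<Sum>i\<in>A. b i) powr p \<le> (real (card A) * m) powr p"
    using assms by (intro powr_mono2 sum_nonneg) auto
  also have "\<dots> = real (card A) powr p * b j powr p"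
    using j assms by (simp add: powr_mult)
  also have "\<dots> \<le> real (card A) powr p * (\<Sum>i\<in>A. b i powr p)"
    using assms j by (intro mult_left_mono member_le_sum) auto
  finally show ?thesis .
qed (use assms in simp)

section \<open>The reference simplex and its volume\<close>

definition std_sx :: "(real^'n) set" where
  "std_sx = {x. (\<forall>i. 0 \<le> x $ i) \<and> (\<Sum>i\<in>UNIV. x $ i) \<le> 1}"

lemma std_sx_component_le_1: "x \<in> std_sx \<Longrightarrow> x $ i \<le> 1"
  using member_le_sum[of i UNIV "\<lambda>i. x $ i"] by (auto simp: std_sx_def)

lemma closed_std_sx: "closed (std_sx :: (real^'n) set)"
proof -
  have "std_sx = (\<Inter>i. {x::real^'n. 0 \<le> x $ i}) \<inter> {x. (\<Sum>i\<in>UNIV. x $ i) \<le> 1}"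
    by (auto simp: std_sx_def)
  also have "closed \<dots>"
    by (intro closed_Int closed_INT ballI closed_Collect_le continuous_intros)
  finally show ?thesis .
qed

lemma bounded_std_sx: "bounded (std_sx :: (real^'n) set)"
proof -
  have "norm x \<le> real CARD('n)" if "x \<in> std_sx" for x :: "real^'n"
  proof -
    have "norm x \<le> (\<Sum>i\<in>UNIV. \<bar>x $ i\<bar>)" by (rule norm_le_l1_cart)
    also have "\<dots> \<le> (\<Sum>i\<in>(UNIV::'n set). 1)"
      using that std_sx_component_le_1[OF that] by (intro sum_mono) (auto simp: std_sx_def)
    finally show ?thesis by simp
  qed
  then show ?thesis by (auto simp: bounded_iff)
qed

lemma compact_std_sx: "compact (std_sx :: (real^'n) set)"
  using closed_std_sx bounded_std_sx compact_eq_bounded_closed by blast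

lemma std_sx_borel [measurable]: "(std_sx :: (real^'n) set) \<in> sets borel"
  using closed_std_sx by (rule borel_closed)

lemma convex_std_sx: "convex (std_sx :: (real^'n) set)"
proof (rule convexI)
  fix x y :: "real^'n" and u v :: real
  assume xy: "x \<in> std_sx" "y \<in> std_sx" and uv: "0 \<le> u" "0 \<le> v" "u + v = 1"
  have "(\<Sum>i\<in>UNIV. (u *\<^sub>R x + v *\<^sub>R y) $ i) = u * (\<Sum>i\<in>UNIV. x $ i) + v * (\<Sum>i\<in>UNIV. y $ i)"
    by (simp add: sum.distrib sum_distrib_left)
  also have "\<dots> \<le> u * 1 + v * 1"
    using xy uv by (intro add_mono mult_left_mono) (auto simp: std_sx_def)
  finally show "u *\<^sub>R x + v *\<^sub>R y \<in> std_sx"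
    using xy uv by (auto simp: std_sx_def)
qed

lemma std_sx_seg:
  assumes "x \<in> std_sx" "y \<in> std_sx" "0 \<le> t" "t \<le> 1"
  shows "(1 - t) *\<^sub>R x + t *\<^sub>R y \<in> (std_sx :: (real^'n) set)"
  using convexD[OF convex_std_sx assms(1,2), of "1 - t" t] assms by simp

lemma zero_in_std_sx: "0 \<in> std_sx" by (simp add: std_sx_def)

lemma axis_in_std_sx: "axis i 1 \<in> std_sx"
  by (auto simp: std_sx_def axis_def)

text \<open>The simplex lies in the unit cube. Mass at most 1 is the hypothesis of the Jensen
  inequalities.\<close>

lemma emeasure_std_sx_le: "emeasure lborel (std_sx :: (real^'n) set) \<le> 1"
proof -
  have "(std_sx :: (real^'n) set) \<subseteq> cbox 0 1"
    using std_sx_component_le_1 by (force simp: mem_box_cart std_sx_def)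
  then have "emeasure lborel (std_sx :: (real^'n) set) \<le> emeasure lborel (cbox 0 (1::real^'n))"
    by (intro emeasure_mono) auto
  also have "\<dots> = ennreal (\<Prod>b\<in>Basis. (1 - 0 :: real^'n) \<bullet> b)"
    by (intro emeasure_lborel_cbox) (auto simp: Basis_vec_def inner_axis)
  also have "(\<Prod>b\<in>Basis. (1 - 0 :: real^'n) \<bullet> b) = 1"
    by (intro prod.neutral) (auto simp: Basis_vec_def inner_axis)
  finally show ?thesis by simp
qed

lemma open_subset_std_sx:
  obtains B :: "(real^'n) set" where "open B" "B \<noteq> {}" "B \<subseteq> std_sx"
proof
  let ?B = "box 0 (\<chi> i. 1 / real CARD('n)) :: (real^'n) set"
  show "open ?B" by (rule open_box)
  have "(\<chi> i. 1 / (2 * real CARD('n))) \<in> ?B"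
    by (simp add: mem_box_cart field_simps)
  then show "?B \<noteq> {}" by blast
  show "?B \<subseteq> std_sx"
  proof
    fix x assume x: "x \<in> ?B"
    have "(\<Sum>i\<in>UNIV. x $ i) \<le> (\<Sum>i\<in>(UNIV::'n set). 1 / real CARD('n))"
      using x by (intro sum_mono) (simp add: mem_box_cart less_imp_le)
    then show "x \<in> std_sx"
      using x by (auto simp: std_sx_def mem_box_cart less_imp_le)
  qed
qed

definition svol :: "'n::finite itself \<Rightarrow> real" where
  "svol _ = measure lborel (std_sx :: (real^'n) set)"

lemma emeasure_std_sx_fin: "emeasure lborel (std_sx :: (real^'n) set) < \<infinity>"
  using emeasure_std_sx_le[where 'n='n] by (rule le_less_trans) simp

lemma svol_pos: "0 < svol TYPE('n::finite)"
proof -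
  obtain B :: "(real^'n) set" where B: "open B" "B \<noteq> {}" "B \<subseteq> std_sx"
    by (rule open_subset_std_sx)
  have "0 < emeasure lborel B"
    using open_not_negligible[OF B(1,2)]
    by (metis B(1) borel_open negligible_iff_null_sets not_gr_zero null_setsI
        null_sets_completionI sets_lborel)
  also have "\<dots> \<le> emeasure lborel (std_sx :: (real^'n) set)"
    using B by (intro emeasure_mono) auto
  finally show ?thesis
    using emeasure_std_sx_fin[where 'n='n]
    by (auto simp: svol_def measure_def enn2real_positive_iff less_top)
qed

section \<open>L^p norms on the reference simplex\<close>

lemma continuous_std_sx_integrable:
  fixes h :: "real^'n \<Rightarrow> real"
  assumes "continuous_on std_sx h"
  shows "set_integrable lborel std_sx h"
  unfolding set_integrable_def by (rule borel_integrable_compact[OF compact_std_sx assms])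

text \<open>The exponent is real; \<open>p = \<infinity>\<close> is treated by supremum bounds. The
  norm is applied to functions continuous on the simplex, for which the integral exists.\<close>

definition nmp :: "real \<Rightarrow> (real^'n::finite \<Rightarrow> real) \<Rightarrow> real" where
  "nmp p h = (LINT x:std_sx|lborel. \<bar>h x\<bar> powr p) powr (1 / p)"

lemma continuous_on_abs_powr:
  assumes "continuous_on S h" "1 \<le> p"
  shows "continuous_on S (\<lambda>x. \<bar>h x :: real\<bar> powr p)"
  using assms by (intro continuous_on_powr' continuous_intros) auto

lemma set_integrable_abs_powr:
  fixes h :: "real^'n \<Rightarrow> real"
  assumes "continuous_on std_sx h" "1 \<le> p"
  shows "set_integrable lborel std_sx (\<lambda>x. \<bar>h x\<bar> powr p)"
  by (intro continuous_std_sx_integrable continuous_on_abs_powr assms)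

lemma nn_set_integral_eq:
  fixes h :: "'a \<Rightarrow> real"
  assumes "set_integrable M A h" "\<And>x. x \<in> A \<Longrightarrow> 0 \<le> h x"
  shows "(\<integral>\<^sup>+x\<in>A. ennreal (h x) \<partial>M) = ennreal (LINT x:A|M. h x)"
proof -
  have "(\<integral>\<^sup>+x\<in>A. ennreal (h x) \<partial>M) = (\<integral>\<^sup>+x. ennreal (indicator A x *\<^sub>R h x) \<partial>M)"
    by (intro nn_integral_cong) (simp add: indicator_def)
  also have "\<dots> = ennreal (\<integral>x. indicator A x *\<^sub>R h x \<partial>M)"
    using assms by (intro nn_integral_eq_integral) (auto simp: set_integrable_def indicator_def)
  finally show ?thesis by (simp add: set_lebesgue_integral_def)
qed

lemma nmp_nonneg [simp]: "0 \<le> nmp p h"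
  by (simp add: nmp_def)

lemma nmp_powr:
  assumes "1 \<le> p"
  shows "nmp p h powr p = (LINT x:std_sx|lborel. \<bar>h x\<bar> powr p)"
proof -
  have "0 \<le> (LINT x:std_sx|lborel. \<bar>h x\<bar> powr p)"
    unfolding set_lebesgue_integral_def by (intro integral_nonneg_AE) (auto simp: indicator_def)
  then show ?thesis using assms by (simp add: nmp_def powr_powr)
qed

lemma nn_nmp:
  fixes h :: "real^'n \<Rightarrow> real"
  assumes "continuous_on std_sx h" "1 \<le> p"
  shows "(\<integral>\<^sup>+x\<in>std_sx. ennreal (\<bar>h x\<bar> powr p) \<partial>lborel) = ennreal (nmp p h powr p)"
  by (subst nn_set_integral_eq[OF set_integrable_abs_powr[OF assms]]) (auto simp: nmp_powr assms)

lemma nmp_leI: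
  fixes h :: "real^'n \<Rightarrow> real"
  assumes "continuous_on std_sx h" "1 \<le> p" "0 \<le> B"
    and "(\<integral>\<^sup>+x\<in>std_sx. ennreal (\<bar>h x\<bar> powr p) \<partial>lborel) \<le> ennreal (B powr p)"
  shows "nmp p h \<le> B"
proof -
  have "nmp p h powr p \<le> B powr p"
    using assms(4) unfolding nn_nmp[OF assms(1,2)] by (simp add: ennreal_le_iff)
  then show ?thesis
    using assms by (metis nmp_nonneg less_le_trans not_le powr_less_mono2 zero_less_one)
qed

text \<open>A substitute for Minkowski's inequality with the factor \<open>card A\<close>, obtained
  by comparing a power of a sum with the sum of powers in both directions. Sharp constants are
  irrelevant to the result.\<close>

lemma nmp_sum_le:
  fixes h :: "real^'n \<Rightarrow> real" and f :: "'i \<Rightarrow> real^'n \<Rightarrow> real"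
  assumes "finite A" and h: "continuous_on std_sx h" and f: "\<And>i. i \<in> A \<Longrightarrow> continuous_on std_sx (f i)"
    and p: "1 \<le> p" and le: "\<And>x. x \<in> std_sx \<Longrightarrow> \<bar>h x\<bar> \<le> (\<Sum>i\<in>A. \<bar>f i x\<bar>)"
  shows "nmp p h \<le> real (card A) * (\<Sum>i\<in>A. nmp p (f i))"
proof (rule nmp_leI[OF h p])
  show "0 \<le> real (card A) * (\<Sum>i\<in>A. nmp p (f i))" by (simp add: sum_nonneg)
  have "(LINT x:std_sx|lborel. \<bar>h x\<bar> powr p) \<le> (LINT x:std_sx|lborel. real (card A) powr p * (\<Sum>i\<in>A. \<bar>f i x\<bar> powr p))"
  proof (rule set_integral_mono)
    show "set_integrable lborel std_sx (\<lambda>x. real (card A) powr p * (\<Sum>i\<in>A. \<bar>f i x\<bar> powr p))"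
      using f p by (intro continuous_std_sx_integrable continuous_intros continuous_on_abs_powr) auto
    fix x :: "real^'n" assume x: "x \<in> std_sx"
    have "\<bar>h x\<bar> powr p \<le> (\<Sum>i\<in>A. \<bar>f i x\<bar>) powr p"
      using le[OF x] p by (intro powr_mono2) auto
    also have "\<dots> \<le> real (card A) powr p * (\<Sum>i\<in>A. \<bar>f i x\<bar> powr p)"
      using assms by (intro powr_sum_le_sum_powr) auto
    finally show "\<bar>h x\<bar> powr p \<le> real (card A) powr p * (\<Sum>i\<in>A. \<bar>f i x\<bar> powr p)" .
  qed (rule set_integrable_abs_powr[OF h p])
  also have "\<dots> = real (card A) powr p * (\<Sum>i\<in>A. nmp p (f i) powr p)"
    using set_integrable_abs_powr[OF f p]
    by (simp add: nmp_powr[OF p] set_lebesgue_integral_def set_integrable_def scaleR_sum_right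
        Bochner_Integration.integral_sum[symmetric] sum_distrib_left[symmetric] mult.left_commute[of "indicator _ _"])
  also have "\<dots> \<le> real (card A) powr p * (\<Sum>i\<in>A. nmp p (f i)) powr p"
    using assms by (intro mult_left_mono sum_powr_le_powr_sum) auto
  also have "\<dots> = (real (card A) * (\<Sum>i\<in>A. nmp p (f i))) powr p"
    by (simp add: powr_mult sum_nonneg)
  finally show "(\<integral>\<^sup>+x\<in>std_sx. ennreal (\<bar>h x\<bar> powr p) \<partial>lborel) \<le> ennreal ((real (card A) * (\<Sum>i\<in>A. nmp p (f i))) powr p)"
    unfolding nn_nmp[OF h p] nmp_powr[OF p] by (rule ennreal_leI)
qed

lemma nmp_le_const:
  fixes h :: "real^'n \<Rightarrow> real"
  assumes h: "continuous_on std_sx h" and p: "1 \<le> p" and le: "\<And>x. x \<in> std_sx \<Longrightarrow> \<bar>h x\<bar> \<le> c"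
  shows "nmp p h \<le> c"
proof (rule nmp_leI[OF h p])
  show "0 \<le> c" using le[OF zero_in_std_sx] by simp
  have "(\<integral>\<^sup>+x\<in>std_sx. ennreal (\<bar>h x\<bar> powr p) \<partial>lborel) \<le> (\<integral>\<^sup>+x\<in>(std_sx::(real^'n) set). ennreal (c powr p) \<partial>lborel)"
    using le p by (intro nn_integral_mono) (auto simp: indicator_def intro!: ennreal_leI powr_mono2)
  also have "\<dots> = ennreal (c powr p) * emeasure lborel (std_sx::(real^'n) set)"
    by (simp add: nn_integral_cmult_indicator)
  also have "\<dots> \<le> ennreal (c powr p) * 1"
    by (intro mult_left_mono emeasure_std_sx_le) auto
  finally show "(\<integral>\<^sup>+x\<in>std_sx. ennreal (\<bar>h x\<bar> powr p) \<partial>lborel) \<le> ennreal (c powr p)" by simp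
qed

lemma nmp_add_le:
  fixes h :: "real^'n \<Rightarrow> real"
  assumes h: "continuous_on std_sx h" "continuous_on std_sx f" "continuous_on std_sx g" and p: "1 \<le> p"
    and le: "\<And>x. x \<in> std_sx \<Longrightarrow> \<bar>h x\<bar> \<le> \<bar>f x\<bar> + \<bar>g x\<bar>"
  shows "nmp p h \<le> 2 * (nmp p f + nmp p g)"
  using nmp_sum_le[of "UNIV::bool set" h "\<lambda>b. if b then f else g" p] assms by (simp add: UNIV_bool add.commute)

text \<open>Jensen, the volume being at most 1. Face traces are proved in \<open>L^1\<close> and
  reach \<open>L^p\<close> through this inequality.\<close>

lemma integral_le_nmp:
  fixes h :: "real^'n \<Rightarrow> real"
  assumes h: "continuous_on std_sx h" and p: "1 \<le> p"
  shows "(LINT x:std_sx|lborel. \<bar>h x\<bar>) \<le> nmp p h"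
proof -
  let ?M = "restrict_space lborel (std_sx :: (real^'n) set)"
  have 1: "emeasure ?M (space ?M) \<le> 1"
    using emeasure_std_sx_le by (simp add: emeasure_restrict_space space_restrict_space)
  have 2: "integrable ?M (\<lambda>x. \<bar>h x\<bar>)"
    using continuous_std_sx_integrable[of "\<lambda>x. \<bar>h x\<bar>"] h
    by (subst integrable_restrict_space) (auto simp: set_integrable_def continuous_on_rabs)
  have "ennreal ((\<integral>x. \<bar>h x\<bar> \<partial>?M) powr p) \<le> (\<integral>\<^sup>+x. ennreal (\<bar>h x\<bar> powr p) \<partial>?M)"
    by (rule jensen_powr_nn[OF 1 2 _ p]) simp
  also have "\<dots> = (\<integral>\<^sup>+x\<in>std_sx. ennreal (\<bar>h x\<bar> powr p) \<partial>lborel)"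
    by (subst nn_integral_restrict_space) auto
  also have "\<dots> = ennreal (nmp p h powr p)" by (rule nn_nmp[OF h p])
  finally have "(\<integral>x. \<bar>h x\<bar> \<partial>?M) powr p \<le> nmp p h powr p"
    by (simp add: ennreal_le_iff)
  then have "(\<integral>x. \<bar>h x\<bar> \<partial>?M) \<le> nmp p h"
    using p by (metis nmp_nonneg less_le_trans not_le powr_less_mono2 zero_less_one)
  then show ?thesis
    by (subst (asm) integral_restrict_space) (auto simp: set_lebesgue_integral_def)
qed

section \<open>Jets and the Poincare inequality\<close>

abbreviation inc :: "('n \<Rightarrow> nat) \<Rightarrow> 'n \<Rightarrow> 'n \<Rightarrow> nat" where
  "inc \<gamma> i \<equiv> \<gamma>(i := Suc (\<gamma> i))"

text \<open>A jet is the family of all partial derivatives of a smooth function \<open>G (\<lambda>_. 0)\<close>, indexed by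
  multi-indices; working with jets avoids iterated derivative operators.\<close>

definition jet :: "(('n \<Rightarrow> nat) \<Rightarrow> real^'n \<Rightarrow> real) \<Rightarrow> bool" where
  "jet G \<longleftrightarrow> (\<forall>\<gamma> x. (G \<gamma> has_derivative (\<lambda>h. \<Sum>i\<in>UNIV. h $ i * G (inc \<gamma> i) x)) (at x))"

lemma jetD: "jet G \<Longrightarrow> (G \<gamma> has_derivative (\<lambda>h. \<Sum>i\<in>UNIV. h $ i * G (inc \<gamma> i) x)) (at x within S)"
  unfolding jet_def by (blast intro: has_derivative_at_withinI)

lemma jet_continuous: "jet G \<Longrightarrow> continuous_on S (G \<gamma>)"
  by (meson has_derivative_continuous_on jetD)

lemma jet_measurable: "jet G \<Longrightarrow> G \<gamma> \<in> borel_measurable borel"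
  by (intro borel_measurable_continuous_onI jet_continuous)

lemma jet_line_deriv:
  assumes "jet G"
  shows "((\<lambda>t. G \<gamma> (x + t *\<^sub>R v)) has_real_derivative (\<Sum>i\<in>UNIV. v $ i * G (inc \<gamma> i) (x + t *\<^sub>R v))) (at t within S)"
proof -
  have "((\<lambda>t. x + t *\<^sub>R v) has_derivative (\<lambda>t. t *\<^sub>R v)) (at t within S)"
    by (auto intro!: derivative_eq_intros)
  then have "((\<lambda>t. G \<gamma> (x + t *\<^sub>R v)) has_derivative
      (\<lambda>s. \<Sum>i\<in>UNIV. (s *\<^sub>R v) $ i * G (inc \<gamma> i) (x + t *\<^sub>R v))) (at t within S)"
    by (rule has_derivative_compose) (rule jetD[OF assms])
  then show ?thesis
    unfolding has_field_derivative_def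
    by (rule has_derivative_eq_rhs) (simp add: fun_eq_iff sum_distrib_left mult_ac)
qed

lemma jet_shift:
  assumes "jet G"
  shows "jet (\<lambda>\<eta>. G (\<lambda>i. \<gamma> i + \<eta> i))"
  unfolding jet_def
proof (intro allI)
  fix \<eta> x
  have "inc (\<lambda>i. \<gamma> i + \<eta> i) j = (\<lambda>i. \<gamma> i + inc \<eta> j i)" for j
    by auto
  then show "(G (\<lambda>i. \<gamma> i + \<eta> i) has_derivative (\<lambda>h. \<Sum>j\<in>UNIV. h $ j * G (\<lambda>i. \<gamma> i + inc \<eta> j i) x)) (at x)"
    using jetD[OF assms, of "\<lambda>i. \<gamma> i + \<eta> i" x UNIV] by simp
qed

definition grad1 :: "(('n::finite \<Rightarrow> nat) \<Rightarrow> real^'n \<Rightarrow> real) \<Rightarrow> ('n \<Rightarrow> nat) \<Rightarrow> real^'n \<Rightarrow> real" where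
  "grad1 G \<gamma> x = (\<Sum>i\<in>UNIV. \<bar>G (inc \<gamma> i) x\<bar>)"

lemma grad1_nonneg [simp]: "0 \<le> grad1 G \<gamma> x"
  by (simp add: grad1_def sum_nonneg)

lemma grad1_continuous: "jet G \<Longrightarrow> continuous_on S (grad1 G \<gamma>)"
  unfolding grad1_def by (intro continuous_intros jet_continuous)

lemma grad1_measurable: "jet G \<Longrightarrow> grad1 G \<gamma> \<in> borel_measurable borel"
  by (intro borel_measurable_continuous_onI grad1_continuous)

lemma std_sx_diff_le:
  assumes "x \<in> std_sx" "y \<in> std_sx"
  shows "\<bar>(x - y) $ i\<bar> \<le> 1"
proof -
  have "0 \<le> x $ i" "0 \<le> y $ i" using assms by (auto simp: std_sx_def)
  then show ?thesis
    using std_sx_component_le_1[OF assms(1), of i] std_sx_component_le_1[OF assms(2), of i]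
    by (simp add: abs_le_iff)
qed

lemma seg_eq: "(1 - t) *\<^sub>R x + t *\<^sub>R y = x + t *\<^sub>R (y - x)" for x :: "'a::real_vector"
  by (simp add: algebra_simps)

text \<open>The fundamental theorem of calculus along the segment. Two points of the simplex differ
  by at most 1 in each coordinate, so the \<open>l^1\<close> norm \<open>grad1\<close> of the
  gradient dominates the directional derivative without a factor for the length.\<close>

lemma jet_segment_bound:
  assumes G: "jet G" and xy: "x \<in> std_sx" "y \<in> std_sx" and ab: "a \<le> b"
  shows "ennreal \<bar>G \<gamma> ((1 - b) *\<^sub>R x + b *\<^sub>R y) - G \<gamma> ((1 - a) *\<^sub>R x + a *\<^sub>R y)\<bar>
    \<le> (\<integral>\<^sup>+t\<in>{a..b}. ennreal (grad1 G \<gamma> ((1 - t) *\<^sub>R x + t *\<^sub>R y)) \<partial>lborel)"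
proof -
  define f where "f t = (\<Sum>i\<in>UNIV. (y - x) $ i * G (inc \<gamma> i) (x + t *\<^sub>R (y - x)))" for t
  have cf: "continuous_on UNIV f"
    unfolding f_def
    by (intro continuous_intros continuous_on_compose2[OF jet_continuous[OF G, of UNIV]]) auto
  have le: "\<bar>f t\<bar> \<le> grad1 G \<gamma> ((1 - t) *\<^sub>R x + t *\<^sub>R y)" for t
    unfolding f_def grad1_def seg_eq
    by (intro order_trans[OF sum_abs] sum_mono)
       (auto simp: abs_mult intro!: mult_left_le_one_le std_sx_diff_le[OF xy(2,1), simplified])
  have *: "has_bochner_integral lborel (\<lambda>t. indicator {a..b} t *\<^sub>R f t)
      (G \<gamma> (x + b *\<^sub>R (y - x)) - G \<gamma> (x + a *\<^sub>R (y - x)))"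
    using ab
    by (intro has_bochner_integral_FTC_Icc)
       (auto simp: has_real_derivative_iff_has_vector_derivative[symmetric] f_def
         simp del: vector_minus_component
         intro!: jet_line_deriv[OF G] continuous_on_subset[OF cf[unfolded f_def]])
  have "ennreal \<bar>G \<gamma> ((1 - b) *\<^sub>R x + b *\<^sub>R y) - G \<gamma> ((1 - a) *\<^sub>R x + a *\<^sub>R y)\<bar>
      \<le> (\<integral>\<^sup>+t. ennreal (norm (indicator {a..b} t *\<^sub>R f t)) \<partial>lborel)"
    unfolding seg_eq has_bochner_integral_integral_eq[OF *, symmetric]
    using integral_norm_bound_ennreal[OF integrable.intros[OF *]]
    by simp
  also have "\<dots> \<le> (\<integral>\<^sup>+t\<in>{a..b}. ennreal (grad1 G \<gamma> ((1 - t) *\<^sub>R x + t *\<^sub>R y)) \<partial>lborel)"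
    using le by (intro nn_integral_mono) (auto simp: indicator_def intro!: ennreal_leI)
  finally show ?thesis .
qed

section \<open>Integrals over segments and the Poincare inequality\<close>

lemma nn_integral_affine:
  fixes h :: "'a::euclidean_space \<Rightarrow> ennreal" and c :: real
  assumes [measurable]: "h \<in> borel_measurable borel" and c: "c \<noteq> 0"
  shows "(\<integral>\<^sup>+x. h (a + c *\<^sub>R x) \<partial>lborel) = ennreal (1 / \<bar>c\<bar> ^ DIM('a)) * (\<integral>\<^sup>+x. h x \<partial>lborel)"
proof -
  have "(\<integral>\<^sup>+x. h x \<partial>lborel) = ennreal (\<bar>c\<bar> ^ DIM('a)) * (\<integral>\<^sup>+x. h (a + c *\<^sub>R x) \<partial>lborel)"
    by (subst lborel_affine[OF c, of a])
       (simp add: nn_integral_density nn_integral_distr nn_integral_cmult)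
  then show ?thesis
    using c by (simp add: mult.assoc[symmetric] ennreal_mult[symmetric])
qed

lemma nn_integral_affine_le:
  fixes h :: "'a::euclidean_space \<Rightarrow> ennreal" and c :: real
  assumes h: "h \<in> borel_measurable borel" and c: "1 / 2 \<le> c"
  shows "(\<integral>\<^sup>+x. h (a + c *\<^sub>R x) \<partial>lborel) \<le> ennreal (2 ^ DIM('a)) * (\<integral>\<^sup>+x. h x \<partial>lborel)"
proof -
  have "(1 / 2) ^ DIM('a) \<le> \<bar>c\<bar> ^ DIM('a)" using c by (intro power_mono) auto
  then have "1 / \<bar>c\<bar> ^ DIM('a) \<le> 2 ^ DIM('a)"
    using c by (simp add: field_simps power_divide)
  then show ?thesis
    using c by (subst nn_integral_affine[OF h]) (auto intro!: mult_right_mono ennreal_leI)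
qed

text \<open>For each \<open>t\<close> one of the two coefficients is at least 1/2. The affine
  substitution is made in \<open>z\<close> when \<open>t \<ge> 1 / 2\<close> and in \<open>x\<close>
  otherwise, so its Jacobian costs at most \<open>2 ^ CARD('n)\<close>; the remaining variable
  contributes the volume of the simplex, at most 1. The lemma is applied to a function cut off
  outside the simplex.\<close>

lemma segment_average_bound:
  fixes h :: "real^'n \<Rightarrow> ennreal"
  assumes [measurable]: "h \<in> borel_measurable borel"
  shows "(\<integral>\<^sup>+x\<in>std_sx. (\<integral>\<^sup>+z\<in>std_sx. (\<integral>\<^sup>+t\<in>{0..1}. h ((1 - t) *\<^sub>R x + t *\<^sub>R z) \<partial>lborel) \<partial>lborel) \<partial>lborel)
    \<le> ennreal (2 ^ CARD('n)) * (\<integral>\<^sup>+x. h x \<partial>lborel)"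
proof -
  let ?K = "std_sx :: (real^'n) set"
  let ?B = "ennreal (2 ^ CARD('n)) * (\<integral>\<^sup>+x. h x \<partial>lborel)"
  have "(\<integral>\<^sup>+x\<in>?K. (\<integral>\<^sup>+z\<in>?K. (\<integral>\<^sup>+t\<in>{0..1}. h ((1 - t) *\<^sub>R x + t *\<^sub>R z) \<partial>lborel) \<partial>lborel) \<partial>lborel)
     = (\<integral>\<^sup>+x. (\<integral>\<^sup>+z. (\<integral>\<^sup>+t. h ((1 - t) *\<^sub>R x + t *\<^sub>R z) * indicator {0..1} t * indicator ?K z * indicator ?K x \<partial>lborel) \<partial>lborel) \<partial>lborel)"
    by (simp add: nn_integral_multc)
  also have "\<dots> = (\<integral>\<^sup>+x. (\<integral>\<^sup>+t. (\<integral>\<^sup>+z. h ((1 - t) *\<^sub>R x + t *\<^sub>R z) * indicator {0..1} t * indicator ?K z * indicator ?K x \<partial>lborel) \<partial>lborel) \<partial>lborel)"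
    by (intro nn_integral_cong lborel_pair.Fubini') measurable
  also have "\<dots> = (\<integral>\<^sup>+t. (\<integral>\<^sup>+x. (\<integral>\<^sup>+z. h ((1 - t) *\<^sub>R x + t *\<^sub>R z) * indicator {0..1} t * indicator ?K z * indicator ?K x \<partial>lborel) \<partial>lborel) \<partial>lborel)"
    by (intro lborel_pair.Fubini') measurable
  also have "\<dots> \<le> (\<integral>\<^sup>+t. ?B * indicator {0..1} (t::real) \<partial>lborel)"
  proof (rule nn_integral_mono)
    fix t :: real
    show "(\<integral>\<^sup>+x. (\<integral>\<^sup>+z. h ((1 - t) *\<^sub>R x + t *\<^sub>R z) * indicator {0..1} t * indicator ?K z * indicator ?K x \<partial>lborel) \<partial>lborel) \<le> ?B * indicator {0..1} t"
    proof (cases "t \<in> {0..1}")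
      case t: True
      show ?thesis
      proof (cases "1 / 2 \<le> t")
        case True
        have "(\<integral>\<^sup>+x. (\<integral>\<^sup>+z. h ((1 - t) *\<^sub>R x + t *\<^sub>R z) * indicator {0..1} t * indicator ?K z * indicator ?K x \<partial>lborel) \<partial>lborel)
          \<le> (\<integral>\<^sup>+x. (\<integral>\<^sup>+z. h ((1 - t) *\<^sub>R x + t *\<^sub>R z) * indicator ?K x \<partial>lborel) \<partial>lborel)"
          by (intro nn_integral_mono) (auto simp: indicator_def)
        also have "\<dots> \<le> (\<integral>\<^sup>+x. ?B * indicator ?K x \<partial>lborel)"
          using nn_integral_affine_le[OF assms True]
          by (intro nn_integral_mono) (auto simp: indicator_def)
        also have "\<dots> = ?B * emeasure lborel ?K" by (simp add: nn_integral_cmult_indicator)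
        also have "\<dots> \<le> ?B * 1" by (intro mult_left_mono emeasure_std_sx_le) auto
        finally show ?thesis using t by simp
      next
        case False
        have "(\<integral>\<^sup>+x. (\<integral>\<^sup>+z. h ((1 - t) *\<^sub>R x + t *\<^sub>R z) * indicator {0..1} t * indicator ?K z * indicator ?K x \<partial>lborel) \<partial>lborel)
          = (\<integral>\<^sup>+z. (\<integral>\<^sup>+x. h ((1 - t) *\<^sub>R x + t *\<^sub>R z) * indicator {0..1} t * indicator ?K z * indicator ?K x \<partial>lborel) \<partial>lborel)"
          by (rule lborel_pair.Fubini') measurable
        also have "\<dots> \<le> (\<integral>\<^sup>+z. (\<integral>\<^sup>+x. h (t *\<^sub>R z + (1 - t) *\<^sub>R x) * indicator ?K z \<partial>lborel) \<partial>lborel)"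
          by (intro nn_integral_mono) (auto simp: indicator_def add.commute)
        also have "\<dots> \<le> (\<integral>\<^sup>+z. ?B * indicator ?K z \<partial>lborel)"
          using nn_integral_affine_le[OF assms, of "1 - t"] False
          by (intro nn_integral_mono) (auto simp: indicator_def)
        also have "\<dots> = ?B * emeasure lborel ?K" by (simp add: nn_integral_cmult_indicator)
        also have "\<dots> \<le> ?B * 1" by (intro mult_left_mono emeasure_std_sx_le) auto
        finally show ?thesis using t by simp
      qed
    qed simp
  qed
  also have "\<dots> = ?B" by (simp add: nn_integral_cmult_indicator)
  finally show ?thesis .
qed

definition avg :: "(real^'n::finite \<Rightarrow> real) \<Rightarrow> real" where
  "avg f = (LINT x:std_sx|lborel. f x) / svol TYPE('n)"

lemma jet_diff_powr_bound:
  assumes G: "jet G" and xy: "x \<in> std_sx" "y \<in> std_sx" and p: "1 \<le> p"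
  shows "ennreal (\<bar>G \<gamma> y - G \<gamma> x\<bar> powr p)
    \<le> (\<integral>\<^sup>+t\<in>{0..1}. ennreal (grad1 G \<gamma> ((1 - t) *\<^sub>R x + t *\<^sub>R y) powr p) \<partial>lborel)"
proof -
  let ?M = "restrict_space lborel {0..1::real}"
  let ?f = "\<lambda>t. grad1 G \<gamma> ((1 - t) *\<^sub>R x + t *\<^sub>R y)"
  have 1: "emeasure ?M (space ?M) \<le> 1" by (simp add: emeasure_restrict_space space_restrict_space)
  have cf: "continuous_on {0..1} ?f"
    by (intro continuous_on_compose2[OF grad1_continuous[OF G, of UNIV]] continuous_intros) auto
  have i: "set_integrable lborel {0..1} ?f"
    by (rule borel_integrable_atLeastAtMost'[OF cf])
  have 2: "integrable ?M ?f"
    using i by (subst integrable_restrict_space) (auto simp: set_integrable_def)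
  have "ennreal \<bar>G \<gamma> y - G \<gamma> x\<bar> \<le> (\<integral>\<^sup>+t\<in>{0..1}. ennreal (?f t) \<partial>lborel)"
    using jet_segment_bound[OF G xy, of 0 1 \<gamma>] by simp
  also have "\<dots> = ennreal (LINT t:{0..1}|lborel. ?f t)"
    by (rule nn_set_integral_eq[OF i]) simp
  also have "(LINT t:{0..1}|lborel. ?f t) = (\<integral>t. ?f t \<partial>?M)"
    by (subst integral_restrict_space) (auto simp: set_lebesgue_integral_def)
  finally have "\<bar>G \<gamma> y - G \<gamma> x\<bar> \<le> (\<integral>t. ?f t \<partial>?M)"
    by (subst (asm) ennreal_le_iff) (auto intro!: integral_nonneg_AE)
  then have "ennreal (\<bar>G \<gamma> y - G \<gamma> x\<bar> powr p) \<le> ennreal ((\<integral>t. ?f t \<partial>?M) powr p)"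
    using p by (intro ennreal_leI powr_mono2) auto
  also have "\<dots> \<le> (\<integral>\<^sup>+t. ennreal (?f t powr p) \<partial>?M)"
    by (rule jensen_powr_nn[OF 1 2 _ p]) simp
  also have "\<dots> = (\<integral>\<^sup>+t\<in>{0..1}. ennreal (?f t powr p) \<partial>lborel)"
    by (subst nn_integral_restrict_space) auto
  finally show ?thesis .
qed

text \<open>Jensen in \<open>z\<close>. The factor is the \<open>p\<close>-th power of
  \<open>1 / svol\<close> because the measure on the simplex is not normalised.\<close>

lemma diff_avg_powr_bound:
  fixes f :: "real^'n \<Rightarrow> real"
  assumes f: "continuous_on std_sx f" and p: "1 \<le> p"
  shows "ennreal (\<bar>a - avg f\<bar> powr p) \<le> ennreal ((1 / svol TYPE('n)) powr p) * (\<integral>\<^sup>+z\<in>std_sx. ennreal (\<bar>f z - a\<bar> powr p) \<partial>lborel)"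
proof -
  let ?M = "restrict_space lborel (std_sx :: (real^'n) set)"
  let ?v = "svol TYPE('n)"
  have v: "0 < ?v" by (rule svol_pos)
  have cd: "continuous_on std_sx (\<lambda>z. \<bar>f z - a\<bar>)" by (intro continuous_intros f)
  have 1: "emeasure ?M (space ?M) \<le> 1"
    using emeasure_std_sx_le by (simp add: emeasure_restrict_space space_restrict_space)
  have 2: "integrable ?M (\<lambda>z. \<bar>f z - a\<bar>)"
    using continuous_std_sx_integrable[OF cd] 
    by (subst integrable_restrict_space) (auto simp: set_integrable_def)
  have "a * ?v - (LINT z:std_sx|lborel. f z) = (LINT z:std_sx|lborel. a - f z)"
    using continuous_std_sx_integrable[OF f] continuous_std_sx_integrable[of "\<lambda>_::real^'n. a"]
    by (subst set_integral_diff) (auto simp: svol_def set_lebesgue_integral_def)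
  then have "a - avg f = (LINT z:std_sx|lborel. a - f z) / ?v"
    using v by (simp add: avg_def field_simps)
  then have "\<bar>a - avg f\<bar> = \<bar>LINT z:std_sx|lborel. a - f z\<bar> / ?v" using v by simp
  also have "\<dots> \<le> (LINT z:std_sx|lborel. \<bar>f z - a\<bar>) / ?v"
    using v set_integral_norm_bound[OF continuous_std_sx_integrable[of "\<lambda>z. a - f z"]] f
    by (intro divide_right_mono) (auto simp: continuous_on_diff abs_minus_commute)
  also have "(LINT z:std_sx|lborel. \<bar>f z - a\<bar>) = (\<integral>z. \<bar>f z - a\<bar> \<partial>?M)"
    by (subst integral_restrict_space) (auto simp: set_lebesgue_integral_def)
  finally have "\<bar>a - avg f\<bar> powr p \<le> ((\<integral>z. \<bar>f z - a\<bar> \<partial>?M) / ?v) powr p"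
    using p by (intro powr_mono2) auto
  also have "\<dots> = (1 / ?v) powr p * (\<integral>z. \<bar>f z - a\<bar> \<partial>?M) powr p"
    using v by (simp add: powr_divide)
  finally have "ennreal (\<bar>a - avg f\<bar> powr p) \<le> ennreal ((1 / ?v) powr p) * ennreal ((\<integral>z. \<bar>f z - a\<bar> \<partial>?M) powr p)"
    by (simp add: ennreal_mult[symmetric] ennreal_leI)
  also have "\<dots> \<le> ennreal ((1 / ?v) powr p) * (\<integral>\<^sup>+z. ennreal (\<bar>f z - a\<bar> powr p) \<partial>?M)"
    by (intro mult_left_mono jensen_powr_nn[OF 1 2 _ p]) auto
  also have "(\<integral>\<^sup>+z. ennreal (\<bar>f z - a\<bar> powr p) \<partial>?M) = (\<integral>\<^sup>+z\<in>std_sx. ennreal (\<bar>f z - a\<bar> powr p) \<partial>lborel)"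
    by (subst nn_integral_restrict_space) auto
  finally show ?thesis .
qed

text \<open>The deviation from the mean at \<open>x\<close> is an average over \<open>z\<close> of
  differences, each bounded by the integral of the gradient over the segment from \<open>x\<close>
  to \<open>z\<close>; \<open>segment_average_bound\<close> integrates these over all pairs. The
  constant multiplies the Jacobian bound, the inverse volume and the factor \<open>CARD('n)\<close>
  for the sum over partial derivatives.\<close>

lemma poincare:
  fixes G :: "('n \<Rightarrow> nat) \<Rightarrow> real^'n \<Rightarrow> real"
  assumes G: "jet G" and p: "1 \<le> p"
  shows "nmp p (\<lambda>x. G \<gamma> x - avg (G \<gamma>)) \<le> (2 ^ CARD('n) * real CARD('n) / svol TYPE('n)) * (\<Sum>i\<in>UNIV. nmp p (G (inc \<gamma> i)))"
proof -
  let ?v = "svol TYPE('n)" and ?H = "grad1 G \<gamma>" and ?K = "std_sx :: (real^'n) set"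
  have v: "0 < ?v" by (rule svol_pos)
  have cG: "continuous_on ?K (\<lambda>x. G \<gamma> x - avg (G \<gamma>))"
    by (intro continuous_intros jet_continuous G)
  have cH: "continuous_on ?K ?H" by (rule grad1_continuous[OF G])
  have [measurable]: "G \<gamma> \<in> borel_measurable borel" "?H \<in> borel_measurable borel"
    using G by (rule jet_measurable, rule grad1_measurable)
  define h where "h x = ennreal (?H x powr p) * indicator ?K x" for x
  have [measurable]: "h \<in> borel_measurable borel" unfolding h_def by measurable
  have "nmp p (\<lambda>x. G \<gamma> x - avg (G \<gamma>)) \<le> 2 ^ CARD('n) / ?v * nmp p ?H"
  proof (rule nmp_leI[OF cG p])
    show "0 \<le> 2 ^ CARD('n) / ?v * nmp p ?H" using v by simp
    have "(\<integral>\<^sup>+x\<in>?K. ennreal (\<bar>G \<gamma> x - avg (G \<gamma>)\<bar> powr p) \<partial>lborel)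
      \<le> (\<integral>\<^sup>+x\<in>?K. (ennreal ((1 / ?v) powr p) * (\<integral>\<^sup>+z\<in>?K. (\<integral>\<^sup>+t\<in>{0..1}. h ((1 - t) *\<^sub>R x + t *\<^sub>R z) \<partial>lborel) \<partial>lborel)) \<partial>lborel)"
    proof (intro nn_integral_mono, goal_cases)
      case (1 x)
      show ?case
      proof (cases "x \<in> ?K")
        case x: True
        have "ennreal (\<bar>G \<gamma> x - avg (G \<gamma>)\<bar> powr p) \<le> ennreal ((1 / ?v) powr p) * (\<integral>\<^sup>+z\<in>?K. ennreal (\<bar>G \<gamma> z - G \<gamma> x\<bar> powr p) \<partial>lborel)"
          by (rule diff_avg_powr_bound[OF jet_continuous[OF G] p])
        also have "\<dots> \<le> ennreal ((1 / ?v) powr p) * (\<integral>\<^sup>+z\<in>?K. (\<integral>\<^sup>+t\<in>{0..1}. h ((1 - t) *\<^sub>R x + t *\<^sub>R z) \<partial>lborel) \<partial>lborel)"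
        proof (intro mult_left_mono nn_integral_mono, goal_cases)
          case (1 z)
          show ?case
          proof (cases "z \<in> ?K")
            case z: True
            have "(\<integral>\<^sup>+t\<in>{0..1}. ennreal (?H ((1 - t) *\<^sub>R x + t *\<^sub>R z) powr p) \<partial>lborel) = (\<integral>\<^sup>+t\<in>{0..1}. h ((1 - t) *\<^sub>R x + t *\<^sub>R z) \<partial>lborel)"
              by (intro nn_integral_cong) (auto simp: indicator_def h_def std_sx_seg[OF x z])
            then show ?thesis
              using jet_diff_powr_bound[OF G x z p, of \<gamma>] z by simp
          qed simp
        qed simp
        finally show ?thesis using x by simp
      qed simp
    qed
    also have "\<dots> = ennreal ((1 / ?v) powr p) * (\<integral>\<^sup>+x\<in>?K. (\<integral>\<^sup>+z\<in>?K. (\<integral>\<^sup>+t\<in>{0..1}. h ((1 - t) *\<^sub>R x + t *\<^sub>R z) \<partial>lborel) \<partial>lborel) \<partial>lborel)"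
      by (subst nn_integral_cmult[symmetric]) (auto simp: mult.assoc)
    also have "\<dots> \<le> ennreal ((1 / ?v) powr p) * (ennreal (2 ^ CARD('n)) * (\<integral>\<^sup>+x. h x \<partial>lborel))"
      by (intro mult_left_mono segment_average_bound) auto
    also have "(\<integral>\<^sup>+x. h x \<partial>lborel) = ennreal (nmp p ?H powr p)"
      using nn_nmp[OF cH p] by (simp add: h_def)
    also have "ennreal ((1 / ?v) powr p) * (ennreal (2 ^ CARD('n)) * ennreal (nmp p ?H powr p)) \<le> ennreal ((2 ^ CARD('n) / ?v * nmp p ?H) powr p)"
    proof -
      \<comment> \<open>Raising \<open>2 ^ CARD('n)\<close> to the power \<open>p\<close> moves it
        inside the norm, as a factor that does not depend on \<open>p\<close>.\<close>
      have "2 ^ CARD('n) \<le> (2 ^ CARD('n) :: real) powr p"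
        using p powr_mono[of 1 p "2 ^ CARD('n) :: real"] by simp
      then have "(1 / ?v) powr p * (2 ^ CARD('n) * nmp p ?H powr p) \<le> (1 / ?v) powr p * ((2 ^ CARD('n)) powr p * nmp p ?H powr p)"
        by (intro mult_left_mono mult_right_mono) auto
      also have "\<dots> = (2 ^ CARD('n) / ?v * nmp p ?H) powr p"
        using v by (simp add: powr_mult powr_divide)
      finally show ?thesis by (simp add: ennreal_mult[symmetric] ennreal_leI)
    qed
    finally show "(\<integral>\<^sup>+x\<in>?K. ennreal (\<bar>G \<gamma> x - avg (G \<gamma>)\<bar> powr p) \<partial>lborel) \<le> ennreal ((2 ^ CARD('n) / ?v * nmp p ?H) powr p)" .
  qed
  also have "\<dots> \<le> 2 ^ CARD('n) / ?v * (real CARD('n) * (\<Sum>i\<in>UNIV. nmp p (G (inc \<gamma> i))))"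
    using v by (intro mult_left_mono nmp_sum_le cH jet_continuous G p) (auto simp: grad1_def)
  finally show ?thesis by (simp add: field_simps)
qed

section \<open>Traces on faces\<close>

text \<open>Product measure over the directions in \<open>B\<close> is Lebesgue measure on the
  coordinate plane through \<open>x\<close> parallel to \<open>B\<close>, in any dimension:
  \<open>B = {}\<close> evaluates at \<open>x\<close>, and \<open>B = Basis\<close> with
  \<open>x = 0\<close> integrates over the whole space. The plane is not cut to the simplex; the
  integrand \<open>restr\<close> does that.\<close>

definition face_int :: "'a::euclidean_space set \<Rightarrow> ('a \<Rightarrow> ennreal) \<Rightarrow> 'a \<Rightarrow> ennreal" where
  "face_int B h x = (\<integral>\<^sup>+f. h (x + (\<Sum>b\<in>B. f b *\<^sub>R b)) \<partial>(\<Pi>\<^sub>M b\<in>B. lborel))"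

interpretation lborel_prod: product_sigma_finite "\<lambda>_::'a. lborel :: real measure"
  by standard

lemma face_int_empty [simp]: "face_int {} h x = h x"
  unfolding face_int_def by (simp add: PiM_empty nn_integral_count_space_finite)

lemma face_int_insert:
  fixes h :: "'a::euclidean_space \<Rightarrow> ennreal"
  assumes B: "finite B" "b \<notin> B" and [measurable]: "h \<in> borel_measurable borel"
  shows "face_int (insert b B) h x = face_int B (\<lambda>y. \<integral>\<^sup>+t. h (y + t *\<^sub>R b) \<partial>lborel) x"
proof -
  have "face_int (insert b B) h x =
    (\<integral>\<^sup>+f. (\<integral>\<^sup>+t. h (x + (\<Sum>c\<in>insert b B. (f(b := t)) c *\<^sub>R c)) \<partial>lborel) \<partial>(\<Pi>\<^sub>M b\<in>B. lborel))"
    unfolding face_int_def by (rule lborel_prod.product_nn_integral_insert[OF B]) measurable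
  moreover have "(\<Sum>c\<in>insert b B. (f(b := t)) c *\<^sub>R c) = (\<Sum>c\<in>B. f c *\<^sub>R c) + t *\<^sub>R b" for f t
  proof -
    have "(\<Sum>c\<in>B. (f(b := t)) c *\<^sub>R c) = (\<Sum>c\<in>B. f c *\<^sub>R c)"
      using B by (intro sum.cong) auto
    then show ?thesis using B by (simp add: add.commute)
  qed
  ultimately show ?thesis by (simp only: face_int_def add.assoc)
qed

lemma face_int_mono: "(\<And>x. h x \<le> g x) \<Longrightarrow> face_int B h x \<le> face_int B g x"
  unfolding face_int_def by (intro nn_integral_mono)

lemma face_int_cmult:
  fixes h :: "'a::euclidean_space \<Rightarrow> ennreal"
  assumes [measurable]: "h \<in> borel_measurable borel"
  shows "face_int B (\<lambda>x. c * h x) x = c * face_int B h x"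
  unfolding face_int_def by (rule nn_integral_cmult) measurable

lemma face_int_add:
  fixes h :: "'a::euclidean_space \<Rightarrow> ennreal"
  assumes [measurable]: "h \<in> borel_measurable borel" "g \<in> borel_measurable borel"
  shows "face_int B (\<lambda>x. h x + g x) x = face_int B h x + face_int B g x"
  unfolding face_int_def by (rule nn_integral_add) measurable

lemma face_int_sum:
  fixes h :: "'i \<Rightarrow> 'a::euclidean_space \<Rightarrow> ennreal"
  assumes [measurable]: "\<And>i. i \<in> I \<Longrightarrow> h i \<in> borel_measurable borel"
  shows "face_int B (\<lambda>x. \<Sum>i\<in>I. h i x) x = (\<Sum>i\<in>I. face_int B (h i) x)"
  unfolding face_int_def by (rule nn_integral_sum) measurable

lemma face_int_shift: "face_int B h (x + y) = face_int B (\<lambda>z. h (z + y)) x"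
  by (simp add: face_int_def algebra_simps)

lemma face_int_Basis:
  fixes h :: "'a::euclidean_space \<Rightarrow> ennreal"
  assumes [measurable]: "h \<in> borel_measurable borel"
  shows "face_int Basis h 0 = (\<integral>\<^sup>+x. h x \<partial>lborel)"
proof -
  have "(\<integral>\<^sup>+x. h x \<partial>lborel) = (\<integral>\<^sup>+x. h x \<partial>distr (\<Pi>\<^sub>M b\<in>Basis. lborel) borel (\<lambda>f. \<Sum>b\<in>Basis. f b *\<^sub>R b))"
    unfolding lborel_def[where 'a='a] lborel_eq_real by simp
  then show ?thesis
    by (simp add: nn_integral_distr face_int_def)
qed

lemma face_int_swap:
  fixes F :: "real \<Rightarrow> 'a::euclidean_space \<Rightarrow> ennreal"
  assumes "finite B" and [measurable]: "(\<lambda>(t, y). F t y) \<in> borel_measurable (borel \<Otimes>\<^sub>M borel)"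
  shows "face_int B (\<lambda>y. \<integral>\<^sup>+t. F t y \<partial>lborel) x = (\<integral>\<^sup>+t. face_int B (F t) x \<partial>lborel)"
proof -
  interpret finite_product_sigma_finite "\<lambda>_::'a. lborel :: real measure" B
    by standard fact
  interpret pair_sigma_finite "lborel :: real measure" "\<Pi>\<^sub>M b\<in>B. (lborel :: real measure)"
    by standard
  show ?thesis
    unfolding face_int_def by (rule Fubini') measurable
qed

text \<open>Integrate first in the direction \<open>b\<close>, where the line integral is
  translation invariant. Averages whose base point has moved along a face are thereby compared with
  the face at the origin.\<close>

lemma face_int_translate:
  fixes h :: "'a::euclidean_space \<Rightarrow> ennreal"
  assumes B: "finite B" "b \<in> B" and [measurable]: "h \<in> borel_measurable borel"
  shows "face_int B h (x + s *\<^sub>R b) = face_int B h x"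
proof -
  define H where "H y = (\<integral>\<^sup>+t. h (y + t *\<^sub>R b) \<partial>lborel)" for y
  have eq: "face_int B h z = face_int (B - {b}) H z" for z
    using face_int_insert[of "B - {b}" b h z] B by (simp add: insert_absorb H_def[abs_def])
  have "H (y + s *\<^sub>R b) = H y" for y
    unfolding H_def using nn_integral_real_affine[of "\<lambda>t. h (y + t *\<^sub>R b)" 1 s]
    by (simp add: algebra_simps)
  then show ?thesis
    unfolding eq by (subst face_int_shift) simp
qed

lemma face_int_dilate:
  fixes h :: "'a::euclidean_space \<Rightarrow> ennreal"
  assumes "finite B" and h: "h \<in> borel_measurable borel" and c: "0 < c"
  shows "face_int B (\<lambda>y. h (a + c *\<^sub>R y)) x = ennreal (1 / c ^ card B) * face_int B h (a + c *\<^sub>R x)"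
  using assms(1) h
proof (induction B arbitrary: h)
  case (insert b B)
  note [measurable] = insert.prems
  define H where "H z = (\<integral>\<^sup>+t. h (z + t *\<^sub>R b) \<partial>lborel)" for z
  have [measurable]: "H \<in> borel_measurable borel" unfolding H_def by measurable
  have inner: "(\<integral>\<^sup>+t. h (a + c *\<^sub>R (y + t *\<^sub>R b)) \<partial>lborel) = ennreal (1 / c) * H (a + c *\<^sub>R y)" for y
  proof -
    have "H (a + c *\<^sub>R y) = ennreal c * (\<integral>\<^sup>+t. h (a + c *\<^sub>R y + (0 + c * t) *\<^sub>R b) \<partial>lborel)"
      unfolding H_def using c by (subst nn_integral_real_affine[where c=c and t=0]) auto
    then show ?thesis
      using c by (simp add: mult.assoc[symmetric] ennreal_mult[symmetric] algebra_simps)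
  qed
  have "face_int (insert b B) (\<lambda>y. h (a + c *\<^sub>R y)) x = face_int B (\<lambda>y. ennreal (1 / c) * H (a + c *\<^sub>R y)) x"
    using insert.hyps by (subst face_int_insert) (auto simp: inner)
  also have "\<dots> = ennreal (1 / c) * (ennreal (1 / c ^ card B) * face_int B H (a + c *\<^sub>R x))"
    by (subst face_int_cmult) (auto simp: insert.IH)
  also have "\<dots> = ennreal (1 / c ^ card (insert b B)) * face_int (insert b B) h (a + c *\<^sub>R x)"
    using insert.hyps insert.prems c
    by (simp add: face_int_insert H_def[abs_def] mult.assoc[symmetric] ennreal_mult[symmetric])
  finally show ?case .
qed simp

text \<open>Compare \<open>y\<close> with every point on the first half of the segment towards
  \<open>z\<close> and average over that half; the factor 2 is the inverse of its length. Stopping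
  halfway keeps the contraction factor \<open>1 - t\<close> at least 1/2, so the later substitution
  does not degenerate.\<close>

lemma cone_pointwise:
  assumes G: "jet G" and y: "y \<in> std_sx" and z: "z \<in> std_sx"
  shows "ennreal \<bar>G \<gamma> y\<bar> \<le> 2 * (\<integral>\<^sup>+t\<in>{0..1/2}. ennreal (\<bar>G \<gamma> ((1 - t) *\<^sub>R y + t *\<^sub>R z)\<bar> + grad1 G \<gamma> ((1 - t) *\<^sub>R y + t *\<^sub>R z)) \<partial>lborel)"
proof -
  let ?y = "\<lambda>t::real. (1 - t) *\<^sub>R y + t *\<^sub>R z"
  let ?D = "\<integral>\<^sup>+t\<in>{0..1/2}. ennreal (grad1 G \<gamma> (?y t)) \<partial>lborel"
  have [measurable]: "G \<gamma> \<in> borel_measurable borel" "grad1 G \<gamma> \<in> borel_measurable borel"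
    using G by (rule jet_measurable, rule grad1_measurable)
  have s: "ennreal \<bar>G \<gamma> y\<bar> \<le> ennreal \<bar>G \<gamma> (?y s)\<bar> + ?D" if "s \<in> {0..1/2}" for s
  proof -
    have "ennreal \<bar>G \<gamma> y\<bar> \<le> ennreal (\<bar>G \<gamma> (?y s)\<bar> + \<bar>G \<gamma> (?y s) - G \<gamma> (?y 0)\<bar>)"
      by (intro ennreal_leI) simp
    also have "\<dots> = ennreal \<bar>G \<gamma> (?y s)\<bar> + ennreal \<bar>G \<gamma> (?y s) - G \<gamma> (?y 0)\<bar>"
      by simp
    also have "ennreal \<bar>G \<gamma> (?y s) - G \<gamma> (?y 0)\<bar> \<le> (\<integral>\<^sup>+t\<in>{0..s}. ennreal (grad1 G \<gamma> (?y t)) \<partial>lborel)"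
      using that by (intro jet_segment_bound G y z) auto
    also have "\<dots> \<le> ?D"
      using that by (intro nn_integral_mono) (auto simp: indicator_def)
    finally show ?thesis by simp
  qed
  have half: "emeasure lborel {0..1/2::real} = ennreal (1 / 2)" by simp
  have "ennreal \<bar>G \<gamma> y\<bar> = ennreal 2 * (ennreal \<bar>G \<gamma> y\<bar> * ennreal (1 / 2))"
    by (simp only: ennreal_mult[symmetric] abs_ge_zero) simp
  also have "\<dots> = 2 * (\<integral>\<^sup>+s\<in>{0..1/2::real}. ennreal \<bar>G \<gamma> y\<bar> \<partial>lborel)"
    by (subst nn_integral_cmult_indicator) (auto simp only: half ennreal_numeral sets_lborel borel_closed closed_atLeastAtMost)
  also have "\<dots> \<le> 2 * (\<integral>\<^sup>+s\<in>{0..1/2::real}. (ennreal \<bar>G \<gamma> (?y s)\<bar> + ?D) \<partial>lborel)"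
    using s by (intro mult_left_mono nn_integral_mono) (auto simp: indicator_def)
  also have "(\<integral>\<^sup>+s\<in>{0..1/2::real}. (ennreal \<bar>G \<gamma> (?y s)\<bar> + ?D) \<partial>lborel)
    = (\<integral>\<^sup>+s\<in>{0..1/2::real}. ennreal \<bar>G \<gamma> (?y s)\<bar> \<partial>lborel) + (\<integral>\<^sup>+s. ?D * indicator {0..1/2::real} s \<partial>lborel)"
    by (subst nn_integral_add[symmetric]) (auto simp: distrib_right)
  also have "(\<integral>\<^sup>+s. ?D * indicator {0..1/2::real} s \<partial>lborel) = ?D * ennreal (1 / 2)"
    by (subst nn_integral_cmult_indicator) (auto simp: half)
  also have "\<dots> \<le> ?D * 1"
    by (intro mult_left_mono order_trans[OF ennreal_leI[of "1 / 2" 1]]) auto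
  also have "(\<integral>\<^sup>+s\<in>{0..1/2::real}. ennreal \<bar>G \<gamma> (?y s)\<bar> \<partial>lborel) + ?D * 1
    = (\<integral>\<^sup>+t\<in>{0..1/2}. ennreal (\<bar>G \<gamma> (?y t)\<bar> + grad1 G \<gamma> (?y t)) \<partial>lborel)"
    by (subst mult_1_right, subst nn_integral_add[symmetric]) (auto simp: distrib_right)
  finally show ?thesis by (simp add: mult_left_mono)
qed

abbreviation restr :: "(real^'n \<Rightarrow> real) \<Rightarrow> real^'n \<Rightarrow> ennreal" where
  "restr h x \<equiv> ennreal \<bar>h x\<bar> * indicator std_sx x"

text \<open>Contract the face towards the vertex \<open>axis i 1\<close>. At fixed \<open>t\<close>
  the contracted face lies in the slice at height \<open>t\<close> of the face spanned by one more
  direction, with Jacobian at most \<open>2 ^ card B\<close>; integrating over \<open>t\<close>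
  stays within that larger face. One dimension is gained at the cost of one derivative.\<close>

lemma cone_step:
  fixes G :: "('n \<Rightarrow> nat) \<Rightarrow> real^'n \<Rightarrow> real"
  assumes G: "jet G" and B: "B \<subseteq> Basis" "axis i 1 \<notin> B"
  shows "face_int B (restr (G \<gamma>)) 0 \<le> ennreal (2 ^ Suc (card B)) *
    (face_int (insert (axis i 1) B) (restr (G \<gamma>)) 0 + (\<Sum>j\<in>UNIV. face_int (insert (axis i 1) B) (restr (G (inc \<gamma> j))) 0))"
proof -
  let ?b = "axis i 1 :: real^'n"
  have fB: "finite B" by (rule finite_subset[OF B(1) finite_Basis])
  have [measurable]: "G \<delta> \<in> borel_measurable borel" for \<delta>
    using G by (rule jet_measurable)
  have [measurable]: "grad1 G \<gamma> \<in> borel_measurable borel" using G by (rule grad1_measurable)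
  define h where "h x = ennreal (\<bar>G \<gamma> x\<bar> + grad1 G \<gamma> x) * indicator std_sx x" for x
  have h[measurable]: "h \<in> borel_measurable borel" unfolding h_def by measurable
  define F where "F t y = h (t *\<^sub>R ?b + (1 - t) *\<^sub>R y) * indicator {0..1/2} t" for t y
  have pw: "restr (G \<gamma>) y \<le> 2 * (\<integral>\<^sup>+t. F t y \<partial>lborel)" for y
  proof (cases "y \<in> std_sx")
    case True
    have "(\<integral>\<^sup>+t\<in>{0..1/2}. ennreal (\<bar>G \<gamma> ((1 - t) *\<^sub>R y + t *\<^sub>R ?b)\<bar> + grad1 G \<gamma> ((1 - t) *\<^sub>R y + t *\<^sub>R ?b)) \<partial>lborel)
      = (\<integral>\<^sup>+t. F t y \<partial>lborel)"
      using std_sx_seg[OF True axis_in_std_sx[of i]]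
      by (intro nn_integral_cong) (auto simp: F_def h_def indicator_def add.commute)
    then show ?thesis using cone_pointwise[OF G True axis_in_std_sx, of \<gamma> i] True by simp
  qed simp
  have "face_int B (restr (G \<gamma>)) 0 \<le> face_int B (\<lambda>y. 2 * (\<integral>\<^sup>+t. F t y \<partial>lborel)) 0"
    by (intro face_int_mono pw)
  also have "\<dots> = 2 * face_int B (\<lambda>y. \<integral>\<^sup>+t. F t y \<partial>lborel) 0"
    by (rule face_int_cmult) (simp add: F_def)
  also have "face_int B (\<lambda>y. \<integral>\<^sup>+t. F t y \<partial>lborel) 0 = (\<integral>\<^sup>+t. face_int B (F t) 0 \<partial>lborel)"
    by (rule face_int_swap[OF fB]) (simp add: F_def)
  also have "\<dots> \<le> (\<integral>\<^sup>+t. ennreal (2 ^ card B) * face_int B (\<lambda>y. h (y + t *\<^sub>R ?b)) 0 \<partial>lborel)"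
  proof (rule nn_integral_mono)
    fix t :: real
    show "face_int B (F t) 0 \<le> ennreal (2 ^ card B) * face_int B (\<lambda>y. h (y + t *\<^sub>R ?b)) 0"
    proof (cases "t \<in> {0..1/2}")
      case True
      have "face_int B (F t) 0 = face_int B (\<lambda>y. h (t *\<^sub>R ?b + (1 - t) *\<^sub>R y)) 0"
        using True by (simp add: F_def[abs_def])
      also have "\<dots> = ennreal (1 / (1 - t) ^ card B) * face_int B h (t *\<^sub>R ?b + (1 - t) *\<^sub>R 0)"
        using True by (intro face_int_dilate fB h) auto
      also have "\<dots> \<le> ennreal (2 ^ card B) * face_int B h (t *\<^sub>R ?b + (1 - t) *\<^sub>R 0)"
      proof (intro mult_right_mono ennreal_leI)
        have "(1 / 2) ^ card B \<le> (1 - t) ^ card B" using True by (intro power_mono) auto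
        then show "1 / (1 - t) ^ card B \<le> 2 ^ card B" 
          using True by (simp add: field_simps power_divide)
      qed simp
      finally show ?thesis using face_int_shift[of B h 0 "t *\<^sub>R ?b"] by simp
    next
      case False
      then have "face_int B (F t) 0 = 0" by (simp add: F_def[abs_def] face_int_def)
      then show ?thesis by simp
    qed
  qed
  also have "\<dots> = ennreal (2 ^ card B) * (\<integral>\<^sup>+t. face_int B (\<lambda>y. h (y + t *\<^sub>R ?b)) 0 \<partial>lborel)"
  proof (rule nn_integral_cmult)
    interpret finite_product_sigma_finite "\<lambda>_. lborel :: real measure" B
      by standard fact
    show "(\<lambda>t. face_int B (\<lambda>y. h (y + t *\<^sub>R ?b)) 0) \<in> borel_measurable lborel"
      unfolding face_int_def by measurable
  qed
  also have "(\<integral>\<^sup>+t. face_int B (\<lambda>y. h (y + t *\<^sub>R ?b)) 0 \<partial>lborel) = face_int (insert ?b B) h 0"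
    using B by (subst face_int_insert[OF fB]) (auto intro!: face_int_swap[OF fB, symmetric])
  finally have "face_int B (restr (G \<gamma>)) 0 \<le> 2 * (ennreal (2 ^ card B) * face_int (insert ?b B) h 0)"
    by (simp add: mult_left_mono)
  moreover have "h = (\<lambda>x. restr (G \<gamma>) x + (\<Sum>j\<in>UNIV. restr (G (inc \<gamma> j)) x))"
  proof
    fix x show "h x = restr (G \<gamma>) x + (\<Sum>j\<in>UNIV. restr (G (inc \<gamma> j)) x)"
      by (cases "x \<in> std_sx") (simp_all add: h_def grad1_def sum_nonneg)
  qed
  moreover have "face_int (insert ?b B) (\<lambda>x. restr (G \<gamma>) x + (\<Sum>j\<in>UNIV. restr (G (inc \<gamma> j)) x)) 0 = face_int (insert ?b B) (restr (G \<gamma>)) 0 + face_int (insert ?b B) (\<lambda>x. \<Sum>j\<in>UNIV. restr (G (inc \<gamma> j)) x) 0"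
    by (rule face_int_add) measurable
  moreover have "face_int (insert ?b B) (\<lambda>x. \<Sum>j\<in>UNIV. restr (G (inc \<gamma> j)) x) 0 = (\<Sum>j\<in>UNIV. face_int (insert ?b B) (restr (G (inc \<gamma> j))) 0)"
    by (rule face_int_sum) measurable
  moreover have "2 * (ennreal (2 ^ card B) * c) = ennreal (2 ^ Suc (card B)) * c" for c
    by (simp add: ennreal_mult mult.assoc)
  ultimately show ?thesis by simp
qed

definition mi_le :: "nat \<Rightarrow> ('n::finite \<Rightarrow> nat) set" where
  "mi_le n = {\<eta>. (\<Sum>i\<in>UNIV. \<eta> i) \<le> n}"

lemma mi_le_eq: "mi_le n = (\<Union>m\<le>n. multi_indices m)"
  by (auto simp: mi_le_def multi_indices_def)

lemma finite_mi_le [simp]: "finite (mi_le n)"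
  unfolding mi_le_eq by (auto intro: finite_multi_indices)

lemma sum_inc: "(\<Sum>i\<in>UNIV. inc \<eta> j i) = Suc (\<Sum>i\<in>UNIV. \<eta> i)" for \<eta> :: "'n::finite \<Rightarrow> nat"
proof -
  have "(\<Sum>i\<in>UNIV. inc \<eta> j i) = (\<Sum>i\<in>UNIV. \<eta> i + (if i = j then 1 else 0))"
    by (intro sum.cong) auto
  then show ?thesis by (simp add: sum.distrib)
qed

lemma inc_mi_le: "\<eta> \<in> mi_le n \<Longrightarrow> inc \<eta> j \<in> mi_le (Suc n)"
  by (simp add: mi_le_def sum_inc del: fun_upd_apply)

lemma inj_inc: "inj (\<lambda>\<eta>. inc \<eta> j)"
proof (rule injI)
  fix a b :: "'a \<Rightarrow> nat" assume eq: "inc a j = inc b j"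
  have "a i = b i" for i using fun_cong[OF eq, of i] by (cases "i = j") auto
  then show "a = b" by auto
qed

lemma sum_inc_mi_le:
  fixes f :: "('n::finite \<Rightarrow> nat) \<Rightarrow> 'b::ordered_comm_monoid_add"
  assumes "\<And>\<eta>. 0 \<le> f \<eta>"
  shows "(\<Sum>\<eta>\<in>mi_le n. f (inc \<eta> j)) \<le> (\<Sum>\<eta>\<in>mi_le (Suc n). f \<eta>)"
proof -
  have "(\<Sum>\<eta>\<in>mi_le n. f (inc \<eta> j)) = (\<Sum>\<eta>\<in>(\<lambda>\<eta>. inc \<eta> j) ` mi_le n. f \<eta>)"
    by (subst sum.reindex) (auto intro: inj_on_subset[OF inj_inc])
  also have "\<dots> \<le> (\<Sum>\<eta>\<in>mi_le (Suc n). f \<eta>)"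
    using assms inc_mi_le by (intro sum_mono2) auto
  finally show ?thesis .
qed

lemma inc_add: "(\<lambda>i. inc \<gamma> j i + \<eta> i) = (\<lambda>i. \<gamma> i + inc \<eta> j i)"
  by auto

lemma Basis_range_axis: "(Basis :: (real^'n::finite) set) = range (\<lambda>i. axis i 1)"
  by (auto simp: Basis_vec_def)

text \<open>Missing directions are added one at a time by \<open>cone_step\<close>, so codimension
  \<open>n\<close> needs \<open>n\<close> derivatives. The \<open>CARD('n) + 1\<close> terms of each
  step are all bounded by the same sum, whence the second factor in the base of the
  constant.\<close>

lemma face_trace_aux:
  fixes G :: "('n \<Rightarrow> nat) \<Rightarrow> real^'n \<Rightarrow> real"
  assumes G: "jet G" and B: "B \<subseteq> Basis" "card (Basis - B) = n"
  shows "face_int B (restr (G \<gamma>)) 0 \<le> ennreal ((2 ^ Suc CARD('n) * real (Suc CARD('n))) ^ n) *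
    (\<Sum>\<eta>\<in>mi_le n. \<integral>\<^sup>+x. restr (G (\<lambda>i. \<gamma> i + \<eta> i)) x \<partial>lborel)"
  using B
proof (induction n arbitrary: B \<gamma>)
  case 0
  then have "B = Basis" by (simp add: finite_subset) 
  moreover have "mi_le 0 = {\<lambda>_::'n. 0}" by (auto simp: mi_le_def)
  ultimately show ?case
    using jet_measurable[OF G] by (simp add: face_int_Basis)
next
  case (Suc n)
  let ?S = "\<lambda>n \<gamma>. \<Sum>\<eta>\<in>mi_le n. \<integral>\<^sup>+x. restr (G (\<lambda>i. \<gamma> i + \<eta> i)) x \<partial>lborel"
  let ?K = "2 ^ Suc CARD('n) * real (Suc CARD('n))"
  have "Basis - B \<noteq> {}" using Suc.prems by (metis card.empty nat.distinct(1))
  then obtain b where b: "b \<in> Basis" "b \<notin> B" by blast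
  obtain i where bi: "b = axis i 1" using b(1) unfolding Basis_range_axis by blast
  have i: "axis i 1 \<in> (Basis :: (real^'n) set)" "axis i 1 \<notin> B"
    using b bi by simp_all
  let ?B = "insert (axis i 1) B"
  have B1: "?B \<subseteq> Basis" using Suc.prems(1) i(1) by (rule insert_subsetI[rotated])
  have "Basis - ?B = (Basis - B) - {axis i 1}" by blast
  then have B2: "card (Basis - ?B) = n"
    using card_Diff_singleton[of "axis i 1" "Basis - B"] i Suc.prems(2) by simp
  note B' = B1 B2
  have IH: "face_int ?B (restr (G \<gamma>)) 0 \<le> ennreal (?K ^ n) * ?S n \<gamma>" for \<gamma>
    by (rule Suc.IH[OF B'])
  have 1: "?S n \<gamma> \<le> ?S (Suc n) \<gamma>"
    by (intro sum_mono2 finite_mi_le) (auto simp: mi_le_def)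
  have 2: "?S n (inc \<gamma> j) \<le> ?S (Suc n) \<gamma>" for j
    unfolding inc_add by (rule sum_inc_mi_le[where f="\<lambda>\<eta>. \<integral>\<^sup>+x. restr (G (\<lambda>i. \<gamma> i + \<eta> i)) x \<partial>lborel"]) simp
  have cB: "card B \<le> CARD('n)"
    using card_mono[OF finite_Basis Suc.prems(1)] by simp
  have "face_int B (restr (G \<gamma>)) 0 \<le> ennreal (2 ^ Suc (card B)) *
    (face_int ?B (restr (G \<gamma>)) 0 + (\<Sum>j\<in>UNIV. face_int ?B (restr (G (inc \<gamma> j))) 0))"
    by (rule cone_step[OF G Suc.prems(1) i(2)])
  also have "\<dots> \<le> ennreal (2 ^ Suc CARD('n)) * (ennreal (?K ^ n) * ?S (Suc n) \<gamma> + (\<Sum>j\<in>(UNIV::'n set). ennreal (?K ^ n) * ?S (Suc n) \<gamma>))"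
    using cB
    by (intro mult_mono add_mono sum_mono order_trans[OF IH] mult_left_mono 1 2 ennreal_leI power_increasing) auto
  also have "\<dots> = ennreal (2 ^ Suc CARD('n)) * (ennreal (real (Suc CARD('n))) * (ennreal (?K ^ n) * ?S (Suc n) \<gamma>))"
    by (simp add: distrib_right ennreal_of_nat_eq_real_of_nat[symmetric] ac_simps)
  also have "\<dots> = ennreal (?K ^ Suc n) * ?S (Suc n) \<gamma>"
    by (simp add: ennreal_mult[symmetric] mult.assoc[symmetric] del: of_nat_Suc)
  finally show ?case .
qed

lemma nn_restr_le:
  fixes h :: "real^'n \<Rightarrow> real"
  assumes "continuous_on std_sx h" "1 \<le> p"
  shows "(\<integral>\<^sup>+x. restr h x \<partial>lborel) \<le> ennreal (nmp p h)"
proof -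
  have "set_integrable lborel std_sx (\<lambda>x. \<bar>h x\<bar>)"
    by (intro continuous_std_sx_integrable continuous_intros assms)
  then have "(\<integral>\<^sup>+x. restr h x \<partial>lborel) = ennreal (LINT x:std_sx|lborel. \<bar>h x\<bar>)"
    by (rule nn_set_integral_eq) simp
  also have "\<dots> \<le> ennreal (nmp p h)" by (intro ennreal_leI integral_le_nmp assms)
  finally show ?thesis .
qed

lemma face_trace:
  fixes p :: real
  assumes p: "1 \<le> p"
  obtains C where "0 \<le> C" "\<And>(G :: ('n \<Rightarrow> nat) \<Rightarrow> real^'n \<Rightarrow> real) (B :: (real^'n) set) \<gamma>. jet G \<Longrightarrow> B \<subseteq> Basis \<Longrightarrow> card (Basis - B) \<le> r \<Longrightarrow>
    face_int B (restr (G \<gamma>)) 0 \<le> ennreal (C * (\<Sum>\<eta>\<in>mi_le r. nmp p (G (\<lambda>i. \<gamma> i + \<eta> i))))"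
proof
  let ?K = "2 ^ Suc CARD('n) * real (Suc CARD('n))"
  have K1: "1 \<le> ?K"
    using mult_mono[of 1 "2 ^ Suc CARD('n) :: real" 1 "real (Suc CARD('n))"] one_le_power[of "2::real" "Suc CARD('n)"] by auto
  show "0 \<le> ?K ^ r" by simp
  fix G :: "('n \<Rightarrow> nat) \<Rightarrow> real^'n \<Rightarrow> real" and B :: "(real^'n) set" and \<gamma>
  assume G: "jet G" and B: "B \<subseteq> Basis" "card (Basis - B) \<le> r"
  let ?n = "card (Basis - B)"
  have "face_int B (restr (G \<gamma>)) 0 \<le> ennreal (?K ^ ?n) * (\<Sum>\<eta>\<in>mi_le ?n. \<integral>\<^sup>+x. restr (G (\<lambda>i. \<gamma> i + \<eta> i)) x \<partial>lborel)"
    by (rule face_trace_aux[OF G B(1) refl])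
  also have "\<dots> \<le> ennreal (?K ^ r) * (\<Sum>\<eta>\<in>mi_le r. \<integral>\<^sup>+x. restr (G (\<lambda>i. \<gamma> i + \<eta> i)) x \<partial>lborel)"
    using B K1 by (intro mult_mono ennreal_leI power_increasing sum_mono2 finite_mi_le) (auto simp: mi_le_def)
  also have "\<dots> \<le> ennreal (?K ^ r) * (\<Sum>\<eta>\<in>mi_le r. ennreal (nmp p (G (\<lambda>i. \<gamma> i + \<eta> i))))"
    by (intro mult_left_mono sum_mono nn_restr_le jet_continuous G p) auto
  also have "\<dots> = ennreal (?K ^ r * (\<Sum>\<eta>\<in>mi_le r. nmp p (G (\<lambda>i. \<gamma> i + \<eta> i))))"
    by (simp add: sum_ennreal ennreal_mult sum_nonneg)
  finally show "face_int B (restr (G \<gamma>)) 0 \<le> ennreal (?K ^ r * (\<Sum>\<eta>\<in>mi_le r. nmp p (G (\<lambda>i. \<gamma> i + \<eta> i))))" .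
qed

section \<open>Differences as iterated averages\<close>

definition line_avg :: "real \<Rightarrow> 'n \<Rightarrow> (real^'n::finite \<Rightarrow> real) \<Rightarrow> real^'n \<Rightarrow> real" where
  "line_avg c i f y = integral {0..1} (\<lambda>s. f (y + (c * s) *\<^sub>R axis i 1))"

text \<open>The word \<open>w\<close> lists directions with repetition: \<open>count_list w\<close>
  is the multi-index, \<open>length w\<close> its order, and \<open>set w\<close> its support, which
  spans the face carrying the average.\<close>

primrec iter_avg :: "real \<Rightarrow> 'n list \<Rightarrow> (real^'n::finite \<Rightarrow> real) \<Rightarrow> real^'n \<Rightarrow> real" where
  "iter_avg c [] f = f"
| "iter_avg c (i # w) f = iter_avg c w (line_avg c i f)"

primrec iter_diff :: "real \<Rightarrow> 'n list \<Rightarrow> (real^'n::finite \<Rightarrow> real) \<Rightarrow> real^'n \<Rightarrow> real" where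
  "iter_diff c [] f = f"
| "iter_diff c (i # w) f = iter_diff c w (\<lambda>y. f (y + c *\<^sub>R axis i 1) - f y)"

lemma continuous_line:
  fixes f :: "real^'n \<Rightarrow> real"
  assumes "continuous_on UNIV f"
  shows "continuous_on S (\<lambda>s. f (y + (c * s) *\<^sub>R v))"
  by (intro continuous_on_compose2[OF assms] continuous_intros) auto

lemma line_avg_continuous:
  assumes "continuous_on UNIV f"
  shows "continuous_on UNIV (line_avg c i f)"
proof -
  have "continuous_on (UNIV \<times> cbox 0 1) (\<lambda>(y, s). f (y + (c * s) *\<^sub>R axis i 1))"
    unfolding case_prod_beta by (intro continuous_on_compose2[OF assms] continuous_intros) auto
  from integral_continuous_on_param[OF this] show ?thesis
    by (simp add: line_avg_def[abs_def])
qed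

lemma line_avg_add:
  assumes "continuous_on UNIV f" "continuous_on UNIV g"
  shows "line_avg c i (\<lambda>y. f y + g y) = (\<lambda>y. line_avg c i f y + line_avg c i g y)"
  unfolding line_avg_def fun_eq_iff
  by (intro allI integral_add integrable_continuous_interval continuous_line assms)

lemma line_avg_cmult: "line_avg c i (\<lambda>y. a * f y) = (\<lambda>y. a * line_avg c i f y)"
  by (simp add: line_avg_def fun_eq_iff)

lemma iter_avg_add:
  assumes "continuous_on UNIV f" "continuous_on UNIV g"
  shows "iter_avg c w (\<lambda>y. f y + g y) = (\<lambda>y. iter_avg c w f y + iter_avg c w g y)"
  using assms by (induction w arbitrary: f g) (auto simp: line_avg_add line_avg_continuous)

lemma iter_avg_cmult: "iter_avg c w (\<lambda>y. a * f y) = (\<lambda>y. a * iter_avg c w f y)"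
  by (induction w arbitrary: f) (auto simp: line_avg_cmult)

lemma iter_avg_const: "iter_avg c w (\<lambda>y. a) = (\<lambda>y. a)"
  by (induction w) (auto simp: line_avg_def[abs_def])

lemma iter_avg_translate: "iter_avg c w f (x + a) = iter_avg c w (\<lambda>y. f (y + a)) x"
proof (induction w arbitrary: f)
  case (Cons i w)
  have "line_avg c i (\<lambda>y. f (y + a)) = (\<lambda>y. line_avg c i f (y + a))"
    by (simp add: line_avg_def fun_eq_iff algebra_simps)
  then show ?case using Cons by simp
qed simp

lemma jet_diff_translate:
  assumes "jet G"
  shows "jet (\<lambda>\<gamma> y. G \<gamma> (y + a) - G \<gamma> y)"
  unfolding jet_def
proof (intro allI)
  fix \<gamma> x
  have "((\<lambda>y. y + a) has_derivative (\<lambda>h. h)) (at x)"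
    by (auto intro!: derivative_eq_intros)
  from has_derivative_compose[OF this jetD[OF assms, of \<gamma> "x + a" UNIV]]
  have "((\<lambda>y. G \<gamma> (y + a)) has_derivative (\<lambda>h. \<Sum>i\<in>UNIV. h $ i * G (inc \<gamma> i) (x + a))) (at x)"
    by simp
  from has_derivative_diff[OF this jetD[OF assms, of \<gamma> x UNIV]]
  show "((\<lambda>y. G \<gamma> (y + a) - G \<gamma> y) has_derivative
      (\<lambda>h. \<Sum>i\<in>UNIV. h $ i * (G (inc \<gamma> i) (x + a) - G (inc \<gamma> i) x))) (at x)"
    by (simp add: right_diff_distrib sum_subtractf)
qed

lemma sum_axis: "(\<Sum>j\<in>UNIV. axis i 1 $ j * f j) = (f i :: real)"
proof -
  have "(\<Sum>j\<in>UNIV. axis i 1 $ j * f j) = (\<Sum>j\<in>UNIV. if j = i then f i else 0)"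
    by (intro sum.cong) (auto simp: axis_def)
  then show ?thesis by simp
qed

lemma jet_diff_eq_line_avg:
  assumes G: "jet G"
  shows "G \<gamma> (y + c *\<^sub>R axis i 1) - G \<gamma> y = c * line_avg c i (G (inc \<gamma> i)) y"
proof -
  have "((\<lambda>s. G \<gamma> (y + s *\<^sub>R (c *\<^sub>R axis i 1))) has_vector_derivative
     (\<Sum>j\<in>UNIV. (c *\<^sub>R axis i 1) $ j * G (inc \<gamma> j) (y + s *\<^sub>R (c *\<^sub>R axis i 1)))) (at s within {0..1})" for s
    by (rule jet_line_deriv[OF G, unfolded has_real_derivative_iff_has_vector_derivative])
  then have "((\<lambda>s. \<Sum>j\<in>UNIV. (c *\<^sub>R axis i 1) $ j * G (inc \<gamma> j) (y + s *\<^sub>R (c *\<^sub>R axis i 1))) has_integral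
      G \<gamma> (y + 1 *\<^sub>R (c *\<^sub>R axis i 1)) - G \<gamma> (y + 0 *\<^sub>R (c *\<^sub>R axis i 1))) {0..1}"
    by (intro fundamental_theorem_of_calculus) auto
  moreover have "(\<Sum>j\<in>UNIV. (c *\<^sub>R axis i 1) $ j * G (inc \<gamma> j) (y + s *\<^sub>R (c *\<^sub>R axis i 1)))
      = c * G (inc \<gamma> i) (y + (c * s) *\<^sub>R axis i 1)" for s
    by (simp add: mult.assoc sum_distrib_left[symmetric] sum_axis mult.commute[of c s])
  ultimately have "((\<lambda>s. c * G (inc \<gamma> i) (y + (c * s) *\<^sub>R axis i 1)) has_integral
      G \<gamma> (y + c *\<^sub>R axis i 1) - G \<gamma> y) {0..1}"
    by simp
  from integral_unique[OF this] show ?thesis by (simp add: line_avg_def)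
qed

text \<open>A difference in one direction is \<open>c\<close> times the average of the partial
  derivative along the step. Differences of a jet again form a jet, so the induction hypothesis
  applies to \<open>G'\<close> and the remaining word.\<close>

lemma iter_diff_eq_iter_avg:
  assumes "jet G"
  shows "iter_diff c w (G \<gamma>) x = c ^ length w * iter_avg c w (G (\<lambda>j. \<gamma> j + count_list w j)) x"
  using assms
proof (induction w arbitrary: G)
  case (Cons i w)
  define G' where "G' \<gamma> y = G \<gamma> (y + c *\<^sub>R axis i 1) - G \<gamma> y" for \<gamma> y
  have G': "jet G'" unfolding G'_def by (rule jet_diff_translate[OF Cons.prems])
  let ?\<delta> = "\<lambda>j. \<gamma> j + count_list w j"
  have inc: "inc ?\<delta> i = (\<lambda>j. \<gamma> j + count_list (i # w) j)" by auto
  have "iter_diff c (i # w) (G \<gamma>) x = iter_diff c w (G' \<gamma>) x" by (simp add: G'_def[abs_def])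
  also have "\<dots> = c ^ length w * iter_avg c w (G' ?\<delta>) x" by (rule Cons.IH[OF G'])
  also have "G' ?\<delta> = (\<lambda>y. c * line_avg c i (G (inc ?\<delta> i)) y)"
    unfolding G'_def by (intro ext jet_diff_eq_line_avg Cons.prems)
  also have "c ^ length w * iter_avg c w (\<lambda>y. c * line_avg c i (G (inc ?\<delta> i)) y) x
      = c ^ length (i # w) * iter_avg c (i # w) (G (inc ?\<delta> i)) x"
    by (simp only: iter_avg_cmult iter_avg.simps list.size power_Suc power_add power_one_right) simp
  finally show ?case unfolding inc .
qed simp

text \<open>Points are described by their coordinates off the vertex 0, whose barycentric coordinate
  is the slack. From a point of \<open>lat k j\<close> one can make \<open>k - j\<close> further
  steps of length \<open>1 / k\<close> without leaving \<open>lat k k\<close>.\<close>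

definition lat :: "nat \<Rightarrow> nat \<Rightarrow> (real^'n::finite) set" where
  "lat k j = {\<chi> i. real (a i) / real k | a. (\<Sum>i\<in>UNIV. a i) \<le> j}"

lemma lat_mono: "j \<le> j' \<Longrightarrow> lat k j \<subseteq> lat k j'"
  by (auto simp: lat_def intro: order_trans)

lemma lat_step:
  assumes "x \<in> lat k j"
  shows "x + (1 / real k) *\<^sub>R axis i 1 \<in> lat k (Suc j)"
proof -
  obtain a where a: "x = (\<chi> i. real (a i) / real k)" "(\<Sum>i\<in>UNIV. a i) \<le> j"
    using assms by (auto simp: lat_def)
  have "x + (1 / real k) *\<^sub>R axis i 1 = (\<chi> l. real (inc a i l) / real k)"
    by (auto simp: a vec_eq_iff axis_def add_divide_distrib)
  moreover have "(\<Sum>l\<in>UNIV. inc a i l) \<le> Suc j" using a by (simp only: sum_inc)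
  ultimately show ?thesis unfolding lat_def by blast
qed

lemma zero_in_lat: "0 \<in> lat k j"
  unfolding lat_def by (auto simp: vec_eq_iff intro!: exI[of _ "\<lambda>_. 0"])

text \<open>Each difference doubles the bound and uses up one lattice step.\<close>

lemma iter_diff_bound:
  assumes "\<And>y. y \<in> lat k (j + length w) \<Longrightarrow> \<bar>u y\<bar> \<le> E" "x \<in> lat k j"
  shows "\<bar>iter_diff (1 / real k) w u x\<bar> \<le> 2 ^ length w * E"
  using assms(1)
proof (induction w arbitrary: u E)
  case (Cons i w)
  have "\<bar>u (y + (1 / real k) *\<^sub>R axis i 1) - u y\<bar> \<le> 2 * E" if "y \<in> lat k (j + length w)" for y
    using Cons.prems[of y] Cons.prems[of "y + (1 / real k) *\<^sub>R axis i 1"] lat_step[OF that, of i]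
      lat_mono[of "j + length w" "Suc (j + length w)" k] that by (auto simp: abs_le_iff)
  from Cons.IH[OF this] show ?case by (simp add: mult_ac)
qed (use assms(2) in simp)

section \<open>Iterated averages bounded by integrals over faces\<close>

definition line_avg_nn :: "real \<Rightarrow> 'n \<Rightarrow> (real^'n::finite \<Rightarrow> ennreal) \<Rightarrow> real^'n \<Rightarrow> ennreal" where
  "line_avg_nn c i h y = (\<integral>\<^sup>+s\<in>{0..1}. h (y + (c * s) *\<^sub>R axis i 1) \<partial>lborel)"

primrec iter_avg_nn :: "real \<Rightarrow> 'n list \<Rightarrow> (real^'n::finite \<Rightarrow> ennreal) \<Rightarrow> real^'n \<Rightarrow> ennreal" where
  "iter_avg_nn c [] h = h"
| "iter_avg_nn c (i # w) h = iter_avg_nn c w (line_avg_nn c i h)"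

lemma iter_avg_nn_mono: "(\<And>y. h y \<le> g y) \<Longrightarrow> iter_avg_nn c w h x \<le> iter_avg_nn c w g x"
proof (induction w arbitrary: h g)
  case (Cons i w)
  show ?case
    by (auto intro!: Cons.IH nn_integral_mono mult_right_mono Cons.prems simp: line_avg_nn_def)
qed simp

lemma abs_line_avg_le:
  assumes "continuous_on UNIV f"
  shows "ennreal \<bar>line_avg c i f y\<bar> \<le> line_avg_nn c i (\<lambda>y. ennreal \<bar>f y\<bar>) y"
proof -
  let ?g = "\<lambda>s. f (y + (c * s) *\<^sub>R axis i 1)"
  have i: "set_integrable lborel {0..1} ?g"
    by (intro borel_integrable_atLeastAtMost' continuous_line assms)
  then have "\<bar>line_avg c i f y\<bar> = \<bar>LINT s:{0..1}|lborel. ?g s\<bar>"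
    unfolding line_avg_def by (simp add: set_borel_integral_eq_integral(2))
  also have "\<dots> \<le> (LINT s:{0..1}|lborel. \<bar>?g s\<bar>)"
    using set_integral_norm_bound[OF i] by simp
  finally have "ennreal \<bar>line_avg c i f y\<bar> \<le> ennreal (LINT s:{0..1}|lborel. \<bar>?g s\<bar>)"
    by (rule ennreal_leI)
  also have "\<dots> = line_avg_nn c i (\<lambda>y. ennreal \<bar>f y\<bar>) y"
    unfolding line_avg_nn_def
    by (intro nn_set_integral_eq[symmetric] borel_integrable_atLeastAtMost' continuous_intros continuous_line assms) auto
  finally show ?thesis .
qed

lemma abs_iter_avg_le:
  assumes "continuous_on UNIV f"
  shows "ennreal \<bar>iter_avg c w f x\<bar> \<le> iter_avg_nn c w (\<lambda>y. ennreal \<bar>f y\<bar>) x"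
  using assms
proof (induction w arbitrary: f)
  case (Cons i w)
  have "ennreal \<bar>iter_avg c (i # w) f x\<bar> \<le> iter_avg_nn c w (\<lambda>y. ennreal \<bar>line_avg c i f y\<bar>) x"
    using Cons.IH[OF line_avg_continuous[OF Cons.prems]] by simp
  also have "\<dots> \<le> iter_avg_nn c w (line_avg_nn c i (\<lambda>y. ennreal \<bar>f y\<bar>)) x"
    by (intro iter_avg_nn_mono abs_line_avg_le Cons.prems)
  finally show ?case by simp
qed simp

text \<open>The points visited keep nonnegative coordinates, and each letter raises the coordinate
  sum by at most \<open>c\<close>, so the budget \<open>b\<close> drops by \<open>c\<close> per
  letter. This is how the indicator of the simplex is inserted into an average.\<close>

lemma iter_avg_nn_cong:
  fixes x :: "real^'n"
  assumes c: "0 \<le> c"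
    and eq: "\<And>y. (\<forall>i. 0 \<le> y $ i) \<Longrightarrow> (\<Sum>i\<in>UNIV. y $ i) \<le> b \<Longrightarrow> h y = g y"
    and x: "\<forall>i. 0 \<le> x $ i" "(\<Sum>i\<in>UNIV. x $ i) + real (length w) * c \<le> b"
  shows "iter_avg_nn c w h x = iter_avg_nn c w g x"
  using eq x
proof (induction w arbitrary: h g b)
  case (Cons i w)
  show ?case
    unfolding iter_avg_nn.simps
  proof (rule Cons.IH[where b="b - c"])
    fix y :: "real^'n" assume y: "\<forall>i. 0 \<le> y $ i" "(\<Sum>i\<in>UNIV. y $ i) \<le> b - c"
    have "h (y + (c * s) *\<^sub>R axis i 1) = g (y + (c * s) *\<^sub>R axis i 1)" if "s \<in> {0..1}" for s
    proof (rule Cons.prems(1))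
      show "\<forall>l. 0 \<le> (y + (c * s) *\<^sub>R axis i 1) $ l"
        using y c that by (auto simp: axis_def)
      have "(\<Sum>l\<in>UNIV. (y + (c * s) *\<^sub>R axis i 1) $ l) = (\<Sum>l\<in>UNIV. y $ l) + c * s"
        using sum_axis[of i "\<lambda>_. c * s"] by (simp add: sum.distrib mult.commute)
      also have "\<dots> \<le> b - c + c * 1"
        using y c that by (intro add_mono mult_left_mono) auto
      finally show "(\<Sum>l\<in>UNIV. (y + (c * s) *\<^sub>R axis i 1) $ l) \<le> b" by simp
    qed
    then show "line_avg_nn c i h y = line_avg_nn c i g y"
      unfolding line_avg_nn_def by (intro nn_integral_cong) (auto simp: indicator_def)
  next
    show "(\<Sum>i\<in>UNIV. x $ i) + real (length w) * c \<le> b - c"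
      using Cons.prems(3) by (simp add: algebra_simps)
  qed (use Cons.prems in simp)
qed simp

abbreviation axes :: "'n list \<Rightarrow> (real^'n) set" where
  "axes w \<equiv> (\<lambda>i. axis i 1) ` set w"

lemma axis1_eq_iff: "axis i (1::real) = axis j 1 \<longleftrightarrow> i = j"
  by (simp add: axis_eq_axis)

lemma borel_measurable_line_avg_nn [measurable (raw)]:
  assumes [measurable]: "h \<in> borel_measurable borel"
  shows "line_avg_nn c i h \<in> borel_measurable borel"
  unfolding line_avg_nn_def by measurable

text \<open>For a letter that does not recur in the rest of the word, the substitution
  \<open>t = c * s\<close> costs \<open>1 / c\<close> and the step is enlarged to the full line. A
  recurring letter only translates within the face, which leaves the face integral unchanged. So
  just the \<open>card (set w)\<close> distinct directions count.\<close>

lemma iter_avg_nn_le_face_int: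
  fixes h :: "real^'n \<Rightarrow> ennreal"
  assumes h: "h \<in> borel_measurable borel" and c: "0 < c"
  shows "iter_avg_nn c w h x \<le> ennreal ((1 / c) ^ card (set w)) * face_int (axes w) h x"
  using h
proof (induction w arbitrary: h)
  case (Cons i w)
  note [measurable] = Cons.prems
  have IH: "iter_avg_nn c (i # w) h x \<le> ennreal ((1 / c) ^ card (set w)) * face_int (axes w) (line_avg_nn c i h) x"
    using Cons.IH[of "line_avg_nn c i h"] by simp
  show ?case
  proof (cases "i \<in> set w")
    case True
    have "face_int (axes w) (line_avg_nn c i h) x = (\<integral>\<^sup>+s. face_int (axes w) (\<lambda>y. h (y + (c * s) *\<^sub>R axis i 1) * indicator {0..1} s) x \<partial>lborel)"
      unfolding line_avg_nn_def by (rule face_int_swap) auto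
    also have "\<dots> = (\<integral>\<^sup>+s. face_int (axes w) h x * indicator {0..1::real} s \<partial>lborel)"
    proof (intro nn_integral_cong)
      fix s :: real
      have "face_int (axes w) (\<lambda>y. h (y + (c * s) *\<^sub>R axis i 1)) x = face_int (axes w) h x"
        using face_int_translate[of "axes w" "axis i 1" h x "c * s"] True Cons.prems
        by (simp add: face_int_shift)
      then show "face_int (axes w) (\<lambda>y. h (y + (c * s) *\<^sub>R axis i 1) * indicator {0..1} s) x = face_int (axes w) h x * indicator {0..1} s"
        by (cases "s \<in> {0..1}") (auto simp: face_int_def)
    qed
    also have "\<dots> = face_int (axes w) h x" by (simp add: nn_integral_cmult_indicator)
    finally show ?thesis using IH True by (simp add: insert_absorb)
  next
    case False
    define H where "H y = (\<integral>\<^sup>+t. h (y + t *\<^sub>R axis i 1) \<partial>lborel)" for y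
    have [measurable]: "H \<in> borel_measurable borel" unfolding H_def by measurable
    have "line_avg_nn c i h y \<le> ennreal (1 / c) * H y" for y
    proof -
      have "H y = ennreal c * (\<integral>\<^sup>+s. h (y + (0 + c * s) *\<^sub>R axis i 1) \<partial>lborel)"
        unfolding H_def using c by (subst nn_integral_real_affine[where c=c and t=0]) auto
      then have "ennreal (1 / c) * H y = (\<integral>\<^sup>+s. h (y + (c * s) *\<^sub>R axis i 1) \<partial>lborel)"
        using c by (simp add: mult.assoc[symmetric] ennreal_mult[symmetric])
      then show ?thesis
        unfolding line_avg_nn_def by (auto intro!: nn_integral_mono simp: indicator_def)
    qed
    then have "face_int (axes w) (line_avg_nn c i h) x \<le> face_int (axes w) (\<lambda>y. ennreal (1 / c) * H y) x"
      by (intro face_int_mono)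
    also have "\<dots> = ennreal (1 / c) * face_int (axes w) H x" by (rule face_int_cmult) measurable
    also have "face_int (axes w) H x = face_int (axes (i # w)) h x"
      using False by (simp add: face_int_insert H_def[abs_def] image_iff axis1_eq_iff)
    finally have "iter_avg_nn c (i # w) h x \<le> ennreal ((1 / c) ^ card (set w)) * (ennreal (1 / c) * face_int (axes (i # w)) h x)"
      using IH by (meson mult_left_mono order_trans zero_le)
    also have "\<dots> = ennreal ((1 / c) ^ card (set (i # w))) * face_int (axes (i # w)) h x"
      using False c by (simp add: mult.assoc[symmetric] ennreal_mult[symmetric] mult.commute)
    finally show ?thesis .
  qed
qed simp

text \<open>The base points in use are the origin and one lattice step along an edge. The conditions
  on \<open>s\<close> keep the average inside the simplex and the base point in the span of the
  face.\<close>

lemma iter_avg_le_face_int: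
  fixes f :: "real^'n \<Rightarrow> real"
  assumes f: "continuous_on UNIV f" and c: "0 < c" and s: "0 \<le> s" "s + real (length w) * c \<le> 1" "s = 0 \<or> i \<in> set w"
  shows "ennreal \<bar>iter_avg c w f (s *\<^sub>R axis i 1)\<bar> \<le> ennreal ((1 / c) ^ card (set w)) * face_int (axes w) (restr f) 0"
proof -
  let ?x = "s *\<^sub>R axis i 1 :: real^'n"
  have [measurable]: "f \<in> borel_measurable borel" by (rule borel_measurable_continuous_onI[OF f])
  have "ennreal \<bar>iter_avg c w f ?x\<bar> \<le> iter_avg_nn c w (\<lambda>y. ennreal \<bar>f y\<bar>) ?x"
    by (rule abs_iter_avg_le[OF f])
  also have "\<dots> = iter_avg_nn c w (restr f) ?x"
  proof (rule iter_avg_nn_cong[where b=1])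
    show "\<forall>j. 0 \<le> ?x $ j" using s by (simp add: axis_def)
    have "(\<Sum>j\<in>UNIV. ?x $ j) = s" using sum_axis[of i "\<lambda>_. s"] by (simp add: mult.commute)
    then show "(\<Sum>j\<in>UNIV. ?x $ j) + real (length w) * c \<le> 1" using s by simp
  qed (use c in \<open>auto simp: std_sx_def\<close>)
  also have "\<dots> \<le> ennreal ((1 / c) ^ card (set w)) * face_int (axes w) (restr f) ?x"
    by (rule iter_avg_nn_le_face_int[OF _ c]) measurable
  also have "face_int (axes w) (restr f) ?x = face_int (axes w) (restr f) 0"
    using s(3) face_int_translate[of "axes w" "axis i 1" "restr f" 0 s] by auto
  finally show ?thesis .
qed

text \<open>The averaging functional at \<open>x\<close> is continuous on \<open>W\<^sup>r\<^sup>,\<^sup>p\<close> of the reference simplex.\<close>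

definition trace_bd :: "real \<Rightarrow> real \<Rightarrow> 'n::finite list \<Rightarrow> real^'n \<Rightarrow> nat \<Rightarrow> bool" where
  "trace_bd p c w x r \<longleftrightarrow> (\<exists>C\<ge>0. \<forall>G \<gamma>. jet G \<longrightarrow>
     \<bar>iter_avg c w (G \<gamma>) x\<bar> \<le> C * (\<Sum>\<eta>\<in>mi_le r. nmp p (G (\<lambda>i. \<gamma> i + \<eta> i))))"

lemma card_Basis_minus_axes: "card (Basis - axes w) = CARD('n::finite) - card (set (w :: 'n list))"
proof -
  have "card (axes w) = card (set w)"
    by (intro card_image inj_onI) (simp add: axis1_eq_iff)
  moreover have "axes w \<subseteq> Basis" by auto
  ultimately show ?thesis by (simp add: card_Diff_subset finite_subset)
qed

lemma trace_bd_face: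
  fixes w :: "'n::finite list"
  assumes p: "1 \<le> p" and c: "0 < c" and s: "0 \<le> s" "s + real (length w) * c \<le> 1" "s = 0 \<or> i \<in> set w"
    and r: "CARD('n) \<le> card (set w) + r"
  shows "trace_bd p c w (s *\<^sub>R axis i 1) r"
proof -
  obtain C where C: "0 \<le> C" "\<And>(G :: ('n \<Rightarrow> nat) \<Rightarrow> real^'n \<Rightarrow> real) (B :: (real^'n) set) \<gamma>. jet G \<Longrightarrow> B \<subseteq> Basis \<Longrightarrow> card (Basis - B) \<le> r \<Longrightarrow>
    face_int B (restr (G \<gamma>)) 0 \<le> ennreal (C * (\<Sum>\<eta>\<in>mi_le r. nmp p (G (\<lambda>i. \<gamma> i + \<eta> i))))"
    using face_trace[OF p, where 'n='n and r=r] by blast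
  have "\<bar>iter_avg c w (G \<gamma>) (s *\<^sub>R axis i 1)\<bar> \<le> ((1 / c) ^ card (set w) * C) * (\<Sum>\<eta>\<in>mi_le r. nmp p (G (\<lambda>i. \<gamma> i + \<eta> i)))"
    if G: "jet G" for G :: "('n \<Rightarrow> nat) \<Rightarrow> real^'n \<Rightarrow> real" and \<gamma>
  proof -
    have cd: "card (Basis - axes w) \<le> r" using r by (simp add: card_Basis_minus_axes)
    have "ennreal \<bar>iter_avg c w (G \<gamma>) (s *\<^sub>R axis i 1)\<bar> \<le> ennreal ((1 / c) ^ card (set w)) * face_int (axes w) (restr (G \<gamma>)) 0"
      by (rule iter_avg_le_face_int[OF jet_continuous[OF G] c s])
    also have "\<dots> \<le> ennreal ((1 / c) ^ card (set w)) * ennreal (C * (\<Sum>\<eta>\<in>mi_le r. nmp p (G (\<lambda>i. \<gamma> i + \<eta> i))))"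
      using cd by (intro mult_left_mono C(2)[OF G]) auto
    also have "\<dots> = ennreal (((1 / c) ^ card (set w) * C) * (\<Sum>\<eta>\<in>mi_le r. nmp p (G (\<lambda>i. \<gamma> i + \<eta> i))))"
      using C c by (simp add: ennreal_mult[symmetric] sum_nonneg mult.assoc)
    finally show ?thesis
      using C c by (subst (asm) ennreal_le_iff) (auto intro!: mult_nonneg_nonneg sum_nonneg)
  qed
  then show ?thesis
    unfolding trace_bd_def using C c by (intro exI[of _ "(1 / c) ^ card (set w) * C"]) auto
qed

section \<open>Point and edge traces\<close>

text \<open>Jensen without integrability of \<open>f\<close> as a hypothesis: it follows from mass
  at most 1 and \<open>f \<le> 1 + f powr p\<close>.\<close>

lemma jensen_nn_le:
  fixes f :: "'a \<Rightarrow> real"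
  assumes M: "emeasure M (space M) \<le> 1" and f[measurable]: "f \<in> borel_measurable M" and f0: "\<And>x. 0 \<le> f x" and p: "1 \<le> p"
    and B: "0 \<le> B" "(\<integral>\<^sup>+x. ennreal (f x powr p) \<partial>M) \<le> ennreal (B powr p)"
  shows "(\<integral>\<^sup>+x. ennreal (f x) \<partial>M) \<le> ennreal B"
proof -
  have le: "f x \<le> 1 + f x powr p" for x
  proof (cases "f x \<le> 1")
    case False
    then have "f x powr 1 \<le> f x powr p" using p by (intro powr_mono) auto
    then show ?thesis using False by simp
  qed (simp add: add_increasing2)
  have "(\<integral>\<^sup>+x. ennreal (f x) \<partial>M) \<le> (\<integral>\<^sup>+x. 1 + ennreal (f x powr p) \<partial>M)"
    using le by (intro nn_integral_mono) (metis ennreal_1 ennreal_leI ennreal_plus powr_ge_zero zero_le_one)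
  also have "\<dots> = emeasure M (space M) + (\<integral>\<^sup>+x. ennreal (f x powr p) \<partial>M)"
    by (subst nn_integral_add) auto
  also have "\<dots> < \<infinity>"
    using M B by (auto simp: less_top[symmetric] top_unique)
  finally have i: "integrable M f"
    using f0 by (intro integrableI_nonneg) auto
  have "ennreal ((\<integral>x. f x \<partial>M) powr p) \<le> ennreal (B powr p)"
    using jensen_powr_nn[OF M i f0 p] B(2) by (rule order_trans)
  then have "(\<integral>x. f x \<partial>M) powr p \<le> B powr p" by simp
  then have "(\<integral>x. f x \<partial>M) \<le> B"
    using p B(1) f0 by (metis less_le_trans not_le powr_less_mono2 zero_less_one)
  then show ?thesis
    by (subst nn_integral_eq_integral[OF i]) (auto simp: f0 ennreal_leI)
qed

lemma nn_integral_powr_01: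
  fixes a :: real
  assumes "-1 < a"
  shows "(\<integral>\<^sup>+s\<in>{0..1}. ennreal (s powr a) \<partial>lborel) = ennreal (1 / (a + 1))"
proof -
  have "((\<lambda>s. s powr a) has_integral (1 powr (a + 1) / (a + 1))) {0..1}"
    by (rule has_integral_powr_from_0[OF assms]) simp
  then have "((\<lambda>s. s powr a) has_integral (1 / (a + 1))) {0..1}" by simp
  from nn_integral_has_integral_lebesgue[OF _ this]
  have "(\<integral>\<^sup>+s. ennreal (indicator {0..1} s * s powr a) \<partial>lborel) = ennreal (1 / (a + 1))"
    by (simp add: nn_integral_completion)
  moreover have "(\<integral>\<^sup>+s\<in>{0..1}. ennreal (s powr a) \<partial>lborel) = (\<integral>\<^sup>+s. ennreal (indicator {0..1} s * s powr a) \<partial>lborel)"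
    by (intro nn_integral_cong) (auto simp: indicator_def)
  ultimately show ?thesis by simp
qed

text \<open>The fundamental theorem on the segment from \<open>y\<close> to \<open>z\<close>,
  integrated over \<open>z\<close>. It is the common source of the point and edge traces, which
  differ in how the integral of the gradient is estimated.\<close>

lemma first_order_average:
  fixes G :: "('n \<Rightarrow> nat) \<Rightarrow> real^'n \<Rightarrow> real"
  assumes G: "jet G" and y: "y \<in> std_sx"
  shows "ennreal (svol TYPE('n)) * ennreal \<bar>G \<gamma> y\<bar> \<le> (\<integral>\<^sup>+x. restr (G \<gamma>) x \<partial>lborel) +
    (\<integral>\<^sup>+s\<in>{0..1}. (\<integral>\<^sup>+z\<in>std_sx. ennreal (grad1 G \<gamma> ((1 - s) *\<^sub>R y + s *\<^sub>R z)) \<partial>lborel) \<partial>lborel)"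
proof -
  let ?K = "std_sx :: (real^'n) set"
  have [measurable]: "G \<gamma> \<in> borel_measurable borel" "grad1 G \<gamma> \<in> borel_measurable borel"
    using G by (rule jet_measurable, rule grad1_measurable)
  have "ennreal (svol TYPE('n)) * ennreal \<bar>G \<gamma> y\<bar> = (\<integral>\<^sup>+z\<in>?K. ennreal \<bar>G \<gamma> y\<bar> \<partial>lborel)"
    using emeasure_std_sx_fin[where 'n='n]
    by (subst nn_integral_cmult_indicator) (simp_all add: svol_def emeasure_eq_ennreal_measure mult.commute)
  also have "\<dots> \<le> (\<integral>\<^sup>+z. restr (G \<gamma>) z + (\<integral>\<^sup>+s\<in>{0..1}. ennreal (grad1 G \<gamma> ((1 - s) *\<^sub>R y + s *\<^sub>R z)) \<partial>lborel) * indicator ?K z \<partial>lborel)"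
  proof (intro nn_integral_mono, goal_cases)
    case (1 z)
    show ?case
    proof (cases "z \<in> ?K")
      case True
      have "ennreal \<bar>G \<gamma> y\<bar> \<le> ennreal (\<bar>G \<gamma> z\<bar> + \<bar>G \<gamma> z - G \<gamma> y\<bar>)" by (intro ennreal_leI) simp
      also have "\<dots> = ennreal \<bar>G \<gamma> z\<bar> + ennreal \<bar>G \<gamma> z - G \<gamma> y\<bar>" by simp
      also have "\<dots> \<le> ennreal \<bar>G \<gamma> z\<bar> + (\<integral>\<^sup>+s\<in>{0..1}. ennreal (grad1 G \<gamma> ((1 - s) *\<^sub>R y + s *\<^sub>R z)) \<partial>lborel)"
        using jet_segment_bound[OF G y True, of 0 1 \<gamma>] by (intro add_left_mono) simp
      finally show ?thesis using True by simp
    qed simp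
  qed
  also have "\<dots> = (\<integral>\<^sup>+x. restr (G \<gamma>) x \<partial>lborel) + (\<integral>\<^sup>+z. (\<integral>\<^sup>+s. ennreal (grad1 G \<gamma> ((1 - s) *\<^sub>R y + s *\<^sub>R z)) * indicator {0..1} s * indicator ?K z \<partial>lborel) \<partial>lborel)"
    by (subst nn_integral_add) (auto simp: nn_integral_multc)
  also have "(\<integral>\<^sup>+z. (\<integral>\<^sup>+s. ennreal (grad1 G \<gamma> ((1 - s) *\<^sub>R y + s *\<^sub>R z)) * indicator {0..1} s * indicator ?K z \<partial>lborel) \<partial>lborel)
     = (\<integral>\<^sup>+s. (\<integral>\<^sup>+z. ennreal (grad1 G \<gamma> ((1 - s) *\<^sub>R y + s *\<^sub>R z)) * indicator {0..1} s * indicator ?K z \<partial>lborel) \<partial>lborel)"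
    by (rule lborel_pair.Fubini') measurable
  also have "\<dots> = (\<integral>\<^sup>+s\<in>{0..1}. (\<integral>\<^sup>+z\<in>?K. ennreal (grad1 G \<gamma> ((1 - s) *\<^sub>R y + s *\<^sub>R z)) \<partial>lborel) \<partial>lborel)"
    by (intro nn_integral_cong) (auto simp: indicator_def)
  finally show ?thesis .
qed

text \<open>Jensen on the simplex, followed by a dilation of ratio \<open>s\<close>, whose Jacobian
  \<open>1 / s ^ CARD('n)\<close> enters under the \<open>p\<close>-th root.\<close>

lemma dilate_holder:
  fixes H :: "real^'n \<Rightarrow> real"
  assumes H: "continuous_on UNIV H" "\<And>x. 0 \<le> H x" and y: "y \<in> std_sx" and s: "0 < s" "s \<le> 1" and p: "1 \<le> p"
  shows "(\<integral>\<^sup>+z\<in>std_sx. ennreal (H ((1 - s) *\<^sub>R y + s *\<^sub>R z)) \<partial>lborel) \<le> ennreal (s powr (- real CARD('n) / p) * nmp p H)"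
proof -
  let ?K = "std_sx :: (real^'n) set"
  have [measurable]: "H \<in> borel_measurable borel" by (rule borel_measurable_continuous_onI[OF H(1)])
  let ?M = "density lborel (indicator ?K) :: (real^'n) measure"
  let ?B = "s powr (- real CARD('n) / p) * nmp p H"
  have 1: "emeasure ?M (space ?M) \<le> 1"
    using emeasure_std_sx_le by (simp add: emeasure_density)
  have "(\<integral>\<^sup>+z. ennreal (H ((1 - s) *\<^sub>R y + s *\<^sub>R z) powr p) \<partial>?M)
     = (\<integral>\<^sup>+z. indicator ?K z * ennreal (H ((1 - s) *\<^sub>R y + s *\<^sub>R z) powr p) \<partial>lborel)"
    by (rule nn_integral_density) measurable
  also have "\<dots> \<le> (\<integral>\<^sup>+z. (\<lambda>x. ennreal (H x powr p) * indicator ?K x) ((1 - s) *\<^sub>R y + s *\<^sub>R z) \<partial>lborel)"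
    using s std_sx_seg[OF y] by (intro nn_integral_mono) (auto simp: indicator_def)
  also have "\<dots> = ennreal (1 / \<bar>s\<bar> ^ DIM(real^'n)) * (\<integral>\<^sup>+x\<in>?K. ennreal (H x powr p) \<partial>lborel)"
    using s by (intro nn_integral_affine) auto
  finally have le: "(\<integral>\<^sup>+z. ennreal (H ((1 - s) *\<^sub>R y + s *\<^sub>R z) powr p) \<partial>?M)
     \<le> ennreal (1 / \<bar>s\<bar> ^ DIM(real^'n)) * (\<integral>\<^sup>+x\<in>?K. ennreal (H x powr p) \<partial>lborel)" .
  have e1: "(\<integral>\<^sup>+x\<in>?K. ennreal (H x powr p) \<partial>lborel) = ennreal (nmp p H powr p)"
    using nn_nmp[OF continuous_on_subset[OF H(1) subset_UNIV] p] H(2) by simp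
  have e2: "ennreal (1 / \<bar>s\<bar> ^ DIM(real^'n)) * ennreal (nmp p H powr p) = ennreal (?B powr p)"
  proof -
    have "?B powr p = (s powr (- real CARD('n) / p)) powr p * nmp p H powr p"
      by (rule powr_mult)
    also have "(s powr (- real CARD('n) / p)) powr p = s powr (- real CARD('n))"
      using p by (simp add: powr_powr)
    also have "s powr (- real CARD('n)) = 1 / \<bar>s\<bar> ^ DIM(real^'n)"
      using s by (simp add: powr_minus powr_realpow divide_inverse)
    finally have "?B powr p = 1 / \<bar>s\<bar> ^ DIM(real^'n) * nmp p H powr p" .
    then show ?thesis using ennreal_mult[of "1 / \<bar>s\<bar> ^ DIM(real^'n)" "nmp p H powr p"] by (metis abs_ge_zero divide_nonneg_nonneg powr_ge_zero zero_le_one zero_le_power)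
  qed
  have "(\<integral>\<^sup>+z. ennreal (H ((1 - s) *\<^sub>R y + s *\<^sub>R z)) \<partial>?M) \<le> ennreal ?B"
    by (rule jensen_nn_le[OF 1 _ _ p _ le[unfolded e1 e2]]) (simp_all add: H(2))
  then show ?thesis
    by (subst (asm) nn_integral_density) (auto simp: mult.commute)
qed

lemma grad1_nmp_le:
  assumes "jet G" "1 \<le> p"
  shows "nmp p (grad1 G \<gamma>) \<le> real CARD('n::finite) * (\<Sum>i\<in>(UNIV::'n set). nmp p (G (inc \<gamma> i)))"
  by (intro nmp_sum_le grad1_continuous jet_continuous assms) (auto simp: grad1_def sum_nonneg)

lemma zero_mi_le: "(\<lambda>_. 0) \<in> mi_le r" by (simp add: mi_le_def)

lemma nmp_le_sum_mi:
  assumes "\<eta> \<in> mi_le r"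
  shows "nmp p (G (\<lambda>i. \<gamma> i + \<eta> i)) \<le> (\<Sum>\<eta>\<in>mi_le r. nmp p (G (\<lambda>i. \<gamma> i + \<eta> i)))"
  using assms by (intro member_le_sum[where f="\<lambda>\<eta>. nmp p (G (\<lambda>i. \<gamma> i + \<eta> i))"]) auto

lemma nmp_inc_le:
  assumes "1 \<le> r"
  shows "nmp p (G (inc \<gamma> i)) \<le> (\<Sum>\<eta>\<in>mi_le r. nmp p (G (\<lambda>i. \<gamma> i + \<eta> i)))"
proof -
  have "inc (\<lambda>_. 0) i \<in> mi_le r" using assms by (simp only: mi_le_def mem_Collect_eq sum_inc) simp
  note nmp_le_sum_mi[OF this, of p G \<gamma>]
  moreover have "(\<lambda>l. \<gamma> l + inc (\<lambda>_. 0) i l) = inc \<gamma> i" by auto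
  ultimately show ?thesis by metis
qed

lemma nmp_inc_inc_le:
  assumes "2 \<le> r"
  shows "nmp p (G (inc (inc \<gamma> i) j)) \<le> (\<Sum>\<eta>\<in>mi_le r. nmp p (G (\<lambda>i. \<gamma> i + \<eta> i)))"
proof -
  have "inc (inc (\<lambda>_. 0) i) j \<in> mi_le r" using assms by (simp only: mi_le_def mem_Collect_eq sum_inc) simp
  note nmp_le_sum_mi[OF this, of p G \<gamma>]
  moreover have "(\<lambda>l. \<gamma> l + inc (inc (\<lambda>_. 0) i) j l) = inc (inc \<gamma> i) j" by auto
  ultimately show ?thesis by metis
qed

lemma grad1_nmp_le_sum:
  fixes G :: "('n \<Rightarrow> nat) \<Rightarrow> real^'n::finite \<Rightarrow> real"
  assumes "jet G" "1 \<le> p" "1 \<le> r"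
  shows "nmp p (grad1 G \<gamma>) \<le> real CARD('n) ^ 2 * (\<Sum>\<eta>\<in>mi_le r. nmp p (G (\<lambda>i. \<gamma> i + \<eta> i)))"
proof -
  have "nmp p (grad1 G \<gamma>) \<le> real CARD('n) * (\<Sum>i\<in>(UNIV::'n set). nmp p (G (inc \<gamma> i)))"
    by (rule grad1_nmp_le[OF assms(1,2)])
  also have "\<dots> \<le> real CARD('n) * (\<Sum>i\<in>(UNIV::'n set). (\<Sum>\<eta>\<in>mi_le r. nmp p (G (\<lambda>i. \<gamma> i + \<eta> i))))"
    by (intro mult_left_mono sum_mono nmp_inc_le assms) auto
  finally show ?thesis by (simp add: power2_eq_square)
qed

text \<open>In \<open>first_order_average\<close> the gradient at the intermediate point is replaced
  by its value at \<open>z\<close> and an integral of second derivatives over the rest of the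
  segment. Exchanging the two parameters gives the weight \<open>u\<close> against the dilation
  factor \<open>u powr (- d / p)\<close>; the product \<open>u powr a\<close> is integrable at 0
  precisely when \<open>p > d / 2\<close>.\<close>

lemma trace_bd_point:
  fixes y :: "real^'n"
  assumes p: "1 \<le> p" "real CARD('n) / 2 < p" and y: "y \<in> std_sx"
  shows "trace_bd p c [] y 2"
proof -
  let ?K = "std_sx :: (real^'n) set"
  let ?v = "svol TYPE('n)" and ?d = "real CARD('n)"
  have v: "0 < ?v" by (rule svol_pos)
  define a where "a = 1 - ?d / p"
  have a: "-1 < a" using p by (simp add: a_def field_simps)
  define C where "C = (1 + ?d ^ 2 + ?d ^ 4 / (a + 1)) / ?v"
  have C: "0 \<le> C" using a v by (simp add: C_def)
  have vC: "?v * (C * S) = S + (?d ^ 2 * S + ?d ^ 4 * S / (a + 1))" for S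
  proof -
    have "?v * (C * S) = (1 + ?d ^ 2 + ?d ^ 4 / (a + 1)) * S" using v by (simp add: C_def)
    then show ?thesis by (simp add: distrib_right)
  qed
  have main: "\<bar>G \<gamma> y\<bar> \<le> C * (\<Sum>\<eta>\<in>mi_le 2. nmp p (G (\<lambda>i. \<gamma> i + \<eta> i)))" (is "_ \<le> C * ?S")
    if G: "jet G" for G :: "('n \<Rightarrow> nat) \<Rightarrow> real^'n \<Rightarrow> real" and \<gamma>
  proof -
    define H where "H x = (\<Sum>i\<in>UNIV. grad1 G (inc \<gamma> i) x)" for x
    have H: "continuous_on S H" "\<And>x. 0 \<le> H x" for S
      unfolding H_def by (auto intro!: continuous_intros grad1_continuous G sum_nonneg)
    have [measurable]: "G \<delta> \<in> borel_measurable borel" "grad1 G \<delta> \<in> borel_measurable borel" for \<delta>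
      using G by (rule jet_measurable, rule grad1_measurable)
    have [measurable]: "H \<in> borel_measurable borel" by (rule borel_measurable_continuous_onI[OF H(1)])
    let ?x = "\<lambda>s z. (1 - s) *\<^sub>R y + s *\<^sub>R z"
    \<comment> \<open>The parameters of the two successive integrations satisfy
      \<open>s \<le> u\<close>. The triangle is a measurable set of its own so that Fubini's theorem
      can exchange them.\<close>
    define T where "T = {x :: real \<times> real. 0 \<le> fst x \<and> fst x \<le> snd x \<and> snd x \<le> 1}"
    have [measurable]: "T \<in> sets borel"
      unfolding T_def
      by (intro borel_closed closed_Collect_conj closed_Collect_le continuous_intros)
    have S0: "0 \<le> ?S" by (simp add: sum_nonneg)
    have g: "ennreal (grad1 G \<gamma> (?x s z)) \<le> ennreal (grad1 G \<gamma> z) + (\<integral>\<^sup>+u\<in>{s..1}. ennreal (H (?x u z)) \<partial>lborel)"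
      if s: "s \<in> {0..1}" and z: "z \<in> ?K" for s z
    proof -
      have "ennreal (grad1 G \<gamma> (?x s z)) = (\<Sum>i\<in>UNIV. ennreal \<bar>G (inc \<gamma> i) (?x s z)\<bar>)"
        by (simp add: grad1_def)
      also have "\<dots> \<le> (\<Sum>i\<in>UNIV. ennreal \<bar>G (inc \<gamma> i) z\<bar> + (\<integral>\<^sup>+u\<in>{s..1}. ennreal (grad1 G (inc \<gamma> i) (?x u z)) \<partial>lborel))"
      proof (rule sum_mono)
        fix i :: 'n
        have "ennreal \<bar>G (inc \<gamma> i) (?x s z)\<bar> \<le> ennreal (\<bar>G (inc \<gamma> i) z\<bar> + \<bar>G (inc \<gamma> i) (?x 1 z) - G (inc \<gamma> i) (?x s z)\<bar>)"
          by (intro ennreal_leI) simp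
        also have "\<dots> = ennreal \<bar>G (inc \<gamma> i) z\<bar> + ennreal \<bar>G (inc \<gamma> i) (?x 1 z) - G (inc \<gamma> i) (?x s z)\<bar>" by simp
        also have "\<dots> \<le> ennreal \<bar>G (inc \<gamma> i) z\<bar> + (\<integral>\<^sup>+u\<in>{s..1}. ennreal (grad1 G (inc \<gamma> i) (?x u z)) \<partial>lborel)"
          using s by (intro add_left_mono jet_segment_bound G y z) auto
        finally show "ennreal \<bar>G (inc \<gamma> i) (?x s z)\<bar> \<le> ennreal \<bar>G (inc \<gamma> i) z\<bar> + (\<integral>\<^sup>+u\<in>{s..1}. ennreal (grad1 G (inc \<gamma> i) (?x u z)) \<partial>lborel)" .
      qed
      also have "\<dots> = ennreal (grad1 G \<gamma> z) + (\<Sum>i\<in>UNIV. \<integral>\<^sup>+u\<in>{s..1}. ennreal (grad1 G (inc \<gamma> i) (?x u z)) \<partial>lborel)"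
        by (simp add: sum.distrib grad1_def)
      also have "(\<Sum>i\<in>UNIV. \<integral>\<^sup>+u\<in>{s..1}. ennreal (grad1 G (inc \<gamma> i) (?x u z)) \<partial>lborel) = (\<integral>\<^sup>+u\<in>{s..1}. ennreal (H (?x u z)) \<partial>lborel)"
        by (subst nn_integral_sum[symmetric]) (auto simp: H_def sum_distrib_right[symmetric])
      finally show ?thesis .
    qed
    have "ennreal ?v * ennreal \<bar>G \<gamma> y\<bar> \<le> (\<integral>\<^sup>+x. restr (G \<gamma>) x \<partial>lborel) +
      (\<integral>\<^sup>+s\<in>{0..1}. (\<integral>\<^sup>+z\<in>?K. ennreal (grad1 G \<gamma> (?x s z)) \<partial>lborel) \<partial>lborel)"
      by (rule first_order_average[OF G y])
    also have "(\<integral>\<^sup>+s\<in>{0..1}. (\<integral>\<^sup>+z\<in>?K. ennreal (grad1 G \<gamma> (?x s z)) \<partial>lborel) \<partial>lborel)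
      \<le> (\<integral>\<^sup>+s. (\<integral>\<^sup>+z. restr (grad1 G \<gamma>) z \<partial>lborel) * indicator {0..1} s + (\<integral>\<^sup>+z. (\<integral>\<^sup>+u. ennreal (H (?x u z)) * indicator T (s, u) * indicator ?K z \<partial>lborel) \<partial>lborel) \<partial>lborel)"
    proof (intro nn_integral_mono, goal_cases)
      case (1 s)
      show ?case
      proof (cases "s \<in> {0..1}")
        case True
        have eq: "(\<integral>\<^sup>+u\<in>{s..1}. ennreal (H (?x u z)) \<partial>lborel) = (\<integral>\<^sup>+u. ennreal (H (?x u z)) * indicator T (s, u) \<partial>lborel)" for z
          using True by (intro nn_integral_cong) (auto simp: indicator_def T_def)
        have "(\<integral>\<^sup>+z\<in>?K. ennreal (grad1 G \<gamma> (?x s z)) \<partial>lborel) \<le> (\<integral>\<^sup>+z. restr (grad1 G \<gamma>) z + (\<integral>\<^sup>+u. ennreal (H (?x u z)) * indicator T (s, u) * indicator ?K z \<partial>lborel) \<partial>lborel)"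
          using g[OF True] unfolding eq by (intro nn_integral_mono) (auto simp: indicator_def)
        also have "\<dots> = (\<integral>\<^sup>+z. restr (grad1 G \<gamma>) z \<partial>lborel) + (\<integral>\<^sup>+z. (\<integral>\<^sup>+u. ennreal (H (?x u z)) * indicator T (s, u) * indicator ?K z \<partial>lborel) \<partial>lborel)"
          by (rule nn_integral_add) measurable
        finally show ?thesis using True by simp
      qed simp
    qed
    also have "\<dots> = (\<integral>\<^sup>+s. (\<integral>\<^sup>+z. restr (grad1 G \<gamma>) z \<partial>lborel) * indicator {0..1} (s::real) \<partial>lborel) + (\<integral>\<^sup>+s. (\<integral>\<^sup>+z. (\<integral>\<^sup>+u. ennreal (H (?x u z)) * indicator T (s, u) * indicator ?K z \<partial>lborel) \<partial>lborel) \<partial>lborel)"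
      by (rule nn_integral_add) measurable
    also have "(\<integral>\<^sup>+s. (\<integral>\<^sup>+z. restr (grad1 G \<gamma>) z \<partial>lborel) * indicator {0..1} (s::real) \<partial>lborel) = (\<integral>\<^sup>+z. restr (grad1 G \<gamma>) z \<partial>lborel)"
      by (subst nn_integral_cmult_indicator) auto
    also have "(\<integral>\<^sup>+s. (\<integral>\<^sup>+z. (\<integral>\<^sup>+u. ennreal (H (?x u z)) * indicator T (s, u) * indicator ?K z \<partial>lborel) \<partial>lborel) \<partial>lborel)
     = (\<integral>\<^sup>+s. (\<integral>\<^sup>+u. (\<integral>\<^sup>+z. ennreal (H (?x u z)) * indicator T (s, u) * indicator ?K z \<partial>lborel) \<partial>lborel) \<partial>lborel)"
      by (intro nn_integral_cong lborel_pair.Fubini') measurable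
    also have "\<dots> = (\<integral>\<^sup>+u. (\<integral>\<^sup>+s. (\<integral>\<^sup>+z. ennreal (H (?x u z)) * indicator T (s, u) * indicator ?K z \<partial>lborel) \<partial>lborel) \<partial>lborel)"
      by (intro lborel_pair.Fubini') measurable
    also have "\<dots> \<le> (\<integral>\<^sup>+u. ennreal (nmp p H) * (ennreal (u powr a) * indicator {0..1} u) \<partial>lborel)"
    proof (rule nn_integral_mono)
      fix u :: real
      show "(\<integral>\<^sup>+s. (\<integral>\<^sup>+z. ennreal (H (?x u z)) * indicator T (s, u) * indicator ?K z \<partial>lborel) \<partial>lborel)
        \<le> ennreal (nmp p H) * (ennreal (u powr a) * indicator {0..1} u)"
      proof (cases "0 < u \<and> u \<le> 1")
        case u: True
        have "(\<integral>\<^sup>+s. (\<integral>\<^sup>+z. ennreal (H (?x u z)) * indicator T (s, u) * indicator ?K z \<partial>lborel) \<partial>lborel)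
          = (\<integral>\<^sup>+s. (\<integral>\<^sup>+z\<in>?K. ennreal (H (?x u z)) \<partial>lborel) * indicator {0..u} s \<partial>lborel)"
          using u by (intro nn_integral_cong) (auto simp: indicator_def T_def)
        also have "\<dots> = (\<integral>\<^sup>+z\<in>?K. ennreal (H (?x u z)) \<partial>lborel) * ennreal u"
          using u by (simp add: nn_integral_cmult_indicator)
        also have "\<dots> \<le> ennreal (u powr (- ?d / p) * nmp p H) * ennreal u"
          using u by (intro mult_right_mono dilate_holder H y p) auto
        also have "\<dots> = ennreal (nmp p H) * (ennreal (u powr a) * indicator {0..1} u)"
          using u by (simp add: ennreal_mult[symmetric] a_def powr_add[of u 1 "- (?d / p)", simplified] mult_ac)
        finally show ?thesis .
      next
        case False
        \<comment> \<open>At \<open>u = 0\<close> the right-hand side is 0, since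
          \<open>0 powr a = 0\<close>. The left-hand side must vanish as well, and does because
          \<open>s\<close> is confined to a null set.\<close>
        have "(\<integral>\<^sup>+s. (\<integral>\<^sup>+z. ennreal (H (?x u z)) * indicator T (s, u) * indicator ?K z \<partial>lborel) \<partial>lborel)
          = (\<integral>\<^sup>+s. (\<integral>\<^sup>+z\<in>?K. ennreal (H (?x u z)) \<partial>lborel) * indicator {s. 0 \<le> s \<and> s \<le> u \<and> u \<le> 1} s \<partial>lborel)"
          by (intro nn_integral_cong) (auto simp: indicator_def T_def)
        also have "\<dots> = 0"
        proof -
          have "{s. 0 \<le> s \<and> s \<le> u \<and> u \<le> 1} \<in> null_sets lborel"
          proof (rule null_sets_subset)
            show "{0::real} \<in> null_sets lborel" by (intro countable_imp_null_set_lborel) simp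
            show "{s. 0 \<le> s \<and> s \<le> u \<and> u \<le> 1} \<subseteq> {0}" using False by auto
          qed auto
          then show ?thesis
            by (subst nn_integral_cmult_indicator) (auto simp: null_sets_def)
        qed
        finally show ?thesis by simp
      qed
    qed
    also have "\<dots> = ennreal (nmp p H) * ennreal (1 / (a + 1))"
      by (subst nn_integral_cmult) (auto simp: nn_integral_powr_01[OF a])
    also have "\<dots> = ennreal (nmp p H / (a + 1))" using a by (simp add: ennreal_mult[symmetric])
    finally have "ennreal ?v * ennreal \<bar>G \<gamma> y\<bar> \<le> (\<integral>\<^sup>+x. restr (G \<gamma>) x \<partial>lborel) + ((\<integral>\<^sup>+z. restr (grad1 G \<gamma>) z \<partial>lborel) + ennreal (nmp p H / (a + 1)))"
      by (simp add: add_left_mono)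
    also have "\<dots> \<le> ennreal (nmp p (G \<gamma>)) + (ennreal (nmp p (grad1 G \<gamma>)) + ennreal (nmp p H / (a + 1)))"
      by (intro add_mono nn_restr_le jet_continuous grad1_continuous G p order_refl)
    also have "\<dots> = ennreal (nmp p (G \<gamma>) + (nmp p (grad1 G \<gamma>) + nmp p H / (a + 1)))"
      using a by simp
    also have "\<dots> \<le> ennreal (?S + (?d ^ 2 * ?S + ?d ^ 4 * ?S / (a + 1)))"
    proof (intro ennreal_leI add_mono divide_right_mono)
      show "nmp p (G \<gamma>) \<le> ?S" using nmp_le_sum_mi[OF zero_mi_le, of p G \<gamma>] by simp
      show "nmp p (grad1 G \<gamma>) \<le> ?d ^ 2 * ?S" by (intro grad1_nmp_le_sum G p) simp
      have "nmp p H \<le> real (card (UNIV :: 'n set)) * (\<Sum>i\<in>(UNIV :: 'n set). nmp p (grad1 G (inc \<gamma> i)))"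
        by (intro nmp_sum_le H grad1_continuous G p) (auto simp: H_def sum_nonneg)
      also have "\<dots> \<le> ?d * (\<Sum>i\<in>(UNIV :: 'n set). ?d * (\<Sum>j\<in>(UNIV :: 'n set). ?S))"
      proof (intro mult_left_mono sum_mono)
        fix i :: 'n
        have "nmp p (grad1 G (inc \<gamma> i)) \<le> ?d * (\<Sum>j\<in>(UNIV :: 'n set). nmp p (G (inc (inc \<gamma> i) j)))"
          by (rule grad1_nmp_le[OF G p(1)])
        also have "\<dots> \<le> ?d * (\<Sum>j\<in>(UNIV :: 'n set). ?S)"
          by (intro mult_left_mono sum_mono nmp_inc_inc_le[of 2 p G \<gamma> i]) auto
        finally show "nmp p (grad1 G (inc \<gamma> i)) \<le> ?d * (\<Sum>j\<in>(UNIV :: 'n set). ?S)" .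
      qed simp
      also have "\<dots> = ?d ^ 4 * ?S" by (simp add: power4_eq_xxxx)
      finally show "nmp p H \<le> ?d ^ 4 * ?S" .
    qed (use a in simp)
    also have "\<dots> = ennreal (?v * (C * ?S))"
      by (simp only: vC)
    finally have "ennreal (?v * \<bar>G \<gamma> y\<bar>) \<le> ennreal (?v * (C * ?S))"
      using v by (simp add: ennreal_mult)
    then show ?thesis using v C S0 by (subst (asm) ennreal_le_iff) auto
  qed
  show ?thesis
    unfolding trace_bd_def
  proof (intro exI[of _ C] conjI allI impI)
    fix G :: "('n \<Rightarrow> nat) \<Rightarrow> real^'n \<Rightarrow> real" and \<gamma>
    assume "jet G"
    from main[OF this, of \<gamma>] show "\<bar>iter_avg c [] (G \<gamma>) y\<bar> \<le> C * (\<Sum>\<eta>\<in>mi_le 2. nmp p (G (\<lambda>i. \<gamma> i + \<eta> i)))"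
      by (simp only: iter_avg.simps)
  qed (fact C)
qed

section \<open>Traces on an edge\<close>

lemma emeasure_slice_le:
  fixes s \<xi> :: real
  assumes "0 < s" "s \<le> 1"
  shows "emeasure lborel {t. 0 \<le> t \<and> t \<le> 1 \<and> 0 \<le> \<xi> - (1 - s) * t \<and> \<xi> - (1 - s) * t \<le> s} \<le> ennreal (2 * s)"
proof (cases "s < 1 / 2")
  case True
  \<comment> \<open>The interval has length \<open>s / (1 - s)\<close>, at most \<open>2 * s\<close>
    for \<open>s < 1 / 2\<close>. For larger \<open>s\<close> the trivial bound 1 is good
    enough.\<close>
  have "{t. 0 \<le> t \<and> t \<le> 1 \<and> 0 \<le> \<xi> - (1 - s) * t \<and> \<xi> - (1 - s) * t \<le> s} \<subseteq> {(\<xi> - s) / (1 - s) .. \<xi> / (1 - s)}"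
    using True by (auto simp: pos_divide_le_eq pos_le_divide_eq mult.commute)
  then have "emeasure lborel {t. 0 \<le> t \<and> t \<le> 1 \<and> 0 \<le> \<xi> - (1 - s) * t \<and> \<xi> - (1 - s) * t \<le> s} \<le> emeasure lborel {(\<xi> - s) / (1 - s) .. \<xi> / (1 - s)}"
    by (rule emeasure_mono) simp
  also have "\<dots> = ennreal (s / (1 - s))"
    using True assms by (subst emeasure_lborel_Icc) (auto simp: diff_divide_distrib)
  also have "\<dots> \<le> ennreal (2 * s)"
  proof (rule ennreal_leI)
    have "s * 1 \<le> s * (2 * (1 - s))" using True assms by (intro mult_left_mono) auto
    then show "s / (1 - s) \<le> 2 * s" using True by (simp add: field_simps)
  qed
  finally show ?thesis .
next
  case False
  have "emeasure lborel {t. 0 \<le> t \<and> t \<le> 1 \<and> 0 \<le> \<xi> - (1 - s) * t \<and> \<xi> - (1 - s) * t \<le> s} \<le> emeasure lborel {0..1::real}"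
    by (rule emeasure_mono) auto
  also have "\<dots> \<le> ennreal (2 * s)" using False by (simp add: ennreal_leI ennreal_1[symmetric] del: ennreal_1)
  finally show ?thesis .
qed

text \<open>While \<open>t\<close> runs along the edge, the simplices dilated by \<open>s\<close>
  slide over a given point only for parameters of total length at most \<open>2 * s\<close>. This
  gains a factor \<open>s\<close> against the Jacobian of the dilation.\<close>

lemma segment_dilate_bound:
  fixes h :: "real^'n \<Rightarrow> ennreal"
  assumes [measurable]: "h \<in> borel_measurable borel" and s: "0 < s" "s \<le> 1"
  shows "(\<integral>\<^sup>+t. (\<integral>\<^sup>+z. h (((1 - s) * t) *\<^sub>R axis i 1 + s *\<^sub>R z) * indicator std_sx z * indicator {0..1} t \<partial>lborel) \<partial>lborel)
    \<le> ennreal (2 * s * (1 / s ^ CARD('n))) * (\<integral>\<^sup>+x. h x \<partial>lborel)"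
proof -
  \<comment> \<open>\<open>P\<close> records that the \<open>i\<close>-th coordinate of
    \<open>z\<close>, recovered from the image point \<open>x\<close>, lies between 0 and 1.\<close>
  define P where "P = (\<lambda>t (x::real^'n). 0 \<le> t \<and> t \<le> 1 \<and> 0 \<le> x $ i - (1 - s) * t \<and> x $ i - (1 - s) * t \<le> s)"
  define Q where "Q = {tx :: real \<times> (real^'n). P (fst tx) (snd tx)}"
  have [measurable]: "Q \<in> sets borel"
    unfolding Q_def P_def
    by (intro borel_closed closed_Collect_conj closed_Collect_le continuous_intros)
  have "(\<integral>\<^sup>+t. (\<integral>\<^sup>+z. h (((1 - s) * t) *\<^sub>R axis i 1 + s *\<^sub>R z) * indicator std_sx z * indicator {0..1} t \<partial>lborel) \<partial>lborel)
    \<le> (\<integral>\<^sup>+t. (\<integral>\<^sup>+z. (\<lambda>x. h x * indicator Q (t, x)) (((1 - s) * t) *\<^sub>R axis i 1 + s *\<^sub>R z) \<partial>lborel) \<partial>lborel)"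
  proof (intro nn_integral_mono)
    fix t :: real and z :: "real^'n"
    show "h (((1 - s) * t) *\<^sub>R axis i 1 + s *\<^sub>R z) * indicator std_sx z * indicator {0..1} t
      \<le> (\<lambda>x. h x * indicator Q (t, x)) (((1 - s) * t) *\<^sub>R axis i 1 + s *\<^sub>R z)"
      using s std_sx_component_le_1[of z i]
      by (auto simp: indicator_def Q_def P_def axis_def std_sx_def)
  qed
  also have "\<dots> = (\<integral>\<^sup>+t. ennreal (1 / s ^ CARD('n)) * (\<integral>\<^sup>+x. h x * indicator Q (t, x) \<partial>lborel) \<partial>lborel)"
    using s by (intro nn_integral_cong, subst nn_integral_affine) auto
  also have "\<dots> = ennreal (1 / s ^ CARD('n)) * (\<integral>\<^sup>+t. (\<integral>\<^sup>+x. h x * indicator Q (t, x) \<partial>lborel) \<partial>lborel)"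
    by (rule nn_integral_cmult) measurable
  also have "(\<integral>\<^sup>+t. (\<integral>\<^sup>+x. h x * indicator Q (t, x) \<partial>lborel) \<partial>lborel) = (\<integral>\<^sup>+x. (\<integral>\<^sup>+t. h x * indicator Q (t, x) \<partial>lborel) \<partial>lborel)"
    by (rule lborel_pair.Fubini') measurable
  also have "\<dots> \<le> (\<integral>\<^sup>+x. h x * ennreal (2 * s) \<partial>lborel)"
  proof (intro nn_integral_mono)
    fix x :: "real^'n"
    have "(\<integral>\<^sup>+t. h x * indicator Q (t, x) \<partial>lborel) = h x * (\<integral>\<^sup>+t. indicator Q (t, x) \<partial>lborel)"
      by (rule nn_integral_cmult) measurable
    also have "(\<integral>\<^sup>+t. indicator Q (t, x) \<partial>lborel) = (\<integral>\<^sup>+t. indicator {t. P t x} t \<partial>lborel)"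
      by (intro nn_integral_cong) (auto simp: indicator_def Q_def)
    also have "\<dots> = emeasure lborel {t. P t x}"
      by (rule nn_integral_indicator) (simp add: P_def)
    also have "\<dots> \<le> ennreal (2 * s)" unfolding P_def by (rule emeasure_slice_le[OF s])
    finally show "(\<integral>\<^sup>+t. h x * indicator Q (t, x) \<partial>lborel) \<le> h x * ennreal (2 * s)"
      by (simp add: mult_left_mono)
  qed
  also have "\<dots> = (\<integral>\<^sup>+x. h x \<partial>lborel) * ennreal (2 * s)"
    by (rule nn_integral_multc) measurable
  finally have X: "(\<integral>\<^sup>+t. (\<integral>\<^sup>+z. h (((1 - s) * t) *\<^sub>R axis i 1 + s *\<^sub>R z) * indicator std_sx z * indicator {0..1} t \<partial>lborel) \<partial>lborel)
    \<le> ennreal (1 / s ^ CARD('n)) * ((\<integral>\<^sup>+x. h x \<partial>lborel) * ennreal (2 * s))"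
    by (simp add: mult_left_mono)
  have "ennreal (2 * s * (1 / s ^ CARD('n))) = ennreal (2 * s) * ennreal (1 / s ^ CARD('n))"
    by (rule ennreal_mult) (use s in auto)
  with X show ?thesis by (simp only: ac_simps)
qed

lemma segment_dilate_holder:
  fixes H :: "real^'n \<Rightarrow> real"
  assumes H: "continuous_on UNIV H" "\<And>x. 0 \<le> H x" and s: "0 < s" "s \<le> 1" and p: "1 \<le> p"
  shows "(\<integral>\<^sup>+t. (\<integral>\<^sup>+z. ennreal (H (((1 - s) * t) *\<^sub>R axis i 1 + s *\<^sub>R z)) * indicator std_sx z * indicator {0..1} t \<partial>lborel) \<partial>lborel)
    \<le> ennreal (2 powr (1 / p) * s powr ((1 - real CARD('n)) / p) * nmp p H)"
proof -
  let ?K = "std_sx :: (real^'n) set"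
  have [measurable]: "H \<in> borel_measurable borel" by (rule borel_measurable_continuous_onI[OF H(1)])
  let ?M = "density (lborel \<Otimes>\<^sub>M lborel) (\<lambda>(t, z). indicator ?K z * indicator {0..1::real} t) :: (real \<times> (real^'n)) measure"
  let ?f = "\<lambda>(t, z). H (((1 - s) * t) *\<^sub>R axis i 1 + s *\<^sub>R z)"
  let ?B = "2 powr (1 / p) * s powr ((1 - real CARD('n)) / p) * nmp p H"
  have M: "(\<integral>\<^sup>+x. g x \<partial>?M) = (\<integral>\<^sup>+t. (\<integral>\<^sup>+z. g (t, z) * indicator ?K z * indicator {0..1} t \<partial>lborel) \<partial>lborel)"
    if [measurable]: "g \<in> borel_measurable (borel \<Otimes>\<^sub>M borel)" for g :: "real \<times> (real^'n) \<Rightarrow> ennreal"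
  proof -
    have "(\<integral>\<^sup>+x. g x \<partial>?M) = (\<integral>\<^sup>+x. (\<lambda>(t, z). indicator ?K z * indicator {0..1} t) x * g x \<partial>(lborel \<Otimes>\<^sub>M lborel))"
      by (rule nn_integral_density) measurable
    also have "\<dots> = (\<integral>\<^sup>+t. (\<integral>\<^sup>+z. (\<lambda>(t, z). indicator ?K z * indicator {0..1} t) (t, z) * g (t, z) \<partial>lborel) \<partial>lborel)"
      by (rule lborel.nn_integral_fst[symmetric]) measurable
    finally show ?thesis by (simp add: ac_simps)
  qed
  have "emeasure ?M (space ?M) = (\<integral>\<^sup>+x. 1 \<partial>?M)" by simp
  also have "\<dots> = (\<integral>\<^sup>+t. emeasure lborel ?K * indicator {0..1::real} t \<partial>lborel)"
    by (subst M) (auto simp: nn_integral_multc)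
  also have "\<dots> = emeasure lborel ?K" by (subst nn_integral_cmult_indicator) auto
  finally have 1: "emeasure ?M (space ?M) \<le> 1" using emeasure_std_sx_le by simp
  define h where "h x = ennreal (H x powr p) * indicator ?K x" for x
  have [measurable]: "h \<in> borel_measurable borel" unfolding h_def by measurable
  have "(\<integral>\<^sup>+x. ennreal (?f x powr p) \<partial>?M)
    = (\<integral>\<^sup>+t. (\<integral>\<^sup>+z. ennreal (H (((1 - s) * t) *\<^sub>R axis i 1 + s *\<^sub>R z) powr p) * indicator ?K z * indicator {0..1} t \<partial>lborel) \<partial>lborel)"
    by (subst M) auto
  also have "\<dots> \<le> (\<integral>\<^sup>+t. (\<integral>\<^sup>+z. h (((1 - s) * t) *\<^sub>R axis i 1 + s *\<^sub>R z) * indicator ?K z * indicator {0..1} t \<partial>lborel) \<partial>lborel)"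
  proof (intro nn_integral_mono)
    fix t :: real and z :: "real^'n"
    show "ennreal (H (((1 - s) * t) *\<^sub>R axis i 1 + s *\<^sub>R z) powr p) * indicator ?K z * indicator {0..1} t
      \<le> h (((1 - s) * t) *\<^sub>R axis i 1 + s *\<^sub>R z) * indicator ?K z * indicator {0..1} t"
    proof (cases "z \<in> ?K \<and> t \<in> {0..1}")
      case True
      have "(1 - t) *\<^sub>R 0 + t *\<^sub>R axis i 1 \<in> ?K"
        using True by (intro std_sx_seg zero_in_std_sx axis_in_std_sx) auto
      then have "(1 - s) *\<^sub>R (t *\<^sub>R axis i 1) + s *\<^sub>R z \<in> ?K"
        using True s by (intro std_sx_seg) auto
      then show ?thesis by (simp add: h_def)
    qed auto
  qed
  also have "\<dots> \<le> ennreal (2 * s * (1 / s ^ CARD('n))) * (\<integral>\<^sup>+x. h x \<partial>lborel)"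
    by (rule segment_dilate_bound[OF _ s]) measurable
  finally have le: "(\<integral>\<^sup>+x. ennreal (?f x powr p) \<partial>?M) \<le> ennreal (2 * s * (1 / s ^ CARD('n))) * (\<integral>\<^sup>+x. h x \<partial>lborel)" .
  have e1: "(\<integral>\<^sup>+x. h x \<partial>lborel) = ennreal (nmp p H powr p)"
    using nn_nmp[OF continuous_on_subset[OF H(1) subset_UNIV] p] H(2) by (simp add: h_def)
  have e2: "ennreal (2 * s * (1 / s ^ CARD('n))) * ennreal (nmp p H powr p) = ennreal (?B powr p)"
  proof -
    have "?B powr p = (2 powr (1 / p)) powr p * (s powr ((1 - real CARD('n)) / p)) powr p * nmp p H powr p"
      by (simp add: powr_mult)
    also have "(2 powr (1 / p)) powr p = (2::real)"
      using p by (simp add: powr_powr)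
    also have "(s powr ((1 - real CARD('n)) / p)) powr p = s powr (1 - real CARD('n))"
      using p by (simp add: powr_powr)
    also have "s powr (1 - real CARD('n)) = s * (1 / s ^ CARD('n))"
      using s by (simp add: powr_diff powr_realpow)
    finally have "?B powr p = (2 * s * (1 / s ^ CARD('n))) * nmp p H powr p" by simp
    moreover have "0 \<le> 2 * s * (1 / s ^ CARD('n))" using s by simp
    ultimately show ?thesis by (metis ennreal_mult powr_ge_zero)
  qed
  have "(\<integral>\<^sup>+x. ennreal (?f x) \<partial>?M) \<le> ennreal ?B"
    by (rule jensen_nn_le[OF 1 _ _ p _ le[unfolded e1 e2]]) (auto simp: H(2))
  then show ?thesis by (subst (asm) M) auto
qed

text \<open>Averaging along the edge improves the Jacobian \<open>s powr (- d)\<close> to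
  \<open>s powr (1 - d)\<close>. After Jensen the singular weight is
  \<open>s powr ((1 - d) / p)\<close>, integrable at 0 precisely when \<open>p > d - 1\<close>; only
  one derivative has been used.\<close>

lemma trace_bd_edge:
  fixes w :: "'n::finite list"
  assumes p: "1 \<le> p" "real CARD('n) - 1 < p" and c: "0 < c" "real (length w) * c \<le> 1" and w: "set w = {i}"
  shows "trace_bd p c w 0 1"
proof -
  let ?K = "std_sx :: (real^'n) set" and ?b = "axis i 1 :: real^'n"
  let ?v = "svol TYPE('n)" and ?d = "real CARD('n)"
  have v: "0 < ?v" by (rule svol_pos)
  define a where "a = (1 - ?d) / p"
  have a: "-1 < a" using p by (simp add: a_def field_simps)
  define C where "C = (1 / c) * ((1 + 2 powr (1 / p) * ?d ^ 2 / (a + 1)) / ?v)"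
  have C: "0 \<le> C" using a v c by (simp add: C_def)
  have vC: "1 / c * (S + 2 powr (1 / p) * (?d ^ 2 * S) / (a + 1)) = ?v * (C * S)" for S
  proof -
    have "?v * (C * S) = 1 / c * ((1 + 2 powr (1 / p) * ?d ^ 2 / (a + 1)) * S)" using v by (simp add: C_def)
    then show ?thesis by (simp add: distrib_right mult.assoc)
  qed
  have main: "\<bar>iter_avg c w (G \<gamma>) 0\<bar> \<le> C * (\<Sum>\<eta>\<in>mi_le 1. nmp p (G (\<lambda>i. \<gamma> i + \<eta> i)))" (is "_ \<le> C * ?S")
    if G: "jet G" for G :: "('n \<Rightarrow> nat) \<Rightarrow> real^'n \<Rightarrow> real" and \<gamma>
  proof -
    let ?g = "grad1 G \<gamma>"
    have [measurable]: "G \<gamma> \<in> borel_measurable borel" "?g \<in> borel_measurable borel"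
      using G by (rule jet_measurable, rule grad1_measurable)
    have S0: "0 \<le> ?S" by (simp add: sum_nonneg)
    have tb: "t *\<^sub>R ?b \<in> ?K \<longleftrightarrow> t \<in> {0..1}" for t
    proof
      assume t: "t *\<^sub>R ?b \<in> ?K"
      then have "0 \<le> (t *\<^sub>R ?b) $ i" unfolding std_sx_def by blast
      with std_sx_component_le_1[OF t, of i] show "t \<in> {0..1}" by simp
    next
      assume "t \<in> {0..1}"
      then have "(1 - t) *\<^sub>R 0 + t *\<^sub>R ?b \<in> ?K"
        by (intro std_sx_seg zero_in_std_sx axis_in_std_sx) auto
      then show "t *\<^sub>R ?b \<in> ?K" by simp
    qed
    have "face_int (axes w) (restr (G \<gamma>)) 0 = face_int (insert ?b {}) (restr (G \<gamma>)) 0"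
      by (simp add: w)
    also have "\<dots> = (\<integral>\<^sup>+t. restr (G \<gamma>) (t *\<^sub>R ?b) \<partial>lborel)"
      by (subst face_int_insert) auto
    also have "\<dots> = (\<integral>\<^sup>+t\<in>{0..1}. ennreal \<bar>G \<gamma> (t *\<^sub>R ?b)\<bar> \<partial>lborel)"
      by (intro nn_integral_cong) (auto simp: indicator_def tb)
    finally have fi: "face_int (axes w) (restr (G \<gamma>)) 0 = (\<integral>\<^sup>+t\<in>{0..1}. ennreal \<bar>G \<gamma> (t *\<^sub>R ?b)\<bar> \<partial>lborel)" .
    let ?A = "\<integral>\<^sup>+x. restr (G \<gamma>) x \<partial>lborel"
    let ?Q = "\<lambda>t s z. ennreal (?g (((1 - s) * t) *\<^sub>R ?b + s *\<^sub>R z)) * indicator ?K z * indicator {0..1} t * indicator {0..1} s"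
    have "ennreal ?v * face_int (axes w) (restr (G \<gamma>)) 0 = (\<integral>\<^sup>+t. ennreal ?v * ennreal \<bar>G \<gamma> (t *\<^sub>R ?b)\<bar> * indicator {0..1} t \<partial>lborel)"
      unfolding fi by (subst nn_integral_cmult[symmetric]) (auto simp: mult.assoc)
    also have "\<dots> \<le> (\<integral>\<^sup>+t. ?A * indicator {0..1} t + (\<integral>\<^sup>+s. (\<integral>\<^sup>+z. ?Q t s z \<partial>lborel) \<partial>lborel) \<partial>lborel)"
    proof (intro nn_integral_mono)
      fix t :: real
      show "ennreal ?v * ennreal \<bar>G \<gamma> (t *\<^sub>R ?b)\<bar> * indicator {0..1} t \<le> ?A * indicator {0..1} t + (\<integral>\<^sup>+s. (\<integral>\<^sup>+z. ?Q t s z \<partial>lborel) \<partial>lborel)"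
      proof (cases "t \<in> {0..1}")
        case True
        have "(\<integral>\<^sup>+s\<in>{0..1}. (\<integral>\<^sup>+z\<in>?K. ennreal (?g ((1 - s) *\<^sub>R (t *\<^sub>R ?b) + s *\<^sub>R z)) \<partial>lborel) \<partial>lborel)
          = (\<integral>\<^sup>+s. (\<integral>\<^sup>+z. ?Q t s z \<partial>lborel) \<partial>lborel)"
          using True by (intro nn_integral_cong) (auto simp: indicator_def)
        then show ?thesis
          using first_order_average[OF G, of "t *\<^sub>R ?b" \<gamma>] True tb[of t] by simp
      qed simp
    qed
    also have "\<dots> = (\<integral>\<^sup>+t. ?A * indicator {0..1} (t::real) \<partial>lborel) + (\<integral>\<^sup>+t. (\<integral>\<^sup>+s. (\<integral>\<^sup>+z. ?Q t s z \<partial>lborel) \<partial>lborel) \<partial>lborel)"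
      by (rule nn_integral_add) measurable
    also have "(\<integral>\<^sup>+t. ?A * indicator {0..1} (t::real) \<partial>lborel) = ?A"
      by (subst nn_integral_cmult_indicator) auto
    also have "(\<integral>\<^sup>+t. (\<integral>\<^sup>+s. (\<integral>\<^sup>+z. ?Q t s z \<partial>lborel) \<partial>lborel) \<partial>lborel) = (\<integral>\<^sup>+s. (\<integral>\<^sup>+t. (\<integral>\<^sup>+z. ?Q t s z \<partial>lborel) \<partial>lborel) \<partial>lborel)"
      by (rule lborel_pair.Fubini') measurable
    also have "\<dots> \<le> (\<integral>\<^sup>+s. ennreal (2 powr (1 / p) * nmp p ?g) * (ennreal (s powr a) * indicator {0..1} s) \<partial>lborel)"
    proof (rule nn_integral_mono_AE)
      \<comment> \<open>The dilation degenerates at \<open>s = 0\<close>.\<close>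
      have "AE s in lborel. s \<noteq> (0::real)" by (rule AE_lborel_singleton)
      then show "AE s in lborel. (\<integral>\<^sup>+t. (\<integral>\<^sup>+z. ?Q t s z \<partial>lborel) \<partial>lborel) \<le> ennreal (2 powr (1 / p) * nmp p ?g) * (ennreal (s powr a) * indicator {0..1} s)"
      proof eventually_elim
        fix s :: real assume s0: "s \<noteq> 0"
        show "(\<integral>\<^sup>+t. (\<integral>\<^sup>+z. ?Q t s z \<partial>lborel) \<partial>lborel) \<le> ennreal (2 powr (1 / p) * nmp p ?g) * (ennreal (s powr a) * indicator {0..1} s)"
        proof (cases "s \<in> {0..1}")
          case True
          have "(\<integral>\<^sup>+t. (\<integral>\<^sup>+z. ?Q t s z \<partial>lborel) \<partial>lborel) \<le> ennreal (2 powr (1 / p) * s powr ((1 - ?d) / p) * nmp p ?g)"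
            using segment_dilate_holder[OF grad1_continuous[OF G] grad1_nonneg, of s p \<gamma> i] True s0 p by simp
          also have "\<dots> = ennreal (2 powr (1 / p) * nmp p ?g) * (ennreal (s powr a) * indicator {0..1} s)"
            using True by (simp add: a_def ennreal_mult[symmetric] mult_ac)
          finally show ?thesis .
        qed simp
      qed
    qed
    also have "\<dots> = ennreal (2 powr (1 / p) * nmp p ?g) * ennreal (1 / (a + 1))"
      by (subst nn_integral_cmult) (auto simp: nn_integral_powr_01[OF a])
    finally have "ennreal ?v * face_int (axes w) (restr (G \<gamma>)) 0 \<le> ?A + ennreal (2 powr (1 / p) * nmp p ?g) * ennreal (1 / (a + 1))"
      by (simp add: add_left_mono)
    also have "\<dots> \<le> ennreal (nmp p (G \<gamma>)) + ennreal (2 powr (1 / p) * nmp p ?g) * ennreal (1 / (a + 1))"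
      by (intro add_mono nn_restr_le jet_continuous G p order_refl)
    also have "\<dots> = ennreal (nmp p (G \<gamma>) + 2 powr (1 / p) * nmp p ?g / (a + 1))"
      using a by (simp add: ennreal_mult[symmetric] ennreal_plus[symmetric] del: ennreal_plus)
    also have "\<dots> \<le> ennreal (?S + 2 powr (1 / p) * (?d ^ 2 * ?S) / (a + 1))"
    proof (intro ennreal_leI add_mono divide_right_mono mult_left_mono)
      show "nmp p (G \<gamma>) \<le> ?S" using nmp_le_sum_mi[OF zero_mi_le, of p G \<gamma>] by simp
      show "nmp p ?g \<le> ?d ^ 2 * ?S" by (intro grad1_nmp_le_sum G p) simp
    qed (use a in simp_all)
    finally have 1: "ennreal ?v * face_int (axes w) (restr (G \<gamma>)) 0 \<le> ennreal (?S + 2 powr (1 / p) * (?d ^ 2 * ?S) / (a + 1))" .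
    have "ennreal ?v * ennreal \<bar>iter_avg c w (G \<gamma>) 0\<bar> \<le> ennreal ?v * (ennreal (1 / c) * face_int (axes w) (restr (G \<gamma>)) 0)"
      using iter_avg_le_face_int[OF jet_continuous[OF G] c(1), of 0 w i \<gamma>] c w by (intro mult_left_mono) auto
    also have "\<dots> = ennreal (1 / c) * (ennreal ?v * face_int (axes w) (restr (G \<gamma>)) 0)" by (simp add: ac_simps)
    also have "\<dots> \<le> ennreal (1 / c) * ennreal (?S + 2 powr (1 / p) * (?d ^ 2 * ?S) / (a + 1))"
      using 1 by (rule mult_left_mono) simp
    also have "\<dots> = ennreal (1 / c * (?S + 2 powr (1 / p) * (?d ^ 2 * ?S) / (a + 1)))"
      using c a S0 by (intro ennreal_mult[symmetric]) auto
    also have "1 / c * (?S + 2 powr (1 / p) * (?d ^ 2 * ?S) / (a + 1)) = ?v * (C * ?S)"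
      by (rule vC)
    finally have "ennreal (?v * \<bar>iter_avg c w (G \<gamma>) 0\<bar>) \<le> ennreal (?v * (C * ?S))"
      using v by (simp add: ennreal_mult)
    then show ?thesis using v C S0 by (subst (asm) ennreal_le_iff) auto
  qed
  show ?thesis
    unfolding trace_bd_def
  proof (intro exI[of _ C] conjI allI impI)
    fix G :: "('n \<Rightarrow> nat) \<Rightarrow> real^'n \<Rightarrow> real" and \<gamma>
    assume "jet G"
    from main[OF this, of \<gamma>] show "\<bar>iter_avg c w (G \<gamma>) 0\<bar> \<le> C * (\<Sum>\<eta>\<in>mi_le 1. nmp p (G (\<lambda>i. \<gamma> i + \<eta> i)))"
      by (simp only: iter_avg.simps)
  qed (fact C)
qed

section \<open>Estimates from lattice values\<close>

abbreviation zmi :: "'n \<Rightarrow> nat" where "zmi \<equiv> \<lambda>_. 0"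

lemma jet_diff:
  assumes "jet G" "jet L"
  shows "jet (\<lambda>\<eta> x. G \<eta> x - L \<eta> x)"
  unfolding jet_def
proof (intro allI)
  fix \<gamma> x
  from has_derivative_diff[OF jetD[OF assms(1), of \<gamma> x UNIV] jetD[OF assms(2), of \<gamma> x UNIV]]
  show "((\<lambda>x. G \<gamma> x - L \<gamma> x) has_derivative (\<lambda>h. \<Sum>i\<in>UNIV. h $ i * (G (inc \<gamma> i) x - L (inc \<gamma> i) x))) (at x)"
    by (simp add: right_diff_distrib sum_subtractf)
qed

text \<open>The jet of an affine function. At order one \<open>\<eta>\<close> is a unit vector, so
  the sum picks out one coefficient.\<close>

definition affine_jet :: "real \<Rightarrow> ('n::finite \<Rightarrow> real) \<Rightarrow> ('n \<Rightarrow> nat) \<Rightarrow> real^'n \<Rightarrow> real" where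
  "affine_jet c0 c \<eta> x = (if (\<Sum>i\<in>UNIV. \<eta> i) = 0 then c0 + (\<Sum>j\<in>UNIV. c j * x $ j)
     else if (\<Sum>i\<in>UNIV. \<eta> i) = 1 then (\<Sum>j\<in>UNIV. c j * real (\<eta> j)) else 0)"

lemma affine_jet_zero: "affine_jet c0 c zmi x = c0 + (\<Sum>j\<in>UNIV. c j * x $ j)"
  by (simp add: affine_jet_def)

lemma affine_jet_inc_zero: "affine_jet c0 c (inc zmi i) x = c i"
proof -
  have "(\<Sum>j\<in>UNIV. c j * real (inc zmi i j)) = (\<Sum>j\<in>UNIV. if j = i then c i else 0)"
    by (intro sum.cong) auto
  then show ?thesis unfolding affine_jet_def sum_inc by simp
qed

lemma affine_jet_ge2: "2 \<le> (\<Sum>i\<in>UNIV. \<eta> i) \<Longrightarrow> affine_jet c0 c \<eta> x = 0"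
  by (simp add: affine_jet_def del: sum_eq_0_iff)

lemma sum_zero_zmi: "(\<Sum>i\<in>UNIV. \<eta> i) = 0 \<Longrightarrow> \<eta> = zmi" for \<eta> :: "'n::finite \<Rightarrow> nat"
  by auto

lemma jet_affine_jet: "jet (affine_jet c0 c)"
  unfolding jet_def
proof (intro allI)
  fix \<eta> :: "'a \<Rightarrow> nat" and x :: "real^'a"
  consider "(\<Sum>i\<in>UNIV. \<eta> i) = 0" | "1 \<le> (\<Sum>i\<in>UNIV. \<eta> i)" by linarith
  then show "(affine_jet c0 c \<eta> has_derivative (\<lambda>h. \<Sum>i\<in>UNIV. h $ i * affine_jet c0 c (inc \<eta> i) x)) (at x)"
  proof cases
    case 1
    then have \<eta>: "\<eta> = zmi" by (rule sum_zero_zmi)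
    have "((\<lambda>x. c0 + (\<Sum>j\<in>UNIV. c j * x $ j)) has_derivative (\<lambda>h. \<Sum>j\<in>UNIV. c j * h $ j)) (at x)"
      by (auto intro!: derivative_eq_intros bounded_linear_imp_has_derivative bounded_linear_vec_nth)
    then show ?thesis
      unfolding \<eta> affine_jet_inc_zero affine_jet_zero[abs_def] by (simp add: mult.commute)
  next
    case 2
    have "affine_jet c0 c (inc \<eta> i) x = 0" for i
      by (rule affine_jet_ge2) (use 2 in \<open>simp only: sum_inc\<close>)
    moreover have "(affine_jet c0 c \<eta> has_derivative (\<lambda>h. 0)) (at x)"
      using 2 by (auto simp: affine_jet_def[abs_def] simp del: sum_eq_0_iff)
    ultimately show ?thesis by simp
  qed
qed

lemma exists_list:
  fixes \<gamma> :: "'n::finite \<Rightarrow> nat"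
  shows "\<exists>w. count_list w = \<gamma> \<and> length w = (\<Sum>i\<in>UNIV. \<gamma> i)"
proof (induction "\<Sum>i\<in>UNIV. \<gamma> i" arbitrary: \<gamma>)
  case 0
  then have "\<gamma> = zmi" by (intro sum_zero_zmi) simp
  then show ?case by (intro exI[of _ "[]"]) auto
next
  case (Suc n)
  then have "\<exists>i. \<gamma> i \<noteq> 0" by (metis nat.distinct(1) sum.neutral)
  then obtain i where i: "\<gamma> i \<noteq> 0" ..
  define \<gamma>' where "\<gamma>' = \<gamma>(i := \<gamma> i - 1)"
  have g: "\<gamma> = inc \<gamma>' i" using i by (auto simp: \<gamma>'_def)
  then have "(\<Sum>j\<in>UNIV. \<gamma>' j) = n"
    using Suc.hyps(2) sum_inc[of \<gamma>' i] by simp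
  then obtain w where w: "count_list w = \<gamma>'" "length w = n"
    using Suc.hyps(1)[of \<gamma>'] by auto
  show ?case
  proof (intro exI[of _ "i # w"] conjI)
    show "count_list (i # w) = \<gamma>" unfolding g using w by auto
    show "length (i # w) = (\<Sum>i\<in>UNIV. \<gamma> i)" using w Suc.hyps(2) by simp
  qed
qed

definition poincare_const :: "'n::finite itself \<Rightarrow> real" where
  "poincare_const _ = 2 ^ CARD('n) * real CARD('n) / svol TYPE('n)"

lemma poincare_const_nonneg: "0 \<le> poincare_const TYPE('n::finite)"
  using svol_pos[where 'n='n] by (simp add: poincare_const_def)

text \<open>The difference is at most \<open>2 ^ length w * E\<close>, and dividing by the steps
  contributes \<open>real k ^ length w\<close>. The condition \<open>length w + j \<le> k\<close>
  keeps all points involved on the lattice.\<close>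

lemma iter_avg_lattice_bound:
  fixes G :: "('n \<Rightarrow> nat) \<Rightarrow> real^'n::finite \<Rightarrow> real"
  assumes G: "jet G" and E: "\<And>x. x \<in> lat k k \<Longrightarrow> \<bar>G zmi x\<bar> \<le> E" and k: "1 \<le> k"
    and w: "count_list w = \<gamma>" "length w + j \<le> k" and x: "x \<in> lat k j"
  shows "\<bar>iter_avg (1 / real k) w (G \<gamma>) x\<bar> \<le> (2 * real k) ^ length w * E"
proof -
  have "\<bar>iter_diff (1 / real k) w (G zmi) x\<bar> \<le> 2 ^ length w * E"
  proof (rule iter_diff_bound[OF _ x])
    fix y :: "real^'n" assume "y \<in> lat k (j + length w)"
    then show "\<bar>G zmi y\<bar> \<le> E"
      using lat_mono[of "j + length w" k k] w by (intro E) auto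
  qed
  also have "iter_diff (1 / real k) w (G zmi) x = (1 / real k) ^ length w * iter_avg (1 / real k) w (G \<gamma>) x"
    using iter_diff_eq_iter_avg[OF G, of "1 / real k" w zmi x] w by simp
  finally have "real k ^ length w * \<bar>(1 / real k) ^ length w * iter_avg (1 / real k) w (G \<gamma>) x\<bar> \<le> real k ^ length w * (2 ^ length w * E)"
    by (intro mult_left_mono) auto
  then show ?thesis using k by (simp add: abs_mult power_one_over power_mult_distrib mult_ac)
qed

lemma iter_avg_diff:
  assumes "continuous_on UNIV f" "continuous_on UNIV g"
  shows "iter_avg c w (\<lambda>y. f y - g y) x = iter_avg c w f x - iter_avg c w g x"
proof -
  have "iter_avg c w (\<lambda>y. f y + (-1) * g y) x = iter_avg c w f x + iter_avg c w (\<lambda>y. (-1) * g y) x"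
    using assms by (subst iter_avg_add) (auto intro!: continuous_intros)
  then show ?thesis by (simp only: iter_avg_cmult) simp
qed

lemma nmp_const_le: "1 \<le> p \<Longrightarrow> nmp p (\<lambda>_::real^'n::finite. c) \<le> \<bar>c\<bar>"
  by (intro nmp_le_const) auto

lemma nmp_le_diff_const:
  fixes f :: "real^'n::finite \<Rightarrow> real"
  assumes "continuous_on std_sx f" "1 \<le> p"
  shows "nmp p f \<le> 2 * (nmp p (\<lambda>x. f x - m) + \<bar>m\<bar>)"
proof -
  have "nmp p f \<le> 2 * (nmp p (\<lambda>x. f x - m) + nmp p (\<lambda>_::real^'n. m))"
    using assms by (intro nmp_add_le) (auto intro!: continuous_intros)
  then show ?thesis using nmp_const_le[OF assms(2), where c=m and 'n='n] by simp
qed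

lemma card_inc_sum_le:
  fixes f :: "('n::finite \<Rightarrow> nat) \<Rightarrow> real"
  assumes "\<And>i. f (inc \<gamma> i) \<le> S"
  shows "(\<Sum>i\<in>UNIV. f (inc \<gamma> i)) \<le> real CARD('n) * S"
  using sum_mono[of UNIV "\<lambda>i. f (inc \<gamma> i)" "\<lambda>_. S"] assms by simp

text \<open>One step of the downward induction: only derivatives strictly above
  \<open>\<gamma>\<close> stand on the right, and \<open>r\<close> is the number of orders that the
  trace consumes.\<close>

definition step_bd :: "real \<Rightarrow> nat \<Rightarrow> ('n::finite \<Rightarrow> nat) \<Rightarrow> nat \<Rightarrow> bool" where
  "step_bd p k \<gamma> r \<longleftrightarrow> (\<exists>C\<ge>0. \<forall>G E. jet G \<longrightarrow> (\<forall>x\<in>lat k k. \<bar>G zmi x\<bar> \<le> E) \<longrightarrow>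
     nmp p (G \<gamma>) \<le> C * (E + (\<Sum>\<eta>\<in>mi_le r - {zmi}. nmp p (G (\<lambda>i. \<gamma> i + \<eta> i)))))"

text \<open>Let \<open>m\<close> be the mean of \<open>\<partial>^\<gamma> u\<close>. Averaging
  reproduces constants, so \<open>m\<close> is the average of \<open>\<partial>^\<gamma> u\<close>,
  bounded by lattice values, minus the average of the mean-free part. For the latter the trace bound
  involves higher derivatives and a zeroth-order term, which the Poincare inequality turns into
  higher derivatives too.\<close>

lemma step_bd_trace:
  fixes w :: "'n::finite list"
  assumes tr: "trace_bd p (1 / real k) w 0 r" and k: "1 \<le> k" "length w \<le> k" and p: "1 \<le> p" and r: "1 \<le> r"
  shows "step_bd p k (count_list w) r"
proof -
  let ?\<gamma> = "count_list w" and ?P = "poincare_const TYPE('n)" and ?d = "real CARD('n)"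
  obtain C where C: "0 \<le> C" "\<And>(G :: ('n \<Rightarrow> nat) \<Rightarrow> real^'n \<Rightarrow> real) \<gamma>. jet G \<Longrightarrow>
     \<bar>iter_avg (1 / real k) w (G \<gamma>) 0\<bar> \<le> C * (\<Sum>\<eta>\<in>mi_le r. nmp p (G (\<lambda>i. \<gamma> i + \<eta> i)))"
    using tr unfolding trace_bd_def by blast
  define A where "A = 2 * (?P * ?d + C * (?P * ?d + 1) + (2 * real k) ^ length w)"
  have P0: "0 \<le> ?P" by (rule poincare_const_nonneg)
  have "nmp p (G ?\<gamma>) \<le> A * (E + (\<Sum>\<eta>\<in>mi_le r - {zmi}. nmp p (G (\<lambda>i. ?\<gamma> i + \<eta> i))))" (is "_ \<le> A * (E + ?S)")
    if G: "jet G" and E: "\<forall>x\<in>lat k k. \<bar>G zmi x\<bar> \<le> E" for G :: "('n \<Rightarrow> nat) \<Rightarrow> real^'n \<Rightarrow> real" and E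
  proof -
    have E0: "0 \<le> E" using bspec[OF E zero_in_lat] by simp
    have S0: "0 \<le> ?S" by (simp add: sum_nonneg)
    define m where "m = avg (G ?\<gamma>)"
    \<comment> \<open>Subtracting the mean alters the shifted jet at order zero only.\<close>
    define G' where "G' = (\<lambda>\<eta> x. G (\<lambda>i. ?\<gamma> i + \<eta> i) x - affine_jet m (\<lambda>_. 0) \<eta> x)"
    have G': "jet G'" unfolding G'_def by (intro jet_diff jet_shift G jet_affine_jet)
    have G'0: "G' zmi = (\<lambda>x. G ?\<gamma> x - m)" by (simp add: G'_def affine_jet_zero)
    have G'1: "G' \<eta> = G (\<lambda>i. ?\<gamma> i + \<eta> i)" if "\<eta> \<noteq> zmi" for \<eta>
    proof -
      have "(\<Sum>i\<in>UNIV. \<eta> i) \<noteq> 0" using that sum_zero_zmi[of \<eta>] by blast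
      then show ?thesis by (simp add: G'_def affine_jet_def del: sum_eq_0_iff)
    qed
    have Sinc: "nmp p (G (inc ?\<gamma> i)) \<le> ?S" for i
    proof -
      have "inc zmi i \<in> mi_le r - {zmi}"
        using r by (simp only: mi_le_def Diff_iff mem_Collect_eq sum_inc singleton_iff) (auto dest: fun_cong[of _ _ i])
      then have "nmp p (G (\<lambda>l. ?\<gamma> l + inc zmi i l)) \<le> ?S"
        by (rule member_le_sum[where f="\<lambda>\<eta>. nmp p (G (\<lambda>i. ?\<gamma> i + \<eta> i))"]) auto
      moreover have "(\<lambda>l. ?\<gamma> l + inc zmi i l) = inc ?\<gamma> i" by auto
      ultimately show ?thesis by metis
    qed
    have "nmp p (G' zmi) \<le> ?P * (\<Sum>i\<in>UNIV. nmp p (G (inc ?\<gamma> i)))"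
      unfolding G'0 m_def poincare_const_def by (rule poincare[OF G p])
    also have "\<dots> \<le> ?P * (?d * ?S)"
      by (intro mult_left_mono P0 card_inc_sum_le[of "\<lambda>\<gamma>. nmp p (G \<gamma>)"] Sinc)
    finally have n0: "nmp p (G' zmi) \<le> ?P * ?d * ?S" by simp
    have "\<bar>iter_avg (1 / real k) w (G' zmi) 0\<bar> \<le> C * (\<Sum>\<eta>\<in>mi_le r. nmp p (G' (\<lambda>i. zmi i + \<eta> i)))"
      by (rule C(2)[OF G'])
    also have "(\<Sum>\<eta>\<in>mi_le r. nmp p (G' (\<lambda>i. zmi i + \<eta> i))) = nmp p (G' zmi) + (\<Sum>\<eta>\<in>mi_le r - {zmi}. nmp p (G' \<eta>))"
      by (simp add: sum.remove[OF finite_mi_le zero_mi_le])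
    also have "(\<Sum>\<eta>\<in>mi_le r - {zmi}. nmp p (G' \<eta>)) = ?S"
      by (intro sum.cong) (auto simp: G'1)
    finally have "\<bar>iter_avg (1 / real k) w (G' zmi) 0\<bar> \<le> C * (nmp p (G' zmi) + ?S)" .
    also have "\<dots> \<le> C * (?P * ?d * ?S + ?S)"
      using n0 C(1) by (intro mult_left_mono) auto
    finally have t: "\<bar>iter_avg (1 / real k) w (G' zmi) 0\<bar> \<le> C * (?P * ?d + 1) * ?S" by (simp add: algebra_simps)
    have "iter_avg (1 / real k) w (G' zmi) 0 = iter_avg (1 / real k) w (G ?\<gamma>) 0 - m"
      unfolding G'0 by (subst iter_avg_diff) (auto simp: iter_avg_const jet_continuous[OF G])
    moreover have "\<bar>iter_avg (1 / real k) w (G ?\<gamma>) 0\<bar> \<le> (2 * real k) ^ length w * E"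
      using iter_avg_lattice_bound[OF G _ k(1) refl, where E=E and j=0 and x=0 and w=w] E k(2) zero_in_lat by auto
    ultimately have m: "\<bar>m\<bar> \<le> (2 * real k) ^ length w * E + C * (?P * ?d + 1) * ?S"
      using t by linarith
    have "nmp p (G ?\<gamma>) \<le> 2 * (nmp p (\<lambda>x. G ?\<gamma> x - m) + \<bar>m\<bar>)"
      by (intro nmp_le_diff_const jet_continuous G p)
    also have "\<dots> \<le> 2 * (?P * ?d * ?S + ((2 * real k) ^ length w * E + C * (?P * ?d + 1) * ?S))"
      using n0 m unfolding G'0 by (intro mult_left_mono add_mono) auto
    also have "\<dots> \<le> A * (E + ?S)"
    proof -
      have "0 \<le> (?P * ?d + C * (?P * ?d + 1)) * E + (2 * real k) ^ length w * ?S"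
        using P0 C(1) E0 S0 by (intro add_nonneg_nonneg mult_nonneg_nonneg) auto
      then show ?thesis by (simp add: A_def algebra_simps)
    qed
    finally show ?thesis .
  qed
  moreover have "0 \<le> A" using P0 C(1) by (simp add: A_def)
  ultimately show ?thesis unfolding step_bd_def by blast
qed

text \<open>Only derivatives \<open>\<partial>\<^sup>\<gamma>\<^sup>+\<^sup>\<eta>\<close> occur on the right, which is what makes the bound stable under anisotropic
  scaling.\<close>

definition sob_bd :: "real \<Rightarrow> nat \<Rightarrow> ('n::finite \<Rightarrow> nat) \<Rightarrow> ('n \<Rightarrow> nat) \<Rightarrow> bool" where
  "sob_bd p k \<gamma> \<delta> \<longleftrightarrow> (\<exists>C\<ge>0. \<forall>G E. jet G \<longrightarrow> (\<forall>x\<in>lat k k. \<bar>G zmi x\<bar> \<le> E) \<longrightarrow>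
     nmp p (G \<delta>) \<le> C * (E + (\<Sum>\<eta>\<in>multi_indices (k + 1 - (\<Sum>i\<in>UNIV. \<gamma> i)). nmp p (G (\<lambda>i. \<gamma> i + \<eta> i)))))"

lemma lat_bd_nonneg: "(\<forall>x\<in>lat k k. \<bar>f x\<bar> \<le> E) \<Longrightarrow> 0 \<le> (E::real)"
  using zero_in_lat[of k k] by force

lemma mi_deg1:
  fixes \<eta> :: "'n::finite \<Rightarrow> nat"
  assumes "1 \<le> (\<Sum>i\<in>UNIV. \<eta> i)"
  obtains \<eta>' i where "\<eta> = inc \<eta>' i" "(\<Sum>i\<in>UNIV. \<eta> i) = Suc (\<Sum>i\<in>UNIV. \<eta>' i)"
proof -
  have "\<exists>i. \<eta> i \<noteq> 0" using assms by (metis not_one_le_zero sum.neutral)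
  then obtain i where i: "\<eta> i \<noteq> 0" ..
  have g: "\<eta> = inc (\<eta>(i := \<eta> i - 1)) i" using i by auto
  then have "(\<Sum>j\<in>UNIV. \<eta> j) = Suc (\<Sum>j\<in>UNIV. (\<eta>(i := \<eta> i - 1)) j)"
    using sum_inc[of "\<eta>(i := \<eta> i - 1)" i] by metis
  with g that show thesis by blast
qed

text \<open>Serves the derivatives of order \<open>k\<close> that have no trace at the price of the
  single derivative left. The mean \<open>c i\<close> of such a derivative is read off from two
  averages of \<open>\<partial>^\<gamma> u\<close>, one order lower, at the origin and one step
  along \<open>axis i 1\<close>: lattice values bound both, and on an affine function they differ by
  \<open>c i / k\<close>. Subtracting the affine function with matching means leaves a remainder
  that the Poincare inequality bounds by second derivatives of \<open>\<partial>^\<gamma> u\<close>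
  alone.\<close>

lemma sob_bd_of_traces:
  fixes w :: "'n::finite list"
  assumes tr: "trace_bd p (1 / real k) w 0 2" "trace_bd p (1 / real k) w ((1 / real k) *\<^sub>R axis i 1) 2"
    and k: "length w + 1 = k" and p: "1 \<le> p"
  shows "sob_bd p k (count_list w) (inc (count_list w) i)"
proof -
  let ?\<gamma> = "count_list w" and ?P = "poincare_const TYPE('n)" and ?d = "real CARD('n)"
  let ?a = "(1 / real k) *\<^sub>R axis i 1 :: real^'n"
  obtain C1 where C1: "0 \<le> C1" "\<And>(G :: ('n \<Rightarrow> nat) \<Rightarrow> real^'n \<Rightarrow> real) \<gamma>. jet G \<Longrightarrow>
     \<bar>iter_avg (1 / real k) w (G \<gamma>) 0\<bar> \<le> C1 * (\<Sum>\<eta>\<in>mi_le 2. nmp p (G (\<lambda>i. \<gamma> i + \<eta> i)))"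
    using tr(1) unfolding trace_bd_def by blast
  obtain C2 where C2: "0 \<le> C2" "\<And>(G :: ('n \<Rightarrow> nat) \<Rightarrow> real^'n \<Rightarrow> real) \<gamma>. jet G \<Longrightarrow>
     \<bar>iter_avg (1 / real k) w (G \<gamma>) ?a\<bar> \<le> C2 * (\<Sum>\<eta>\<in>mi_le 2. nmp p (G (\<lambda>i. \<gamma> i + \<eta> i)))"
    using tr(2) unfolding trace_bd_def by blast
  define Q where "Q = ?P * ?d"
  \<comment> \<open>The summands \<open>Q * Q\<close>, \<open>Q\<close> and 1 belong to the
    derivatives of the remainder of order 0, 1 and 2.\<close>
  define M where "M = real (card (mi_le 2 :: ('n \<Rightarrow> nat) set)) * (1 + Q + Q * Q)"
  define A where "A = 2 * (Q + real k * (2 * (2 * real k) ^ length w + (C1 + C2) * M))"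
  have P0: "0 \<le> ?P" by (rule poincare_const_nonneg)
  have Q0: "0 \<le> Q" using P0 by (simp add: Q_def)
  have M0: "0 \<le> M" using Q0 by (simp add: M_def)
  have k1: "1 \<le> k" using k by simp
  have deg: "k + 1 - (\<Sum>i\<in>UNIV. ?\<gamma> i) = 2"
  proof -
    have "(\<Sum>i\<in>UNIV. ?\<gamma> i) = (\<Sum>i\<in>set w. ?\<gamma> i)"
      by (intro sum.mono_neutral_right) (auto simp: count_list_0_iff)
    also have "\<dots> = length w" by (rule sum_count_set) auto
    finally show ?thesis using k by simp
  qed
  have "nmp p (G (inc ?\<gamma> i)) \<le> A * (E + (\<Sum>\<eta>\<in>multi_indices 2. nmp p (G (\<lambda>i. ?\<gamma> i + \<eta> i))))" (is "_ \<le> A * (E + ?R)")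
    if G: "jet G" and E: "\<forall>x\<in>lat k k. \<bar>G zmi x\<bar> \<le> E" for G :: "('n \<Rightarrow> nat) \<Rightarrow> real^'n \<Rightarrow> real" and E
  proof -
    have E0: "0 \<le> E" using E by (rule lat_bd_nonneg)
    have R0: "0 \<le> ?R" by (simp add: sum_nonneg)
    define F where "F = (\<lambda>\<eta>. G (\<lambda>i. ?\<gamma> i + \<eta> i))"
    have F: "jet F" unfolding F_def by (rule jet_shift[OF G])
    define c where "c j = avg (F (inc zmi j))" for j
    define F1 where "F1 = (\<lambda>\<eta> x. F \<eta> x - affine_jet 0 c \<eta> x)"
    have F1: "jet F1" unfolding F1_def by (intro jet_diff F jet_affine_jet)
    \<comment> \<open>The slopes are fixed before the constant term, so that the Poincare inequality
      applies first to the gradient and then to the function.\<close>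
    define c0 where "c0 = avg (F1 zmi)"
    define G' where "G' = (\<lambda>\<eta> x. F \<eta> x - affine_jet c0 c \<eta> x)"
    have G': "jet G'" unfolding G'_def by (intro jet_diff F jet_affine_jet)
    have R: "nmp p (F \<eta>) \<le> ?R" if "(\<Sum>i\<in>UNIV. \<eta> i) = 2" for \<eta>
      unfolding F_def
      by (rule member_le_sum[where f="\<lambda>\<eta>. nmp p (G (\<lambda>i. ?\<gamma> i + \<eta> i))"])
         (use that finite_multi_indices in \<open>auto simp: multi_indices_def\<close>)
    have d1: "nmp p (\<lambda>x. F (inc zmi j) x - c j) \<le> Q * ?R" for j
    proof -
      have "nmp p (\<lambda>x. F (inc zmi j) x - c j) \<le> ?P * (\<Sum>l\<in>UNIV. nmp p (F (inc (inc zmi j) l)))"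
        unfolding c_def poincare_const_def by (rule poincare[OF F p])
      also have "\<dots> \<le> ?P * (?d * ?R)"
        by (intro mult_left_mono P0 card_inc_sum_le[of "\<lambda>\<gamma>. nmp p (F \<gamma>)"] R) (simp only: sum_inc, simp)
      finally show ?thesis by (simp add: Q_def)
    qed
    have F11: "F1 (inc zmi j) = (\<lambda>x. F (inc zmi j) x - c j)" "G' (inc zmi j) = (\<lambda>x. F (inc zmi j) x - c j)" for j
      unfolding F1_def G'_def affine_jet_inc_zero by simp_all
    have d0: "nmp p (G' zmi) \<le> Q * Q * ?R"
    proof -
      have "G' zmi = (\<lambda>x. F1 zmi x - c0)" by (simp add: G'_def F1_def affine_jet_zero algebra_simps)
      then have "nmp p (G' zmi) \<le> ?P * (\<Sum>l\<in>UNIV. nmp p (F1 (inc zmi l)))"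
        unfolding c0_def poincare_const_def using poincare[OF F1 p, of zmi] by (simp only:)
      also have "\<dots> \<le> ?P * (?d * (Q * ?R))"
        by (intro mult_left_mono P0 card_inc_sum_le[of "\<lambda>\<gamma>. nmp p (F1 \<gamma>)"]) (simp only: F11 d1)
      finally show ?thesis by (simp add: Q_def mult_ac)
    qed
    have each: "nmp p (G' \<eta>) \<le> (1 + Q + Q * Q) * ?R" if e: "\<eta> \<in> mi_le 2" for \<eta>
    proof -
      have QR: "0 \<le> Q * ?R" "0 \<le> Q * Q * ?R" using Q0 R0 by auto
      consider "(\<Sum>i\<in>UNIV. \<eta> i) = 0" | "(\<Sum>i\<in>UNIV. \<eta> i) = 1" | "(\<Sum>i\<in>UNIV. \<eta> i) = 2"
        using e unfolding mi_le_def mem_Collect_eq by linarith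
      then show ?thesis
      proof cases
        case 1
        then have "\<eta> = zmi" by (rule sum_zero_zmi)
        then show ?thesis using d0 QR R0 by (simp add: algebra_simps)
      next
        case 2
        then obtain \<eta>' j where "\<eta> = inc \<eta>' j" "(\<Sum>i\<in>UNIV. \<eta> i) = Suc (\<Sum>i\<in>UNIV. \<eta>' i)"
          using mi_deg1[of \<eta>] by (metis order_refl)
        then have "\<eta> = inc zmi j" using 2 sum_zero_zmi[of \<eta>'] by simp
        then have "nmp p (G' \<eta>) \<le> Q * ?R" using d1[of j] F11 by simp
        then show ?thesis using QR R0 by (simp add: algebra_simps)
      next
        case 3
        then have "G' \<eta> = F \<eta>" by (simp add: G'_def affine_jet_ge2)
        then show ?thesis using R[OF 3] QR by (simp add: algebra_simps)
      qed
    qed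
    have Msum: "(\<Sum>\<eta>\<in>mi_le 2. nmp p (G' (\<lambda>i. zmi i + \<eta> i))) \<le> M * ?R"
      using sum_mono[of "mi_le 2" "\<lambda>\<eta>. nmp p (G' \<eta>)" "\<lambda>_. (1 + Q + Q * Q) * ?R"] each
      by (simp add: M_def mult_ac)
    have t1: "\<bar>iter_avg (1 / real k) w (G' zmi) 0\<bar> \<le> C1 * (M * ?R)"
      using C1(2)[OF G', of zmi] Msum C1(1) by (meson mult_left_mono order_trans)
    have t2: "\<bar>iter_avg (1 / real k) w (G' zmi) ?a\<bar> \<le> C2 * (M * ?R)"
      using C2(2)[OF G', of zmi] Msum C2(1) by (meson mult_left_mono order_trans)
    let ?l = "\<lambda>x. c0 + (\<Sum>j\<in>UNIV. c j * x $ j)"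
    have cl: "continuous_on UNIV ?l" by (intro continuous_intros)
    have G'0: "G' zmi = (\<lambda>x. G ?\<gamma> x - ?l x)" by (simp add: G'_def F_def affine_jet_zero)
    have i1: "iter_avg (1 / real k) w (G' zmi) x = iter_avg (1 / real k) w (G ?\<gamma>) x - iter_avg (1 / real k) w ?l x" for x
      unfolding G'0 by (rule iter_avg_diff[OF jet_continuous[OF G] cl])
    have la: "?l (y + ?a) = ?l y + c i / real k" for y
    proof -
      have "(\<Sum>j\<in>UNIV. c j * ?a $ j) = (\<Sum>j\<in>UNIV. axis i 1 $ j * (c j / real k))"
        by (intro sum.cong) auto
      also have "\<dots> = c i / real k" by (rule sum_axis)
      finally show ?thesis by (simp only: vector_add_component distrib_left sum.distrib add.assoc)
    qed
    have "iter_avg (1 / real k) w ?l (0 + ?a) = iter_avg (1 / real k) w (\<lambda>y. ?l y + c i / real k) 0"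
      unfolding iter_avg_translate la ..
    also have "\<dots> = iter_avg (1 / real k) w ?l 0 + c i / real k"
      by (subst iter_avg_add[OF cl]) (auto simp: iter_avg_const)
    finally have i2: "iter_avg (1 / real k) w ?l ?a = iter_avg (1 / real k) w ?l 0 + c i / real k" by simp
    have l0: "\<bar>iter_avg (1 / real k) w (G ?\<gamma>) 0\<bar> \<le> (2 * real k) ^ length w * E"
      using iter_avg_lattice_bound[OF G _ k1 refl, where E=E and j=0 and x=0 and w=w] E k zero_in_lat by auto
    have "0 + ?a \<in> lat k (Suc 0)" by (rule lat_step[OF zero_in_lat])
    then have l1: "\<bar>iter_avg (1 / real k) w (G ?\<gamma>) ?a\<bar> \<le> (2 * real k) ^ length w * E"
      using iter_avg_lattice_bound[OF G _ k1 refl, where E=E and j=1 and x="?a" and w=w] E k by auto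
    have "\<bar>c i / real k\<bar> \<le> 2 * ((2 * real k) ^ length w * E) + (C1 * (M * ?R) + C2 * (M * ?R))"
      using t1 t2 l0 l1 i2 unfolding i1 by linarith
    then have "real k * \<bar>c i / real k\<bar> \<le> real k * (2 * ((2 * real k) ^ length w * E) + (C1 * (M * ?R) + C2 * (M * ?R)))"
      by (rule mult_left_mono) simp
    then have ci: "\<bar>c i\<bar> \<le> real k * (2 * ((2 * real k) ^ length w * E) + (C1 * (M * ?R) + C2 * (M * ?R)))"
      using k1 by (simp add: abs_div)
    have Fi: "F (inc zmi i) = G (inc ?\<gamma> i)"
    proof -
      have "(\<lambda>l. ?\<gamma> l + inc zmi i l) = inc ?\<gamma> i" by auto
      then show ?thesis unfolding F_def by metis
    qed
    have "nmp p (G (inc ?\<gamma> i)) \<le> 2 * (nmp p (\<lambda>x. G (inc ?\<gamma> i) x - c i) + \<bar>c i\<bar>)"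
      by (intro nmp_le_diff_const jet_continuous G p)
    also have "\<dots> \<le> 2 * (Q * ?R + real k * (2 * ((2 * real k) ^ length w * E) + (C1 * (M * ?R) + C2 * (M * ?R))))"
      using d1[of i] ci unfolding Fi by (intro mult_left_mono add_mono) auto
    also have "\<dots> \<le> A * (E + ?R)"
    proof -
      have "0 \<le> (Q + real k * ((C1 + C2) * M)) * E + (real k * (2 * (2 * real k) ^ length w)) * ?R"
        using Q0 C1(1) C2(1) M0 E0 R0 by (intro add_nonneg_nonneg mult_nonneg_nonneg) auto
      then show ?thesis by (simp add: A_def algebra_simps)
    qed
    finally show ?thesis .
  qed
  moreover have "0 \<le> A" using Q0 C1(1) C2(1) M0 by (simp add: A_def)
  ultimately show ?thesis unfolding sob_bd_def deg by blast
qed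

section \<open>Downward induction on the order\<close>

lemma sob_bd_top:
  fixes \<eta> :: "'n::finite \<Rightarrow> nat"
  assumes "(\<Sum>i\<in>UNIV. \<eta> i) = k + 1 - (\<Sum>i\<in>UNIV. \<gamma> i)"
  shows "sob_bd p k \<gamma> (\<lambda>i. \<gamma> i + \<eta> i)"
  unfolding sob_bd_def
proof (intro exI[of _ 1] conjI allI impI)
  fix G :: "('n \<Rightarrow> nat) \<Rightarrow> real^'n \<Rightarrow> real" and E
  assume "\<forall>x\<in>lat k k. \<bar>G zmi x\<bar> \<le> E"
  then have "0 \<le> E" by (rule lat_bd_nonneg)
  moreover have "nmp p (G (\<lambda>i. \<gamma> i + \<eta> i)) \<le> (\<Sum>\<eta>\<in>multi_indices (k + 1 - (\<Sum>i\<in>UNIV. \<gamma> i)). nmp p (G (\<lambda>i. \<gamma> i + \<eta> i)))"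
    by (rule member_le_sum[where f="\<lambda>\<eta>. nmp p (G (\<lambda>i. \<gamma> i + \<eta> i))"])
       (use assms finite_multi_indices in \<open>auto simp: multi_indices_def\<close>)
  ultimately show "nmp p (G (\<lambda>i. \<gamma> i + \<eta> i)) \<le> 1 * (E + (\<Sum>\<eta>\<in>multi_indices (k + 1 - (\<Sum>i\<in>UNIV. \<gamma> i)). nmp p (G (\<lambda>i. \<gamma> i + \<eta> i))))"
    by simp
qed simp

lemma sum_inc_multi_indices:
  fixes f :: "('n::finite \<Rightarrow> nat) \<Rightarrow> real"
  assumes "\<And>\<eta>. 0 \<le> f \<eta>"
  shows "(\<Sum>\<eta>\<in>multi_indices n. f (inc \<eta> j)) \<le> (\<Sum>\<eta>\<in>multi_indices (Suc n). f \<eta>)"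
proof -
  have "(\<Sum>\<eta>\<in>multi_indices n. f (inc \<eta> j)) = (\<Sum>\<eta>\<in>(\<lambda>\<eta>. inc \<eta> j) ` multi_indices n. f \<eta>)"
    by (subst sum.reindex) (auto intro: inj_on_subset[OF inj_inc])
  also have "\<dots> \<le> (\<Sum>\<eta>\<in>multi_indices (Suc n). f \<eta>)"
  proof (rule sum_mono2)
    show "(\<lambda>\<eta>. inc \<eta> j) ` multi_indices n \<subseteq> multi_indices (Suc n)"
      unfolding multi_indices_def by (auto simp only: sum_inc mem_Collect_eq image_iff)
  qed (use assms finite_multi_indices in auto)
  finally show ?thesis .
qed

text \<open>Adding \<open>\<eta>\<close> to \<open>inc \<gamma> i\<close> is adding
  \<open>inc \<eta> i\<close> to \<open>\<gamma>\<close>, so the sum for the larger base index is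
  part of the sum for the smaller one.\<close>

lemma sob_bd_trans:
  fixes \<gamma> :: "'n::finite \<Rightarrow> nat"
  assumes "sob_bd p k (inc \<gamma> i) \<delta>" and le: "(\<Sum>i\<in>UNIV. \<gamma> i) \<le> k"
  shows "sob_bd p k \<gamma> \<delta>"
proof -
  let ?n = "k - (\<Sum>i\<in>UNIV. \<gamma> i)"
  have n: "k + 1 - (\<Sum>l\<in>UNIV. inc \<gamma> i l) = ?n" "k + 1 - (\<Sum>i\<in>UNIV. \<gamma> i) = Suc ?n"
    unfolding sum_inc using le by auto
  obtain C where C: "0 \<le> C" "\<And>G E. jet G \<Longrightarrow> (\<forall>x\<in>lat k k. \<bar>G zmi x\<bar> \<le> E) \<Longrightarrow>
     nmp p (G \<delta>) \<le> C * (E + (\<Sum>\<eta>\<in>multi_indices ?n. nmp p (G (\<lambda>l. inc \<gamma> i l + \<eta> l))))"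
    using assms(1) unfolding sob_bd_def n by blast
  show ?thesis
    unfolding sob_bd_def n
  proof (intro exI[of _ C] conjI allI impI C(1))
    fix G :: "('n \<Rightarrow> nat) \<Rightarrow> real^'n \<Rightarrow> real" and E
    assume G: "jet G" and E: "\<forall>x\<in>lat k k. \<bar>G zmi x\<bar> \<le> E"
    have "(\<Sum>\<eta>\<in>multi_indices ?n. nmp p (G (\<lambda>l. inc \<gamma> i l + \<eta> l))) \<le> (\<Sum>\<eta>\<in>multi_indices (Suc ?n). nmp p (G (\<lambda>l. \<gamma> l + \<eta> l)))"
      unfolding inc_add by (rule sum_inc_multi_indices[where f="\<lambda>\<eta>. nmp p (G (\<lambda>l. \<gamma> l + \<eta> l))"]) simp
    then have "C * (E + (\<Sum>\<eta>\<in>multi_indices ?n. nmp p (G (\<lambda>l. inc \<gamma> i l + \<eta> l)))) \<le> C * (E + (\<Sum>\<eta>\<in>multi_indices (Suc ?n). nmp p (G (\<lambda>l. \<gamma> l + \<eta> l))))"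
      using C(1) by (intro mult_left_mono add_left_mono)
    with C(2)[OF G E] show "nmp p (G \<delta>) \<le> C * (E + (\<Sum>\<eta>\<in>multi_indices (Suc ?n). nmp p (G (\<lambda>l. \<gamma> l + \<eta> l))))"
      by (rule order_trans)
  qed
qed

lemma sob_bd_step:
  fixes \<gamma> :: "'n::finite \<Rightarrow> nat"
  assumes st: "step_bd p k \<delta> r" and ih: "\<And>\<eta>. \<eta> \<in> mi_le r \<Longrightarrow> \<eta> \<noteq> zmi \<Longrightarrow> sob_bd p k \<gamma> (\<lambda>i. \<delta> i + \<eta> i)"
  shows "sob_bd p k \<gamma> \<delta>"
proof -
  let ?n = "k + 1 - (\<Sum>i\<in>UNIV. \<gamma> i)"
  obtain C where C: "0 \<le> C" "\<And>G E. jet G \<Longrightarrow> (\<forall>x\<in>lat k k. \<bar>G zmi x\<bar> \<le> E) \<Longrightarrow>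
     nmp p (G \<delta>) \<le> C * (E + (\<Sum>\<eta>\<in>mi_le r - {zmi}. nmp p (G (\<lambda>i. \<delta> i + \<eta> i))))"
    using st unfolding step_bd_def by blast
  have "\<forall>\<eta>\<in>mi_le r - {zmi}. \<exists>D\<ge>0. \<forall>G E. jet G \<longrightarrow> (\<forall>x\<in>lat k k. \<bar>G zmi x\<bar> \<le> E) \<longrightarrow>
     nmp p (G (\<lambda>i. \<delta> i + \<eta> i)) \<le> D * (E + (\<Sum>\<eta>\<in>multi_indices ?n. nmp p (G (\<lambda>i. \<gamma> i + \<eta> i))))"
    using ih unfolding sob_bd_def by blast
  from bchoice[OF this] obtain D where D: "\<And>\<eta>. \<eta> \<in> mi_le r - {zmi} \<Longrightarrow> 0 \<le> D \<eta>"
    "\<And>\<eta> G E. \<eta> \<in> mi_le r - {zmi} \<Longrightarrow> jet G \<Longrightarrow> (\<forall>x\<in>lat k k. \<bar>G zmi x\<bar> \<le> E) \<Longrightarrow>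
     nmp p (G (\<lambda>i. \<delta> i + \<eta> i)) \<le> D \<eta> * (E + (\<Sum>\<eta>\<in>multi_indices ?n. nmp p (G (\<lambda>i. \<gamma> i + \<eta> i))))"
    by blast
  define A where "A = C * (1 + (\<Sum>\<eta>\<in>mi_le r - {zmi}. D \<eta>))"
  show ?thesis
    unfolding sob_bd_def
  proof (intro exI[of _ A] conjI allI impI)
    show "0 \<le> A" unfolding A_def using C(1) D(1) by (auto intro!: mult_nonneg_nonneg add_nonneg_nonneg sum_nonneg)
    fix G :: "('n \<Rightarrow> nat) \<Rightarrow> real^'n \<Rightarrow> real" and E
    assume G: "jet G" and E: "\<forall>x\<in>lat k k. \<bar>G zmi x\<bar> \<le> E"
    let ?R = "\<Sum>\<eta>\<in>multi_indices ?n. nmp p (G (\<lambda>i. \<gamma> i + \<eta> i))"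
    have E0: "0 \<le> E" using E by (rule lat_bd_nonneg)
    have R0: "0 \<le> ?R" by (simp add: sum_nonneg)
    have "nmp p (G \<delta>) \<le> C * (E + (\<Sum>\<eta>\<in>mi_le r - {zmi}. nmp p (G (\<lambda>i. \<delta> i + \<eta> i))))"
      by (rule C(2)[OF G E])
    also have "\<dots> \<le> C * ((E + ?R) + (\<Sum>\<eta>\<in>mi_le r - {zmi}. D \<eta> * (E + ?R)))"
      using R0 by (intro mult_left_mono add_mono sum_mono D(2)[OF _ G E] C(1)) auto
    also have "\<dots> = A * (E + ?R)"
    proof -
      have "C * (X + s * X) = C * (1 + s) * X" for X s :: real by (simp add: algebra_simps)
      then show ?thesis unfolding A_def sum_distrib_right[symmetric] .
    qed
    finally show "nmp p (G \<delta>) \<le> A * (E + ?R)" .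
  qed
qed

text \<open>All derivatives of \<open>\<partial>^\<gamma> u\<close> up to order \<open>k + 1\<close>
  are included, because the next step of the induction needs the intermediate ones.\<close>

definition level :: "'n::finite itself \<Rightarrow> real \<Rightarrow> nat \<Rightarrow> nat \<Rightarrow> bool" where
  "level _ p k j \<longleftrightarrow> (\<forall>(\<gamma> :: 'n \<Rightarrow> nat) \<eta>. (\<Sum>i\<in>UNIV. \<gamma> i) = j \<longrightarrow> (\<Sum>i\<in>UNIV. \<eta> i) \<le> k + 1 - j \<longrightarrow>
     sob_bd p k \<gamma> (\<lambda>i. \<gamma> i + \<eta> i))"

lemma level_top: "level TYPE('n::finite) p k (k + 1)"
  unfolding level_def by (auto intro!: sob_bd_top simp del: sum_eq_0_iff)

lemma mi_le_nonzero:
  fixes \<eta> :: "'n::finite \<Rightarrow> nat"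
  assumes "\<eta> \<noteq> zmi"
  shows "1 \<le> (\<Sum>i\<in>UNIV. \<eta> i)"
  using assms sum_zero_zmi[of \<eta>] by (metis less_one not_le)

text \<open>A nonzero \<open>\<eta>\<close> contains a unit vector, which reduces
  \<open>\<gamma> + \<eta>\<close> to the level above; only \<open>\<gamma>\<close> itself needs a
  new trace. The condition \<open>r \<le> k + 1 - j\<close> says that the trace consumes no more
  derivatives than there are.\<close>

lemma level_step:
  assumes L: "level TYPE('n::finite) p k (Suc j)" and j: "j \<le> k"
    and st: "\<And>\<gamma> :: 'n \<Rightarrow> nat. (\<Sum>i\<in>UNIV. \<gamma> i) = j \<Longrightarrow> \<exists>r \<le> k + 1 - j. step_bd p k \<gamma> r"
  shows "level TYPE('n) p k j"
  unfolding level_def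
proof (intro allI impI)
  fix \<gamma> \<eta> :: "'n \<Rightarrow> nat"
  assume \<gamma>: "(\<Sum>i\<in>UNIV. \<gamma> i) = j" and \<eta>: "(\<Sum>i\<in>UNIV. \<eta> i) \<le> k + 1 - j"
  have pos: "sob_bd p k \<gamma> (\<lambda>i. \<gamma> i + \<eta> i)" if nz: "\<eta> \<noteq> zmi" and le: "(\<Sum>i\<in>UNIV. \<eta> i) \<le> k + 1 - j" for \<eta>
  proof -
    obtain \<eta>' i where e: "\<eta> = inc \<eta>' i" "(\<Sum>i\<in>UNIV. \<eta> i) = Suc (\<Sum>i\<in>UNIV. \<eta>' i)"
      by (rule mi_deg1[OF mi_le_nonzero[OF nz]])
    have "(\<Sum>l\<in>UNIV. inc \<gamma> i l) = Suc j" unfolding sum_inc \<gamma> ..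
    moreover have "(\<Sum>i\<in>UNIV. \<eta>' i) \<le> k + 1 - Suc j" using e le by simp
    ultimately have "sob_bd p k (inc \<gamma> i) (\<lambda>l. inc \<gamma> i l + \<eta>' l)"
      using L unfolding level_def by blast
    then have "sob_bd p k \<gamma> (\<lambda>l. inc \<gamma> i l + \<eta>' l)"
      by (rule sob_bd_trans) (use \<gamma> j in simp)
    then show ?thesis unfolding inc_add e .
  qed
  show "sob_bd p k \<gamma> (\<lambda>i. \<gamma> i + \<eta> i)"
  proof (cases "\<eta> = zmi")
    case True
    obtain r where r: "r \<le> k + 1 - j" "step_bd p k \<gamma> r" using st[OF \<gamma>] by blast
    have "sob_bd p k \<gamma> \<gamma>"
    proof (rule sob_bd_step[OF r(2)])
      fix \<eta> :: "'n \<Rightarrow> nat" assume e: "\<eta> \<in> mi_le r" "\<eta> \<noteq> zmi"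
      have "(\<Sum>i\<in>UNIV. \<eta> i) \<le> k + 1 - j"
        using e(1) r(1) unfolding mi_le_def mem_Collect_eq by (rule order_trans)
      then show "sob_bd p k \<gamma> (\<lambda>i. \<gamma> i + \<eta> i)" by (rule pos[OF e(2)])
    qed
    then show ?thesis by (simp add: True)
  next
    case False
    then show ?thesis by (rule pos[OF _ \<eta>])
  qed
qed

section \<open>Counting derivatives in dimensions two and three\<close>

lemma set_count_list: "set w = {i. count_list w i \<noteq> 0}"
  by (simp add: set_eq_iff count_list_0_iff del: neq0_conv)

text \<open>The support of \<open>\<gamma>\<close> spans the face of the average; the last
  hypothesis says that its codimension is at most \<open>r\<close>.\<close>

lemma step_bd_face:
  fixes \<gamma> :: "'n::finite \<Rightarrow> nat"
  assumes "(\<Sum>i\<in>UNIV. \<gamma> i) \<le> k" "1 \<le> k" "1 \<le> p" "1 \<le> r" "CARD('n) \<le> card {i. \<gamma> i \<noteq> 0} + r"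
  shows "step_bd p k \<gamma> r"
proof -
  obtain w where w: "count_list w = \<gamma>" "length w = (\<Sum>i\<in>UNIV. \<gamma> i)" using exists_list by blast
  have sw: "set w = {i. \<gamma> i \<noteq> 0}" using set_count_list[of w] w(1) by simp
  have lk: "length w \<le> k" unfolding w(2) by (rule assms(1))
  have le: "real (length w) * (1 / real k) \<le> 1" using lk assms(2) by simp
  have "trace_bd p (1 / real k) w (0 *\<^sub>R axis undefined 1) r"
    by (rule trace_bd_face[OF assms(3)]) (use assms(2,5) le sw in simp_all)
  then have "trace_bd p (1 / real k) w 0 r" by simp
  from step_bd_trace[OF this assms(2) lk assms(3,4)] show ?thesis using w(1) by simp
qed

lemma support_nonempty:
  fixes \<gamma> :: "'n::finite \<Rightarrow> nat"
  assumes "1 \<le> (\<Sum>i\<in>UNIV. \<gamma> i)"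
  shows "1 \<le> card {i. \<gamma> i \<noteq> 0}"
proof -
  have "\<exists>i. \<gamma> i \<noteq> 0" using assms by (metis not_one_le_zero sum.neutral)
  then have "{i. \<gamma> i \<noteq> 0} \<noteq> {}" by blast
  then show ?thesis by (simp add: Suc_leI card_gt_0_iff)
qed

text \<open>A nonzero index spans at least an edge, of codimension one, and one derivative is always
  left. At order 0 the trace is a point value of codimension two, affordable because
  \<open>k \<ge> 1\<close>.\<close>

lemma level_2D:
  assumes d: "CARD('n::finite) = 2" and k: "1 \<le> k" and p: "1 \<le> p" and m: "m \<le> k + 1"
  shows "level TYPE('n) p k m"
  using m
proof (induction rule: inc_induct)
  case base
  show ?case by (rule level_top)
next
  case (step j)
  show ?case
  proof (rule level_step[OF step.IH])
    show "j \<le> k" using step by simp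
    fix \<gamma> :: "'n \<Rightarrow> nat" assume g: "(\<Sum>i\<in>UNIV. \<gamma> i) = j"
    show "\<exists>r\<le>k + 1 - j. step_bd p k \<gamma> r"
    proof (cases "j = 0")
      case True
      then show ?thesis
        using k p d g by (intro exI[of _ 2] conjI step_bd_face) auto
    next
      case False
      then have "1 \<le> card {i. \<gamma> i \<noteq> 0}" using g by (intro support_nonempty) simp
      then show ?thesis
        using step k p d g by (intro exI[of _ 1] conjI step_bd_face) auto
    qed
  qed
qed

text \<open>At order \<open>k\<close> a single derivative is left. It pays for faces of codimension
  at most one; a pure derivative lives on an edge, of codimension two, and needs the edge trace,
  hence \<open>p > 2\<close>.\<close>

lemma level_3D_top:
  assumes d: "CARD('n::finite) = 3" and k: "1 \<le> k" and p: "2 < p"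
  shows "level TYPE('n) p k k"
proof (rule level_step)
  show "level TYPE('n) p k (Suc k)" using level_top[of p k] by simp
  fix \<gamma> :: "'n \<Rightarrow> nat" assume g: "(\<Sum>i\<in>UNIV. \<gamma> i) = k"
  have "1 \<le> card {i. \<gamma> i \<noteq> 0}" using g k by (intro support_nonempty) simp
  then consider "2 \<le> card {i. \<gamma> i \<noteq> 0}" | "card {i. \<gamma> i \<noteq> 0} = 1" by linarith
  then have "step_bd p k \<gamma> 1"
  proof cases
    case 1
    then show ?thesis using g k p d by (intro step_bd_face) auto
  next
    case 2
    then obtain i where i: "{i. \<gamma> i \<noteq> 0} = {i}" by (auto simp: card_1_singleton_iff)
    obtain w where w: "count_list w = \<gamma>" "length w = (\<Sum>i\<in>UNIV. \<gamma> i)" using exists_list by blast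
    have sw: "set w = {i}" using set_count_list[of w] w(1) i by simp
    have le: "real (length w) * (1 / real k) \<le> 1" using g k w(2) by simp
    have p1: "1 \<le> p" using p by simp
    have "trace_bd p (1 / real k) w 0 1"
      by (rule trace_bd_edge[OF p1 _ _ le sw]) (use k p d in simp_all)
    from step_bd_trace[OF this k _ p1] show ?thesis using g w by simp
  qed
  then show "\<exists>r\<le>k + 1 - k. step_bd p k \<gamma> r" by (intro exI[of _ 1]) simp
qed simp

text \<open>Order \<open>k - 1\<close> is reached without passing through \<open>level\<close> at
  order \<open>k\<close>, which these traces do not give for small \<open>p\<close>. Here a
  derivative \<open>inc \<gamma> i\<close> may be bounded by all second derivatives of
  \<open>\<partial>^\<gamma> u\<close>, a weaker demand than a bound by its own first
  derivatives.\<close>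

lemma level_below_top:
  assumes k: "1 \<le> k"
    and s2: "\<And>\<gamma> :: 'n::finite \<Rightarrow> nat. (\<Sum>i\<in>UNIV. \<gamma> i) = k - 1 \<Longrightarrow> step_bd p k \<gamma> 2"
    and s1: "\<And>(\<gamma> :: 'n \<Rightarrow> nat) i. (\<Sum>i\<in>UNIV. \<gamma> i) = k - 1 \<Longrightarrow> step_bd p k (inc \<gamma> i) 1 \<or> sob_bd p k \<gamma> (inc \<gamma> i)"
  shows "level TYPE('n) p k (k - 1)"
  unfolding level_def
proof (intro allI impI)
  fix \<gamma> \<eta> :: "'n \<Rightarrow> nat"
  assume \<gamma>: "(\<Sum>i\<in>UNIV. \<gamma> i) = k - 1" and \<eta>: "(\<Sum>i\<in>UNIV. \<eta> i) \<le> k + 1 - (k - 1)"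
  have two: "sob_bd p k \<gamma> (\<lambda>i. \<gamma> i + \<eta> i)" if "(\<Sum>i\<in>UNIV. \<eta> i) = 2" for \<eta>
    using that \<gamma> k by (intro sob_bd_top) simp
  have one: "sob_bd p k \<gamma> (inc \<gamma> i)" for i
    using s1[OF \<gamma>, of i]
  proof
    assume "step_bd p k (inc \<gamma> i) 1"
    then show ?thesis
    proof (rule sob_bd_step)
      fix \<eta> :: "'n \<Rightarrow> nat" assume "\<eta> \<in> mi_le 1" "\<eta> \<noteq> zmi"
      then have "(\<Sum>i\<in>UNIV. \<eta> i) = 1" using mi_le_nonzero[of \<eta>] unfolding mi_le_def by (simp del: sum_eq_Suc0_iff)
      then have "(\<Sum>l\<in>UNIV. inc \<eta> i l) = 2" by (simp only: sum_inc)
      then show "sob_bd p k \<gamma> (\<lambda>l. inc \<gamma> i l + \<eta> l)" unfolding inc_add by (rule two)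
    qed
  qed
  have one': "sob_bd p k \<gamma> (\<lambda>i. \<gamma> i + \<eta> i)" if s: "(\<Sum>i\<in>UNIV. \<eta> i) = 1" for \<eta>
  proof -
    obtain \<eta>' i where e: "\<eta> = inc \<eta>' i" "(\<Sum>i\<in>UNIV. \<eta> i) = Suc (\<Sum>i\<in>UNIV. \<eta>' i)"
      by (rule mi_deg1[of \<eta>]) (simp add: s)
    have "\<eta>' = zmi" by (rule sum_zero_zmi) (use e s in simp)
    then have "(\<lambda>l. \<gamma> l + \<eta> l) = inc \<gamma> i" using e by auto
    then show ?thesis using one[of i] by metis
  qed
  show "sob_bd p k \<gamma> (\<lambda>i. \<gamma> i + \<eta> i)"
  proof (cases "\<eta> = zmi")
    case True
    have "sob_bd p k \<gamma> \<gamma>"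
    proof (rule sob_bd_step[OF s2[OF \<gamma>]])
      fix \<eta> :: "'n \<Rightarrow> nat" assume e: "\<eta> \<in> mi_le 2" "\<eta> \<noteq> zmi"
      then have "(\<Sum>i\<in>UNIV. \<eta> i) = 1 \<or> (\<Sum>i\<in>UNIV. \<eta> i) = 2"
        using mi_le_nonzero[of \<eta>] unfolding mi_le_def mem_Collect_eq by linarith
      then show "sob_bd p k \<gamma> (\<lambda>i. \<gamma> i + \<eta> i)" using one' two by blast
    qed
    then show ?thesis by (simp add: True)
  next
    case False
    then have "(\<Sum>i\<in>UNIV. \<eta> i) = 1 \<or> (\<Sum>i\<in>UNIV. \<eta> i) = 2"
      using mi_le_nonzero[of \<eta>] \<eta> k by linarith
    then show ?thesis using one' two by blast
  qed
qed

text \<open>The word is empty, so the averages are point values at the vertices 0 and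
  \<open>axis i 1\<close>, which cost two derivatives when \<open>p > 3 / 2\<close>.\<close>

lemma level_3D_point:
  assumes d: "CARD('n::finite) = 3" and p: "3 / 2 < p"
  shows "level TYPE('n) p 1 0"
proof -
  have "level TYPE('n) p 1 (1 - 1)"
  proof (rule level_below_top)
    fix \<gamma> :: "'n \<Rightarrow> nat" and i :: 'n assume "(\<Sum>i\<in>UNIV. \<gamma> i) = 1 - 1"
    then have g: "\<gamma> = count_list []" by auto
    have tr: "trace_bd p (1 / real 1) [] y 2" if "y \<in> (std_sx :: (real^'n) set)" for y
      using p d that by (intro trace_bd_point) auto
    show "step_bd p 1 \<gamma> 2"
      unfolding g by (rule step_bd_trace[OF tr[OF zero_in_std_sx]]) (use p in auto)
    have "trace_bd p (1 / real 1) [] ((1 / real 1) *\<^sub>R axis i 1 :: real^'n) 2"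
      by (rule tr) (simp add: axis_in_std_sx)
    then have "sob_bd p 1 (count_list []) (inc (count_list []) i)"
      by (rule sob_bd_of_traces[OF tr[OF zero_in_std_sx]]) (use p in auto)
    then show "step_bd p 1 (inc \<gamma> i) 1 \<or> sob_bd p 1 \<gamma> (inc \<gamma> i)"
      unfolding g by blast
  qed simp
  then show ?thesis by simp
qed

text \<open>At order \<open>k - 1 \<ge> 1\<close> the index spans at least an edge, whose trace
  costs the two derivatives available. If raising it in direction \<open>i\<close> yields at least
  two directions, one derivative suffices at order \<open>k\<close>; otherwise it is a multiple of
  the \<open>i\<close>-th unit vector, and two averages on the same edge are compared. At positive
  orders below, two derivatives suffice; order 0 takes three, which \<open>k \<ge> 2\<close>
  provides.\<close>

lemma level_3D_low:
  assumes d: "CARD('n::finite) = 3" and k: "2 \<le> k" and p: "1 \<le> p" and m: "m \<le> k - 1"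
  shows "level TYPE('n) p k m"
  using m
proof (induction rule: inc_induct)
  case base
  show ?case
  proof (rule level_below_top)
    show "1 \<le> k" using k by simp
    fix \<gamma> :: "'n \<Rightarrow> nat" and i assume g: "(\<Sum>i\<in>UNIV. \<gamma> i) = k - 1"
    have c1: "1 \<le> card {i. \<gamma> i \<noteq> 0}" using g k by (intro support_nonempty) simp
    show "step_bd p k \<gamma> 2"
      using c1 g k p d by (intro step_bd_face) auto
    have gi: "(\<Sum>l\<in>UNIV. inc \<gamma> i l) = k" unfolding sum_inc g using k by simp
    show "step_bd p k (inc \<gamma> i) 1 \<or> sob_bd p k \<gamma> (inc \<gamma> i)"
    proof (cases "2 \<le> card {l. inc \<gamma> i l \<noteq> 0}")
      case True
      then have "step_bd p k (inc \<gamma> i) 1"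
        using gi k p d by (intro step_bd_face) (simp_all del: fun_upd_apply)
      then show ?thesis ..
    next
      case False
      have sub: "{l. \<gamma> l \<noteq> 0} \<subseteq> {l. inc \<gamma> i l \<noteq> 0}" and i: "i \<in> {l. inc \<gamma> i l \<noteq> 0}" by auto
      have "card {l. inc \<gamma> i l \<noteq> 0} = 1"
        using False card_mono[OF _ sub] c1 by (simp del: fun_upd_apply)
      then have "{l. inc \<gamma> i l \<noteq> 0} = {i}" using i by (metis card_1_singletonE singletonD)
      moreover have "{l. \<gamma> l \<noteq> 0} \<noteq> {}" using c1 by (metis card.empty not_one_le_zero)
      ultimately have s: "{l. \<gamma> l \<noteq> 0} = {i}" using sub by (metis subset_singletonD)
      obtain w where w: "count_list w = \<gamma>" "length w = (\<Sum>i\<in>UNIV. \<gamma> i)" using exists_list by blast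
      have sw: "set w = {i}" using set_count_list[of w] w(1) s by simp
      have len: "length w + 1 = k" using w(2) g k by simp
      \<comment> \<open>The second average starts at \<open>1 / k\<close> and ends exactly at the
        vertex, so both averages stay inside the simplex.\<close>
      have le: "real (length w) * (1 / real k) \<le> 1" "1 / real k + real (length w) * (1 / real k) = 1"
        using len k by (auto simp: field_simps)
      have "trace_bd p (1 / real k) w (0 *\<^sub>R axis i 1) 2" "trace_bd p (1 / real k) w ((1 / real k) *\<^sub>R axis i 1) 2"
        by (intro trace_bd_face p; use k d sw le in simp)+
      then have "sob_bd p k (count_list w) (inc (count_list w) i)"
        by (intro sob_bd_of_traces len p) simp_all
      then show ?thesis unfolding w ..
    qed
  qed
next
  case (step j)
  show ?case
  proof (rule level_step[OF step.IH])
    show "j \<le> k" using step by simp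
    fix \<gamma> :: "'n \<Rightarrow> nat" assume g: "(\<Sum>i\<in>UNIV. \<gamma> i) = j"
    show "\<exists>r\<le>k + 1 - j. step_bd p k \<gamma> r"
    proof (cases "j = 0")
      case True
      then show ?thesis
        using k p d g by (intro exI[of _ 3] conjI step_bd_face) auto
    next
      case False
      then have "1 \<le> card {i. \<gamma> i \<noteq> 0}" using g by (intro support_nonempty) simp
      then show ?thesis
        using step k p d g by (intro exI[of _ 2] conjI step_bd_face) auto
    qed
  qed
qed

definition jet_bd :: "'n::finite itself \<Rightarrow> real \<Rightarrow> nat \<Rightarrow> nat \<Rightarrow> real \<Rightarrow> bool" where
  "jet_bd _ p k m C \<longleftrightarrow> 0 \<le> C \<and> (\<forall>(\<gamma> :: 'n \<Rightarrow> nat) G E. (\<Sum>i\<in>UNIV. \<gamma> i) = m \<longrightarrow> jet G \<longrightarrow> (\<forall>x\<in>lat k k. \<bar>G zmi x\<bar> \<le> E) \<longrightarrow>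
     nmp p (G \<gamma>) \<le> C * (E + (\<Sum>\<eta>\<in>multi_indices (k + 1 - m). nmp p (G (\<lambda>i. \<gamma> i + \<eta> i)))))"

lemma level_jet_bd:
  assumes "level TYPE('n::finite) p k m"
  shows "\<exists>C. jet_bd TYPE('n) p k m C"
proof -
  have "\<forall>\<gamma>\<in>(multi_indices m :: ('n \<Rightarrow> nat) set). \<exists>C\<ge>0. \<forall>G E. jet G \<longrightarrow> (\<forall>x\<in>lat k k. \<bar>G zmi x\<bar> \<le> E) \<longrightarrow>
     nmp p (G \<gamma>) \<le> C * (E + (\<Sum>\<eta>\<in>multi_indices (k + 1 - m). nmp p (G (\<lambda>i. \<gamma> i + \<eta> i))))"
  proof
    fix \<gamma> :: "'n \<Rightarrow> nat" assume "\<gamma> \<in> multi_indices m"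
    then have g: "(\<Sum>i\<in>UNIV. \<gamma> i) = m" by (simp add: multi_indices_def)
    have "sob_bd p k \<gamma> (\<lambda>i. \<gamma> i + zmi i)"
      by (rule assms[unfolded level_def, rule_format, OF g]) simp
    then have "sob_bd p k \<gamma> \<gamma>" by simp
    then show "\<exists>C\<ge>0. \<forall>G E. jet G \<longrightarrow> (\<forall>x\<in>lat k k. \<bar>G zmi x\<bar> \<le> E) \<longrightarrow>
     nmp p (G \<gamma>) \<le> C * (E + (\<Sum>\<eta>\<in>multi_indices (k + 1 - m). nmp p (G (\<lambda>i. \<gamma> i + \<eta> i))))"
      unfolding sob_bd_def g .
  qed
  from bchoice[OF this] obtain C where C: "\<And>\<gamma> :: 'n \<Rightarrow> nat. \<gamma> \<in> multi_indices m \<Longrightarrow> 0 \<le> C \<gamma>"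
    "\<And>(\<gamma> :: 'n \<Rightarrow> nat) G E. \<gamma> \<in> multi_indices m \<Longrightarrow> jet G \<Longrightarrow> (\<forall>x\<in>lat k k. \<bar>G zmi x\<bar> \<le> E) \<Longrightarrow>
     nmp p (G \<gamma>) \<le> C \<gamma> * (E + (\<Sum>\<eta>\<in>multi_indices (k + 1 - m). nmp p (G (\<lambda>i. \<gamma> i + \<eta> i))))"
    by blast
  have "jet_bd TYPE('n) p k m (\<Sum>\<gamma>\<in>multi_indices m. C \<gamma>)"
    unfolding jet_bd_def
  proof (intro conjI allI impI)
    show "0 \<le> (\<Sum>\<gamma>\<in>multi_indices m. C \<gamma>)" using C(1) by (rule sum_nonneg)
    fix \<gamma> :: "'n \<Rightarrow> nat" and G :: "('n \<Rightarrow> nat) \<Rightarrow> real^'n \<Rightarrow> real" and E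
    assume g: "(\<Sum>i\<in>UNIV. \<gamma> i) = m" and G: "jet G" and E: "\<forall>x\<in>lat k k. \<bar>G zmi x\<bar> \<le> E"
    let ?R = "\<Sum>\<eta>\<in>multi_indices (k + 1 - m). nmp p (G (\<lambda>i. \<gamma> i + \<eta> i))"
    have mem: "\<gamma> \<in> multi_indices m" using g by (simp add: multi_indices_def)
    have "nmp p (G \<gamma>) \<le> C \<gamma> * (E + ?R)" by (rule C(2)[OF mem G E])
    also have "\<dots> \<le> (\<Sum>\<gamma>\<in>multi_indices m. C \<gamma>) * (E + ?R)"
    proof (rule mult_right_mono)
      show "C \<gamma> \<le> (\<Sum>\<gamma>\<in>multi_indices m. C \<gamma>)"
        by (rule member_le_sum[OF mem]) (use C(1) finite_multi_indices in auto)
      show "0 \<le> E + ?R" using lat_bd_nonneg[OF E] by (simp add: sum_nonneg)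
    qed
    finally show "nmp p (G \<gamma>) \<le> (\<Sum>\<gamma>\<in>multi_indices m. C \<gamma>) * (E + ?R)" .
  qed
  then show ?thesis ..
qed

section \<open>Bounds in the supremum norm\<close>

lemma iter_avg_nn_const: "iter_avg_nn c w (\<lambda>_. a) = (\<lambda>_. a)"
proof (induction w)
  case (Cons i w)
  have "line_avg_nn c i (\<lambda>_. a) = (\<lambda>_. a)"
    by (simp add: line_avg_nn_def fun_eq_iff nn_integral_cmult_indicator)
  then show ?case using Cons by simp
qed simp

lemma abs_iter_avg_le_sup:
  fixes f :: "real^'n::finite \<Rightarrow> real"
  assumes f: "continuous_on UNIV f" and le: "\<And>y. y \<in> std_sx \<Longrightarrow> \<bar>f y\<bar> \<le> B"
    and c: "0 \<le> c" "real (length w) * c \<le> 1"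
  shows "\<bar>iter_avg c w f 0\<bar> \<le> B"
proof -
  have B: "0 \<le> B" using le[OF zero_in_std_sx] by simp
  define h where "h y = (if y \<in> std_sx then ennreal \<bar>f y\<bar> else 0)" for y
  have "ennreal \<bar>iter_avg c w f 0\<bar> \<le> iter_avg_nn c w (\<lambda>y. ennreal \<bar>f y\<bar>) 0" by (rule abs_iter_avg_le[OF f])
  also have "\<dots> = iter_avg_nn c w h 0"
    by (rule iter_avg_nn_cong[where b=1]) (use c in \<open>auto simp: h_def std_sx_def\<close>)
  also have "\<dots> \<le> iter_avg_nn c w (\<lambda>_. ennreal B) 0"
    by (rule iter_avg_nn_mono) (use le in \<open>auto simp: h_def intro: ennreal_leI\<close>)
  also have "\<dots> = ennreal B" by (simp add: iter_avg_nn_const)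
  finally show ?thesis using B by simp
qed

lemma jet_lipschitz:
  fixes G :: "('n \<Rightarrow> nat) \<Rightarrow> real^'n::finite \<Rightarrow> real"
  assumes G: "jet G" and xy: "x \<in> std_sx" "y \<in> std_sx" and B: "\<And>i z. z \<in> std_sx \<Longrightarrow> \<bar>G (inc \<gamma> i) z\<bar> \<le> B"
  shows "\<bar>G \<gamma> y - G \<gamma> x\<bar> \<le> real CARD('n) * B"
proof -
  have B0: "0 \<le> B" using B[OF xy(1)] by (meson abs_ge_zero order_trans)
  have "ennreal \<bar>G \<gamma> y - G \<gamma> x\<bar> \<le> (\<integral>\<^sup>+t\<in>{0..1}. ennreal (grad1 G \<gamma> ((1 - t) *\<^sub>R x + t *\<^sub>R y)) \<partial>lborel)"
    using jet_segment_bound[OF G xy, of 0 1 \<gamma>] by simp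
  also have "\<dots> \<le> (\<integral>\<^sup>+t\<in>{0..1::real}. ennreal (real CARD('n) * B) \<partial>lborel)"
  proof (intro nn_integral_mono)
    fix t :: real
    show "ennreal (grad1 G \<gamma> ((1 - t) *\<^sub>R x + t *\<^sub>R y)) * indicator {0..1} t \<le> ennreal (real CARD('n) * B) * indicator {0..1} t"
    proof (cases "t \<in> {0..1}")
      case True
      then have "grad1 G \<gamma> ((1 - t) *\<^sub>R x + t *\<^sub>R y) \<le> (\<Sum>i\<in>(UNIV::'n set). B)"
        unfolding grad1_def using xy by (intro sum_mono B std_sx_seg) auto
      then show ?thesis using True by (simp add: ennreal_leI)
    qed simp
  qed
  also have "\<dots> = ennreal (real CARD('n) * B)" by (simp add: nn_integral_cmult_indicator)
  finally show ?thesis using B0 by simp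
qed

text \<open>An average is bounded by the supremum, so no trace inequality and no condition on the
  dimension enter: \<open>G \<gamma> x\<close> differs from an average controlled by the lattice by
  at most the oscillation of \<open>G \<gamma>\<close>, which the derivatives of the next order
  bound.\<close>

lemma jet_sup_bd:
  fixes \<gamma> :: "'n::finite \<Rightarrow> nat"
  assumes "j \<le> k + 1" and k: "1 \<le> k"
  shows "\<exists>C\<ge>0. \<forall>(\<gamma> :: 'n \<Rightarrow> nat) G E B. (\<Sum>i\<in>UNIV. \<gamma> i) = j \<longrightarrow> jet G \<longrightarrow> (\<forall>x\<in>lat k k. \<bar>G zmi x\<bar> \<le> E) \<longrightarrow>
    (\<forall>\<eta>\<in>multi_indices (k + 1 - j). \<forall>x\<in>std_sx. \<bar>G (\<lambda>i. \<gamma> i + \<eta> i) x\<bar> \<le> B) \<longrightarrow> (\<forall>x\<in>std_sx. \<bar>G \<gamma> x\<bar> \<le> C * (E + B))"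
  using assms(1)
proof (induction rule: inc_induct)
  case base
  show ?case
  proof (intro exI[of _ 1] conjI allI impI ballI)
    fix \<gamma> :: "'n \<Rightarrow> nat" and G :: "('n \<Rightarrow> nat) \<Rightarrow> real^'n \<Rightarrow> real" and E B x
    assume E: "\<forall>x\<in>lat k k. \<bar>G zmi x\<bar> \<le> E" and B: "\<forall>\<eta>\<in>multi_indices (k + 1 - (k + 1)). \<forall>x\<in>std_sx. \<bar>G (\<lambda>i. \<gamma> i + \<eta> i) x\<bar> \<le> B"
      and x: "x \<in> (std_sx :: (real^'n) set)"
    have "zmi \<in> (multi_indices (k + 1 - (k + 1)) :: ('n \<Rightarrow> nat) set)" by (simp add: multi_indices_def)
    from bspec[OF bspec[OF B this] x] show "\<bar>G \<gamma> x\<bar> \<le> 1 * (E + B)"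
      using lat_bd_nonneg[OF E] by simp
  qed simp
next
  case (step j)
  obtain C where C: "0 \<le> C" "\<And>(\<gamma> :: 'n \<Rightarrow> nat) G E B x. (\<Sum>i\<in>UNIV. \<gamma> i) = Suc j \<Longrightarrow> jet G \<Longrightarrow> (\<forall>x\<in>lat k k. \<bar>G zmi x\<bar> \<le> E) \<Longrightarrow>
    (\<forall>\<eta>\<in>multi_indices (k + 1 - Suc j). \<forall>x\<in>std_sx. \<bar>G (\<lambda>i. \<gamma> i + \<eta> i) x\<bar> \<le> B) \<Longrightarrow> x \<in> std_sx \<Longrightarrow> \<bar>G \<gamma> x\<bar> \<le> C * (E + B)"
    using step.IH by blast
  define A where "A = real CARD('n) * C + (2 * real k) ^ j"
  show ?case
  proof (intro exI[of _ A] conjI allI impI ballI)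
    show "0 \<le> A" using C(1) by (simp add: A_def)
    fix \<gamma> :: "'n \<Rightarrow> nat" and G :: "('n \<Rightarrow> nat) \<Rightarrow> real^'n \<Rightarrow> real" and E B x
    assume g: "(\<Sum>i\<in>UNIV. \<gamma> i) = j" and G: "jet G" and E: "\<forall>x\<in>lat k k. \<bar>G zmi x\<bar> \<le> E"
      and B: "\<forall>\<eta>\<in>multi_indices (k + 1 - j). \<forall>x\<in>std_sx. \<bar>G (\<lambda>i. \<gamma> i + \<eta> i) x\<bar> \<le> B"
      and x: "x \<in> (std_sx :: (real^'n) set)"
    have E0: "0 \<le> E" using E by (rule lat_bd_nonneg)
    have kj: "k + 1 - j = Suc (k + 1 - Suc j)" using step.hyps by simp
    obtain \<eta>0 :: "'n \<Rightarrow> nat" where "\<eta>0 \<in> multi_indices (k + 1 - j)" using multi_indices_nonempty by blast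
    from bspec[OF bspec[OF B this] x] have B0: "0 \<le> B" by (meson abs_ge_zero order_trans)
    have inc: "\<bar>G (inc \<gamma> i) z\<bar> \<le> C * (E + B)" if "z \<in> std_sx" for i z
    proof (rule C(2)[OF _ G E _ that])
      show "(\<Sum>l\<in>UNIV. inc \<gamma> i l) = Suc j" unfolding sum_inc g ..
      show "\<forall>\<eta>\<in>multi_indices (k + 1 - Suc j). \<forall>x\<in>std_sx. \<bar>G (\<lambda>l. inc \<gamma> i l + \<eta> l) x\<bar> \<le> B"
      proof
        fix \<eta> :: "'n \<Rightarrow> nat" assume "\<eta> \<in> multi_indices (k + 1 - Suc j)"
        then have "inc \<eta> i \<in> multi_indices (k + 1 - j)" 
          unfolding multi_indices_def mem_Collect_eq sum_inc kj by simp
        from bspec[OF B this] show "\<forall>x\<in>std_sx. \<bar>G (\<lambda>l. inc \<gamma> i l + \<eta> l) x\<bar> \<le> B"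
          unfolding inc_add .
      qed
    qed
    obtain w where w: "count_list w = \<gamma>" "length w = j" using exists_list[of \<gamma>] g by blast
    have len: "length w \<le> k" using w step.hyps by simp
    have lat: "\<bar>iter_avg (1 / real k) w (G \<gamma>) 0\<bar> \<le> (2 * real k) ^ j * E"
      using iter_avg_lattice_bound[OF G _ k w(1), where E=E and j=0 and x=0] E len zero_in_lat w(2) by auto
    have "\<bar>iter_avg (1 / real k) w (\<lambda>y. G \<gamma> y - G \<gamma> x) 0\<bar> \<le> real CARD('n) * (C * (E + B))"
    proof (rule abs_iter_avg_le_sup)
      show "continuous_on UNIV (\<lambda>y. G \<gamma> y - G \<gamma> x)"
        by (rule continuous_on_diff[OF jet_continuous[OF G] continuous_on_const])
      show "\<bar>G \<gamma> y - G \<gamma> x\<bar> \<le> real CARD('n) * (C * (E + B))" if "y \<in> std_sx" for y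
        by (rule jet_lipschitz[OF G x that]) (rule inc)
      show "real (length w) * (1 / real k) \<le> 1" using len k by simp
    qed simp
    moreover have "iter_avg (1 / real k) w (\<lambda>y. G \<gamma> y - G \<gamma> x) 0 = iter_avg (1 / real k) w (G \<gamma>) 0 - G \<gamma> x"
      by (subst iter_avg_diff) (auto simp: iter_avg_const jet_continuous[OF G])
    ultimately have "\<bar>G \<gamma> x\<bar> \<le> real CARD('n) * (C * (E + B)) + (2 * real k) ^ j * E"
      using lat by linarith
    also have "\<dots> \<le> A * (E + B)"
    proof -
      have "0 \<le> (2 * real k) ^ j * B" using B0 by simp
      then show ?thesis by (simp add: A_def algebra_simps)
    qed
    finally show "\<bar>G \<gamma> x\<bar> \<le> A * (E + B)" .
  qed
qed

section \<open>Bump functions and mollification\<close>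

text \<open>The derivative of \<open>P (1 / t) * exp (- 1 / t)\<close> is
  \<open>(1 / t)^2 * (P - P') (1 / t) * exp (- 1 / t)\<close>.\<close>

primrec flat_poly :: "nat \<Rightarrow> real poly" where
  "flat_poly 0 = 1"
| "flat_poly (Suc n) = [:0, 0, 1:] * (flat_poly n - pderiv (flat_poly n))"

text \<open>\<open>flat n\<close> is the \<open>n\<close>-th derivative of \<open>t \<mapsto> exp (-1 / t)\<close>, extended by \<open>0\<close> to \<open>t \<le> 0\<close>.\<close>

definition flat :: "nat \<Rightarrow> real \<Rightarrow> real" where
  "flat n t = (if t \<le> 0 then 0 else poly (flat_poly n) (1 / t) * exp (- (1 / t)))"

lemma poly_exp_tendsto_0: "((\<lambda>x::real. poly p x * exp (- x)) \<longlongrightarrow> 0) at_top"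
proof -
  have "((\<lambda>x. \<Sum>i\<le>degree p. coeff p i * (x ^ i / exp x)) \<longlongrightarrow> (\<Sum>i\<le>degree p. coeff p i * 0)) at_top"
    by (intro tendsto_intros tendsto_power_div_exp_0)
  moreover have "(\<Sum>i\<le>degree p. coeff p i * (x ^ i / exp x)) = poly p x * exp (- x)" for x
    by (simp add: poly_altdef sum_distrib_right exp_minus divide_inverse mult.assoc)
  ultimately show ?thesis by simp
qed

lemma flat_deriv: "(flat n has_real_derivative flat (Suc n) t) (at t)"
proof -
  consider "t < 0" | "0 < t" | "t = 0" by linarith
  then show ?thesis
  proof cases
    case 1
    have "(flat n has_real_derivative 0) (at t)"
      by (rule DERIV_cong[OF _ refl], rule has_field_derivative_transform_within_open[where f="\<lambda>_. 0" and S="{..<0}"])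
         (use 1 in \<open>auto simp: flat_def\<close>)
    then show ?thesis using 1 by (simp add: flat_def)
  next
    case 2
    have "((\<lambda>t. poly (flat_poly n) (1 / t) * exp (- (1 / t))) has_real_derivative flat (Suc n) t) (at t)"
      using 2 by (auto intro!: derivative_eq_intros simp: flat_def algebra_simps power2_eq_square divide_simps)
    then show ?thesis
      by (rule has_field_derivative_transform_within_open[where S="{0<..}"]) (use 2 in \<open>auto simp: flat_def\<close>)
  next
    case 3
    have "((\<lambda>h. (flat n h - flat n 0) / (h - 0)) \<longlongrightarrow> 0) (at 0)"
      proof (rule filterlim_split_at)
      have "eventually (\<lambda>h. 0 = (flat n h - flat n 0) / (h - 0)) (at_left (0::real))"
        by (auto simp: eventually_at_filter flat_def)
      then show "((\<lambda>h. (flat n h - flat n 0) / (h - 0)) \<longlongrightarrow> 0) (at_left 0)"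
        by (rule Lim_transform_eventually[rotated]) simp
      \<comment> \<open>From the right the difference quotient is again a polynomial in
        \<open>1 / h\<close> times \<open>exp (- 1 / h)\<close>; the factor \<open>[:0, 1:]\<close>
        is the division by \<open>h\<close>.\<close>
      have "((\<lambda>h. poly ([:0, 1:] * flat_poly n) (inverse h) * exp (- inverse h)) \<longlongrightarrow> 0) (at_right 0)"
        by (rule filterlim_compose[OF poly_exp_tendsto_0 filterlim_inverse_at_top_right])
      moreover have "eventually (\<lambda>h. poly ([:0, 1:] * flat_poly n) (inverse h) * exp (- inverse h) = (flat n h - flat n 0) / (h - 0)) (at_right (0::real))"
        by (auto simp: eventually_at_filter flat_def field_simps)
      ultimately show "((\<lambda>h. (flat n h - flat n 0) / (h - 0)) \<longlongrightarrow> 0) (at_right 0)"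
        by (rule Lim_transform_eventually)
    qed
    then show ?thesis using 3 by (simp add: has_field_derivative_iff flat_def)
  qed
qed

text \<open>By the Leibniz rule, the \<open>n\<close>-th derivative of \<open>flat 0 t * flat 0 (1 - t)\<close>.\<close>

definition bump1 :: "nat \<Rightarrow> real \<Rightarrow> real" where
  "bump1 n t = (\<Sum>i\<le>n. real (n choose i) * (flat i t * ((-1) ^ (n - i) * flat (n - i) (1 - t))))"

text \<open>Pascal's rule, in the form that differentiating a Leibniz sum requires: the two shifts
  of \<open>a\<close> recombine after reindexing.\<close>

lemma leibniz_sum:
  fixes a :: "nat \<Rightarrow> nat \<Rightarrow> real"
  shows "(\<Sum>i\<le>n. real (n choose i) * (a (Suc i) (n - i) + a i (Suc (n - i)))) = (\<Sum>i\<le>Suc n. real (Suc n choose i) * a i (Suc n - i))"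
proof -
  have "(\<Sum>i\<le>n. real (n choose i) * a i (Suc (n - i))) = (\<Sum>i\<le>n. real (n choose i) * a i (Suc n - i))"
    by (intro sum.cong) (auto simp: Suc_diff_le)
  also have "\<dots> = (\<Sum>i\<le>Suc n. real (n choose i) * a i (Suc n - i))"
    by (simp add: binomial_eq_0)
  also have "\<dots> = a 0 (Suc n) + (\<Sum>i\<le>n. real (n choose Suc i) * a (Suc i) (n - i))"
    by (subst sum.atMost_Suc_shift) simp
  finally have "(\<Sum>i\<le>n. real (n choose i) * (a (Suc i) (n - i) + a i (Suc (n - i))))
     = a 0 (Suc n) + (\<Sum>i\<le>n. (real (n choose i) + real (n choose Suc i)) * a (Suc i) (n - i))"
    by (simp add: distrib_left distrib_right sum.distrib)
  also have "\<dots> = (\<Sum>i\<le>Suc n. real (Suc n choose i) * a i (Suc n - i))"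
    by (subst sum.atMost_Suc_shift[of "\<lambda>i. real (Suc n choose i) * a i (Suc n - i)"]) (simp add: add.commute)
  finally show ?thesis .
qed

lemma bump1_deriv: "(bump1 n has_real_derivative bump1 (Suc n) t) (at t)"
proof -
  define a where "a i j = flat i t * ((-1) ^ j * flat j (1 - t))" for i j
  have "((\<lambda>t. flat i t * ((-1) ^ j * flat j (1 - t))) has_real_derivative a (Suc i) j + a i (Suc j)) (at t)" for i j
  proof -
    have "((\<lambda>t. flat j (1 - t)) has_real_derivative flat (Suc j) (1 - t) * (- 1)) (at t)"
      by (rule DERIV_chain2[OF flat_deriv]) (auto intro!: derivative_eq_intros)
    then show ?thesis
      by (auto intro!: derivative_eq_intros flat_deriv simp: a_def)
  qed
  then have "(bump1 n has_real_derivative (\<Sum>i\<le>n. real (n choose i) * (a (Suc i) (n - i) + a i (Suc (n - i))))) (at t)"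
    unfolding bump1_def by (intro DERIV_sum DERIV_cmult)
  then show ?thesis
    unfolding leibniz_sum by (simp only: bump1_def a_def)
qed

lemma bump1_outside: "t \<notin> {0..1} \<Longrightarrow> bump1 n t = 0"
  by (auto simp: bump1_def flat_def)

lemma bump1_0: "bump1 0 t = flat 0 t * flat 0 (1 - t)"
  by (simp add: bump1_def)

lemma bump1_0_nonneg: "0 \<le> bump1 0 t"
  by (simp add: bump1_0 flat_def)

lemma bump1_0_pos: "0 < t \<Longrightarrow> t < 1 \<Longrightarrow> 0 < bump1 0 t"
  by (simp add: bump1_0 flat_def)

text \<open>A tensor product keeps every partial derivative explicit, so the family over all
  \<open>\<nu>\<close> is its own jet. The support lies in the unit cube, which is why cubes inside
  the domain appear later.\<close>

definition bump :: "('n::finite \<Rightarrow> nat) \<Rightarrow> real^'n \<Rightarrow> real" where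
  "bump \<nu> x = (\<Prod>j\<in>UNIV. bump1 (\<nu> j) (x $ j))"

lemma jet_bump: "jet bump"
  unfolding jet_def
proof (intro allI)
  fix \<nu> :: "'a \<Rightarrow> nat" and x :: "real^'a"
  have "((\<lambda>x. bump1 (\<nu> j) (x $ j)) has_derivative (\<lambda>h. h $ j * bump1 (Suc (\<nu> j)) (x $ j))) (at x)" for j
  proof -
    have "((\<lambda>x. x $ j) has_derivative (\<lambda>h. h $ j)) (at x)"
      by (rule bounded_linear_imp_has_derivative[OF bounded_linear_vec_nth])
    from has_derivative_compose[OF this bump1_deriv[unfolded has_field_derivative_def]]
    show ?thesis by (simp add: mult.commute)
  qed
  then have "(bump \<nu> has_derivative (\<lambda>h. \<Sum>i\<in>UNIV. (h $ i * bump1 (Suc (\<nu> i)) (x $ i)) * (\<Prod>j\<in>UNIV - {i}. bump1 (\<nu> j) (x $ j)))) (at x)"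
    unfolding bump_def by (intro has_derivative_prod)
  moreover have "bump (inc \<nu> i) x = bump1 (Suc (\<nu> i)) (x $ i) * (\<Prod>j\<in>UNIV - {i}. bump1 (\<nu> j) (x $ j))" for i
  proof -
    have "bump (inc \<nu> i) x = bump1 (inc \<nu> i i) (x $ i) * (\<Prod>j\<in>UNIV - {i}. bump1 (inc \<nu> i j) (x $ j))"
      unfolding bump_def by (rule prod.remove) auto
    also have "(\<Prod>j\<in>UNIV - {i}. bump1 (inc \<nu> i j) (x $ j)) = (\<Prod>j\<in>UNIV - {i}. bump1 (\<nu> j) (x $ j))"
      by (intro prod.cong) auto
    finally show ?thesis by (simp only: fun_upd_same)
  qed
  ultimately show "(bump \<nu> has_derivative (\<lambda>h. \<Sum>i\<in>UNIV. h $ i * bump (inc \<nu> i) x)) (at x)"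
    by (simp add: mult.assoc)
qed

lemma bump_outside: "x \<notin> cbox 0 1 \<Longrightarrow> bump \<nu> x = 0"
proof -
  assume "x \<notin> cbox 0 1"
  then obtain j where "x $ j \<notin> {0..1}" by (auto simp: mem_box_cart)
  then have "bump1 (\<nu> j) (x $ j) = 0" by (rule bump1_outside)
  then show ?thesis unfolding bump_def by (intro prod_zero) auto
qed

lemma bump_bounded: "\<exists>B\<ge>0. \<forall>x. \<bar>bump \<nu> x\<bar> \<le> B"
proof -
  have "compact (bump \<nu> ` cbox 0 1)"
    by (intro compact_continuous_image jet_continuous jet_bump compact_cbox)
  then have "bounded (bump \<nu> ` cbox 0 1)" by (rule compact_imp_bounded)
  then obtain B where "\<forall>y\<in>bump \<nu> ` cbox 0 1. norm y \<le> B" unfolding bounded_iff by blast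
  then have B: "\<bar>bump \<nu> x\<bar> \<le> B" if "x \<in> cbox 0 1" for x using that by auto
  have "\<bar>bump \<nu> x\<bar> \<le> max B 0" for x
    by (cases "x \<in> cbox 0 1") (use B[of x] in \<open>auto simp: bump_outside\<close>)
  then show ?thesis by (intro exI[of _ "max B 0"]) auto
qed

lemma bump_nonneg: "0 \<le> bump zmi x"
  unfolding bump_def by (intro prod_nonneg) (simp add: bump1_0_nonneg)

lemma bump_measurable [measurable]: "bump \<nu> \<in> borel_measurable borel"
  by (rule jet_measurable[OF jet_bump])

lemma bump_integrable: "integrable lborel (bump \<nu> :: real^'n::finite \<Rightarrow> real)"
proof -
  have "integrable lborel (\<lambda>x::real^'n. indicator (cbox 0 1) x *\<^sub>R bump \<nu> x)"
    by (intro borel_integrable_compact compact_cbox jet_continuous jet_bump)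
  moreover have "(\<lambda>x::real^'n. indicator (cbox 0 1) x *\<^sub>R bump \<nu> x) = bump \<nu>"
    by (auto simp: fun_eq_iff indicator_def bump_outside)
  ultimately show ?thesis by simp
qed

lemma bump_integral_pos: "0 < (\<integral>x. bump zmi (x :: real^'n::finite) \<partial>lborel)"
proof -
  have "(\<integral>x. bump zmi (x :: real^'n) \<partial>lborel) \<noteq> 0"
  proof
    assume "(\<integral>x. bump zmi (x :: real^'n) \<partial>lborel) = 0"
    then have "AE x in lborel. bump zmi (x :: real^'n) = 0"
      by (subst (asm) integral_nonneg_eq_0_iff_AE) (auto simp: bump_integrable bump_nonneg)
    then have "AE x in lborel. x \<notin> (box 0 1 :: (real^'n) set)"
    proof eventually_elim
      fix x :: "real^'n" assume z: "bump zmi x = 0"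
      show "x \<notin> box 0 1"
      proof
        assume "x \<in> box 0 1"
        then have "0 < bump zmi x"
          unfolding bump_def by (intro prod_pos bump1_0_pos) (auto simp: mem_box_cart)
        with z show False by simp
      qed
    qed
    then have "(box 0 1 :: (real^'n) set) \<in> null_sets lborel"
      by (subst (asm) AE_iff_null_sets[symmetric]) auto
    then have "negligible (box 0 1 :: (real^'n) set)"
      by (simp add: negligible_iff_null_sets null_sets_completionI)
    moreover have "(\<chi> i. 1 / 2) \<in> (box 0 1 :: (real^'n) set)" by (simp add: mem_box_cart)
    ultimately show False using open_not_negligible[OF open_box] by blast
  qed
  moreover have "0 \<le> (\<integral>x. bump zmi (x :: real^'n) \<partial>lborel)"
    by (intro integral_nonneg_AE) (simp add: bump_nonneg)
  ultimately show ?thesis by simp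
qed

section \<open>Differentiation under the integral sign\<close>

lemma jet_taylor2:
  fixes G :: "('n \<Rightarrow> nat) \<Rightarrow> real^'n::finite \<Rightarrow> real"
  assumes G: "jet G" and B: "\<And>i j x. \<bar>G (inc (inc \<gamma> i) j) x\<bar> \<le> B"
  shows "\<bar>G \<gamma> (z + k) - G \<gamma> z - (\<Sum>i\<in>UNIV. k $ i * G (inc \<gamma> i) z)\<bar> \<le> (real CARD('n))\<^sup>2 * B * (norm k)\<^sup>2"
proof -
  have B0: "0 \<le> B" using B[of undefined undefined 0] by linarith
  let ?d = "real CARD('n)"
  have line: "\<exists>t. 0 < t \<and> t < s \<and> G \<delta> (z + s *\<^sub>R k) - G \<delta> z = s * (\<Sum>i\<in>UNIV. k $ i * G (inc \<delta> i) (z + t *\<^sub>R k))" if "0 < s" for s \<delta>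
    using MVT2[of 0 s "\<lambda>t. G \<delta> (z + t *\<^sub>R k)" "\<lambda>t. \<Sum>i\<in>UNIV. k $ i * G (inc \<delta> i) (z + t *\<^sub>R k)"]
      jet_line_deriv[OF G] that by auto
  obtain t where t: "0 < t" "t < 1" "G \<gamma> (z + k) - G \<gamma> z = (\<Sum>i\<in>UNIV. k $ i * G (inc \<gamma> i) (z + t *\<^sub>R k))"
    using line[of 1 \<gamma>] by auto
  have kB: "\<bar>k $ j * G (inc (inc \<gamma> i) j) w\<bar> \<le> norm k * B" for i j w
    unfolding abs_mult by (rule mult_mono[OF component_le_norm_cart B]) simp_all
  have second: "\<bar>G (inc \<gamma> i) (z + t *\<^sub>R k) - G (inc \<gamma> i) z\<bar> \<le> ?d * (norm k * B)" for i
  proof -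
    obtain u where "G (inc \<gamma> i) (z + t *\<^sub>R k) - G (inc \<gamma> i) z = t * (\<Sum>j\<in>UNIV. k $ j * G (inc (inc \<gamma> i) j) (z + u *\<^sub>R k))"
      using line[OF t(1), of "inc \<gamma> i"] by blast
    then have "\<bar>G (inc \<gamma> i) (z + t *\<^sub>R k) - G (inc \<gamma> i) z\<bar> = t * \<bar>\<Sum>j\<in>UNIV. k $ j * G (inc (inc \<gamma> i) j) (z + u *\<^sub>R k)\<bar>"
      using t by (simp add: abs_mult)
    also have "\<dots> \<le> 1 * (\<Sum>j\<in>(UNIV::'n set). norm k * B)"
      by (intro mult_mono order_trans[OF sum_abs] sum_mono kB) (use t in simp_all)
    finally show ?thesis by simp
  qed
  have "G \<gamma> (z + k) - G \<gamma> z - (\<Sum>i\<in>UNIV. k $ i * G (inc \<gamma> i) z) = (\<Sum>i\<in>UNIV. k $ i * (G (inc \<gamma> i) (z + t *\<^sub>R k) - G (inc \<gamma> i) z))"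
    by (simp add: t(3) right_diff_distrib sum_subtractf)
  then have eq: "G \<gamma> (z + k) - G \<gamma> z - (\<Sum>i\<in>UNIV. k $ i * G (inc \<gamma> i) z) = (\<Sum>i\<in>UNIV. k $ i * (G (inc \<gamma> i) (z + t *\<^sub>R k) - G (inc \<gamma> i) z))" .
  have "\<bar>\<Sum>i\<in>UNIV. k $ i * (G (inc \<gamma> i) (z + t *\<^sub>R k) - G (inc \<gamma> i) z)\<bar> \<le> (\<Sum>i\<in>(UNIV::'n set). norm k * (?d * (norm k * B)))"
  proof (rule order_trans[OF sum_abs], rule sum_mono)
    fix i :: 'n
    show "\<bar>k $ i * (G (inc \<gamma> i) (z + t *\<^sub>R k) - G (inc \<gamma> i) z)\<bar> \<le> norm k * (?d * (norm k * B))"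
      unfolding abs_mult by (rule mult_mono[OF component_le_norm_cart second]) simp_all
  qed
  also have "\<dots> = ?d\<^sup>2 * B * (norm k)\<^sup>2" by (simp add: power2_eq_square mult_ac)
  finally show ?thesis unfolding eq .
qed

text \<open>Unlike in a convolution, the coefficients of \<open>x\<close> and \<open>y\<close> in
  the kernel differ: \<open>s\<close> is the scale of the kernel, and \<open>r\<close> is that scale
  times the contraction ratio in \<open>x\<close>.\<close>

definition mol :: "(real^'n::finite \<Rightarrow> real) \<Rightarrow> real \<Rightarrow> real \<Rightarrow> real^'n \<Rightarrow> ('n \<Rightarrow> nat) \<Rightarrow> real^'n \<Rightarrow> real" where
  "mol v s r c \<nu> x = (\<integral>y. v y * bump \<nu> (c + s *\<^sub>R y - r *\<^sub>R x) \<partial>lborel)"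

lemma mol_integrable:
  assumes "integrable lborel v"
  shows "integrable lborel (\<lambda>y. v y * bump \<nu> (c + s *\<^sub>R y - r *\<^sub>R x))"
proof -
  obtain B where B: "0 \<le> B" "\<And>x. \<bar>bump \<nu> (x :: real^'a)\<bar> \<le> B" using bump_bounded[of \<nu>] by blast
  have [measurable]: "v \<in> borel_measurable borel" using assms by simp
  show ?thesis
  proof (rule Bochner_Integration.integrable_bound)
    show "integrable lborel (\<lambda>y. B * v y)" using assms by simp
    show "AE y in lborel. norm (v y * bump \<nu> (c + s *\<^sub>R y - r *\<^sub>R x)) \<le> norm (B * v y)"
      using B by (auto simp: abs_mult mult.commute[of B] intro!: mult_left_mono AE_I2)
  qed measurable
qed

text \<open>All derivatives of the bump are bounded, so its second-order Taylor remainder is uniform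
  in the position. Integrated against \<open>v\<close> it stays quadratic in the increment, which
  gives differentiability for a merely integrable \<open>v\<close>.\<close>

lemma mol_has_derivative:
  fixes v :: "real^'n::finite \<Rightarrow> real"
  assumes v: "integrable lborel v"
  shows "(mol v s r c \<nu> has_derivative (\<lambda>h. \<Sum>i\<in>UNIV. h $ i * (- r * mol v s r c (inc \<nu> i) x))) (at x)"
proof -
  have "\<forall>i j. \<exists>B. \<forall>x. \<bar>bump (inc (inc \<nu> i) j) (x :: real^'n)\<bar> \<le> B"
    using bump_bounded by blast
  then obtain BB where BB: "\<And>i j x. \<bar>bump (inc (inc \<nu> i) j) (x :: real^'n)\<bar> \<le> BB i j" by metis
  define B where "B = (\<Sum>i\<in>UNIV. \<Sum>j\<in>UNIV. BB i j)"
  have BB0: "0 \<le> BB i j" for i j using BB[of i j 0] by linarith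
  have B: "\<bar>bump (inc (inc \<nu> i) j) (x :: real^'n)\<bar> \<le> B" for i j x
  proof -
    have "BB i j \<le> (\<Sum>j\<in>UNIV. BB i j)" by (rule member_le_sum) (auto simp: BB0)
    also have "\<dots> \<le> B" unfolding B_def by (rule member_le_sum) (auto intro!: sum_nonneg BB0)
    finally show ?thesis using BB[of i j x] by linarith
  qed
  have B0: "0 \<le> B" unfolding B_def by (intro sum_nonneg BB0)
  let ?C = "(real CARD('n))\<^sup>2 * B * r\<^sup>2"
  let ?z = "\<lambda>y. c + s *\<^sub>R y - r *\<^sub>R x"
  have est: "\<bar>mol v s r c \<nu> y - mol v s r c \<nu> x - (\<Sum>i\<in>UNIV. (y - x) $ i * (- r * mol v s r c (inc \<nu> i) x))\<bar>
     \<le> (\<integral>y. \<bar>v y\<bar> \<partial>lborel) * ?C * (norm (y - x))\<^sup>2" for y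
  proof -
    let ?k = "- r *\<^sub>R (y - x)"
    let ?D = "\<lambda>w. bump \<nu> (?z w + ?k) - bump \<nu> (?z w) - (\<Sum>i\<in>UNIV. ?k $ i * bump (inc \<nu> i) (?z w))"
    have zk: "c + s *\<^sub>R w - r *\<^sub>R y = ?z w + ?k" for w by (simp add: algebra_simps)
    have i: "integrable lborel (\<lambda>w. v w * bump \<nu> (?z w + ?k))" "integrable lborel (\<lambda>w. v w * bump \<delta> (?z w))" for \<delta>
      using mol_integrable[OF v, of \<nu> c s r y] mol_integrable[OF v] unfolding zk by auto
    have "mol v s r c \<nu> y - mol v s r c \<nu> x - (\<Sum>i\<in>UNIV. (y - x) $ i * (- r * mol v s r c (inc \<nu> i) x))
      = (\<integral>w. v w * bump \<nu> (?z w + ?k) \<partial>lborel) - (\<integral>w. v w * bump \<nu> (?z w) \<partial>lborel)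
        - (\<Sum>i\<in>UNIV. (\<integral>w. ?k $ i * (v w * bump (inc \<nu> i) (?z w)) \<partial>lborel))"
    proof -
      have "(\<integral>w. ?k $ i * (v w * bump (inc \<nu> i) (?z w)) \<partial>lborel) = (y - x) $ i * (- r * mol v s r c (inc \<nu> i) x)" for i
        unfolding mol_def integral_mult_right_zero vector_scaleR_component real_scaleR_def by (simp only: mult_ac)
      then show ?thesis unfolding mol_def zk by (simp only:)
    qed
    also have "\<dots> = (\<integral>w. v w * bump \<nu> (?z w + ?k) - v w * bump \<nu> (?z w) - (\<Sum>i\<in>UNIV. ?k $ i * (v w * bump (inc \<nu> i) (?z w))) \<partial>lborel)"
      using i by (simp add: Bochner_Integration.integral_sum Bochner_Integration.integral_diff Bochner_Integration.integrable_sum)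
    also have "\<dots> = (\<integral>w. v w * ?D w \<partial>lborel)"
      by (intro Bochner_Integration.integral_cong) (auto simp: right_diff_distrib sum_distrib_left mult_ac)
    finally have eq: "mol v s r c \<nu> y - mol v s r c \<nu> x - (\<Sum>i\<in>UNIV. (y - x) $ i * (- r * mol v s r c (inc \<nu> i) x)) = (\<integral>w. v w * ?D w \<partial>lborel)" .
    have "\<bar>\<integral>w. v w * ?D w \<partial>lborel\<bar> \<le> (\<integral>w. \<bar>v w\<bar> * (?C * (norm (y - x))\<^sup>2) \<partial>lborel)"
    proof (rule integral_abs_bound_integral)
      have "integrable lborel (\<lambda>w. v w * bump \<nu> (?z w + ?k) - v w * bump \<nu> (?z w) - (\<Sum>i\<in>UNIV. ?k $ i * (v w * bump (inc \<nu> i) (?z w))))"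
        using i by (intro Bochner_Integration.integrable_diff Bochner_Integration.integrable_sum) auto
      moreover have "(\<lambda>w. v w * bump \<nu> (?z w + ?k) - v w * bump \<nu> (?z w) - (\<Sum>i\<in>UNIV. ?k $ i * (v w * bump (inc \<nu> i) (?z w)))) = (\<lambda>w. v w * ?D w)"
        by (auto simp: fun_eq_iff right_diff_distrib sum_distrib_left mult_ac)
      ultimately show "integrable lborel (\<lambda>w. v w * ?D w)" by (simp only:)
      show "integrable lborel (\<lambda>w. \<bar>v w\<bar> * (?C * (norm (y - x))\<^sup>2))" using v by simp
      fix w
      have "\<bar>?D w\<bar> \<le> (real CARD('n))\<^sup>2 * B * (norm ?k)\<^sup>2"
        by (rule jet_taylor2[OF jet_bump B])
      also have "\<dots> = ?C * (norm (y - x))\<^sup>2" by (simp add: power_mult_distrib)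
      finally show "\<bar>v w * ?D w\<bar> \<le> \<bar>v w\<bar> * (?C * (norm (y - x))\<^sup>2)"
        by (simp add: abs_mult mult_left_mono)
    qed
    also have "\<dots> = (\<integral>y. \<bar>v y\<bar> \<partial>lborel) * ?C * (norm (y - x))\<^sup>2" by simp
    finally show ?thesis unfolding eq .
  qed
  show ?thesis
  proof (rule has_derivativeI_sandwich[where e=1])
    show "bounded_linear (\<lambda>h. \<Sum>i\<in>UNIV. h $ i * (- r * mol v s r c (inc \<nu> i) x))"
      by (intro bounded_linear_sum bounded_linear_compose[OF bounded_linear_mult_left] bounded_linear_vec_nth)
    let ?V = "(\<integral>y. \<bar>v y\<bar> \<partial>lborel) * ?C"
    show "norm (mol v s r c \<nu> y - mol v s r c \<nu> x - (\<Sum>i\<in>UNIV. (y - x) $ i * (- r * mol v s r c (inc \<nu> i) x))) / norm (y - x) \<le> ?V * norm (y - x)"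
      if "y \<noteq> x" for y
      using est[of y] that by (simp add: divide_le_eq power2_eq_square mult.assoc)
    have "((\<lambda>y. ?V * norm (y - x)) \<longlongrightarrow> ?V * norm (x - x)) (at x)"
      by (intro tendsto_intros)
    then show "((\<lambda>y. ?V * norm (y - x)) \<longlongrightarrow> 0) (at x)" by simp
  qed simp
qed

lemma jet_mol:
  assumes "integrable lborel v"
  shows "jet (\<lambda>\<nu> x. \<kappa> * (- r) ^ (\<Sum>i\<in>UNIV. \<nu> i) * mol v s r c \<nu> x)"
  unfolding jet_def
proof (intro allI)
  fix \<nu> :: "'a \<Rightarrow> nat" and x :: "real^'a"
  let ?a = "\<kappa> * (- r) ^ (\<Sum>i\<in>UNIV. \<nu> i)"
  have "((\<lambda>x. ?a * mol v s r c \<nu> x) has_derivative (\<lambda>h. ?a * (\<Sum>i\<in>UNIV. h $ i * (- r * mol v s r c (inc \<nu> i) x)))) (at x)"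
    by (intro has_derivative_mult_right mol_has_derivative assms)
  moreover have "?a * (\<Sum>i\<in>UNIV. h $ i * (- r * mol v s r c (inc \<nu> i) x))
     = (\<Sum>i\<in>UNIV. h $ i * (\<kappa> * (- r) ^ (\<Sum>l\<in>UNIV. inc \<nu> i l) * mol v s r c (inc \<nu> i) x))" for h
    unfolding sum_inc by (simp add: sum_distrib_left mult_ac)
  ultimately show "((\<lambda>x. ?a * mol v s r c \<nu> x) has_derivative
     (\<lambda>h. \<Sum>i\<in>UNIV. h $ i * (\<kappa> * (- r) ^ (\<Sum>l\<in>UNIV. inc \<nu> i l) * mol v s r c (inc \<nu> i) x))) (at x)"
    by (simp only:)
qed

section \<open>Jets and iterated partial derivatives\<close>

lemma jet_partial:
  assumes "jet G"
  shows "partial i (G \<gamma>) = G (inc \<gamma> i)"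
proof
  fix x
  have "frechet_derivative (G \<gamma>) (at x) = (\<lambda>h. \<Sum>j\<in>UNIV. h $ j * G (inc \<gamma> j) x)"
    by (rule frechet_derivative_at[OF jetD[OF assms], symmetric])
  then show "partial i (G \<gamma>) x = G (inc \<gamma> i) x"
    unfolding partial_def by (simp add: sum_axis)
qed

lemma jet_smooth:
  assumes "jet G"
  shows "smooth (G \<gamma>)"
proof -
  have ex: "\<exists>\<delta>. foldr partial is (G \<gamma>) = G \<delta>" for "is"
    by (induction "is") (auto simp: jet_partial[OF assms])
  have "G \<delta> differentiable_on UNIV" for \<delta>
    unfolding differentiable_on_def differentiable_def using jetD[OF assms] by blast
  then show ?thesis
    unfolding smooth_def using ex by metis
qed

lemma jet_partial_pow:
  assumes "jet G"
  shows "(partial i ^^ n) (G \<gamma>) = G (\<gamma>(i := \<gamma> i + n))"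
proof (induction n)
  case (Suc n)
  have "(partial i ^^ Suc n) (G \<gamma>) = partial i (G (\<gamma>(i := \<gamma> i + n)))" using Suc by (simp only: funpow.simps comp_apply)
  also have "\<dots> = G (inc (\<gamma>(i := \<gamma> i + n)) i)" by (rule jet_partial[OF assms])
  also have "inc (\<gamma>(i := \<gamma> i + n)) i = \<gamma>(i := \<gamma> i + Suc n)" by auto
  finally show ?case .
qed simp

text \<open>Each coordinate occurs exactly once in the sorted list, so the fold raises the
  corresponding entry of the index from 0 to its value in \<open>\<gamma>\<close>.\<close>

lemma jet_mpartial:
  fixes G :: "('n::{finite,linorder} \<Rightarrow> nat) \<Rightarrow> real^'n::{finite,linorder} \<Rightarrow> real"
  assumes "jet G"
  shows "mpartial \<gamma> (G zmi) = G \<gamma>"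
proof -
  have "foldr (\<lambda>i. partial i ^^ \<gamma> i) l (G zmi) = G (\<lambda>j. if j \<in> set l then \<gamma> j else 0)" if "distinct l" for l
    using that
  proof (induction l)
    case (Cons a l)
    then have "foldr (\<lambda>i. partial i ^^ \<gamma> i) (a # l) (G zmi) = G ((\<lambda>j. if j \<in> set l then \<gamma> j else 0)(a := 0 + \<gamma> a))"
      using jet_partial_pow[OF assms, where i=a and n="\<gamma> a" and \<gamma>="\<lambda>j. if j \<in> set l then \<gamma> j else 0"] by simp
    also have "(\<lambda>j. if j \<in> set l then \<gamma> j else 0)(a := 0 + \<gamma> a) = (\<lambda>j. if j \<in> set (a # l) then \<gamma> j else 0)"
      by auto
    finally show ?case .
  qed simp
  from this[of "sorted_list_of_set UNIV"] show ?thesis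
    by (simp add: mpartial_def)
qed

lemma jet_affine:
  assumes "jet G"
  shows "jet (\<lambda>\<gamma> y. s ^ (\<Sum>i\<in>UNIV. \<gamma> i) * G \<gamma> (c + s *\<^sub>R y))"
  unfolding jet_def
proof (intro allI)
  fix \<gamma> and x :: "real^'a"
  have "((\<lambda>y. c + s *\<^sub>R y) has_derivative (\<lambda>h. s *\<^sub>R h)) (at x)"
    by (auto intro!: derivative_eq_intros)
  from has_derivative_compose[OF this jetD[OF assms, of \<gamma> "c + s *\<^sub>R x" UNIV]]
  have "((\<lambda>y. s ^ (\<Sum>i\<in>UNIV. \<gamma> i) * G \<gamma> (c + s *\<^sub>R y)) has_derivative
     (\<lambda>h. s ^ (\<Sum>i\<in>UNIV. \<gamma> i) * (\<Sum>i\<in>UNIV. (s *\<^sub>R h) $ i * G (inc \<gamma> i) (c + s *\<^sub>R x)))) (at x)"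
    by (rule has_derivative_mult_right)
  moreover have "s ^ (\<Sum>i\<in>UNIV. \<gamma> i) * (\<Sum>i\<in>UNIV. (s *\<^sub>R h) $ i * G (inc \<gamma> i) (c + s *\<^sub>R x))
     = (\<Sum>i\<in>UNIV. h $ i * (s ^ (\<Sum>l\<in>UNIV. inc \<gamma> i l) * G (inc \<gamma> i) (c + s *\<^sub>R x)))" for h
    unfolding sum_inc by (simp add: sum_distrib_left mult_ac)
  ultimately show "((\<lambda>y. s ^ (\<Sum>i\<in>UNIV. \<gamma> i) * G \<gamma> (c + s *\<^sub>R y)) has_derivative
     (\<lambda>h. \<Sum>i\<in>UNIV. h $ i * (s ^ (\<Sum>l\<in>UNIV. inc \<gamma> i l) * G (inc \<gamma> i) (c + s *\<^sub>R x)))) (at x)"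
    by (simp only:)
qed

section \<open>Averages over contractions\<close>

definition bump_int :: "'n::finite itself \<Rightarrow> real" where
  "bump_int _ = (\<integral>x. bump zmi (x :: real^'n) \<partial>lborel)"

lemma bump_int_pos: "0 < bump_int TYPE('n::finite)"
  unfolding bump_int_def by (rule bump_integral_pos)

text \<open>Normalised to a probability measure so that Jensen's inequality applies to
  averages.\<close>

definition bump_measure :: "(real^'n::finite) measure" where
  "bump_measure = density lborel (\<lambda>z. ennreal (bump zmi z / bump_int TYPE('n)))"

lemma sets_bump_measure [measurable_cong, simp]: "sets bump_measure = sets borel"
  by (simp add: bump_measure_def)

lemma space_bump_measure [simp]: "space bump_measure = UNIV"
  by (simp add: bump_measure_def)

lemma prob_space_bump_measure: "prob_space (bump_measure :: (real^'n::finite) measure)"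
proof
  have "emeasure (bump_measure :: (real^'n) measure) UNIV = (\<integral>\<^sup>+z. ennreal (bump zmi (z::real^'n) / bump_int TYPE('n)) \<partial>lborel)"
    unfolding bump_measure_def by (subst emeasure_density) auto
  also have "\<dots> = ennreal (\<integral>z. bump zmi (z::real^'n) / bump_int TYPE('n) \<partial>lborel)"
    using bump_int_pos[where 'n='n]
    by (intro nn_integral_eq_integral) (auto simp: bump_integrable bump_nonneg)
  also have "\<dots> = 1" using bump_int_pos[where 'n='n] by (simp add: bump_int_def)
  finally show "emeasure (bump_measure :: (real^'n) measure) (space bump_measure) = 1" by simp
qed

interpretation bump_prob: prob_space "bump_measure :: (real^'n::finite) measure"
  by (rule prob_space_bump_measure)

lemma AE_bump_measureI:
  assumes "AE z in lborel. P z"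
  shows "AE z in (bump_measure :: (real^'n::finite) measure). P z"
  using assms unfolding bump_measure_def by (subst AE_density) (auto elim: eventually_mono)

lemma AE_bump_measure_cbox: "AE z in bump_measure. z \<in> cbox 0 (1 :: real^'n::finite)"
proof -
  have "AE z in lborel. 0 < ennreal (bump zmi (z :: real^'n) / bump_int TYPE('n)) \<longrightarrow> z \<in> cbox 0 1"
  proof (rule AE_I2, rule impI, rule ccontr)
    fix z :: "real^'n" assume "0 < ennreal (bump zmi z / bump_int TYPE('n))" "z \<notin> cbox 0 1"
    then show False by (simp add: bump_outside)
  qed
  then show ?thesis unfolding bump_measure_def by (subst AE_density) auto
qed

lemma integral_bump_measure:
  fixes f :: "real^'n::finite \<Rightarrow> real"
  assumes "f \<in> borel_measurable borel"
  shows "(\<integral>z. f z \<partial>bump_measure) = (\<integral>z. f z * bump zmi z \<partial>lborel) / bump_int TYPE('n)"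
  unfolding bump_measure_def
  using assms bump_int_pos[where 'n='n]
  by (subst integral_density) (auto simp: bump_nonneg mult.commute)

lemma integral_affine:
  fixes f :: "'a::euclidean_space \<Rightarrow> real" and c :: real
  assumes [measurable]: "f \<in> borel_measurable borel" and c: "c \<noteq> 0"
  shows "(\<integral>x. f x \<partial>lborel) = \<bar>c\<bar> ^ DIM('a) * (\<integral>x. f (a + c *\<^sub>R x) \<partial>lborel)"
  by (subst lborel_affine[OF c, of a]) (simp add: integral_density integral_distr)

lemma integrable_affine:
  fixes f :: "'a::euclidean_space \<Rightarrow> real" and c :: real
  assumes f: "integrable lborel f" and c: "c \<noteq> 0"
  shows "integrable lborel (\<lambda>x. f (a + c *\<^sub>R x))"
proof -
  have [measurable]: "f \<in> borel_measurable borel" using f by simp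
  have "(\<integral>\<^sup>+x. ennreal (norm (f (a + c *\<^sub>R x))) \<partial>lborel) = ennreal (1 / \<bar>c\<bar> ^ DIM('a)) * (\<integral>\<^sup>+x. ennreal (norm (f x)) \<partial>lborel)"
    by (rule nn_integral_affine[OF _ c, of "\<lambda>x. ennreal (norm (f x))"]) measurable
  also have "\<dots> < \<infinity>" using f by (auto simp: integrable_iff_bounded ennreal_mult_less_top)
  finally show ?thesis by (simp add: integrable_iff_bounded)
qed

lemma integrable_bump_measure:
  fixes f :: "real^'n::finite \<Rightarrow> real"
  assumes f: "integrable lborel f"
  shows "integrable bump_measure f"
proof -
  obtain B where B: "0 \<le> B" "\<And>x. \<bar>bump zmi (x :: real^'n)\<bar> \<le> B" using bump_bounded[of zmi] by blast
  have [measurable]: "f \<in> borel_measurable borel" using f by simp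
  have "integrable lborel (\<lambda>z. (bump zmi z / bump_int TYPE('n)) * f z)"
  proof (rule Bochner_Integration.integrable_bound)
    show "integrable lborel (\<lambda>z. (B / bump_int TYPE('n)) * f z)" using f by simp
    show "AE z in lborel. norm ((bump zmi z / bump_int TYPE('n)) * f z) \<le> norm ((B / bump_int TYPE('n)) * f z)"
    proof (rule AE_I2)
      fix z :: "real^'n"
      show "norm ((bump zmi z / bump_int TYPE('n)) * f z) \<le> norm ((B / bump_int TYPE('n)) * f z)"
        unfolding norm_mult using B(2)[of z] B(1) bump_int_pos[where 'n='n]
        by (intro mult_right_mono) (auto simp: divide_right_mono)
    qed
  qed measurable
  then show ?thesis
    unfolding bump_measure_def using bump_int_pos[where 'n='n]
    by (subst integrable_density) (auto simp: bump_nonneg)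
qed

text \<open>For fixed \<open>z\<close> this contracts in \<open>x\<close> with ratio
  \<open>1 - \<epsilon>\<close> towards an interior point; for fixed \<open>x\<close> it dilates in
  \<open>z\<close> with ratio \<open>\<epsilon> * r\<close>. The first reading gives integral bounds
  that are uniform in \<open>\<epsilon>\<close>, the second makes averages smooth.\<close>

definition ymap :: "real \<Rightarrow> real^'n::finite \<Rightarrow> real \<Rightarrow> real^'n \<Rightarrow> real^'n \<Rightarrow> real^'n" where
  "ymap \<epsilon> q r x z = (1 - \<epsilon>) *\<^sub>R x + \<epsilon> *\<^sub>R (q + r *\<^sub>R z)"

lemma ymap_measurable [measurable (raw)]:
  assumes [measurable]: "f \<in> borel_measurable M" "g \<in> borel_measurable M"
  shows "(\<lambda>x. ymap \<epsilon> q r (f x) (g x)) \<in> borel_measurable M"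
  unfolding ymap_def by measurable

lemma ymap_z: "ymap \<epsilon> q r x z = ((1 - \<epsilon>) *\<^sub>R x + \<epsilon> *\<^sub>R q) + (\<epsilon> * r) *\<^sub>R z"
  by (simp add: ymap_def algebra_simps)

lemma ymap_x: "ymap \<epsilon> q r x z = \<epsilon> *\<^sub>R (q + r *\<^sub>R z) + (1 - \<epsilon>) *\<^sub>R x"
  by (simp add: ymap_def)

lemma ymap_in:
  assumes "convex U" "open U" "x \<in> closure U" "q + r *\<^sub>R z \<in> U" "0 < \<epsilon>" "\<epsilon> \<le> 1"
  shows "ymap \<epsilon> q r x z \<in> U"
proof -
  have "x - \<epsilon> *\<^sub>R (x - (q + r *\<^sub>R z)) \<in> interior U"
    using assms by (intro mem_interior_closure_convex_shrink) (auto simp: interior_open)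
  then show ?thesis using assms(2) by (simp add: interior_open ymap_def algebra_simps)
qed

definition contr_avg :: "real \<Rightarrow> real^'n::finite \<Rightarrow> real \<Rightarrow> (real^'n \<Rightarrow> real) \<Rightarrow> real^'n \<Rightarrow> real" where
  "contr_avg \<epsilon> q r g x = (\<integral>z. g (ymap \<epsilon> q r x z) \<partial>bump_measure)"

lemma contr_avg_integrable:
  fixes g :: "real^'n::finite \<Rightarrow> real"
  assumes "integrable lborel g" "0 < \<epsilon>" "0 < r"
  shows "integrable bump_measure (\<lambda>z. g (ymap \<epsilon> q r x z))"
  unfolding ymap_z using assms by (intro integrable_bump_measure integrable_affine) auto

text \<open>Fubini's theorem and, for fixed \<open>z\<close>, the substitution in \<open>x\<close>,
  whose Jacobian is at most \<open>2 ^ CARD('n)\<close> for \<open>\<epsilon> \<le> 1 / 2\<close>.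
  The bound does not deteriorate as \<open>\<epsilon>\<close> tends to 0.\<close>

lemma nn_contr_avg_le:
  fixes h :: "real^'n::finite \<Rightarrow> ennreal"
  assumes [measurable]: "h \<in> borel_measurable borel" and \<epsilon>: "0 < \<epsilon>" "\<epsilon> \<le> 1 / 2"
  shows "(\<integral>\<^sup>+x. (\<integral>\<^sup>+z. h (ymap \<epsilon> q r x z) \<partial>bump_measure) \<partial>lborel) \<le> ennreal (2 ^ CARD('n)) * (\<integral>\<^sup>+x. h x \<partial>lborel)"
proof -
  interpret pair_sigma_finite "lborel :: (real^'n) measure" "bump_measure :: (real^'n) measure"
    by standard
  have "(\<integral>\<^sup>+x. (\<integral>\<^sup>+z. h (ymap \<epsilon> q r x z) \<partial>bump_measure) \<partial>lborel) = (\<integral>\<^sup>+z. (\<integral>\<^sup>+x. h (ymap \<epsilon> q r x z) \<partial>lborel) \<partial>bump_measure)"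
    by (rule Fubini'[symmetric]) measurable
  also have "\<dots> \<le> (\<integral>\<^sup>+z. ennreal (2 ^ CARD('n)) * (\<integral>\<^sup>+x. h x \<partial>lborel) \<partial>(bump_measure :: (real^'n) measure))"
    unfolding ymap_x using \<epsilon> nn_integral_affine_le[OF assms(1), of "1 - \<epsilon>"]
    by (intro nn_integral_mono) simp
  also have "\<dots> = ennreal (2 ^ CARD('n)) * (\<integral>\<^sup>+x. h x \<partial>lborel)"
    using bump_prob.emeasure_space_1[where 'n='n] by simp
  finally show ?thesis .
qed

lemma contr_avg_powr_le:
  fixes g :: "real^'n::finite \<Rightarrow> real"
  assumes g: "integrable lborel g" and \<epsilon>: "0 < \<epsilon>" "\<epsilon> \<le> 1 / 2" and r: "0 < r" and p: "1 \<le> p"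
  shows "(\<integral>\<^sup>+x. ennreal (\<bar>contr_avg \<epsilon> q r g x\<bar> powr p) \<partial>lborel) \<le> ennreal (2 ^ CARD('n)) * (\<integral>\<^sup>+x. ennreal (\<bar>g x\<bar> powr p) \<partial>lborel)"
proof -
  have [measurable]: "g \<in> borel_measurable borel" using g by simp
  have "ennreal (\<bar>contr_avg \<epsilon> q r g x\<bar> powr p) \<le> (\<integral>\<^sup>+z. ennreal (\<bar>g (ymap \<epsilon> q r x z)\<bar> powr p) \<partial>bump_measure)" for x
  proof -
    have i: "integrable bump_measure (\<lambda>z. \<bar>g (ymap \<epsilon> q r x z)\<bar>)"
      using contr_avg_integrable[OF g \<epsilon>(1) r] by simp
    have "\<bar>contr_avg \<epsilon> q r g x\<bar> \<le> (\<integral>z. \<bar>g (ymap \<epsilon> q r x z)\<bar> \<partial>bump_measure)"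
      unfolding contr_avg_def by (rule integral_abs_bound)
    then have "ennreal (\<bar>contr_avg \<epsilon> q r g x\<bar> powr p) \<le> ennreal ((\<integral>z. \<bar>g (ymap \<epsilon> q r x z)\<bar> \<partial>bump_measure) powr p)"
      using p by (intro ennreal_leI powr_mono2) auto
    also have "\<dots> \<le> (\<integral>\<^sup>+z. ennreal (\<bar>g (ymap \<epsilon> q r x z)\<bar> powr p) \<partial>bump_measure)"
      by (rule jensen_powr_nn[OF _ i _ p]) (use bump_prob.emeasure_space_1[where 'n='n] in auto)
    finally show ?thesis .
  qed
  then have "(\<integral>\<^sup>+x. ennreal (\<bar>contr_avg \<epsilon> q r g x\<bar> powr p) \<partial>lborel) \<le> (\<integral>\<^sup>+x. (\<integral>\<^sup>+z. ennreal (\<bar>g (ymap \<epsilon> q r x z)\<bar> powr p) \<partial>bump_measure) \<partial>lborel)"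
    by (rule nn_integral_mono)
  also have "\<dots> \<le> ennreal (2 ^ CARD('n)) * (\<integral>\<^sup>+x. ennreal (\<bar>g x\<bar> powr p) \<partial>lborel)"
    by (rule nn_contr_avg_le[OF _ \<epsilon>]) measurable
  finally show ?thesis .
qed

lemma AE_affine:
  fixes P :: "'a::euclidean_space \<Rightarrow> bool"
  assumes "AE x in lborel. P x" and c: "c \<noteq> 0"
  shows "AE x in lborel. P (a + c *\<^sub>R x)"
proof -
  obtain N where N: "N \<in> null_sets lborel" "{x. \<not> P x} \<subseteq> N"
    using assms(1) by (auto simp: eventually_ae_filter)
  have [measurable]: "N \<in> sets borel" using N by auto
  have "(\<integral>\<^sup>+x. indicator N (a + c *\<^sub>R x) \<partial>lborel) = ennreal (1 / \<bar>c\<bar> ^ DIM('a)) * (\<integral>\<^sup>+x. indicator N x \<partial>lborel)"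
    by (rule nn_integral_affine[OF _ c]) measurable
  also have "\<dots> = 0" using N by (simp add: null_sets_def)
  finally have "AE x in lborel. indicator N (a + c *\<^sub>R x) = (0::ennreal)"
    by (subst (asm) nn_integral_0_iff_AE) auto
  then show ?thesis
    using N(2) by (auto elim!: eventually_mono simp: indicator_def split: if_splits)
qed

text \<open>The conclusion holds at every \<open>x\<close>, not just almost everywhere: for fixed
  \<open>x\<close> the points averaged depend on \<open>z\<close> through an invertible affine map,
  under which null sets pull back to null sets.\<close>

lemma contr_avg_abs_le:
  fixes g :: "real^'n::finite \<Rightarrow> real"
  assumes g: "integrable lborel g" and \<epsilon>: "0 < \<epsilon>" and r: "0 < r" and B: "AE x in lborel. \<bar>g x\<bar> \<le> B"
  shows "\<bar>contr_avg \<epsilon> q r g x\<bar> \<le> B"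
proof -
  have "AE z in lborel. \<bar>g (ymap \<epsilon> q r x z)\<bar> \<le> B"
    unfolding ymap_z using \<epsilon> r by (intro AE_affine[OF B]) auto
  then have ae: "AE z in bump_measure. \<bar>g (ymap \<epsilon> q r x z)\<bar> \<le> B" by (rule AE_bump_measureI)
  have "\<bar>contr_avg \<epsilon> q r g x\<bar> \<le> (\<integral>z. \<bar>g (ymap \<epsilon> q r x z)\<bar> \<partial>bump_measure)"
    unfolding contr_avg_def by (rule integral_abs_bound)
  also have "\<dots> \<le> B"
    using contr_avg_integrable[OF g \<epsilon> r] ae by (intro bump_prob.integral_le_const) auto
  finally show ?thesis .
qed

text \<open>Clip \<open>g\<close> at a high level, approximate the clipped function almost
  everywhere by continuous ones, and clip these at the same level, so that dominated convergence
  applies on the set \<open>U\<close> of finite measure.\<close>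

lemma L1_dense_continuous:
  fixes g :: "'a::euclidean_space \<Rightarrow> real"
  assumes g: "integrable lborel g" and U[measurable]: "U \<in> sets borel" and fU: "emeasure lborel U < \<infinity>" and \<delta>: "0 < \<delta>"
  shows "\<exists>h. continuous_on UNIV h \<and> (\<integral>\<^sup>+x\<in>U. ennreal \<bar>g x - h x\<bar> \<partial>lborel) < ennreal \<delta>"
proof -
  define cl where "cl c t = max (- c) (min c t)" for c t :: real
  have cl_le: "\<bar>cl c t\<bar> \<le> c" if "0 \<le> c" for c t using that by (auto simp: cl_def)
  have cl_cont: "continuous_on UNIV (cl c)" for c unfolding cl_def by (intro continuous_intros)
  have [measurable]: "g \<in> borel_measurable borel" using g by simp
  have [measurable]: "cl c \<in> borel_measurable borel" for c by (rule borel_measurable_continuous_onI[OF cl_cont])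
  have "(\<lambda>n. \<integral>x. \<bar>g x - cl (real n) (g x)\<bar> \<partial>lborel) \<longlonglongrightarrow> (\<integral>x. 0 \<partial>(lborel :: 'a measure))"
  proof (rule integral_dominated_convergence[where w="\<lambda>x. 2 * \<bar>g x\<bar>"])
    show "AE x in lborel. (\<lambda>n. \<bar>g x - cl (real n) (g x)\<bar>) \<longlonglongrightarrow> 0"
    proof (rule AE_I2)
      fix x
      obtain N where N: "\<bar>g x\<bar> \<le> real N" using real_arch_simple by blast
      have "\<bar>g x - cl (real n) (g x)\<bar> = 0" if "n \<ge> N" for n
      proof -
        have "\<bar>g x\<bar> \<le> real n" using that N by (meson of_nat_le_iff order_trans)
        then show ?thesis by (auto simp: cl_def)
      qed
      then have "eventually (\<lambda>n. \<bar>g x - cl (real n) (g x)\<bar> = 0) sequentially"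
        unfolding eventually_sequentially by blast
      then show "(\<lambda>n. \<bar>g x - cl (real n) (g x)\<bar>) \<longlonglongrightarrow> 0" by (rule tendsto_eventually)
    qed
    show "AE x in lborel. norm \<bar>g x - cl (real n) (g x)\<bar> \<le> 2 * \<bar>g x\<bar>" for n
      by (rule AE_I2) (auto simp: cl_def)
  qed (use g in auto)
  then have "(\<lambda>n. \<integral>x. \<bar>g x - cl (real n) (g x)\<bar> \<partial>lborel) \<longlonglongrightarrow> 0" by simp
  then have "eventually (\<lambda>n. (\<integral>x. \<bar>g x - cl (real n) (g x)\<bar> \<partial>lborel) < \<delta> / 2) sequentially"
    using \<delta> by (intro order_tendstoD) auto
  then obtain n where n: "(\<integral>x. \<bar>g x - cl (real n) (g x)\<bar> \<partial>lborel) < \<delta> / 2"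
    by (auto simp: eventually_sequentially)
  define c where "c = real n"
  define gn where "gn = (\<lambda>x. cl c (g x))"
  have c0: "0 \<le> c" by (simp add: c_def)
  have [measurable]: "gn \<in> borel_measurable borel" unfolding gn_def by measurable
  have i1: "integrable lborel (\<lambda>x. \<bar>g x - gn x\<bar>)"
  proof (rule Bochner_Integration.integrable_bound[of _ "\<lambda>x. 2 * \<bar>g x\<bar>"])
    show "AE x in lborel. norm \<bar>g x - gn x\<bar> \<le> norm (2 * \<bar>g x\<bar>)"
      by (rule AE_I2) (auto simp: gn_def cl_def c_def)
  qed (use g in auto)
  have "gn \<in> borel_measurable lebesgue"
    by (rule measurable_completion) simp
  then have "gn measurable_on UNIV" by (rule lebesgue_measurable_imp_measurable_on) simp
  then obtain N h where N: "negligible N" and h: "\<And>m. continuous_on UNIV (h m)" and lim: "\<And>x. x \<notin> N \<Longrightarrow> (\<lambda>m. h m x) \<longlonglongrightarrow> gn x"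
    unfolding measurable_on_def by auto
  define H where "H m x = cl c (h m x)" for m x
  have Hc: "continuous_on UNIV (H m)" for m
    unfolding H_def by (rule continuous_on_compose2[OF cl_cont h]) simp
  have [measurable]: "H m \<in> borel_measurable borel" for m by (rule borel_measurable_continuous_onI[OF Hc])
  obtain N' where N': "N' \<in> null_sets lborel" "N \<subseteq> N'"
    using N by (auto simp: negligible_iff_null_sets null_sets_completion_iff2)
  have "(\<lambda>m. \<integral>x. indicator U x * \<bar>gn x - H m x\<bar> \<partial>lborel) \<longlonglongrightarrow> (\<integral>x. 0 \<partial>(lborel :: 'a measure))"
  proof (rule integral_dominated_convergence[where w="\<lambda>x. 2 * c * indicator U x"])
    show "integrable lborel (\<lambda>x. 2 * c * indicator U x)"
      using fU by (intro integrable_mult_right) simp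
    show "AE x in lborel. (\<lambda>m. indicator U x * \<bar>gn x - H m x\<bar>) \<longlonglongrightarrow> 0"
      using AE_not_in[OF N'(1)]
    proof eventually_elim
      fix x assume "x \<notin> N'"
      then have "(\<lambda>m. h m x) \<longlonglongrightarrow> gn x" using N'(2) by (intro lim) auto
      then have "(\<lambda>m. H m x) \<longlonglongrightarrow> cl c (gn x)"
        unfolding H_def by (intro continuous_on_tendsto_compose[OF cl_cont]) auto
      moreover have "cl c (gn x) = gn x" using c0 by (auto simp: gn_def cl_def)
      ultimately have "(\<lambda>m. indicator U x * \<bar>gn x - H m x\<bar>) \<longlonglongrightarrow> indicator U x * \<bar>gn x - gn x\<bar>"
        by (intro tendsto_intros) simp
      then show "(\<lambda>m. indicator U x * \<bar>gn x - H m x\<bar>) \<longlonglongrightarrow> 0" by simp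
    qed
    show "AE x in lborel. norm (indicator U x * \<bar>gn x - H m x\<bar>) \<le> 2 * c * indicator U x" for m
    proof (rule AE_I2)
      fix x
      show "norm (indicator U x * \<bar>gn x - H m x\<bar>) \<le> 2 * c * indicator U x"
        using cl_le[OF c0, of "g x"] cl_le[OF c0, of "h m x"] unfolding gn_def H_def
        by (auto simp: indicator_def)
    qed
  qed auto
  then have "(\<lambda>m. \<integral>x. indicator U x * \<bar>gn x - H m x\<bar> \<partial>lborel) \<longlonglongrightarrow> 0" by simp
  then have "eventually (\<lambda>m. (\<integral>x. indicator U x * \<bar>gn x - H m x\<bar> \<partial>lborel) < \<delta> / 2) sequentially"
    using \<delta> by (intro order_tendstoD) auto
  then obtain m where m: "(\<integral>x. indicator U x * \<bar>gn x - H m x\<bar> \<partial>lborel) < \<delta> / 2"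
    by (auto simp: eventually_sequentially)
  have i2: "integrable lborel (\<lambda>x. indicator U x * \<bar>gn x - H m x\<bar>)"
  proof (rule Bochner_Integration.integrable_bound[of _ "\<lambda>x. 2 * c * indicator U x"])
    show "integrable lborel (\<lambda>x. 2 * c * indicator U x)"
      using fU by (intro integrable_mult_right) simp
    show "AE x in lborel. norm (indicator U x * \<bar>gn x - H m x\<bar>) \<le> norm (2 * c * indicator U x)"
    proof (rule AE_I2)
      fix x
      show "norm (indicator U x * \<bar>gn x - H m x\<bar>) \<le> norm (2 * c * indicator U x)"
        using cl_le[OF c0, of "g x"] cl_le[OF c0, of "h m x"] c0 unfolding gn_def H_def
        by (auto simp: indicator_def)
    qed
  qed simp
  have "(\<integral>\<^sup>+x\<in>U. ennreal \<bar>g x - H m x\<bar> \<partial>lborel) \<le> (\<integral>\<^sup>+x. ennreal (\<bar>g x - gn x\<bar> + indicator U x * \<bar>gn x - H m x\<bar>) \<partial>lborel)"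
    by (intro nn_integral_mono) (auto simp: indicator_def simp del: ennreal_plus intro!: ennreal_leI)
  also have "\<dots> = ennreal (\<integral>x. \<bar>g x - gn x\<bar> + indicator U x * \<bar>gn x - H m x\<bar> \<partial>lborel)"
    using i1 i2 by (intro nn_integral_eq_integral) auto
  also have "(\<integral>x. \<bar>g x - gn x\<bar> + indicator U x * \<bar>gn x - H m x\<bar> \<partial>lborel) = (\<integral>x. \<bar>g x - gn x\<bar> \<partial>lborel) + (\<integral>x. indicator U x * \<bar>gn x - H m x\<bar> \<partial>lborel)"
    by (rule Bochner_Integration.integral_add[OF i1 i2])
  also have "ennreal \<dots> < ennreal \<delta>"
    using n m \<delta> unfolding gn_def c_def by (intro ennreal_lessI) auto
  finally show ?thesis using Hc by blast
qed

text \<open>For a continuous \<open>h\<close> the average moves points of \<open>U\<close> by at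
  most \<open>\<epsilon>\<close> times a bound for the diameter, so uniform continuity on
  \<open>closure U\<close> applies. The error \<open>g - h\<close> enters once directly and once
  averaged, where \<open>nn_contr_avg_le\<close> controls it.\<close>

lemma contr_avg_L1:
  fixes g :: "real^'n::finite \<Rightarrow> real"
  assumes g: "integrable lborel g" and U: "open U" "convex U" "bounded U"
    and q: "\<And>z. z \<in> cbox 0 1 \<Longrightarrow> q + r *\<^sub>R z \<in> U" and r: "0 < r" and \<delta>: "0 < \<delta>"
  shows "\<exists>\<epsilon>0>0. \<forall>\<epsilon>. 0 < \<epsilon> \<and> \<epsilon> < \<epsilon>0 \<longrightarrow> (\<integral>\<^sup>+x\<in>U. ennreal \<bar>contr_avg \<epsilon> q r g x - g x\<bar> \<partial>lborel) \<le> ennreal \<delta>"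
proof -
  have [measurable]: "U \<in> sets borel" using U by simp
  have [measurable]: "g \<in> borel_measurable borel" using g by simp
  have fU: "emeasure lborel U < \<infinity>" using emeasure_bounded_finite[OF U(3)] .
  define vU where "vU = measure lborel U"
  have vU: "emeasure lborel U = ennreal vU" "0 \<le> vU"
    using fU by (auto simp: vU_def emeasure_eq_ennreal_measure)
  \<comment> \<open>Half of \<open>\<delta>\<close> pays for \<open>g - h\<close>, averaged with the
    factor \<open>2 ^ CARD('n)\<close> and once unaveraged. The other half, spread over the volume
    by \<open>w\<close>, pays for the oscillation of \<open>h\<close>.\<close>
  define \<delta>1 where "\<delta>1 = \<delta> / (2 * (2 ^ CARD('n) + 1))"
  have \<delta>1: "0 < \<delta>1" using \<delta> by (simp add: \<delta>1_def add_pos_pos)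
  define w where "w = \<delta> / (2 * (vU + 1))"
  have w: "0 < w" "w * vU \<le> \<delta> / 2" using \<delta> vU by (auto simp: w_def field_simps)
  obtain h where h: "continuous_on UNIV h" "(\<integral>\<^sup>+x\<in>U. ennreal \<bar>g x - h x\<bar> \<partial>lborel) < ennreal \<delta>1"
    using L1_dense_continuous[OF g _ fU \<delta>1] by auto
  have [measurable]: "h \<in> borel_measurable borel" by (rule borel_measurable_continuous_onI[OF h(1)])
  have "compact (closure U)" using U by (simp add: compact_closure)
  then have "uniformly_continuous_on (closure U) h"
    using h(1) by (intro compact_uniformly_continuous) (auto intro: continuous_on_subset)
  then obtain \<eta> where \<eta>: "0 < \<eta>" "\<And>x y. x \<in> closure U \<Longrightarrow> y \<in> closure U \<Longrightarrow> dist y x < \<eta> \<Longrightarrow> dist (h y) (h x) < w"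
    unfolding uniformly_continuous_on_def using w(1) by metis
  obtain R where R: "0 < R" "\<And>x y. x \<in> U \<Longrightarrow> y \<in> U \<Longrightarrow> dist x y \<le> R"
    using bounded_two_points[of U] U(3) by (metis linorder_not_less not_less_iff_gr_or_eq order.strict_trans1 zero_less_one)
  let ?F = "\<lambda>x. ennreal \<bar>g x - h x\<bar> * indicator U x"
  have main: "(\<integral>\<^sup>+x\<in>U. ennreal \<bar>contr_avg \<epsilon> q r g x - g x\<bar> \<partial>lborel) \<le> ennreal \<delta>" if \<epsilon>: "0 < \<epsilon>" "\<epsilon> < min (1 / 2) (\<eta> / R)" for \<epsilon>
  proof -
    have pw: "ennreal \<bar>contr_avg \<epsilon> q r g x - g x\<bar> * indicator U x \<le> (\<integral>\<^sup>+z. ?F (ymap \<epsilon> q r x z) \<partial>bump_measure) + (ennreal w * indicator U x + ?F x)" for x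
    proof (cases "x \<in> U")
      case x: True
      have i: "integrable bump_measure (\<lambda>z. g (ymap \<epsilon> q r x z))" by (rule contr_avg_integrable[OF g \<epsilon>(1) r])
      have "contr_avg \<epsilon> q r g x - g x = (\<integral>z. g (ymap \<epsilon> q r x z) - g x \<partial>bump_measure)"
        unfolding contr_avg_def using i bump_prob.prob_space[where 'n='n] by simp
      then have "ennreal \<bar>contr_avg \<epsilon> q r g x - g x\<bar> \<le> (\<integral>\<^sup>+z. ennreal \<bar>g (ymap \<epsilon> q r x z) - g x\<bar> \<partial>bump_measure)"
        using integral_norm_bound_ennreal[of bump_measure "\<lambda>z. g (ymap \<epsilon> q r x z) - g x"] i by simp
      also have "\<dots> \<le> (\<integral>\<^sup>+z. ?F (ymap \<epsilon> q r x z) + (ennreal w + ennreal \<bar>g x - h x\<bar>) \<partial>bump_measure)"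
      proof (rule nn_integral_mono_AE)
        show "AE z in bump_measure. ennreal \<bar>g (ymap \<epsilon> q r x z) - g x\<bar> \<le> ?F (ymap \<epsilon> q r x z) + (ennreal w + ennreal \<bar>g x - h x\<bar>)"
          using AE_bump_measure_cbox
        proof eventually_elim
          fix z :: "real^'n" assume z: "z \<in> cbox 0 1"
          let ?y = "ymap \<epsilon> q r x z"
          have y: "?y \<in> U" using \<epsilon> q[OF z] x closure_subset U by (intro ymap_in) auto
          have "dist ?y x = \<epsilon> * dist (q + r *\<^sub>R z) x"
          proof -
            have "?y - x = \<epsilon> *\<^sub>R ((q + r *\<^sub>R z) - x)" by (simp add: ymap_def algebra_simps)
            then show ?thesis using \<epsilon> by (simp add: dist_norm)
          qed
          also have "\<dots> \<le> \<epsilon> * R" using \<epsilon> R(2)[OF q[OF z] x] by (intro mult_left_mono) auto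
          also have "\<dots> < \<eta>" using \<epsilon> R(1) by (simp add: field_simps)
          finally have "dist (h ?y) (h x) < w" using x y closure_subset by (intro \<eta>(2)) auto
          then have "\<bar>g ?y - g x\<bar> \<le> \<bar>g ?y - h ?y\<bar> + (w + \<bar>g x - h x\<bar>)" by (simp add: dist_real_def)
          then have "ennreal \<bar>g ?y - g x\<bar> \<le> ennreal (\<bar>g ?y - h ?y\<bar> + (w + \<bar>g x - h x\<bar>))" by (rule ennreal_leI)
          then show "ennreal \<bar>g ?y - g x\<bar> \<le> ?F ?y + (ennreal w + ennreal \<bar>g x - h x\<bar>)"
            using y w(1) by simp
        qed
      qed
      also have "\<dots> = (\<integral>\<^sup>+z. ?F (ymap \<epsilon> q r x z) \<partial>bump_measure) + (ennreal w + ennreal \<bar>g x - h x\<bar>)"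
        using bump_prob.emeasure_space_1[where 'n='n] by (subst nn_integral_add) auto
      finally show ?thesis using x by simp
    qed simp
    have "(\<integral>\<^sup>+x\<in>U. ennreal \<bar>contr_avg \<epsilon> q r g x - g x\<bar> \<partial>lborel)
      \<le> (\<integral>\<^sup>+x. (\<integral>\<^sup>+z. ?F (ymap \<epsilon> q r x z) \<partial>bump_measure) + (ennreal w * indicator U x + ?F x) \<partial>lborel)"
      by (intro nn_integral_mono pw)
    also have "\<dots> = (\<integral>\<^sup>+x. (\<integral>\<^sup>+z. ?F (ymap \<epsilon> q r x z) \<partial>bump_measure) \<partial>lborel) + ((\<integral>\<^sup>+x. ennreal w * indicator U x \<partial>lborel) + (\<integral>\<^sup>+x. ?F x \<partial>lborel))"
      by (simp add: nn_integral_add)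
    also have "\<dots> \<le> ennreal (2 ^ CARD('n)) * ennreal \<delta>1 + (ennreal w * ennreal vU + ennreal \<delta>1)"
    proof (intro add_mono)
      have "(\<integral>\<^sup>+x. (\<integral>\<^sup>+z. ?F (ymap \<epsilon> q r x z) \<partial>bump_measure) \<partial>lborel) \<le> ennreal (2 ^ CARD('n)) * (\<integral>\<^sup>+x. ?F x \<partial>lborel)"
        by (rule nn_contr_avg_le) (use \<epsilon> in auto)
      also have "\<dots> \<le> ennreal (2 ^ CARD('n)) * ennreal \<delta>1"
        using h(2) by (intro mult_left_mono) auto
      finally show "(\<integral>\<^sup>+x. (\<integral>\<^sup>+z. ?F (ymap \<epsilon> q r x z) \<partial>bump_measure) \<partial>lborel) \<le> ennreal (2 ^ CARD('n)) * ennreal \<delta>1" .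
      show "(\<integral>\<^sup>+x. ennreal w * indicator U x \<partial>lborel) \<le> ennreal w * ennreal vU"
        by (simp add: nn_integral_cmult_indicator vU)
      show "(\<integral>\<^sup>+x. ?F x \<partial>lborel) \<le> ennreal \<delta>1" using h(2) by simp
    qed
    also have "\<dots> = ennreal (2 ^ CARD('n) * \<delta>1 + (w * vU + \<delta>1))"
      using w \<delta>1 vU by (simp add: ennreal_mult[symmetric])
    also have "\<dots> \<le> ennreal \<delta>"
    proof (rule ennreal_leI)
      have "2 ^ CARD('n) * \<delta>1 + \<delta>1 = (2 ^ CARD('n) + 1) * \<delta>1" by (simp add: distrib_right)
      also have "\<dots> = \<delta> / 2"
      proof -
        have "(X + 1) * (\<delta> / (2 * (X + 1))) = \<delta> / 2" if "0 \<le> X" for X :: real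
          using that by (simp add: divide_simps)
        then show ?thesis unfolding \<delta>1_def by simp
      qed
      finally show "2 ^ CARD('n) * \<delta>1 + (w * vU + \<delta>1) \<le> \<delta>" using w(2) by linarith
    qed
    finally show ?thesis .
  qed
  show ?thesis
    by (intro exI[of _ "min (1 / 2) (\<eta> / R)"] conjI allI impI main) (use \<eta> R in auto)
qed

section \<open>Uniqueness of weak derivatives\<close>

lemma open_contains_cube:
  fixes U :: "(real^'n::finite) set"
  assumes "open U" "U \<noteq> {}"
  shows "\<exists>q r. 0 < r \<and> (\<forall>z\<in>cbox 0 1. q + r *\<^sub>R z \<in> U)"
proof -
  obtain q where q: "q \<in> U" using assms by blast
  obtain e where e: "0 < e" "ball q e \<subseteq> U" using assms(1) q by (auto simp: open_contains_ball)
  define r where "r = e / (2 * real CARD('n))"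
  have r: "0 < r" using e by (simp add: r_def)
  have "q + r *\<^sub>R z \<in> U" if z: "z \<in> cbox 0 1" for z
  proof -
    have "norm z \<le> (\<Sum>i\<in>UNIV. \<bar>z $ i\<bar>)" by (rule norm_le_l1_cart)
    also have "\<dots> \<le> (\<Sum>i\<in>(UNIV::'n set). 1)" using z by (intro sum_mono) (auto simp: mem_box_cart)
    finally have "r * norm z \<le> r * real CARD('n)" using r by (intro mult_left_mono) auto
    also have "\<dots> < e" using e by (simp add: r_def)
    finally have "dist q (q + r *\<^sub>R z) < e" using r by (simp add: dist_norm)
    then show ?thesis using e by auto
  qed
  with r show ?thesis by blast
qed

text \<open>Passage from Lebesgue to Borel measurability with extension by zero; Fubini's theorem
  and affine substitutions can then be carried out over \<open>lborel\<close> on the whole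
  space.\<close>

lemma borel_representative:
  fixes g :: "'a::euclidean_space \<Rightarrow> real"
  assumes g: "g \<in> borel_measurable (lebesgue_on U)" and U: "open U"
  shows "\<exists>h. h \<in> borel_measurable borel \<and> (\<forall>x. x \<notin> U \<longrightarrow> h x = 0) \<and> (AE x in lborel. x \<in> U \<longrightarrow> h x = g x)"
proof -
  have Us: "U \<in> sets borel" using U by simp
  then have "U \<in> sets lebesgue" by simp
  then have m: "(\<lambda>x. indicator U x * g x) \<in> borel_measurable lebesgue"
    using g by (subst (asm) borel_measurable_restrict_space_iff) auto
  from completion_ex_borel_measurable_real[OF m]
  obtain h where h: "h \<in> borel_measurable lborel" "AE x in lborel. indicator U x * g x = h x" by blast
  show ?thesis
  proof (intro exI[of _ "\<lambda>x. indicator U x * h x"] conjI)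
    show "(\<lambda>x. indicator U x * h x) \<in> borel_measurable borel" using h(1) Us by simp
    show "AE x in lborel. x \<in> U \<longrightarrow> indicator U x * h x = g x"
      using h(2) by eventually_elim auto
  qed simp
qed

lemma integral_representative:
  fixes g h :: "'a::euclidean_space \<Rightarrow> real"
  assumes g: "g \<in> borel_measurable (lebesgue_on U)" and U: "open U"
    and h[measurable]: "h \<in> borel_measurable borel" and h0: "\<And>x. x \<notin> U \<Longrightarrow> h x = 0" and ae: "AE x in lborel. x \<in> U \<longrightarrow> h x = g x"
    and \<phi>[measurable]: "\<phi> \<in> borel_measurable borel"
  shows "(LINT x|lebesgue_on U. g x * \<phi> x) = (\<integral>x. h x * \<phi> x \<partial>lborel)"
proof -
  have Us: "U \<in> sets borel" "U \<in> sets lebesgue" using U by auto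
  have m: "(\<lambda>x. indicator U x * g x) \<in> borel_measurable lebesgue"
    using g Us by (subst (asm) borel_measurable_restrict_space_iff) auto
  have \<phi>': "\<phi> \<in> borel_measurable lebesgue" by (rule measurable_completion) simp
  have hm: "h \<in> borel_measurable lebesgue" by (rule measurable_completion) simp
  have "(LINT x|lebesgue_on U. g x * \<phi> x) = (\<integral>x. (indicator U x * g x) * \<phi> x \<partial>lebesgue)"
    using Us by (subst integral_restrict_space) (auto simp: mult.assoc)
  also have "\<dots> = (\<integral>x. h x * \<phi> x \<partial>lebesgue)"
  proof (rule integral_cong_AE)
    show "(\<lambda>x. (indicator U x * g x) * \<phi> x) \<in> borel_measurable lebesgue" by (intro borel_measurable_times m \<phi>')
    show "(\<lambda>x. h x * \<phi> x) \<in> borel_measurable lebesgue" by (intro borel_measurable_times hm \<phi>')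
    show "AE x in lebesgue. (indicator U x * g x) * \<phi> x = h x * \<phi> x"
      using AE_completion[OF ae] by eventually_elim (auto simp: indicator_def h0)
  qed
  also have "\<dots> = (\<integral>x. h x * \<phi> x \<partial>lborel)" by (rule integral_completion) simp
  finally show ?thesis .
qed

text \<open>As a function of \<open>y\<close>, the kernel of \<open>contr_avg \<epsilon> q r\<close> at \<open>x\<close> up to normalisation, with its derivatives.\<close>

definition tjet :: "real \<Rightarrow> real^'n::finite \<Rightarrow> real \<Rightarrow> real^'n \<Rightarrow> ('n \<Rightarrow> nat) \<Rightarrow> real^'n \<Rightarrow> real" where
  "tjet \<epsilon> q r x \<gamma> y = (1 / (\<epsilon> * r)) ^ (\<Sum>i\<in>UNIV. \<gamma> i) *
     bump \<gamma> (- (1 / (\<epsilon> * r)) *\<^sub>R ((1 - \<epsilon>) *\<^sub>R x + \<epsilon> *\<^sub>R q) + (1 / (\<epsilon> * r)) *\<^sub>R y)"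

lemma jet_tjet: "jet (tjet \<epsilon> q r x)"
proof -
  have "tjet \<epsilon> q r x = (\<lambda>\<gamma> y. (1 / (\<epsilon> * r)) ^ (\<Sum>i\<in>UNIV. \<gamma> i) *
     bump \<gamma> (- (1 / (\<epsilon> * r)) *\<^sub>R ((1 - \<epsilon>) *\<^sub>R x + \<epsilon> *\<^sub>R q) + (1 / (\<epsilon> * r)) *\<^sub>R y))"
    by (intro ext) (simp only: tjet_def)
  then show ?thesis using jet_affine[OF jet_bump] by (simp only:)
qed

lemma tjet_measurable [measurable]: "tjet \<epsilon> q r x \<gamma> \<in> borel_measurable borel"
  by (rule jet_measurable[OF jet_tjet])

lemma tjet_ymap:
  assumes "0 < \<epsilon>" "0 < r"
  shows "tjet \<epsilon> q r x \<gamma> (ymap \<epsilon> q r x z) = (1 / (\<epsilon> * r)) ^ (\<Sum>i\<in>UNIV. \<gamma> i) * bump \<gamma> z"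
proof -
  have "- (1 / (\<epsilon> * r)) *\<^sub>R ((1 - \<epsilon>) *\<^sub>R x + \<epsilon> *\<^sub>R q) + (1 / (\<epsilon> * r)) *\<^sub>R ymap \<epsilon> q r x z = (1 / (\<epsilon> * r)) *\<^sub>R ((\<epsilon> * r) *\<^sub>R z)"
    unfolding ymap_z by (simp add: scaleR_right_distrib)
  also have "\<dots> = z" using assms by simp
  finally show ?thesis by (simp add: tjet_def)
qed

lemma ymap_surj:
  assumes "0 < \<epsilon>" "0 < r"
  shows "\<exists>z. y = ymap \<epsilon> q r x z"
proof
  let ?b = "(1 - \<epsilon>) *\<^sub>R x + \<epsilon> *\<^sub>R q"
  show "y = ymap \<epsilon> q r x ((1 / (\<epsilon> * r)) *\<^sub>R (y - ?b))"
    unfolding ymap_z using assms by simp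
qed

lemma tjet_bounded: "\<exists>B. \<forall>y. \<bar>tjet \<epsilon> q r x \<gamma> y\<bar> \<le> B"
proof -
  obtain B where "0 \<le> B" "\<And>x. \<bar>bump \<gamma> (x :: real^'a)\<bar> \<le> B" using bump_bounded[of \<gamma>] by blast
  then show ?thesis
    by (intro exI[of _ "\<bar>1 / (\<epsilon> * r)\<bar> ^ (\<Sum>i\<in>UNIV. \<gamma> i) * B"])
       (auto simp: tjet_def abs_mult power_abs intro!: mult_left_mono)
qed

lemma tjet_support:
  assumes "0 < \<epsilon>" "0 < r"
  shows "closure {y. tjet \<epsilon> q r x \<gamma> y \<noteq> 0} \<subseteq> ymap \<epsilon> q r x ` cbox 0 1" "compact (ymap \<epsilon> q r x ` cbox 0 1)"
proof -
  show c: "compact (ymap \<epsilon> q r x ` cbox 0 1)"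
    unfolding ymap_def by (intro compact_continuous_image continuous_intros compact_cbox)
  have "{y. tjet \<epsilon> q r x \<gamma> y \<noteq> 0} \<subseteq> ymap \<epsilon> q r x ` cbox 0 1"
  proof
    fix y assume y: "y \<in> {y. tjet \<epsilon> q r x \<gamma> y \<noteq> 0}"
    obtain z where z: "y = ymap \<epsilon> q r x z" using ymap_surj[OF assms] by blast
    then have "bump \<gamma> z \<noteq> 0" using y tjet_ymap[OF assms, of q x \<gamma> z] by auto
    then have "z \<in> cbox 0 1" using bump_outside by blast
    with z show "y \<in> ymap \<epsilon> q r x ` cbox 0 1" by blast
  qed
  then show "closure {y. tjet \<epsilon> q r x \<gamma> y \<noteq> 0} \<subseteq> ymap \<epsilon> q r x ` cbox 0 1"
    using c by (intro closure_minimal compact_imp_closed)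
qed

text \<open>The point \<open>x\<close> may lie on the boundary: by convexity the combination with an
  interior cube pulls the compact support of the kernel into \<open>U\<close>. Weak derivatives can
  therefore be averaged at all points of the closed simplex.\<close>

lemma tjet_test_function:
  fixes U :: "(real^'n::finite) set"
  assumes U: "convex U" "open U" and x: "x \<in> closure U" and q: "\<And>z. z \<in> cbox 0 1 \<Longrightarrow> q + r *\<^sub>R z \<in> U"
    and e: "0 < \<epsilon>" "\<epsilon> \<le> 1" "0 < r"
  shows "tjet \<epsilon> q r x zmi \<in> test_functions U"
  unfolding test_functions_def mem_Collect_eq
proof (intro conjI)
  note s = tjet_support[OF e(1,3), of q x]
  show "smooth (tjet \<epsilon> q r x zmi)" by (rule jet_smooth[OF jet_tjet])
  show "compact (closure {y. tjet \<epsilon> q r x zmi y \<noteq> 0})"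
    using s by (metis closed_closure compact_Int_closed inf.absorb_iff2)
  have "ymap \<epsilon> q r x ` cbox 0 1 \<subseteq> U" using ymap_in[OF U x q e(1,2)] by blast
  then show "closure {y. tjet \<epsilon> q r x zmi y \<noteq> 0} \<subseteq> U" using s(1) by blast
qed

text \<open>Substituting \<open>y = ymap \<epsilon> q r x z\<close> turns the kernel into the bump,
  so pairing with the kernel is averaging, up to the Jacobian and the mass of the bump.\<close>

lemma integral_tjet:
  fixes g :: "real^'n::finite \<Rightarrow> real"
  assumes [measurable]: "g \<in> borel_measurable borel" and e: "0 < \<epsilon>" "0 < r"
  shows "(\<integral>y. g y * tjet \<epsilon> q r x zmi y \<partial>lborel) = (\<epsilon> * r) ^ CARD('n) * bump_int TYPE('n) * contr_avg \<epsilon> q r g x"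
proof -
  have "(\<integral>y. g y * tjet \<epsilon> q r x zmi y \<partial>lborel)
    = \<bar>\<epsilon> * r\<bar> ^ DIM(real^'n) * (\<integral>z. g (ymap \<epsilon> q r x z) * tjet \<epsilon> q r x zmi (ymap \<epsilon> q r x z) \<partial>lborel)"
    unfolding ymap_z using e by (intro integral_affine[of "\<lambda>y. g y * tjet \<epsilon> q r x zmi y"]) auto
  also have "(\<integral>z. g (ymap \<epsilon> q r x z) * tjet \<epsilon> q r x zmi (ymap \<epsilon> q r x z) \<partial>lborel) = (\<integral>z. g (ymap \<epsilon> q r x z) * bump zmi z \<partial>lborel)"
    by (simp add: tjet_ymap[OF e])
  also have "\<dots> = bump_int TYPE('n) * contr_avg \<epsilon> q r g x"
    unfolding contr_avg_def using bump_int_pos[where 'n='n] by (subst integral_bump_measure) auto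
  finally show ?thesis using e by simp
qed

text \<open>The jet, in the variable \<open>x\<close>, of the contraction average of
  \<open>v\<close>. The normalisation undoes the factor in \<open>integral_tjet\<close>, and each
  derivative in \<open>x\<close> brings down the coefficient of \<open>x\<close> in the
  kernel.\<close>

definition moljet :: "real \<Rightarrow> real^'n::finite \<Rightarrow> real \<Rightarrow> (real^'n \<Rightarrow> real) \<Rightarrow> ('n \<Rightarrow> nat) \<Rightarrow> real^'n \<Rightarrow> real" where
  "moljet \<epsilon> q r v = (\<lambda>\<nu> x. (1 / ((\<epsilon> * r) ^ CARD('n) * bump_int TYPE('n))) * (- ((1 - \<epsilon>) * (1 / (\<epsilon> * r)))) ^ (\<Sum>i\<in>UNIV. \<nu> i) *
     mol v (1 / (\<epsilon> * r)) ((1 - \<epsilon>) * (1 / (\<epsilon> * r))) (- (1 / (\<epsilon> * r)) *\<^sub>R (\<epsilon> *\<^sub>R q)) \<nu> x)"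

lemma jet_moljet: "integrable lborel v \<Longrightarrow> jet (moljet \<epsilon> q r v)"
  unfolding moljet_def by (rule jet_mol)

text \<open>Differentiating the kernel in \<open>x\<close> is \<open>- (1 - \<epsilon>)\<close>
  times differentiating it in \<open>y\<close>, and the weak derivative moves the latter from the
  kernel to \<open>v\<close>. Averaging thus commutes with differentiation up to the factor
  \<open>(1 - \<epsilon>) ^ |\<gamma>|\<close>.\<close>

lemma moljet_eq:
  fixes v g :: "real^'n::{finite,linorder} \<Rightarrow> real"
  assumes g: "g \<in> borel_measurable borel" and e: "0 < \<epsilon>" "0 < r"
    and wd: "(\<integral>y. v y * mpartial \<gamma> (tjet \<epsilon> q r x zmi) y \<partial>lborel) = (- 1) ^ (\<Sum>i\<in>UNIV. \<gamma> i) * (\<integral>y. g y * tjet \<epsilon> q r x zmi y \<partial>lborel)"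
  shows "moljet \<epsilon> q r v \<gamma> x = (1 - \<epsilon>) ^ (\<Sum>i\<in>UNIV. \<gamma> i) * contr_avg \<epsilon> q r g x"
proof -
  let ?s = "1 / (\<epsilon> * r)" and ?n = "\<Sum>i\<in>UNIV. \<gamma> i" and ?I = "(\<epsilon> * r) ^ CARD('n) * bump_int TYPE('n)"
  let ?m = "mol v ?s ((1 - \<epsilon>) * ?s) (- ?s *\<^sub>R (\<epsilon> *\<^sub>R q)) \<gamma> x"
  have I: "?I \<noteq> 0" using e bump_int_pos[where 'n='n] by simp
  have arg: "- ?s *\<^sub>R (\<epsilon> *\<^sub>R q) + ?s *\<^sub>R y - ((1 - \<epsilon>) * ?s) *\<^sub>R x = - ?s *\<^sub>R ((1 - \<epsilon>) *\<^sub>R x + \<epsilon> *\<^sub>R q) + ?s *\<^sub>R y" for y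
    by (simp add: scaleR_right_distrib mult.commute)
  have "(\<integral>y. v y * mpartial \<gamma> (tjet \<epsilon> q r x zmi) y \<partial>lborel) = (\<integral>y. ?s ^ ?n * (v y * bump \<gamma> (- ?s *\<^sub>R (\<epsilon> *\<^sub>R q) + ?s *\<^sub>R y - ((1 - \<epsilon>) * ?s) *\<^sub>R x)) \<partial>lborel)"
    unfolding jet_mpartial[OF jet_tjet] arg by (simp only: tjet_def mult.left_commute)
  also have "\<dots> = ?s ^ ?n * ?m" by (simp add: mol_def)
  finally have "?s ^ ?n * ?m = (- 1) ^ ?n * (?I * contr_avg \<epsilon> q r g x)"
    using wd integral_tjet[OF g e] by simp
  then have "(- (1 - \<epsilon>)) ^ ?n * (?s ^ ?n * ?m) = (- (1 - \<epsilon>)) ^ ?n * ((- 1) ^ ?n * (?I * contr_avg \<epsilon> q r g x))" by simp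
  moreover have "(- (1 - \<epsilon>)) ^ ?n * (?s ^ ?n * ?m) = (- ((1 - \<epsilon>) * ?s)) ^ ?n * ?m"
    by (simp only: mult.assoc[symmetric] power_mult_distrib[symmetric] mult_minus_left)
  moreover have "(- (1 - \<epsilon>)) ^ ?n * ((- 1) ^ ?n * (?I * contr_avg \<epsilon> q r g x)) = (1 - \<epsilon>) ^ ?n * (?I * contr_avg \<epsilon> q r g x)"
    by (simp only: mult.assoc[symmetric] power_mult_distrib[symmetric]) simp
  ultimately have "(- ((1 - \<epsilon>) * ?s)) ^ ?n * ?m = ?I * ((1 - \<epsilon>) ^ ?n * contr_avg \<epsilon> q r g x)" by (simp only: ac_simps)
  then have "1 / ?I * ((- ((1 - \<epsilon>) * ?s)) ^ ?n * ?m) = (1 - \<epsilon>) ^ ?n * contr_avg \<epsilon> q r g x" using I by simp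
  then show ?thesis unfolding moljet_def by (simp only: mult.assoc)
qed

text \<open>Convergence in \<open>L^1\<close> holds along \<open>\<epsilon>'\<close>, hence almost
  everywhere along a subsequence. The bound \<open>e0\<close> leaves room to impose another
  smallness condition on the same sequence.\<close>

lemma contr_avg_AE_seq:
  fixes g :: "real^'n::finite \<Rightarrow> real"
  assumes g: "integrable lborel g" and U: "open U" "convex U" "bounded U"
    and q: "\<forall>z\<in>cbox 0 1. q + r *\<^sub>R z \<in> U" and r: "0 < r" and e0: "0 < e0"
  shows "\<exists>\<epsilon> :: nat \<Rightarrow> real. (\<forall>n. 0 < \<epsilon> n) \<and> (\<forall>n. \<epsilon> n < e0) \<and> (\<forall>n. \<epsilon> n \<le> 1 / 2) \<and> \<epsilon> \<longlonglongrightarrow> 0 \<and>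
    (AE x in lborel. x \<in> U \<longrightarrow> (\<lambda>n. contr_avg (\<epsilon> n) q r g x) \<longlonglongrightarrow> g x)"
proof -
  have [measurable]: "g \<in> borel_measurable borel" "U \<in> sets borel" using g U by auto
  define e1 where "e1 = min (1 / 2) (e0 / 2)"
  have e1: "0 < e1" "e1 \<le> 1 / 2" "e1 < e0" using e0 by (auto simp: e1_def)
  define \<epsilon>' where "\<epsilon>' n = e1 / (real n + 1)" for n
  have \<epsilon>'pos: "0 < \<epsilon>' n" for n using e1 by (simp add: \<epsilon>'_def)
  have \<epsilon>'le: "\<epsilon>' n \<le> e1" for n using e1 by (simp add: \<epsilon>'_def field_simps)
  have lim: "\<epsilon>' \<longlonglongrightarrow> 0"
  proof -
    have "(\<lambda>n. e1 * inverse (real (Suc n))) \<longlonglongrightarrow> e1 * 0"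
      by (intro tendsto_intros LIMSEQ_inverse_real_of_nat)
    then show ?thesis by (simp add: \<epsilon>'_def[abs_def] divide_inverse add.commute)
  qed
  have [measurable]: "contr_avg e q r g \<in> borel_measurable borel" for e
    unfolding contr_avg_def by measurable
  define u where "u n x = indicator U x * (contr_avg (\<epsilon>' n) q r g x - g x)" for n x
  have i: "integrable lborel (u n)" for n
  proof -
    have "(\<integral>\<^sup>+x. ennreal (\<bar>contr_avg (\<epsilon>' n) q r g x\<bar> powr 1) \<partial>lborel) \<le> ennreal (2 ^ CARD('n)) * (\<integral>\<^sup>+x. ennreal (\<bar>g x\<bar> powr 1) \<partial>lborel)"
      by (rule contr_avg_powr_le[OF g \<epsilon>'pos _ r]) (use \<epsilon>'le[of n] e1 in auto)
    also have "\<dots> < \<infinity>" using g by (auto simp: integrable_iff_bounded ennreal_mult_less_top)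
    finally have "integrable lborel (contr_avg (\<epsilon>' n) q r g)" by (simp add: integrable_iff_bounded)
    then have "integrable lborel (\<lambda>x. contr_avg (\<epsilon>' n) q r g x - g x)" using g by simp
    then show ?thesis unfolding u_def by (intro integrable_mult_indicator[of U lborel "\<lambda>x. contr_avg (\<epsilon>' n) q r g x - g x", simplified]) auto
  qed
  have n0: "(\<lambda>n. \<integral>x. norm (u n x) \<partial>lborel) \<longlonglongrightarrow> 0"
  proof (rule LIMSEQ_I)
    fix \<delta> :: real assume \<delta>: "0 < \<delta>"
    obtain \<epsilon>0 where \<epsilon>0: "0 < \<epsilon>0" "\<And>e. 0 < e \<Longrightarrow> e < \<epsilon>0 \<Longrightarrow> (\<integral>\<^sup>+x\<in>U. ennreal \<bar>contr_avg e q r g x - g x\<bar> \<partial>lborel) \<le> ennreal (\<delta> / 2)"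
      using contr_avg_L1[OF g U bspec[OF q] r, of "\<delta> / 2"] \<delta> by auto
    from order_tendstoD(2)[OF lim \<epsilon>0(1)] obtain N where N: "\<And>n. n \<ge> N \<Longrightarrow> \<epsilon>' n < \<epsilon>0"
      by (auto simp: eventually_sequentially)
    show "\<exists>N. \<forall>n\<ge>N. norm ((\<integral>x. norm (u n x) \<partial>lborel) - 0) < \<delta>"
    proof (intro exI[of _ N] allI impI)
      fix n assume n: "N \<le> n"
      have "ennreal (\<integral>x. norm (u n x) \<partial>lborel) = (\<integral>\<^sup>+x. ennreal (norm (u n x)) \<partial>lborel)"
        using i by (intro nn_integral_eq_integral[symmetric]) auto
      also have "\<dots> = (\<integral>\<^sup>+x\<in>U. ennreal \<bar>contr_avg (\<epsilon>' n) q r g x - g x\<bar> \<partial>lborel)"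
        by (intro nn_integral_cong) (auto simp: u_def indicator_def)
      also have "\<dots> \<le> ennreal (\<delta> / 2)" by (rule \<epsilon>0(2)[OF \<epsilon>'pos N[OF n]])
      finally have "(\<integral>x. norm (u n x) \<partial>lborel) \<le> \<delta> / 2" using \<delta> by simp
      then show "norm ((\<integral>x. norm (u n x) \<partial>lborel) - 0) < \<delta>" using \<delta> by simp
    qed
  qed
  obtain s :: "nat \<Rightarrow> nat" where s: "strict_mono s" "AE x in lborel. (\<lambda>n. u (s n) x) \<longlonglongrightarrow> 0"
    using tendsto_L1_AE_subseq[OF i n0] by blast
  show ?thesis
  proof (intro exI[of _ "\<lambda>n. \<epsilon>' (s n)"] conjI allI)
    show "(\<lambda>n. \<epsilon>' (s n)) \<longlonglongrightarrow> 0" using LIMSEQ_subseq_LIMSEQ[OF lim s(1)] by (simp add: o_def)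
    show "AE x in lborel. x \<in> U \<longrightarrow> (\<lambda>n. contr_avg (\<epsilon>' (s n)) q r g x) \<longlonglongrightarrow> g x"
      using s(2)
    proof eventually_elim
      fix x assume l: "(\<lambda>n. u (s n) x) \<longlonglongrightarrow> 0"
      show "x \<in> U \<longrightarrow> (\<lambda>n. contr_avg (\<epsilon>' (s n)) q r g x) \<longlonglongrightarrow> g x"
      proof
        assume "x \<in> U"
        then have "(\<lambda>n. contr_avg (\<epsilon>' (s n)) q r g x - g x) \<longlonglongrightarrow> 0" using l by (simp add: u_def)
        then show "(\<lambda>n. contr_avg (\<epsilon>' (s n)) q r g x) \<longlonglongrightarrow> g x" by (simp add: LIM_zero_iff)
      qed
    qed
    show "0 < \<epsilon>' (s n)" for n by (rule \<epsilon>'pos)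
    show "\<epsilon>' (s n) < e0" for n using \<epsilon>'le[of "s n"] e1 by linarith
    show "\<epsilon>' (s n) \<le> 1 / 2" for n using \<epsilon>'le[of "s n"] e1 by linarith
  qed
qed

text \<open>The fundamental lemma of the calculus of variations: pairings with the kernels are
  averages up to a positive factor, and averages recover \<open>h\<close> almost everywhere.\<close>

lemma box_integral_eq_zero:
  fixes h :: "real^'n::finite \<Rightarrow> real"
  assumes h: "integrable lborel h" and W: "open W" "convex W" "bounded W" "W \<noteq> {}"
    and z: "\<And>\<epsilon> q r x. (\<And>z. z \<in> cbox 0 1 \<Longrightarrow> q + r *\<^sub>R z \<in> W) \<Longrightarrow> 0 < r \<Longrightarrow> 0 < \<epsilon> \<Longrightarrow> \<epsilon> \<le> 1 \<Longrightarrow> x \<in> W \<Longrightarrow>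
      (\<integral>y. h y * tjet \<epsilon> q r x zmi y \<partial>lborel) = 0"
  shows "AE x in lborel. x \<in> W \<longrightarrow> h x = 0"
proof -
  from open_contains_cube[OF W(1,4)] obtain q r where qr0: "0 < r" "\<forall>z\<in>cbox 0 1. q + r *\<^sub>R z \<in> W"
    by (elim exE conjE)
  have qr: "0 < r" "\<And>z. z \<in> cbox 0 1 \<Longrightarrow> q + r *\<^sub>R z \<in> W" using qr0 by auto
  from contr_avg_AE_seq[OF h W(1-3) qr0(2,1) zero_less_one]
  obtain \<epsilon> :: "nat \<Rightarrow> real" where \<epsilon>1: "\<forall>n. 0 < \<epsilon> n" and \<epsilon>2: "\<forall>n. \<epsilon> n < 1" and
    \<epsilon>5: "AE x in lborel. x \<in> W \<longrightarrow> (\<lambda>n. contr_avg (\<epsilon> n) q r h x) \<longlonglongrightarrow> h x"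
    by (elim exE conjE)
  have "contr_avg (\<epsilon> n) q r h x = 0" if "x \<in> W" for n x
  proof -
    have "(\<integral>y. h y * tjet (\<epsilon> n) q r x zmi y \<partial>lborel) = 0"
      by (rule z[OF qr(2,1) spec[OF \<epsilon>1] less_imp_le[OF spec[OF \<epsilon>2]] that])
    then show ?thesis
      using integral_tjet[of h "\<epsilon> n" r q x] h spec[OF \<epsilon>1, of n] qr(1) bump_int_pos[where 'n='n] by simp
  qed
  with \<epsilon>5 show ?thesis
    by (auto elim!: eventually_mono simp: LIMSEQ_const_iff)
qed

lemma locally_integrable_measurable:
  fixes U :: "(real^'n::finite) set"
  assumes "locally_integrable U g" "cbox a b \<subseteq> U"
  shows "g \<in> borel_measurable (lebesgue_on (box a b))"
proof -
  have "integrable (lebesgue_on (cbox a b)) g" using assms by (auto simp: locally_integrable_def)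
  then have "g \<in> borel_measurable (lebesgue_on (cbox a b))" by simp
  then show ?thesis
    by (rule measurable_restrict_mono) (rule box_subset_cbox)
qed

text \<open>Weak derivatives are only locally integrable, so they are compared on open boxes whose
  closure lies in \<open>U\<close>, where their extensions by zero are integrable. Countably many
  closed boxes cover \<open>U\<close>, and the frontiers of the boxes are null.\<close>

lemma weak_deriv_unique:
  fixes U :: "(real^'n::{finite,linorder}) set"
  assumes U: "open U" and g1: "has_weak_deriv U \<gamma> v g1" and g2: "has_weak_deriv U \<gamma> v g2"
  shows "AE x in lborel. x \<in> U \<longrightarrow> g1 x = g2 x"
proof -
  have loc: "AE x in lborel. x \<in> box a b \<longrightarrow> g1 x = g2 x" if ab: "cbox a b \<subseteq> U" for a b
  proof (cases "box a b = {}")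
    case False
    let ?W = "box a b"
    have W: "open ?W" "convex ?W" "bounded ?W" "?W \<noteq> {}" using False by auto
    have WU: "?W \<subseteq> U" using ab box_subset_cbox by blast
    have l1: "locally_integrable U g1" and l2: "locally_integrable U g2"
      using g1 g2 by (auto simp: has_weak_deriv_def)
    have m1: "g1 \<in> borel_measurable (lebesgue_on ?W)" and m2: "g2 \<in> borel_measurable (lebesgue_on ?W)"
      by (rule locally_integrable_measurable[OF l1 ab], rule locally_integrable_measurable[OF l2 ab])
    obtain h1 where h1: "h1 \<in> borel_measurable borel" "\<And>x. x \<notin> ?W \<Longrightarrow> h1 x = 0" "AE x in lborel. x \<in> ?W \<longrightarrow> h1 x = g1 x"
      using borel_representative[OF m1 W(1)] by blast
    obtain h2 where h2: "h2 \<in> borel_measurable borel" "\<And>x. x \<notin> ?W \<Longrightarrow> h2 x = 0" "AE x in lborel. x \<in> ?W \<longrightarrow> h2 x = g2 x"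
      using borel_representative[OF m2 W(1)] by blast
    have int: "integrable lborel h" if h: "h \<in> borel_measurable borel" "\<And>x. x \<notin> ?W \<Longrightarrow> h x = 0" "AE x in lborel. x \<in> ?W \<longrightarrow> h x = g x"
      and g: "locally_integrable U g" for h g
    proof -
      have "integrable (lebesgue_on (cbox a b)) g" using g ab by (auto simp: locally_integrable_def)
      then have "integrable lebesgue (\<lambda>x. indicator (cbox a b) x * g x)"
        by (subst (asm) integrable_restrict_space) auto
      then have "integrable lebesgue (\<lambda>x. indicator ?W x * (indicator (cbox a b) x * g x))"
        using integrable_mult_indicator[of ?W lebesgue "\<lambda>x. indicator (cbox a b) x * g x"] by simp
      note a = this
      have b: "AE x in lebesgue. indicator ?W x * (indicator (cbox a b) x * g x) = h x"
        using AE_completion[OF h(3)] by eventually_elim (use h(2) box_subset_cbox[of a b] in \<open>auto simp: indicator_def\<close>)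
      have c: "h \<in> borel_measurable lebesgue" by (rule measurable_completion) (use h(1) in simp)
      have "integrable lebesgue h" by (rule integrable_cong_AE_imp[OF a c b])
      then show ?thesis using h(1) by (simp add: integrable_completion)
    qed
    have i1: "integrable lborel h1" by (rule int[OF h1 l1])
    have i2: "integrable lborel h2" by (rule int[OF h2 l2])
    have "AE x in lborel. x \<in> ?W \<longrightarrow> h1 x - h2 x = 0"
    proof (rule box_integral_eq_zero[OF _ W])
      show "integrable lborel (\<lambda>x. h1 x - h2 x)" using i1 i2 by simp
      fix \<epsilon> r :: real and q x :: "real^'n::{finite,linorder}"
      assume q: "\<And>z. z \<in> cbox 0 1 \<Longrightarrow> q + r *\<^sub>R z \<in> ?W" and e: "0 < r" "0 < \<epsilon>" "\<epsilon> \<le> 1" and x: "x \<in> ?W"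
      let ?\<phi> = "tjet \<epsilon> q r x zmi"
      have t: "?\<phi> \<in> test_functions ?W"
        using x closure_subset by (intro tjet_test_function W q e) auto
      then have tU: "?\<phi> \<in> test_functions U" using WU by (auto simp: test_functions_def)
      have \<phi>0: "?\<phi> y = 0" if "y \<notin> ?W" for y
        using t that closure_subset[of "{y. ?\<phi> y \<noteq> 0}"] unfolding test_functions_def by blast
      have eq: "(LINT x|lebesgue_on U. g x * ?\<phi> x) = (\<integral>y. h y * ?\<phi> y \<partial>lborel)"
        if g: "g \<in> borel_measurable (lebesgue_on ?W)" and h: "h \<in> borel_measurable borel" "\<And>x. x \<notin> ?W \<Longrightarrow> h x = 0" "AE x in lborel. x \<in> ?W \<longrightarrow> h x = g x" for g h
      proof -
        have "(LINT x|lebesgue_on U. g x * ?\<phi> x) = (\<integral>x. indicator U x * (g x * ?\<phi> x) \<partial>lebesgue)"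
          using U by (subst integral_restrict_space) auto
        also have "\<dots> = (\<integral>x. indicator ?W x * (g x * ?\<phi> x) \<partial>lebesgue)"
          by (intro Bochner_Integration.integral_cong) (use WU \<phi>0 in \<open>auto simp: indicator_def\<close>)
        also have "\<dots> = (LINT x|lebesgue_on ?W. g x * ?\<phi> x)"
          by (subst integral_restrict_space) auto
        also have "\<dots> = (\<integral>y. h y * ?\<phi> y \<partial>lborel)"
          by (rule integral_representative[OF g W(1) h]) auto
        finally show ?thesis .
      qed
      have w1: "(LINT x|lebesgue_on U. v x * mpartial \<gamma> ?\<phi> x) = (- 1) ^ (\<Sum>i\<in>UNIV. \<gamma> i) * (LINT x|lebesgue_on U. g1 x * ?\<phi> x)"
        using g1 tU unfolding has_weak_deriv_def by blast
      have w2: "(LINT x|lebesgue_on U. v x * mpartial \<gamma> ?\<phi> x) = (- 1) ^ (\<Sum>i\<in>UNIV. \<gamma> i) * (LINT x|lebesgue_on U. g2 x * ?\<phi> x)"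
        using g2 tU unfolding has_weak_deriv_def by blast
      have "(LINT x|lebesgue_on U. g1 x * ?\<phi> x) = (LINT x|lebesgue_on U. g2 x * ?\<phi> x)"
        using trans[OF w1[symmetric] w2] by simp
      moreover have "(LINT x|lebesgue_on U. g1 x * ?\<phi> x) = (\<integral>y. h1 y * ?\<phi> y \<partial>lborel)" by (rule eq[OF m1 h1])
      moreover have "(LINT x|lebesgue_on U. g2 x * ?\<phi> x) = (\<integral>y. h2 y * ?\<phi> y \<partial>lborel)" by (rule eq[OF m2 h2])
      ultimately have z: "(\<integral>y. h1 y * ?\<phi> y \<partial>lborel) = (\<integral>y. h2 y * ?\<phi> y \<partial>lborel)" by simp
      obtain B where B: "\<And>y. \<bar>?\<phi> y\<bar> \<le> B" using tjet_bounded by blast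
      have ip: "integrable lborel (\<lambda>y. h y * ?\<phi> y)" if h: "integrable lborel h" for h
      proof (rule Bochner_Integration.integrable_bound[of _ "\<lambda>y. B * h y"])
        show "integrable lborel (\<lambda>y. B * h y)" using h by simp
        show "(\<lambda>y. h y * ?\<phi> y) \<in> borel_measurable lborel" using h by simp
        show "AE y in lborel. norm (h y * ?\<phi> y) \<le> norm (B * h y)"
        proof (rule AE_I2)
          fix y
          have "\<bar>h y\<bar> * \<bar>?\<phi> y\<bar> \<le> \<bar>h y\<bar> * \<bar>B\<bar>" using B[of y] by (intro mult_left_mono) auto
          then show "norm (h y * ?\<phi> y) \<le> norm (B * h y)" by (simp add: abs_mult mult.commute)
        qed
      qed
      have "(\<integral>y. (h1 y - h2 y) * ?\<phi> y \<partial>lborel) = (\<integral>y. h1 y * ?\<phi> y \<partial>lborel) - (\<integral>y. h2 y * ?\<phi> y \<partial>lborel)"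
        unfolding left_diff_distrib by (rule Bochner_Integration.integral_diff[OF ip[OF i1] ip[OF i2]])
      then show "(\<integral>y. (h1 y - h2 y) * ?\<phi> y \<partial>lborel) = 0" using z by simp
    qed
    then show ?thesis using h1(3) h2(3) by eventually_elim auto
  qed simp
  have "\<exists>D. countable D \<and> (\<forall>X\<in>D. X \<subseteq> U \<and> (\<exists>a b. X = cbox a b)) \<and> \<Union>D = U"
  proof (rule open_countable_Union_open_cbox[OF U])
    fix D :: "(real^'n::{finite,linorder}) set set"
    assume "countable D" "D \<subseteq> Pow U" "\<And>X. X \<in> D \<Longrightarrow> \<exists>a b. X = cbox a b" "\<Union>D = U"
    then show ?thesis by (intro exI[of _ D]) blast
  qed
  then obtain D where D: "countable D" "\<forall>X\<in>D. X \<subseteq> U \<and> (\<exists>a b. X = cbox a b)" "\<Union>D = U"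
    by (elim exE conjE)
  have "AE x in lborel. \<forall>X\<in>D. x \<in> X \<longrightarrow> g1 x = g2 x"
  proof (subst AE_ball_countable[OF D(1)], rule ballI)
    fix X assume "X \<in> D"
    then obtain a b where X: "X = cbox a b" "cbox a b \<subseteq> U" using D(2) by metis
    have "negligible (cbox a b - box a b)" by (rule negligible_frontier_interval)
    then obtain N where N: "N \<in> null_sets lborel" "cbox a b - box a b \<subseteq> N"
      by (auto simp: negligible_iff_null_sets null_sets_completion_iff2)
    show "AE x in lborel. x \<in> X \<longrightarrow> g1 x = g2 x"
      using loc[OF X(2)] AE_not_in[OF N(1)] by eventually_elim (use N(2) X(1) in auto)
  qed
  then show ?thesis
  proof eventually_elim
    fix x assume a: "\<forall>X\<in>D. x \<in> X \<longrightarrow> g1 x = g2 x"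
    show "x \<in> U \<longrightarrow> g1 x = g2 x" using a D(3) by blast
  qed
qed

section \<open>Transfer to scaled simplices\<close>

definition dmap :: "('n::finite \<Rightarrow> real) \<Rightarrow> real^'n \<Rightarrow> real^'n" where
  "dmap \<alpha> x = (\<chi> i. \<alpha> i * x $ i)"

definition apow :: "('n::finite \<Rightarrow> real) \<Rightarrow> ('n \<Rightarrow> nat) \<Rightarrow> real" where
  "apow \<alpha> \<gamma> = (\<Prod>i\<in>UNIV. \<alpha> i ^ \<gamma> i)"

lemma apow_inc: "apow \<alpha> (inc \<gamma> i) = \<alpha> i * apow \<alpha> \<gamma>"
proof -
  have "apow \<alpha> (inc \<gamma> i) = \<alpha> i ^ inc \<gamma> i i * (\<Prod>j\<in>UNIV - {i}. \<alpha> j ^ inc \<gamma> i j)"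
    unfolding apow_def by (rule prod.remove) auto
  also have "(\<Prod>j\<in>UNIV - {i}. \<alpha> j ^ inc \<gamma> i j) = (\<Prod>j\<in>UNIV - {i}. \<alpha> j ^ \<gamma> j)"
    by (intro prod.cong) auto
  also have "\<alpha> i ^ inc \<gamma> i i * (\<Prod>j\<in>UNIV - {i}. \<alpha> j ^ \<gamma> j) = \<alpha> i * (\<alpha> i ^ \<gamma> i * (\<Prod>j\<in>UNIV - {i}. \<alpha> j ^ \<gamma> j))"
    by (simp add: mult.assoc)
  also have "\<alpha> i ^ \<gamma> i * (\<Prod>j\<in>UNIV - {i}. \<alpha> j ^ \<gamma> j) = apow \<alpha> \<gamma>"
    unfolding apow_def by (rule prod.remove[symmetric]) auto
  finally show ?thesis .
qed

lemma apow_zero: "apow \<alpha> zmi = 1"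
  by (simp add: apow_def)

lemma apow_add: "apow \<alpha> (\<lambda>i. \<gamma> i + \<eta> i) = apow \<alpha> \<gamma> * apow \<alpha> \<eta>"
  by (simp add: apow_def power_add prod.distrib)

lemma linear_dmap: "linear (dmap \<alpha>)"
  by (intro linearI) (auto simp: dmap_def vec_eq_iff algebra_simps)

lemma has_derivative_dmap: "(dmap \<alpha> has_derivative dmap \<alpha>) (at x)"
  by (intro bounded_linear_imp_has_derivative) (simp add: linear_linear linear_dmap)

lemma continuous_dmap: "continuous_on S (dmap \<alpha>)"
  by (rule linear_continuous_on) (simp add: linear_linear linear_dmap)

lemma dmap_measurable [measurable]: "dmap \<alpha> \<in> borel_measurable borel"
  by (rule borel_measurable_continuous_onI[OF continuous_dmap])

lemma jet_dmap:
  assumes "jet G"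
  shows "jet (\<lambda>\<gamma> x. apow \<alpha> \<gamma> * G \<gamma> (dmap \<alpha> x))"
  unfolding jet_def
proof (intro allI)
  fix \<gamma> and x :: "real^'a"
  from has_derivative_compose[OF has_derivative_dmap jetD[OF assms, of \<gamma> "dmap \<alpha> x" UNIV]]
  have "((\<lambda>x. apow \<alpha> \<gamma> * G \<gamma> (dmap \<alpha> x)) has_derivative
     (\<lambda>h. apow \<alpha> \<gamma> * (\<Sum>i\<in>UNIV. dmap \<alpha> h $ i * G (inc \<gamma> i) (dmap \<alpha> x)))) (at x)"
    by (rule has_derivative_mult_right)
  moreover have "apow \<alpha> \<gamma> * (\<Sum>i\<in>UNIV. dmap \<alpha> h $ i * G (inc \<gamma> i) (dmap \<alpha> x))
    = (\<Sum>i\<in>UNIV. h $ i * (apow \<alpha> (inc \<gamma> i) * G (inc \<gamma> i) (dmap \<alpha> x)))" for h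
    unfolding apow_inc by (simp add: sum_distrib_left mult_ac dmap_def)
  ultimately show "((\<lambda>x. apow \<alpha> \<gamma> * G \<gamma> (dmap \<alpha> x)) has_derivative
     (\<lambda>h. \<Sum>i\<in>UNIV. h $ i * (apow \<alpha> (inc \<gamma> i) * G (inc \<gamma> i) (dmap \<alpha> x)))) (at x)"
    by (simp only:)
qed

lemma nn_integral_dmap:
  fixes h :: "real^'n::finite \<Rightarrow> ennreal"
  assumes [measurable]: "h \<in> borel_measurable borel" and \<alpha>: "\<And>i. 0 < \<alpha> i"
  shows "ennreal (\<Prod>i\<in>UNIV. \<alpha> i) * (\<integral>\<^sup>+x. h (dmap \<alpha> x) \<partial>lborel) = (\<integral>\<^sup>+x. h x \<partial>lborel)"
proof -
  define c where "c b = (\<chi> i. \<alpha> i) \<bullet> b" for b :: "real^'n"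
  have ci: "c (axis i 1) = \<alpha> i" for i by (simp add: c_def inner_axis)
  have inj: "inj (\<lambda>i. axis i (1::real) :: real^'n)" by (auto simp: inj_def axis1_eq_iff)
  have T: "0 + (\<Sum>j\<in>Basis. (c j * (x \<bullet> j)) *\<^sub>R j) = dmap \<alpha> x" for x :: "real^'n"
  proof -
    have "(\<Sum>j\<in>Basis. (c j * (x \<bullet> j)) *\<^sub>R j) = (\<Sum>i\<in>UNIV. (\<alpha> i * x $ i) *\<^sub>R axis i 1)"
      unfolding Basis_range_axis by (subst sum.reindex[OF inj]) (simp add: ci inner_axis)
    also have "\<dots> = dmap \<alpha> x"
    proof (subst vec_eq_iff, rule allI)
      fix l
      have "(\<Sum>i\<in>UNIV. (\<alpha> i * x $ i) *\<^sub>R axis i (1::real)) $ l = (\<Sum>i\<in>UNIV. if i = l then \<alpha> i * x $ i else 0)"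
        unfolding sum_component by (intro sum.cong) (auto simp: axis_def)
      then show "(\<Sum>i\<in>UNIV. (\<alpha> i * x $ i) *\<^sub>R axis i (1::real)) $ l = dmap \<alpha> x $ l" by (simp add: dmap_def)
    qed
    finally show ?thesis by simp
  qed
  have P: "(\<Prod>j\<in>Basis. \<bar>c j\<bar>) = (\<Prod>i\<in>UNIV. \<alpha> i)"
    unfolding Basis_range_axis by (subst prod.reindex[OF inj]) (simp add: ci \<alpha> less_imp_le)
  have "lborel = density (distr lborel borel (dmap \<alpha>)) (\<lambda>_. ennreal (\<Prod>i\<in>UNIV. \<alpha> i))"
  proof -
    have nz: "c j \<noteq> 0" if "j \<in> Basis" for j
      using that \<alpha> unfolding Basis_range_axis by (force simp: ci less_imp_neq[symmetric])
    show ?thesis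
      using lborel_affine_euclidean[of c 0] nz unfolding T P by blast
  qed
  then have "(\<integral>\<^sup>+x. h x \<partial>lborel) = (\<integral>\<^sup>+x. h x \<partial>density (distr lborel borel (dmap \<alpha>)) (\<lambda>_. ennreal (\<Prod>i\<in>UNIV. \<alpha> i)))"
    by (rule arg_cong[where f="\<lambda>M. integral\<^sup>N M h"])
  also have "\<dots> = ennreal (\<Prod>i\<in>UNIV. \<alpha> i) * (\<integral>\<^sup>+x. h (dmap \<alpha> x) \<partial>lborel)"
    by (simp add: nn_integral_density nn_integral_distr nn_integral_cmult)
  finally show ?thesis ..
qed

definition scaled_sx :: "('n::finite \<Rightarrow> real) \<Rightarrow> (real^'n) set" where
  "scaled_sx \<alpha> = dmap \<alpha> ` std_sx"

lemma lat_subset_std_sx: "1 \<le> k \<Longrightarrow> lat k k \<subseteq> std_sx"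
proof
  fix x assume k: "1 \<le> k" and "x \<in> lat k k"
  then obtain a where a: "x = (\<chi> i. real (a i) / real k)" "(\<Sum>i\<in>UNIV. a i) \<le> k" by (auto simp: lat_def)
  have "(\<Sum>i\<in>UNIV. x $ i) = real (\<Sum>i\<in>UNIV. a i) / real k" by (simp add: a sum_divide_distrib)
  also have "\<dots> \<le> 1" using a k by (simp only: of_nat_le_iff divide_le_eq_1) simp
  finally show "x \<in> std_sx" by (simp add: std_sx_def a)
qed

lemma ennreal_recip: "0 < V \<Longrightarrow> X = ennreal (1 / V) * (ennreal V * X)"
  by (simp add: mult.assoc[symmetric] ennreal_mult[symmetric])

lemma powr_le_cancel_base:
  fixes X Y p :: real
  assumes "0 < p" "0 \<le> Y" "X powr p \<le> Y powr p"
  shows "X \<le> Y"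
  by (rule ccontr) (use assms powr_less_mono2[of p Y X] in auto)

lemma powr_recip_cancel: "0 < (V::real) \<Longrightarrow> V powr (1 / p) * V powr (- 1 / p) = 1"
  by (simp add: powr_add[symmetric])

lemma powr_recip_neg: "0 < (V::real) \<Longrightarrow> p \<noteq> 0 \<Longrightarrow> (V powr (- 1 / p)) powr p = 1 / V"
  unfolding powr_powr by (simp add: powr_minus_divide)

text \<open>\<open>g \<gamma>\<close> stands for a Borel representative of the weak derivative of order \<open>\<gamma>\<close>; the weak derivative
  identity is only needed for the test functions \<open>tjet\<close>.\<close>

locale sob_data =
  fixes \<alpha> :: "'n::{finite,linorder} \<Rightarrow> real" and k :: nat and g :: "('n \<Rightarrow> nat) \<Rightarrow> real^'n::{finite,linorder} \<Rightarrow> real"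
    and u :: "real^'n::{finite,linorder} \<Rightarrow> real" and U
  assumes \<alpha>: "\<And>i. 0 < \<alpha> i" "\<And>i. \<alpha> i \<le> 1" and k: "1 \<le> k"
    and U_def: "U = interior (scaled_sx \<alpha>)"
    and g_int: "\<And>\<gamma>. (\<Sum>i\<in>UNIV. \<gamma> i) \<le> k + 1 \<Longrightarrow> integrable lborel (g \<gamma>)"
    and wd: "\<And>\<gamma> \<epsilon> q r x. (\<Sum>i\<in>UNIV. \<gamma> i) \<le> k + 1 \<Longrightarrow> tjet \<epsilon> q r x zmi \<in> test_functions U \<Longrightarrow>
      (\<integral>y. g zmi y * mpartial \<gamma> (tjet \<epsilon> q r x zmi) y \<partial>lborel) = (- 1) ^ (\<Sum>i\<in>UNIV. \<gamma> i) * (\<integral>y. g \<gamma> y * tjet \<epsilon> q r x zmi y \<partial>lborel)"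
    and u_cont: "continuous_on (scaled_sx \<alpha>) u" and u_lat: "\<And>x. x \<in> lat k k \<Longrightarrow> u (dmap \<alpha> x) = 0"
    and u_eq: "AE x in lborel. x \<in> U \<longrightarrow> u x = g zmi x"
begin

lemma compact_sx: "compact (scaled_sx \<alpha>)"
  unfolding scaled_sx_def by (intro compact_continuous_image continuous_dmap compact_std_sx)

lemma convex_sx: "convex (scaled_sx \<alpha>)"
  unfolding scaled_sx_def by (intro convex_linear_image linear_dmap convex_std_sx)

lemma open_U: "open U" and convex_U: "convex U" and bounded_U: "bounded U"
  unfolding U_def using convex_sx compact_sx
  by (auto simp: convex_interior intro: bounded_interior compact_imp_bounded)

lemma U_nonempty: "U \<noteq> {}"
proof -
  let ?B = "box 0 (\<chi> i. \<alpha> i / real CARD('n)) :: (real^'n::{finite,linorder}) set"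
  have "?B \<subseteq> scaled_sx \<alpha>"
  proof
    fix x assume x: "x \<in> ?B"
    define y where "y = (\<chi> i. x $ i / \<alpha> i)"
    have "0 \<le> y $ i" "y $ i \<le> 1 / real CARD('n)" for i
      using x \<alpha>(1)[of i] by (auto simp: y_def mem_box_cart less_imp_le field_simps)
    moreover from this(2) have "(\<Sum>i\<in>UNIV. y $ i) \<le> (\<Sum>i\<in>(UNIV::'n set). 1 / real CARD('n))" by (intro sum_mono)
    ultimately have "y \<in> std_sx" by (simp add: std_sx_def)
    moreover have "x = dmap \<alpha> y" using \<alpha>(1) by (auto simp: y_def dmap_def vec_eq_iff less_imp_neq[symmetric])
    ultimately show "x \<in> scaled_sx \<alpha>" unfolding scaled_sx_def by blast
  qed
  then have "?B \<subseteq> U" unfolding U_def by (rule interior_maximal) (rule open_box)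
  moreover have "(\<chi> i. \<alpha> i / (2 * real CARD('n))) \<in> ?B"
    using \<alpha>(1) by (simp add: mem_box_cart field_simps)
  ultimately show ?thesis by blast
qed

lemma closure_U: "closure U = scaled_sx \<alpha>"
proof -
  have "closure U = closure (scaled_sx \<alpha>)"
    unfolding U_def by (rule convex_closure_interior[OF convex_sx]) (use U_nonempty U_def in simp)
  then show ?thesis using compact_sx by (simp add: compact_imp_closed closure_closed)
qed

lemma sx_subset: "U \<subseteq> scaled_sx \<alpha>"
  unfolding U_def by (rule interior_subset)

lemma moljet_contr_avg:
  assumes \<gamma>: "(\<Sum>i\<in>UNIV. \<gamma> i) \<le> k + 1" and q: "\<forall>z\<in>cbox 0 1. q + r *\<^sub>R z \<in> U" and e: "0 < r" "0 < \<epsilon>" "\<epsilon> \<le> 1 / 2"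
    and x: "x \<in> scaled_sx \<alpha>"
  shows "moljet \<epsilon> q r (g zmi) \<gamma> x = (1 - \<epsilon>) ^ (\<Sum>i\<in>UNIV. \<gamma> i) * contr_avg \<epsilon> q r (g \<gamma>) x"
proof (rule moljet_eq)
  have "tjet \<epsilon> q r x zmi \<in> test_functions U"
    using q e x by (intro tjet_test_function convex_U open_U) (auto simp: closure_U)
  then show "(\<integral>y. g zmi y * mpartial \<gamma> (tjet \<epsilon> q r x zmi) y \<partial>lborel) = (- 1) ^ (\<Sum>i\<in>UNIV. \<gamma> i) * (\<integral>y. g \<gamma> y * tjet \<epsilon> q r x zmi y \<partial>lborel)"
    by (rule wd[OF \<gamma>])
qed (use g_int[OF \<gamma>] e in auto)

lemma moljet_abs_le:
  assumes "(\<Sum>i\<in>UNIV. \<gamma> i) \<le> k + 1" "\<forall>z\<in>cbox 0 1. q + r *\<^sub>R z \<in> U" "0 < r" "0 < \<epsilon>" "\<epsilon> \<le> 1 / 2" "x \<in> scaled_sx \<alpha>"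
  shows "\<bar>moljet \<epsilon> q r (g zmi) \<gamma> x\<bar> \<le> \<bar>contr_avg \<epsilon> q r (g \<gamma>) x\<bar>"
proof -
  have "(1 - \<epsilon>) ^ (\<Sum>i\<in>UNIV. \<gamma> i) \<le> 1" using assms by (intro power_le_one) auto
  then have "(1 - \<epsilon>) ^ (\<Sum>i\<in>UNIV. \<gamma> i) * \<bar>contr_avg \<epsilon> q r (g \<gamma>) x\<bar> \<le> 1 * \<bar>contr_avg \<epsilon> q r (g \<gamma>) x\<bar>"
    by (rule mult_right_mono) simp
  then show ?thesis
    unfolding moljet_contr_avg[OF assms] using assms by (simp add: abs_mult power_abs)
qed

text \<open>At a lattice point the average is taken over points at distance at most
  \<open>\<epsilon> * R\<close>, where \<open>g zmi\<close> agrees almost everywhere with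
  \<open>u\<close>; and \<open>u\<close> is uniformly continuous and vanishes at the lattice
  point.\<close>

lemma lattice_small:
  assumes q: "\<forall>z\<in>cbox 0 1. q + r *\<^sub>R z \<in> U" and r: "0 < r" and \<delta>: "0 < \<delta>"
  shows "\<exists>e0>0. \<forall>\<epsilon>. 0 < \<epsilon> \<and> \<epsilon> < e0 \<and> \<epsilon> \<le> 1 / 2 \<longrightarrow> (\<forall>x\<in>lat k k. \<bar>moljet \<epsilon> q r (g zmi) zmi (dmap \<alpha> x)\<bar> \<le> \<delta>)"
proof -
  have "uniformly_continuous_on (scaled_sx \<alpha>) u"
    by (rule compact_uniformly_continuous[OF u_cont compact_sx])
  then obtain \<eta> where \<eta>: "0 < \<eta>" "\<And>x y. x \<in> scaled_sx \<alpha> \<Longrightarrow> y \<in> scaled_sx \<alpha> \<Longrightarrow> dist y x < \<eta> \<Longrightarrow> dist (u y) (u x) < \<delta>"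
    unfolding uniformly_continuous_on_def using \<delta> by metis
  obtain R0 where R0: "\<And>x. x \<in> scaled_sx \<alpha> \<Longrightarrow> norm x \<le> R0"
    using compact_imp_bounded[OF compact_sx] unfolding bounded_iff by blast
  define R where "R = 2 * \<bar>R0\<bar> + 1"
  have R: "0 < R" by (simp add: R_def)
  have dR: "dist x y \<le> R" if "x \<in> scaled_sx \<alpha>" "y \<in> scaled_sx \<alpha>" for x y
    using R0[OF that(1)] R0[OF that(2)] norm_triangle_ineq4[of x y] by (simp add: dist_norm R_def)
  show ?thesis
  proof (intro exI[of _ "\<eta> / R"] conjI allI impI ballI)
    show "0 < \<eta> / R" using \<eta> R by simp
    fix \<epsilon> and x :: "real^'n::{finite,linorder}" assume e: "0 < \<epsilon> \<and> \<epsilon> < \<eta> / R \<and> \<epsilon> \<le> 1 / 2" and x: "x \<in> lat k k"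
    let ?X = "dmap \<alpha> x"
    have X: "?X \<in> scaled_sx \<alpha>" using x lat_subset_std_sx[OF k] unfolding scaled_sx_def by blast
    have "AE z in lborel. ymap \<epsilon> q r ?X z \<in> U \<longrightarrow> u (ymap \<epsilon> q r ?X z) = g zmi (ymap \<epsilon> q r ?X z)"
      unfolding ymap_z using e r by (intro AE_affine[OF u_eq]) auto
    then have ae: "AE z in bump_measure. ymap \<epsilon> q r ?X z \<in> U \<longrightarrow> u (ymap \<epsilon> q r ?X z) = g zmi (ymap \<epsilon> q r ?X z)"
      by (rule AE_bump_measureI)
    have small: "AE z in bump_measure. \<bar>g zmi (ymap \<epsilon> q r ?X z)\<bar> \<le> \<delta>"
      using ae AE_bump_measure_cbox
    proof eventually_elim
      fix z :: "real^'n::{finite,linorder}" assume z: "z \<in> cbox 0 1" and eq: "ymap \<epsilon> q r ?X z \<in> U \<longrightarrow> u (ymap \<epsilon> q r ?X z) = g zmi (ymap \<epsilon> q r ?X z)"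
      have qz: "q + r *\<^sub>R z \<in> U" using q z by blast
      have y: "ymap \<epsilon> q r ?X z \<in> U"
        using e X qz by (intro ymap_in convex_U open_U) (auto simp: closure_U)
      have "ymap \<epsilon> q r ?X z - ?X = \<epsilon> *\<^sub>R ((q + r *\<^sub>R z) - ?X)" by (simp add: ymap_def algebra_simps)
      then have "dist (ymap \<epsilon> q r ?X z) ?X = \<epsilon> * dist (q + r *\<^sub>R z) ?X" using e by (simp add: dist_norm)
      also have "\<dots> \<le> \<epsilon> * R" using e dR[of "q + r *\<^sub>R z" ?X] qz sx_subset X by (intro mult_left_mono) auto
      also have "\<dots> < \<eta>" using e R by (simp add: field_simps)
      finally have "dist (u (ymap \<epsilon> q r ?X z)) (u ?X) < \<delta>" using X y sx_subset by (intro \<eta>(2)) auto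
      then show "\<bar>g zmi (ymap \<epsilon> q r ?X z)\<bar> \<le> \<delta>" using u_lat[OF x] eq y by (simp add: dist_real_def)
    qed
    have i: "integrable lborel (g zmi)" by (rule g_int) simp
    have "\<bar>moljet \<epsilon> q r (g zmi) zmi ?X\<bar> \<le> \<bar>contr_avg \<epsilon> q r (g zmi) ?X\<bar>"
      using e by (intro moljet_abs_le q r X) auto
    also have "\<dots> \<le> (\<integral>z. \<bar>g zmi (ymap \<epsilon> q r ?X z)\<bar> \<partial>bump_measure)"
      unfolding contr_avg_def by (rule integral_abs_bound)
    also have "\<dots> \<le> \<delta>"
      using contr_avg_integrable[OF i, of \<epsilon> r q ?X] e r small by (intro bump_prob.integral_le_const) auto
    finally show "\<bar>moljet \<epsilon> q r (g zmi) zmi ?X\<bar> \<le> \<delta>" .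
  qed
qed

lemma moljet_AE_lim:
  assumes "AE x in lborel. x \<in> U \<longrightarrow> (\<lambda>n. contr_avg (\<epsilon> n) q r (g \<gamma>) x) \<longlonglongrightarrow> g \<gamma> x" and \<epsilon>0: "\<epsilon> \<longlonglongrightarrow> 0"
    and "(\<Sum>i\<in>UNIV. \<gamma> i) \<le> k + 1" "\<forall>z\<in>cbox 0 1. q + r *\<^sub>R z \<in> U" "0 < r" "\<forall>n. 0 < \<epsilon> n" "\<forall>n. \<epsilon> n \<le> 1 / 2"
  shows "AE x in lborel. x \<in> U \<longrightarrow> (\<lambda>n. moljet (\<epsilon> n) q r (g zmi) \<gamma> x) \<longlonglongrightarrow> g \<gamma> x"
  using assms(1)
proof eventually_elim
  fix x assume l: "x \<in> U \<longrightarrow> (\<lambda>n. contr_avg (\<epsilon> n) q r (g \<gamma>) x) \<longlonglongrightarrow> g \<gamma> x"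
  show "x \<in> U \<longrightarrow> (\<lambda>n. moljet (\<epsilon> n) q r (g zmi) \<gamma> x) \<longlonglongrightarrow> g \<gamma> x"
  proof
    assume x: "x \<in> U"
    have "(\<lambda>n. (1 - \<epsilon> n) ^ (\<Sum>i\<in>UNIV. \<gamma> i) * contr_avg (\<epsilon> n) q r (g \<gamma>) x) \<longlonglongrightarrow> (1 - 0) ^ (\<Sum>i\<in>UNIV. \<gamma> i) * g \<gamma> x"
      using l x by (intro tendsto_intros \<epsilon>0) auto
    moreover have "moljet (\<epsilon> n) q r (g zmi) \<gamma> x = (1 - \<epsilon> n) ^ (\<Sum>i\<in>UNIV. \<gamma> i) * contr_avg (\<epsilon> n) q r (g \<gamma>) x" for n
      using assms x sx_subset by (intro moljet_contr_avg) auto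
    ultimately show "(\<lambda>n. moljet (\<epsilon> n) q r (g zmi) \<gamma> x) \<longlonglongrightarrow> g \<gamma> x" by simp
  qed
qed

section \<open>Estimates transported from the reference simplex\<close>

lemma apow_pos: "0 < apow \<alpha> \<gamma>"
  unfolding apow_def using \<alpha>(1) by (intro prod_pos) simp

lemma apow_le_1: "apow \<alpha> \<gamma> \<le> 1"
  unfolding apow_def using \<alpha> by (intro prod_le_1) (auto simp: less_imp_le power_le_one)

text \<open>The averaged function pulled back to the reference simplex;
  \<open>apow \<alpha> \<gamma>\<close> is the chain-rule factor of the diagonal map.\<close>

definition hjet :: "real \<Rightarrow> real^'n::{finite,linorder} \<Rightarrow> real \<Rightarrow> ('n \<Rightarrow> nat) \<Rightarrow> real^'n::{finite,linorder} \<Rightarrow> real" where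
  "hjet \<epsilon> q r = (\<lambda>\<gamma> x. apow \<alpha> \<gamma> * moljet \<epsilon> q r (g zmi) \<gamma> (dmap \<alpha> x))"

lemma jet_hjet: "jet (hjet \<epsilon> q r)"
  unfolding hjet_def by (intro jet_dmap jet_moljet g_int) simp

text \<open>On the reference simplex the derivatives on the right carry \<open>apow \<alpha>
  (\<lambda>i. \<gamma> i + \<eta> i) \<le> apow \<alpha> \<gamma>\<close>, which cancels against
  the factor on the left. The lattice error keeps the factor
  \<open>1 / apow \<alpha> \<gamma>\<close>, but \<open>\<alpha>\<close> is fixed while
  \<open>\<delta>\<close> tends to 0.\<close>

lemma sup_transfer:
  assumes C: "0 \<le> C" "\<And>G E B x. jet G \<Longrightarrow> (\<forall>x\<in>lat k k. \<bar>G zmi x\<bar> \<le> E) \<Longrightarrow>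
    (\<forall>\<eta>\<in>multi_indices (k + 1 - m). \<forall>x\<in>std_sx. \<bar>G (\<lambda>i. \<gamma> i + \<eta> i) x\<bar> \<le> B) \<Longrightarrow> x \<in> std_sx \<Longrightarrow> \<bar>G \<gamma> x\<bar> \<le> C * (E + B)"
    and \<gamma>: "(\<Sum>i\<in>UNIV. \<gamma> i) = m" and m: "m \<le> k"
    and B: "\<And>\<eta>. \<eta> \<in> multi_indices (k + 1 - m) \<Longrightarrow> AE x in lborel. \<bar>g (\<lambda>i. \<gamma> i + \<eta> i) x\<bar> \<le> B"
  shows "AE x in lborel. x \<in> U \<longrightarrow> \<bar>g \<gamma> x\<bar> \<le> C * B"
proof -
  from open_contains_cube[OF open_U U_nonempty] obtain q r where r: "0 < r" and q: "\<forall>z\<in>cbox 0 1. q + r *\<^sub>R z \<in> U"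
    by (elim exE conjE)
  let ?a = "apow \<alpha> \<gamma>"
  have a: "0 < ?a" by (rule apow_pos)
  have B0: "0 \<le> B"
  proof -
    obtain \<eta> :: "'n \<Rightarrow> nat" where "\<eta> \<in> multi_indices (k + 1 - m)" using multi_indices_nonempty by blast
    \<comment> \<open>Any single instance of the bound on averages, here
      \<open>\<epsilon> = 1\<close> at the origin, shows that \<open>B\<close> is
      nonnegative.\<close>
    from contr_avg_abs_le[OF g_int _ r B[OF this], of 1 q 0] \<gamma> m this show ?thesis
      by (auto simp: multi_indices_def sum.distrib)
  qed
  have main: "AE x in lborel. x \<in> U \<longrightarrow> \<bar>g \<gamma> x\<bar> \<le> C * \<delta> / ?a + C * B" if \<delta>: "0 < \<delta>" for \<delta>
  proof -
    obtain e0 where e0: "0 < e0" "\<And>\<epsilon> x. 0 < \<epsilon> \<Longrightarrow> \<epsilon> < e0 \<Longrightarrow> \<epsilon> \<le> 1 / 2 \<Longrightarrow> x \<in> lat k k \<Longrightarrow> \<bar>moljet \<epsilon> q r (g zmi) zmi (dmap \<alpha> x)\<bar> \<le> \<delta>"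
      using lattice_small[OF q r \<delta>] by blast
    have g1: "(\<Sum>i\<in>UNIV. \<gamma> i) \<le> k + 1" using \<gamma> m by simp
    from contr_avg_AE_seq[OF g_int[OF g1] open_U convex_U bounded_U q r e0(1)]
    obtain \<epsilon> :: "nat \<Rightarrow> real" where \<epsilon>: "\<forall>n. 0 < \<epsilon> n" "\<forall>n. \<epsilon> n < e0" "\<forall>n. \<epsilon> n \<le> 1 / 2" "\<epsilon> \<longlonglongrightarrow> 0"
      "AE x in lborel. x \<in> U \<longrightarrow> (\<lambda>n. contr_avg (\<epsilon> n) q r (g \<gamma>) x) \<longlonglongrightarrow> g \<gamma> x"
      by (elim exE conjE)
    have bd: "\<bar>moljet (\<epsilon> n) q r (g zmi) \<gamma> x\<bar> \<le> C * \<delta> / ?a + C * B" if x: "x \<in> scaled_sx \<alpha>" for n x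
    proof -
      have e: "0 < \<epsilon> n" "\<epsilon> n < e0" "\<epsilon> n \<le> 1 / 2" using \<epsilon> by auto
      obtain y where y: "y \<in> std_sx" "x = dmap \<alpha> y" using x unfolding scaled_sx_def by blast
      have "\<bar>hjet (\<epsilon> n) q r \<gamma> y\<bar> \<le> C * (\<delta> + ?a * B)"
      proof (rule C(2)[OF jet_hjet _ _ y(1)])
        show "\<forall>x\<in>lat k k. \<bar>hjet (\<epsilon> n) q r zmi x\<bar> \<le> \<delta>"
          using e0(2)[OF e] by (simp add: hjet_def apow_zero)
        show "\<forall>\<eta>\<in>multi_indices (k + 1 - m). \<forall>x\<in>std_sx. \<bar>hjet (\<epsilon> n) q r (\<lambda>i. \<gamma> i + \<eta> i) x\<bar> \<le> ?a * B"
        proof (intro ballI)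
          fix \<eta> :: "'n \<Rightarrow> nat" and x :: "real^'n::{finite,linorder}"
          assume \<eta>: "\<eta> \<in> multi_indices (k + 1 - m)" and x: "x \<in> std_sx"
          have s: "(\<Sum>i\<in>UNIV. \<gamma> i + \<eta> i) \<le> k + 1" using \<eta> \<gamma> m by (simp add: multi_indices_def sum.distrib)
          have "\<bar>moljet (\<epsilon> n) q r (g zmi) (\<lambda>i. \<gamma> i + \<eta> i) (dmap \<alpha> x)\<bar> \<le> \<bar>contr_avg (\<epsilon> n) q r (g (\<lambda>i. \<gamma> i + \<eta> i)) (dmap \<alpha> x)\<bar>"
            using x by (intro moljet_abs_le s q r e) (auto simp: scaled_sx_def)
          also have "\<dots> \<le> B" by (rule contr_avg_abs_le[OF g_int[OF s] e(1) r B[OF \<eta>]])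
          finally have mb: "\<bar>moljet (\<epsilon> n) q r (g zmi) (\<lambda>i. \<gamma> i + \<eta> i) (dmap \<alpha> x)\<bar> \<le> B" .
          have "apow \<alpha> (\<lambda>i. \<gamma> i + \<eta> i) \<le> ?a * 1"
            unfolding apow_add using a by (intro mult_left_mono apow_le_1) simp
          then show "\<bar>hjet (\<epsilon> n) q r (\<lambda>i. \<gamma> i + \<eta> i) x\<bar> \<le> ?a * B"
            unfolding hjet_def abs_mult using mb apow_pos[of "\<lambda>i. \<gamma> i + \<eta> i"] a B0 by (intro mult_mono) auto
        qed
      qed
      then have "?a * \<bar>moljet (\<epsilon> n) q r (g zmi) \<gamma> x\<bar> \<le> C * (\<delta> + ?a * B)"
        using a by (simp add: hjet_def abs_mult y)
      then show ?thesis using a by (simp add: field_simps)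
    qed
    have "AE x in lborel. x \<in> U \<longrightarrow> (\<lambda>n. moljet (\<epsilon> n) q r (g zmi) \<gamma> x) \<longlonglongrightarrow> g \<gamma> x"
      by (rule moljet_AE_lim[OF \<epsilon>(5,4) g1 q r \<epsilon>(1,3)])
    then show ?thesis
    proof eventually_elim
      fix x assume l: "x \<in> U \<longrightarrow> (\<lambda>n. moljet (\<epsilon> n) q r (g zmi) \<gamma> x) \<longlonglongrightarrow> g \<gamma> x"
      show "x \<in> U \<longrightarrow> \<bar>g \<gamma> x\<bar> \<le> C * \<delta> / ?a + C * B"
      proof
        assume x: "x \<in> U"
        then have "(\<lambda>n. \<bar>moljet (\<epsilon> n) q r (g zmi) \<gamma> x\<bar>) \<longlonglongrightarrow> \<bar>g \<gamma> x\<bar>" using l by (intro tendsto_rabs) auto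
        then show "\<bar>g \<gamma> x\<bar> \<le> C * \<delta> / ?a + C * B"
          by (rule LIMSEQ_le_const2) (use bd x sx_subset in blast)
      qed
    qed
  qed
  \<comment> \<open>Countably many tolerances keep the union of the exceptional sets null.\<close>
  have "AE x in lborel. \<forall>n. x \<in> U \<longrightarrow> \<bar>g \<gamma> x\<bar> \<le> C * inverse (real (Suc n)) / ?a + C * B"
    by (subst AE_all_countable) (intro allI main, simp)
  then show ?thesis
  proof eventually_elim
    fix x assume l: "\<forall>n. x \<in> U \<longrightarrow> \<bar>g \<gamma> x\<bar> \<le> C * inverse (real (Suc n)) / ?a + C * B"
    show "x \<in> U \<longrightarrow> \<bar>g \<gamma> x\<bar> \<le> C * B"
    proof
      assume x: "x \<in> U"
      have "(\<lambda>n. C * inverse (real (Suc n)) / ?a + C * B) \<longlonglongrightarrow> C * 0 / ?a + C * B"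
        by (intro tendsto_intros LIMSEQ_inverse_real_of_nat) (use a in simp)
      then show "\<bar>g \<gamma> x\<bar> \<le> C * B" by (intro LIMSEQ_le_const[of _ "C * B"]) (use l x in auto)
    qed
  qed
qed

definition Lg :: "real \<Rightarrow> ('n \<Rightarrow> nat) \<Rightarrow> real" where
  "Lg p \<gamma> = (\<integral>x. \<bar>g \<gamma> x\<bar> powr p \<partial>lborel) powr (1 / p)"

lemma Lg_nonneg: "0 \<le> Lg p \<gamma>" by (simp add: Lg_def)

lemma nn_Lg:
  assumes "integrable lborel (\<lambda>x. \<bar>g \<gamma> x\<bar> powr p)" "1 \<le> p"
  shows "(\<integral>\<^sup>+x. ennreal (\<bar>g \<gamma> x\<bar> powr p) \<partial>lborel) = ennreal (Lg p \<gamma> powr p)"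
proof -
  have "(\<integral>\<^sup>+x. ennreal (\<bar>g \<gamma> x\<bar> powr p) \<partial>lborel) = ennreal (\<integral>x. \<bar>g \<gamma> x\<bar> powr p \<partial>lborel)"
    using assms by (intro nn_integral_eq_integral) auto
  also have "(\<integral>x. \<bar>g \<gamma> x\<bar> powr p \<partial>lborel) = Lg p \<gamma> powr p"
    using assms by (simp add: Lg_def powr_powr)
  finally show ?thesis .
qed

text \<open>The Jacobian of the diagonal map enters as the product of the \<open>\<alpha> i\<close>
  to the power \<open>- 1 / p\<close>, whatever the order of the derivative.
  \<open>nn_moljet_le\<close> produces the inverse factor on the other side of the estimate, and the
  two cancel.\<close>

lemma nmp_hjet_le:
  assumes \<gamma>: "(\<Sum>i\<in>UNIV. \<gamma> i) \<le> k + 1" and q: "\<forall>z\<in>cbox 0 1. q + r *\<^sub>R z \<in> U" and e: "0 < r" "0 < \<epsilon>" "\<epsilon> \<le> 1 / 2"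
    and p: "1 \<le> p" and Lp: "integrable lborel (\<lambda>x. \<bar>g \<gamma> x\<bar> powr p)"
  shows "nmp p (hjet \<epsilon> q r \<gamma>) \<le> apow \<alpha> \<gamma> * ((\<Prod>i\<in>UNIV. \<alpha> i) powr (- 1 / p) * 2 ^ CARD('n) * Lg p \<gamma>)"
proof (rule nmp_leI[OF jet_continuous[OF jet_hjet] p])
  let ?V = "\<Prod>i\<in>UNIV. \<alpha> i" and ?a = "apow \<alpha> \<gamma>" and ?S = "contr_avg \<epsilon> q r (g \<gamma>)"
  have V: "0 < ?V" using \<alpha>(1) by (intro prod_pos) simp
  have a: "0 < ?a" by (rule apow_pos)
  have gi: "integrable lborel (g \<gamma>)" by (rule g_int[OF \<gamma>])
  have [measurable]: "?S \<in> borel_measurable borel" using gi unfolding contr_avg_def by measurable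
  show "0 \<le> ?a * (?V powr (- 1 / p) * 2 ^ CARD('n) * Lg p \<gamma>)" using a Lg_nonneg by simp
  have "(\<integral>\<^sup>+x\<in>std_sx. ennreal (\<bar>hjet \<epsilon> q r \<gamma> x\<bar> powr p) \<partial>lborel)
    \<le> (\<integral>\<^sup>+x. ennreal (?a powr p) * ennreal (\<bar>?S (dmap \<alpha> x)\<bar> powr p) \<partial>lborel)"
  proof (rule nn_integral_mono)
    fix x :: "real^'n::{finite,linorder}"
    show "ennreal (\<bar>hjet \<epsilon> q r \<gamma> x\<bar> powr p) * indicator std_sx x \<le> ennreal (?a powr p) * ennreal (\<bar>?S (dmap \<alpha> x)\<bar> powr p)"
    proof (cases "x \<in> std_sx")
      case True
      have "\<bar>hjet \<epsilon> q r \<gamma> x\<bar> \<le> ?a * \<bar>?S (dmap \<alpha> x)\<bar>"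
        unfolding hjet_def abs_mult using a True
        by (intro mult_mono moljet_abs_le \<gamma> q e) (auto simp: scaled_sx_def)
      then have "\<bar>hjet \<epsilon> q r \<gamma> x\<bar> powr p \<le> (?a * \<bar>?S (dmap \<alpha> x)\<bar>) powr p" using p by (intro powr_mono2) auto
      also have "\<dots> = ?a powr p * \<bar>?S (dmap \<alpha> x)\<bar> powr p" using a by (simp add: powr_mult)
      finally show ?thesis using True by (simp add: ennreal_mult[symmetric] ennreal_leI)
    qed simp
  qed
  also have "\<dots> = ennreal (?a powr p) * (\<integral>\<^sup>+x. ennreal (\<bar>?S (dmap \<alpha> x)\<bar> powr p) \<partial>lborel)"
    by (rule nn_integral_cmult) measurable
  finally have 1: "(\<integral>\<^sup>+x\<in>std_sx. ennreal (\<bar>hjet \<epsilon> q r \<gamma> x\<bar> powr p) \<partial>lborel)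
    \<le> ennreal (?a powr p) * (\<integral>\<^sup>+x. ennreal (\<bar>?S (dmap \<alpha> x)\<bar> powr p) \<partial>lborel)" .
  have "ennreal ?V * (\<integral>\<^sup>+x. ennreal (\<bar>?S (dmap \<alpha> x)\<bar> powr p) \<partial>lborel) = (\<integral>\<^sup>+x. ennreal (\<bar>?S x\<bar> powr p) \<partial>lborel)"
    using \<alpha>(1) by (intro nn_integral_dmap[of "\<lambda>x. ennreal (\<bar>?S x\<bar> powr p)"]) auto
  also have "\<dots> \<le> ennreal (2 ^ CARD('n)) * (\<integral>\<^sup>+x. ennreal (\<bar>g \<gamma> x\<bar> powr p) \<partial>lborel)"
    by (rule contr_avg_powr_le[OF gi e(2,3,1) p])
  also have "\<dots> = ennreal (2 ^ CARD('n) * Lg p \<gamma> powr p)"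
    unfolding nn_Lg[OF Lp p] by (rule ennreal_mult[symmetric]) auto
  finally have 2: "ennreal ?V * (\<integral>\<^sup>+x. ennreal (\<bar>?S (dmap \<alpha> x)\<bar> powr p) \<partial>lborel) \<le> ennreal (2 ^ CARD('n) * Lg p \<gamma> powr p)" .
  have "(\<integral>\<^sup>+x. ennreal (\<bar>?S (dmap \<alpha> x)\<bar> powr p) \<partial>lborel) = ennreal (1 / ?V) * (ennreal ?V * (\<integral>\<^sup>+x. ennreal (\<bar>?S (dmap \<alpha> x)\<bar> powr p) \<partial>lborel))"
    by (rule ennreal_recip[OF V])
  also have "\<dots> \<le> ennreal (1 / ?V) * ennreal (2 ^ CARD('n) * Lg p \<gamma> powr p)"
    by (intro mult_left_mono 2) simp
  finally have "(\<integral>\<^sup>+x\<in>std_sx. ennreal (\<bar>hjet \<epsilon> q r \<gamma> x\<bar> powr p) \<partial>lborel) \<le> ennreal (?a powr p) * (ennreal (1 / ?V) * ennreal (2 ^ CARD('n) * Lg p \<gamma> powr p))"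
    using 1 by (meson mult_left_mono order_trans zero_le)
  also have "\<dots> = ennreal (?a powr p * (1 / ?V * (2 ^ CARD('n) * Lg p \<gamma> powr p)))"
    using V by (simp add: ennreal_mult[symmetric])
  also have "\<dots> \<le> ennreal ((?a * (?V powr (- 1 / p) * 2 ^ CARD('n) * Lg p \<gamma>)) powr p)"
  proof (rule ennreal_leI)
    have x1: "(2::real) ^ CARD('n) \<le> (2 ^ CARD('n)) powr p"
      using p powr_mono[of 1 p "2 ^ CARD('n) :: real"] by simp
    have x2: "(?V powr (- 1 / p)) powr p = 1 / ?V"
      using p by (intro powr_recip_neg V) simp
    have "(?a * (?V powr (- 1 / p) * 2 ^ CARD('n) * Lg p \<gamma>)) powr p = ?a powr p * (1 / ?V * (2 ^ CARD('n)) powr p * Lg p \<gamma> powr p)"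
      unfolding powr_mult x2 ..
    moreover have "?a powr p * (1 / ?V * (2 ^ CARD('n) * Lg p \<gamma> powr p)) \<le> ?a powr p * (1 / ?V * ((2 ^ CARD('n)) powr p * Lg p \<gamma> powr p))"
      using V by (intro mult_left_mono mult_right_mono x1) auto
    ultimately show "?a powr p * (1 / ?V * (2 ^ CARD('n) * Lg p \<gamma> powr p)) \<le> (?a * (?V powr (- 1 / p) * 2 ^ CARD('n) * Lg p \<gamma>)) powr p"
      by (simp only: mult.assoc)
  qed
  finally show "(\<integral>\<^sup>+x\<in>std_sx. ennreal (\<bar>hjet \<epsilon> q r \<gamma> x\<bar> powr p) \<partial>lborel) \<le> ennreal ((?a * (?V powr (- 1 / p) * 2 ^ CARD('n) * Lg p \<gamma>)) powr p)" .
qed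

lemma nn_moljet_le:
  assumes p: "1 \<le> p"
  shows "(\<integral>\<^sup>+x\<in>U. ennreal (\<bar>moljet \<epsilon> q r (g zmi) \<gamma> x\<bar> powr p) \<partial>lborel)
    \<le> ennreal (((\<Prod>i\<in>UNIV. \<alpha> i) powr (1 / p) / apow \<alpha> \<gamma> * nmp p (hjet \<epsilon> q r \<gamma>)) powr p)"
proof -
  let ?V = "\<Prod>i\<in>UNIV. \<alpha> i" and ?a = "apow \<alpha> \<gamma>" and ?M = "moljet \<epsilon> q r (g zmi) \<gamma>"
  have V: "0 < ?V" using \<alpha>(1) by (intro prod_pos) simp
  have a: "0 < ?a" by (rule apow_pos)
  have i0: "integrable lborel (g zmi)" by (rule g_int) simp
  have [measurable]: "?M \<in> borel_measurable borel" by (rule jet_measurable[OF jet_moljet[OF i0]])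
  have [measurable]: "scaled_sx \<alpha> \<in> sets borel" using compact_sx by (simp add: borel_compact)
  let ?h = "\<lambda>x. ennreal (\<bar>?M x\<bar> powr p) * indicator (scaled_sx \<alpha>) x"
  have "(\<integral>\<^sup>+x\<in>U. ennreal (\<bar>?M x\<bar> powr p) \<partial>lborel) \<le> (\<integral>\<^sup>+x. ?h x \<partial>lborel)"
    using sx_subset by (intro nn_integral_mono) (auto simp: indicator_def)
  also have "\<dots> = ennreal ?V * (\<integral>\<^sup>+x. ?h (dmap \<alpha> x) \<partial>lborel)"
    using \<alpha>(1) by (intro nn_integral_dmap[symmetric, of ?h]) auto
  also have "(\<integral>\<^sup>+x. ?h (dmap \<alpha> x) \<partial>lborel) = (\<integral>\<^sup>+x. ennreal ((1 / ?a) powr p) * (ennreal (\<bar>hjet \<epsilon> q r \<gamma> x\<bar> powr p) * indicator std_sx x) \<partial>lborel)"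
  proof (rule nn_integral_cong)
    fix x :: "real^'n::{finite,linorder}"
    have inj: "dmap \<alpha> x \<in> scaled_sx \<alpha> \<longleftrightarrow> x \<in> std_sx"
    proof -
      have "x = y" if "dmap \<alpha> x = dmap \<alpha> y" for y
        using that \<alpha>(1) by (auto simp: dmap_def vec_eq_iff less_imp_neq[symmetric])
      then show ?thesis unfolding scaled_sx_def by blast
    qed
    have "\<bar>?M (dmap \<alpha> x)\<bar> powr p = (1 / ?a * \<bar>hjet \<epsilon> q r \<gamma> x\<bar>) powr p"
      using a by (simp add: hjet_def abs_mult)
    also have "\<dots> = (1 / ?a) powr p * \<bar>hjet \<epsilon> q r \<gamma> x\<bar> powr p" by (rule powr_mult)
    finally have "ennreal (\<bar>?M (dmap \<alpha> x)\<bar> powr p) = ennreal ((1 / ?a) powr p) * ennreal (\<bar>hjet \<epsilon> q r \<gamma> x\<bar> powr p)"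
      by (simp add: ennreal_mult[symmetric])
    then show "?h (dmap \<alpha> x) = ennreal ((1 / ?a) powr p) * (ennreal (\<bar>hjet \<epsilon> q r \<gamma> x\<bar> powr p) * indicator std_sx x)"
      using inj by (simp add: indicator_def)
  qed
  also have "\<dots> = ennreal ((1 / ?a) powr p) * (\<integral>\<^sup>+x\<in>std_sx. ennreal (\<bar>hjet \<epsilon> q r \<gamma> x\<bar> powr p) \<partial>lborel)"
    using jet_measurable[OF jet_hjet] by (intro nn_integral_cmult) auto
  also have "(\<integral>\<^sup>+x\<in>std_sx. ennreal (\<bar>hjet \<epsilon> q r \<gamma> x\<bar> powr p) \<partial>lborel) = ennreal (nmp p (hjet \<epsilon> q r \<gamma>) powr p)"
    by (rule nn_nmp[OF jet_continuous[OF jet_hjet] p])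
  finally have 1: "(\<integral>\<^sup>+x\<in>U. ennreal (\<bar>?M x\<bar> powr p) \<partial>lborel) \<le> ennreal ?V * (ennreal ((1 / ?a) powr p) * ennreal (nmp p (hjet \<epsilon> q r \<gamma>) powr p))"
    by (simp add: mult_left_mono)
  have "ennreal ?V * (ennreal ((1 / ?a) powr p) * ennreal (nmp p (hjet \<epsilon> q r \<gamma>) powr p)) = ennreal (?V * ((1 / ?a) powr p * nmp p (hjet \<epsilon> q r \<gamma>) powr p))"
    using V by (simp add: ennreal_mult[symmetric])
  also have "?V * ((1 / ?a) powr p * nmp p (hjet \<epsilon> q r \<gamma>) powr p) = (?V powr (1 / p) / ?a * nmp p (hjet \<epsilon> q r \<gamma>)) powr p"
  proof -
    have "(?V powr (1 / p) * (1 / ?a) * nmp p (hjet \<epsilon> q r \<gamma>)) powr p = (?V powr (1 / p)) powr p * (1 / ?a) powr p * nmp p (hjet \<epsilon> q r \<gamma>) powr p"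
      by (simp only: powr_mult)
    moreover have "(?V powr (1 / p)) powr p = ?V" using p V by (simp add: powr_powr less_imp_le del: prod_nonneg)
    ultimately show ?thesis by simp
  qed
  finally show ?thesis using 1 by simp
qed

text \<open>The scaling argument of \<open>sup_transfer\<close> in \<open>L^p\<close> norms, with
  cancelling volume factors. The left-hand side passes to the limit by Fatou's lemma along an almost
  everywhere convergent sequence. On the right the uniform bound on averages is enough; its factor
  \<open>2 ^ CARD('n)\<close> stays in the constant.\<close>

lemma fin_transfer:
  assumes C: "jet_bd TYPE('n) p k m C" and p: "1 \<le> p"
    and \<gamma>: "(\<Sum>i\<in>UNIV. \<gamma> i) = m" and m: "m \<le> k"
    and Lp: "\<And>\<delta>. (\<Sum>i\<in>UNIV. \<delta> i) \<le> k + 1 \<Longrightarrow> integrable lborel (\<lambda>x. \<bar>g \<delta> x\<bar> powr p)"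
    and g0: "\<And>x. x \<notin> U \<Longrightarrow> g \<gamma> x = 0"
  shows "Lg p \<gamma> \<le> C * 2 ^ CARD('n) * (\<Sum>\<eta>\<in>multi_indices (k + 1 - m). Lg p (\<lambda>i. \<gamma> i + \<eta> i))"
proof -
  from open_contains_cube[OF open_U U_nonempty] obtain q r where r: "0 < r" and q: "\<forall>z\<in>cbox 0 1. q + r *\<^sub>R z \<in> U"
    by (elim exE conjE)
  let ?V = "\<Prod>i\<in>UNIV. \<alpha> i" and ?a = "apow \<alpha> \<gamma>"
  let ?S = "\<Sum>\<eta>\<in>multi_indices (k + 1 - m). Lg p (\<lambda>i. \<gamma> i + \<eta> i)"
  have V: "0 < ?V" using \<alpha>(1) by (intro prod_pos) simp
  have a: "0 < ?a" by (rule apow_pos)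
  have C0: "0 \<le> C" using C by (simp add: jet_bd_def)
  have S0: "0 \<le> ?S" by (simp add: sum_nonneg Lg_nonneg)
  have g1: "(\<Sum>i\<in>UNIV. \<gamma> i) \<le> k + 1" using \<gamma> m by simp
  have i0: "integrable lborel (g zmi)" by (rule g_int) simp
  have [measurable]: "g \<gamma> \<in> borel_measurable borel" using g_int[OF g1] by simp
  have [measurable]: "moljet \<epsilon> q r (g zmi) \<gamma> \<in> borel_measurable borel" for \<epsilon> by (rule jet_measurable[OF jet_moljet[OF i0]])
  have [measurable]: "U \<in> sets borel" using open_U by simp
  have main: "Lg p \<gamma> \<le> C * ?V powr (1 / p) / ?a * \<delta> + C * 2 ^ CARD('n) * ?S" (is "_ \<le> ?Y \<delta>") if \<delta>: "0 < \<delta>" for \<delta>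
  proof -
    obtain e0 where e0: "0 < e0" "\<And>\<epsilon> x. 0 < \<epsilon> \<Longrightarrow> \<epsilon> < e0 \<Longrightarrow> \<epsilon> \<le> 1 / 2 \<Longrightarrow> x \<in> lat k k \<Longrightarrow> \<bar>moljet \<epsilon> q r (g zmi) zmi (dmap \<alpha> x)\<bar> \<le> \<delta>"
      using lattice_small[OF q r \<delta>] by blast
    from contr_avg_AE_seq[OF g_int[OF g1] open_U convex_U bounded_U q r e0(1)]
    obtain \<epsilon> :: "nat \<Rightarrow> real" where \<epsilon>: "\<forall>n. 0 < \<epsilon> n" "\<forall>n. \<epsilon> n < e0" "\<forall>n. \<epsilon> n \<le> 1 / 2" "\<epsilon> \<longlonglongrightarrow> 0"
      "AE x in lborel. x \<in> U \<longrightarrow> (\<lambda>n. contr_avg (\<epsilon> n) q r (g \<gamma>) x) \<longlonglongrightarrow> g \<gamma> x"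
      by (elim exE conjE)
    have Y0: "0 \<le> ?Y \<delta>" using C0 V a \<delta> S0 by (intro add_nonneg_nonneg mult_nonneg_nonneg divide_nonneg_pos) auto
    have bd: "(\<integral>\<^sup>+x\<in>U. ennreal (\<bar>moljet (\<epsilon> n) q r (g zmi) \<gamma> x\<bar> powr p) \<partial>lborel) \<le> ennreal (?Y \<delta> powr p)" for n
    proof -
      have e: "0 < \<epsilon> n" "\<epsilon> n < e0" "\<epsilon> n \<le> 1 / 2" using \<epsilon> by auto
      have E: "\<forall>x\<in>lat k k. \<bar>hjet (\<epsilon> n) q r zmi x\<bar> \<le> \<delta>"
        using e0(2)[OF e] by (simp add: hjet_def apow_zero)
      have "nmp p (hjet (\<epsilon> n) q r \<gamma>) \<le> C * (\<delta> + (\<Sum>\<eta>\<in>multi_indices (k + 1 - m). nmp p (hjet (\<epsilon> n) q r (\<lambda>i. \<gamma> i + \<eta> i))))"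
        using C \<gamma> jet_hjet E unfolding jet_bd_def by blast
      also have "\<dots> \<le> C * (\<delta> + (\<Sum>\<eta>\<in>multi_indices (k + 1 - m). ?a * (?V powr (- 1 / p) * 2 ^ CARD('n) * Lg p (\<lambda>i. \<gamma> i + \<eta> i))))"
      proof (intro mult_left_mono add_left_mono sum_mono C0)
        fix \<eta> :: "'n \<Rightarrow> nat" assume \<eta>: "\<eta> \<in> multi_indices (k + 1 - m)"
        have s: "(\<Sum>i\<in>UNIV. \<gamma> i + \<eta> i) \<le> k + 1" using \<eta> \<gamma> m by (simp add: multi_indices_def sum.distrib)
        have "nmp p (hjet (\<epsilon> n) q r (\<lambda>i. \<gamma> i + \<eta> i)) \<le> apow \<alpha> (\<lambda>i. \<gamma> i + \<eta> i) * (?V powr (- 1 / p) * 2 ^ CARD('n) * Lg p (\<lambda>i. \<gamma> i + \<eta> i))"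
          by (rule nmp_hjet_le[OF s q r e(1,3) p Lp[OF s]])
        also have "\<dots> \<le> ?a * (?V powr (- 1 / p) * 2 ^ CARD('n) * Lg p (\<lambda>i. \<gamma> i + \<eta> i))"
        proof (rule mult_right_mono)
          show "apow \<alpha> (\<lambda>i. \<gamma> i + \<eta> i) \<le> ?a"
            unfolding apow_add using a apow_le_1[of \<eta>] by (simp add: mult_left_le)
        qed (simp add: Lg_nonneg)
        finally show "nmp p (hjet (\<epsilon> n) q r (\<lambda>i. \<gamma> i + \<eta> i)) \<le> ?a * (?V powr (- 1 / p) * 2 ^ CARD('n) * Lg p (\<lambda>i. \<gamma> i + \<eta> i))" .
      qed
      also have "\<dots> = C * (\<delta> + ?a * (?V powr (- 1 / p) * 2 ^ CARD('n) * ?S))"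
        by (simp add: sum_distrib_left)
      finally have "?V powr (1 / p) / ?a * nmp p (hjet (\<epsilon> n) q r \<gamma>) \<le> ?V powr (1 / p) / ?a * (C * (\<delta> + ?a * (?V powr (- 1 / p) * 2 ^ CARD('n) * ?S)))"
        using a by (intro mult_left_mono) auto
      also have "\<dots> = ?Y \<delta>"
      proof -
        have v: "?V powr (1 / p) * ?V powr (- 1 / p) = 1" by (rule powr_recip_cancel[OF V])
        have "W / A * (C * (\<delta> + A * (W' * T * S))) = C * W / A * \<delta> + C * T * S * (W * W')" if "A \<noteq> 0" for W A W' T S :: real
          using that by (simp add: field_simps)
        from this[of ?a "?V powr (1 / p)" "?V powr (- 1 / p)" "2 ^ CARD('n)" ?S] a v show ?thesis by simp
      qed
      finally have le: "?V powr (1 / p) / ?a * nmp p (hjet (\<epsilon> n) q r \<gamma>) \<le> ?Y \<delta>" .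
      have "(\<integral>\<^sup>+x\<in>U. ennreal (\<bar>moljet (\<epsilon> n) q r (g zmi) \<gamma> x\<bar> powr p) \<partial>lborel) \<le> ennreal ((?V powr (1 / p) / ?a * nmp p (hjet (\<epsilon> n) q r \<gamma>)) powr p)"
        by (rule nn_moljet_le[OF p])
      also have "\<dots> \<le> ennreal (?Y \<delta> powr p)"
        using le p a by (intro ennreal_leI powr_mono2) auto
      finally show ?thesis .
    qed
    let ?F = "\<lambda>n x. ennreal (\<bar>moljet (\<epsilon> n) q r (g zmi) \<gamma> x\<bar> powr p) * indicator U x"
    have "(\<integral>\<^sup>+x. ennreal (\<bar>g \<gamma> x\<bar> powr p) \<partial>lborel) \<le> (\<integral>\<^sup>+x. liminf (\<lambda>n. ?F n x) \<partial>lborel)"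
    proof (rule nn_integral_mono_AE)
      show "AE x in lborel. ennreal (\<bar>g \<gamma> x\<bar> powr p) \<le> liminf (\<lambda>n. ?F n x)"
        using moljet_AE_lim[OF \<epsilon>(5,4) g1 q r \<epsilon>(1,3)]
      proof eventually_elim
        fix x assume l: "x \<in> U \<longrightarrow> (\<lambda>n. moljet (\<epsilon> n) q r (g zmi) \<gamma> x) \<longlonglongrightarrow> g \<gamma> x"
        show "ennreal (\<bar>g \<gamma> x\<bar> powr p) \<le> liminf (\<lambda>n. ?F n x)"
        proof (cases "x \<in> U")
          case True
          have "continuous_on UNIV (\<lambda>t::real. \<bar>t\<bar> powr p)" using p by (intro continuous_on_powr' continuous_intros) auto
          then have "(\<lambda>n. \<bar>moljet (\<epsilon> n) q r (g zmi) \<gamma> x\<bar> powr p) \<longlonglongrightarrow> \<bar>g \<gamma> x\<bar> powr p"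
            using l True by (intro continuous_on_tendsto_compose[of UNIV "\<lambda>t::real. \<bar>t\<bar> powr p"]) auto
          then have "(\<lambda>n. ?F n x) \<longlonglongrightarrow> ennreal (\<bar>g \<gamma> x\<bar> powr p)" using True by (simp add: tendsto_ennrealI)
          then have "liminf (\<lambda>n. ?F n x) = ennreal (\<bar>g \<gamma> x\<bar> powr p)" by (intro lim_imp_Liminf) auto
          then show ?thesis by simp
        next
          case False
          then show ?thesis using g0 p by simp
        qed
      qed
    qed
    also have "\<dots> \<le> liminf (\<lambda>n. \<integral>\<^sup>+x. ?F n x \<partial>lborel)"
      by (rule nn_integral_liminf) measurable
    also have "\<dots> \<le> ennreal (?Y \<delta> powr p)"
      by (rule order_trans[OF Liminf_le_Limsup Limsup_bounded[OF always_eventually]]) (simp, rule allI, rule bd)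
    finally have "ennreal (Lg p \<gamma> powr p) \<le> ennreal (?Y \<delta> powr p)" unfolding nn_Lg[OF Lp[OF g1] p] .
    then have "Lg p \<gamma> powr p \<le> ?Y \<delta> powr p" by simp
    with p show ?thesis by (intro powr_le_cancel_base[of p, OF _ Y0]) linarith+
  qed
  have lim: "(\<lambda>n. ?Y (inverse (real (Suc n)))) \<longlonglongrightarrow> ?Y 0"
    by (intro tendsto_intros LIMSEQ_inverse_real_of_nat)
  have "Lg p \<gamma> \<le> ?Y 0"
    by (rule LIMSEQ_le_const[OF lim]) (intro exI allI impI main, simp)
  then show ?thesis by simp
qed

end

section \<open>Sobolev seminorms\<close>

lemma AE_lebesgue_on_open:
  fixes U :: "'a::euclidean_space set"
  assumes "open U"
  shows "(AE x in lebesgue_on U. P x) \<longleftrightarrow> (AE x in lborel. x \<in> U \<longrightarrow> P x)"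
  using assms by (subst AE_restrict_space_iff) (auto simp: AE_completion_iff)

lemma measurable_lebesgue_on_AE:
  fixes f g :: "'a::euclidean_space \<Rightarrow> real"
  assumes U: "open U" and f: "f \<in> borel_measurable (lebesgue_on U)" and ae: "AE x in lborel. x \<in> U \<longrightarrow> f x = g x"
  shows "g \<in> borel_measurable (lebesgue_on U)"
proof -
  have Us: "U \<in> sets lebesgue" using U by simp
  have "(\<lambda>x. indicator U x * f x) \<in> borel_measurable lebesgue"
    using f Us by (subst (asm) borel_measurable_restrict_space_iff) auto
  moreover have "AE x in lebesgue. indicator U x * f x = indicator U x * g x"
    using AE_completion[OF ae] by eventually_elim (auto simp: indicator_def)
  ultimately have "(\<lambda>x. indicator U x * g x) \<in> borel_measurable lebesgue"
    by (rule borel_measurable_AE)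
  then show ?thesis using Us by (subst borel_measurable_restrict_space_iff) auto
qed

lemma powr_representative:
  fixes f h :: "'a::euclidean_space \<Rightarrow> real"
  assumes f: "f \<in> borel_measurable (lebesgue_on U)" and U: "open U"
    and h[measurable]: "h \<in> borel_measurable borel" and h0: "\<And>x. x \<notin> U \<Longrightarrow> h x = 0" and ae: "AE x in lborel. x \<in> U \<longrightarrow> h x = f x"
  shows "(LINT x|lebesgue_on U. \<bar>f x\<bar> powr p) = (\<integral>x. \<bar>h x\<bar> powr p \<partial>lborel)"
    and "integrable (lebesgue_on U) (\<lambda>x. \<bar>f x\<bar> powr p) \<longleftrightarrow> integrable lborel (\<lambda>x. \<bar>h x\<bar> powr p)"
proof -
  have Us: "U \<in> sets lebesgue" using U by simp
  have fm: "(\<lambda>x. \<bar>f x\<bar> powr p) \<in> borel_measurable (lebesgue_on U)" using f by measurable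
  have hm: "(\<lambda>x. \<bar>h x\<bar> powr p) \<in> borel_measurable borel" by measurable
  have ae': "AE x in lborel. x \<in> U \<longrightarrow> \<bar>h x\<bar> powr p = \<bar>f x\<bar> powr p" using ae by eventually_elim auto
  have h0': "\<bar>h x\<bar> powr p = 0" if "x \<notin> U" for x using h0[OF that] by simp
  have "(LINT x|lebesgue_on U. \<bar>f x\<bar> powr p * 1) = (\<integral>x. \<bar>h x\<bar> powr p * 1 \<partial>lborel)"
    by (rule integral_representative[OF fm U hm h0' ae']) auto
  then show "(LINT x|lebesgue_on U. \<bar>f x\<bar> powr p) = (\<integral>x. \<bar>h x\<bar> powr p \<partial>lborel)" by simp
  have "(\<lambda>x. indicator U x * (\<bar>f x\<bar> powr p)) \<in> borel_measurable lebesgue"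
    using fm Us by (subst (asm) borel_measurable_restrict_space_iff) auto
  moreover have "(\<lambda>x. \<bar>h x\<bar> powr p) \<in> borel_measurable lebesgue" by (rule measurable_completion) simp
  moreover have "AE x in lebesgue. indicator U x * (\<bar>f x\<bar> powr p) = \<bar>h x\<bar> powr p"
    using AE_completion[OF ae'] by eventually_elim (auto simp: indicator_def h0)
  ultimately have "integrable lebesgue (\<lambda>x. indicator U x * (\<bar>f x\<bar> powr p)) \<longleftrightarrow> integrable lebesgue (\<lambda>x. \<bar>h x\<bar> powr p)"
    by (rule integrable_cong_AE)
  then show "integrable (lebesgue_on U) (\<lambda>x. \<bar>f x\<bar> powr p) \<longleftrightarrow> integrable lborel (\<lambda>x. \<bar>h x\<bar> powr p)"
    using Us by (simp add: integrable_restrict_space integrable_completion)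
qed

lemma in_Lp_AE:
  assumes f: "f \<in> borel_measurable M" and "g \<in> borel_measurable M" and ae: "AE x in M. f x = g x" and Lp: "in_Lp p M f"
  shows "in_Lp p M g"
proof (cases "p = \<infinity>")
  case True
  have "esssup M (\<lambda>x. ereal \<bar>g x\<bar>) = esssup M (\<lambda>x. ereal \<bar>f x\<bar>)"
    using assms by (intro esssup_AE_cong) auto
  then show ?thesis using True assms by (simp add: in_Lp_def)
next
  case False
  have "integrable M (\<lambda>x. \<bar>g x\<bar> powr real_of_ereal p) \<longleftrightarrow> integrable M (\<lambda>x. \<bar>f x\<bar> powr real_of_ereal p)"
    using assms by (intro integrable_cong_AE) auto
  then show ?thesis using False assms by (simp add: in_Lp_def)
qed

lemma Lp_infinity_AE:
  assumes "in_Lp \<infinity> M f"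
  shows "AE x in M. \<bar>f x\<bar> \<le> Lp_norm \<infinity> M f"
proof -
  let ?e = "esssup M (\<lambda>x. ereal \<bar>f x\<bar>)"
  have lt: "?e < \<infinity>" using assms by (simp add: in_Lp_def)
  have "AE x in M. ereal \<bar>f x\<bar> \<le> ?e" by (rule esssup_AE)
  then show ?thesis
  proof eventually_elim
    fix x assume "ereal \<bar>f x\<bar> \<le> ?e"
    then show "\<bar>f x\<bar> \<le> Lp_norm \<infinity> M f"
      using lt by (cases ?e) (auto simp: Lp_norm_def)
  qed
qed

lemma Lp_infinity_leI:
  assumes f: "f \<in> borel_measurable M" and ae: "AE x in M. \<bar>f x\<bar> \<le> B" and B: "0 \<le> B"
  shows "Lp_norm \<infinity> M f \<le> B"
proof -
  have "esssup M (\<lambda>x. ereal \<bar>f x\<bar>) \<le> ereal B" using f ae by (intro esssup_I) auto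
  then show ?thesis using B by (cases "esssup M (\<lambda>x. ereal \<bar>f x\<bar>)") (auto simp: Lp_norm_def)
qed

text \<open>The essential supremum of \<open>\<bar>f\<bar>\<close> can be negative only when the
  space is null; it is then \<open>- \<infinity>\<close>, whose real value is 0. For non-measurable
  \<open>f\<close> it is \<open>\<infinity>\<close>, with real value 0 as well.\<close>

lemma Lp_norm_nonneg: "0 \<le> Lp_norm p M f"
proof (cases "p = \<infinity>")
  case True
  let ?e = "esssup M (\<lambda>x. ereal \<bar>f x\<bar>)"
  have "0 \<le> real_of_ereal ?e"
  proof (cases "(\<lambda>x. ereal \<bar>f x\<bar>) \<in> borel_measurable M")
    case m: True
    show ?thesis
    proof (cases "?e < 0")
      case True
      have "AE x in M. ereal \<bar>f x\<bar> \<le> ?e" by (rule esssup_AE)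
      then have "AE x in M. ereal \<bar>f x\<bar> \<le> - \<infinity>"
      proof eventually_elim
        fix x assume "ereal \<bar>f x\<bar> \<le> ?e"
        then have "ereal \<bar>f x\<bar> < 0" using True by (rule le_less_trans)
        then show "ereal \<bar>f x\<bar> \<le> - \<infinity>" by simp
      qed
      then have "?e \<le> - \<infinity>" by (rule esssup_I[OF m])
      then show ?thesis by simp
    qed (simp add: real_of_ereal_pos)
  qed (simp add: esssup_non_measurable top_ereal_def)
  then show ?thesis using True by (simp add: Lp_norm_def)
qed (simp add: Lp_norm_def)

lemma in_Lp_integrable:
  fixes h :: "real^'n::finite \<Rightarrow> real"
  assumes Lp: "in_Lp p (lebesgue_on U) f" and p: "1 \<le> p" and U: "open U" "bounded U"
    and h[measurable]: "h \<in> borel_measurable borel" and h0: "\<And>x. x \<notin> U \<Longrightarrow> h x = 0" and ae: "AE x in lborel. x \<in> U \<longrightarrow> h x = f x"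
  shows "integrable lborel h"
proof (cases "p = \<infinity>")
  case True
  have "AE x in lborel. x \<in> U \<longrightarrow> \<bar>f x\<bar> \<le> Lp_norm \<infinity> (lebesgue_on U) f"
    using Lp_infinity_AE Lp True U(1) by (simp add: AE_lebesgue_on_open[symmetric])
  with ae have "AE x in lborel. x \<in> U \<longrightarrow> norm (h x) \<le> Lp_norm \<infinity> (lebesgue_on U) f"
    by eventually_elim auto
  then show ?thesis
    using U emeasure_bounded_finite[OF U(2)] h0 by (intro integrableI_bounded_set[where A=U]) auto
next
  case False
  define P where "P = real_of_ereal p"
  have P: "1 \<le> P" using p False by (cases p) (auto simp: P_def)
  have fm: "f \<in> borel_measurable (lebesgue_on U)" using Lp by (simp add: in_Lp_def)
  have "integrable lborel (\<lambda>x. \<bar>h x\<bar> powr P)"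
    using Lp False powr_representative(2)[OF fm U(1) h h0 ae] by (simp add: in_Lp_def P_def)
  moreover have "integrable lborel (indicator U :: _ \<Rightarrow> real)"
    using U emeasure_bounded_finite[OF U(2)] by (intro integrable_real_indicator) auto
  ultimately have i: "integrable lborel (\<lambda>x. indicator U x + \<bar>h x\<bar> powr P)" by (rule Bochner_Integration.integrable_add[rotated])
  show ?thesis
  proof (rule Bochner_Integration.integrable_bound[OF i])
    have "\<bar>h x\<bar> \<le> indicator U x + \<bar>h x\<bar> powr P" for x
    proof (cases "x \<in> U")
      case True
      show ?thesis
      proof (cases "\<bar>h x\<bar> \<le> 1")
        case False
        then have "\<bar>h x\<bar> powr 1 \<le> \<bar>h x\<bar> powr P" using P by (intro powr_mono) auto
        then show ?thesis using True False by simp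
      qed (use True in \<open>simp add: add_increasing2\<close>)
    qed (use h0 in simp)
    then show "AE x in lborel. norm (h x) \<le> norm (indicator U x + \<bar>h x\<bar> powr P)" by (auto intro!: AE_I2)
  qed simp
qed

lemma mpartial_zmi: "mpartial zmi \<phi> = \<phi>"
proof -
  have "foldr (\<lambda>i. partial i ^^ 0) l \<phi> = \<phi>" for l by (induction l) auto
  then show ?thesis by (simp add: mpartial_def)
qed

text \<open>At order zero this is \<open>v\<close> itself, as in the seminorms, rather than a
  function chosen by \<open>weak_deriv\<close>.\<close>

definition wder :: "(real^'n::{finite,linorder}) set \<Rightarrow> (real^'n::{finite,linorder} \<Rightarrow> real) \<Rightarrow> ('n \<Rightarrow> nat) \<Rightarrow> real^'n::{finite,linorder} \<Rightarrow> real" where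
  "wder U v \<gamma> = (if \<gamma> = zmi then v else weak_deriv U \<gamma> v)"

text \<open>At positive order \<open>weak_deriv\<close> is an arbitrary choice among the weak
  derivatives. Its membership in \<open>L^p\<close> follows from uniqueness, by comparison with the
  weak derivative that the Sobolev space provides.\<close>

lemma wder:
  assumes v: "v \<in> Sobolev l p U" and U: "open U" and \<gamma>: "(\<Sum>i\<in>UNIV. \<gamma> i) \<le> l"
  shows "has_weak_deriv U \<gamma> v (wder U v \<gamma>)" "in_Lp p (lebesgue_on U) (wder U v \<gamma>)"
proof -
  from v \<gamma> have "\<exists>g. has_weak_deriv U \<gamma> v g \<and> in_Lp p (lebesgue_on U) g"
    unfolding Sobolev_def by (auto simp: multi_indices_def)
  then obtain g where g: "has_weak_deriv U \<gamma> v g" "in_Lp p (lebesgue_on U) g" by (elim exE conjE)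
  show w: "has_weak_deriv U \<gamma> v (wder U v \<gamma>)"
  proof (cases "\<gamma> = zmi")
    case True
    have "locally_integrable U v" using g by (simp add: has_weak_deriv_def)
    then show ?thesis using True by (simp add: wder_def has_weak_deriv_def mpartial_zmi)
  next
    case False
    then show ?thesis using someI[of "has_weak_deriv U \<gamma> v", OF g(1)] by (simp add: wder_def weak_deriv_def)
  qed
  show "in_Lp p (lebesgue_on U) (wder U v \<gamma>)"
  proof -
    have ae: "AE x in lborel. x \<in> U \<longrightarrow> g x = wder U v \<gamma> x" by (rule weak_deriv_unique[OF U g(1) w])
    have gm: "g \<in> borel_measurable (lebesgue_on U)" using g(2) by (simp add: in_Lp_def)
    show ?thesis
      by (rule in_Lp_AE[OF gm measurable_lebesgue_on_AE[OF U gm ae] _ g(2)]) (use ae U in \<open>simp add: AE_lebesgue_on_open\<close>)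
  qed
qed

text \<open>Multinomial coefficients are at least 1, so a seminorm dominates each of the norms that
  it combines.\<close>

lemma prod_fact_le: "(\<Prod>i\<in>A. fact (\<gamma> i)) \<le> (fact (\<Sum>i\<in>A. \<gamma> i) :: real)"
proof (induction A rule: infinite_finite_induct)
  case (insert i A)
  have "fact (\<gamma> i) * fact (\<Sum>i\<in>A. \<gamma> i) \<le> (fact (\<gamma> i + (\<Sum>i\<in>A. \<gamma> i)) :: nat)"
    by (rule dvd_imp_le[OF fact_fact_dvd_fact]) simp
  then have "real (fact (\<gamma> i) * fact (\<Sum>i\<in>A. \<gamma> i)) \<le> real (fact (\<gamma> i + (\<Sum>i\<in>A. \<gamma> i)))" by (rule of_nat_mono)
  then have "fact (\<gamma> i) * fact (\<Sum>i\<in>A. \<gamma> i) \<le> (fact (\<gamma> i + (\<Sum>i\<in>A. \<gamma> i)) :: real)" by simp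
  moreover have "fact (\<gamma> i) * (\<Prod>i\<in>A. fact (\<gamma> i)) \<le> fact (\<gamma> i) * (fact (\<Sum>i\<in>A. \<gamma> i) :: real)"
    using insert.IH by (intro mult_left_mono) auto
  ultimately show ?case unfolding prod.insert[OF insert.hyps] sum.insert[OF insert.hyps] by linarith
qed auto

lemma multi_indices_0: "multi_indices 0 = {zmi :: 'n::finite \<Rightarrow> nat}"
  by (auto simp: multi_indices_def)

lemma seminorm_wder_fin:
  assumes p: "1 \<le> p" "p \<noteq> \<infinity>"
  shows "Sobolev_seminorm m p U v = (\<Sum>\<gamma>\<in>multi_indices m. fact m / (\<Prod>i\<in>UNIV. fact (\<gamma> i)) *
     Lp_norm p (lebesgue_on U) (wder U v \<gamma>) powr real_of_ereal p) powr (1 / real_of_ereal p)"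
proof (cases "m = 0")
  case True
  have P: "1 \<le> real_of_ereal p" using p by (cases p) auto
  show ?thesis
    using True P by (simp add: Sobolev_seminorm_def multi_indices_0 wder_def powr_powr Lp_norm_nonneg)
next
  case False
  then have "\<gamma> \<noteq> zmi" if "\<gamma> \<in> multi_indices m" for \<gamma> :: "'a \<Rightarrow> nat"
    using that by (auto simp: multi_indices_def)
  then show ?thesis using False p by (simp add: Sobolev_seminorm_def wder_def cong: sum.cong)
qed

lemma seminorm_wder_inf:
  "Sobolev_seminorm m \<infinity> U v = Max ((\<lambda>\<gamma>. Lp_norm \<infinity> (lebesgue_on U) (wder U v \<gamma>)) ` multi_indices m)"
proof (cases "m = 0")
  case True
  then show ?thesis by (simp add: Sobolev_seminorm_def multi_indices_0 wder_def)
next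
  case False
  then have "\<gamma> \<noteq> zmi" if "\<gamma> \<in> multi_indices m" for \<gamma> :: "'a \<Rightarrow> nat"
    using that by (auto simp: multi_indices_def)
  then show ?thesis using False by (simp add: Sobolev_seminorm_def wder_def cong: image_cong)
qed

lemma seminorm_nonneg:
  fixes U :: "(real^'n::{finite,linorder}) set"
  assumes "1 \<le> p"
  shows "0 \<le> Sobolev_seminorm m p U v"
proof (cases "p = \<infinity>")
  case True
  obtain \<gamma> :: "'n \<Rightarrow> nat" where "\<gamma> \<in> multi_indices m" using multi_indices_nonempty by blast
  then have "Lp_norm \<infinity> (lebesgue_on U) (wder U v \<gamma>) \<le> Sobolev_seminorm m \<infinity> U v"
    unfolding seminorm_wder_inf by (intro Max_ge finite_imageI finite_multi_indices imageI)
  then show ?thesis using True Lp_norm_nonneg order_trans by blast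
qed (simp add: seminorm_wder_fin[OF assms])

lemma Lp_norm_le_seminorm:
  fixes U :: "(real^'n::{finite,linorder}) set"
  assumes p: "1 \<le> p" and \<gamma>: "\<gamma> \<in> multi_indices m"
  shows "Lp_norm p (lebesgue_on U) (wder U v \<gamma>) \<le> Sobolev_seminorm m p U v"
proof (cases "p = \<infinity>")
  case True
  show ?thesis
    unfolding True seminorm_wder_inf using \<gamma> by (intro Max_ge finite_imageI finite_multi_indices imageI)
next
  case False
  define P where "P = real_of_ereal p"
  have P: "1 \<le> P" using p False by (cases p) (auto simp: P_def)
  let ?N = "\<lambda>\<gamma>. Lp_norm p (lebesgue_on U) (wder U v \<gamma>)"
  let ?w = "\<lambda>\<gamma> :: 'n \<Rightarrow> nat. fact m / (\<Prod>i\<in>UNIV. fact (\<gamma> i)) :: real"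
  have pos: "0 < (\<Prod>i\<in>UNIV. fact (\<gamma> i) :: real)" for \<gamma> :: "'n \<Rightarrow> nat" by (intro prod_pos) simp
  have "1 \<le> ?w \<gamma>" using prod_fact_le[of \<gamma> UNIV] \<gamma> pos[of \<gamma>] by (simp add: multi_indices_def le_divide_eq_1_pos)
  then have "1 * ?N \<gamma> powr P \<le> ?w \<gamma> * ?N \<gamma> powr P" by (rule mult_right_mono) simp
  moreover have "?w \<gamma> * ?N \<gamma> powr P \<le> (\<Sum>\<gamma>\<in>multi_indices m. ?w \<gamma> * ?N \<gamma> powr P)"
    by (rule member_le_sum[OF \<gamma>]) (auto intro!: mult_nonneg_nonneg divide_nonneg_nonneg prod_nonneg finite_multi_indices)
  ultimately have "?N \<gamma> powr P \<le> (\<Sum>\<gamma>\<in>multi_indices m. ?w \<gamma> * ?N \<gamma> powr P)" by simp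
  then have "(?N \<gamma> powr P) powr (1 / P) \<le> (\<Sum>\<gamma>\<in>multi_indices m. ?w \<gamma> * ?N \<gamma> powr P) powr (1 / P)"
    using P by (intro powr_mono2) auto
  moreover have "(?N \<gamma> powr P) powr (1 / P) = ?N \<gamma>" using P by (simp add: powr_powr Lp_norm_nonneg)
  ultimately show ?thesis unfolding seminorm_wder_fin[OF p False] P_def by simp
qed

text \<open>There are finitely many terms, with weights at most \<open>m!\<close>. The summand 1
  makes the factor at least 1, so that it is dominated by its own \<open>p\<close>-th power and can
  be pulled out of the root independently of \<open>p\<close>.\<close>

lemma seminorm_le:
  fixes U :: "(real^'n::{finite,linorder}) set"
  assumes p: "1 \<le> p" and B: "0 \<le> B" and le: "\<And>\<gamma>. \<gamma> \<in> multi_indices m \<Longrightarrow> Lp_norm p (lebesgue_on U) (wder U v \<gamma>) \<le> B"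
  shows "Sobolev_seminorm m p U v \<le> (1 + real (card (multi_indices m :: ('n \<Rightarrow> nat) set)) * fact m) * B"
proof (cases "p = \<infinity>")
  case True
  have "Sobolev_seminorm m p U v \<le> 1 * B"
    unfolding True seminorm_wder_inf using le True
    by (simp add: finite_multi_indices multi_indices_nonempty)
  also have "\<dots> \<le> (1 + real (card (multi_indices m :: ('n \<Rightarrow> nat) set)) * fact m) * B"
    using B by (intro mult_right_mono) auto
  finally show ?thesis .
next
  case False
  define P where "P = real_of_ereal p"
  have P: "1 \<le> P" using p False by (cases p) (auto simp: P_def)
  let ?N = "\<lambda>\<gamma>. Lp_norm p (lebesgue_on U) (wder U v \<gamma>)"
  let ?w = "\<lambda>\<gamma> :: 'n \<Rightarrow> nat. fact m / (\<Prod>i\<in>UNIV. fact (\<gamma> i)) :: real"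
  let ?c = "real (card (multi_indices m :: ('n \<Rightarrow> nat) set)) * fact m"
  have "(\<Sum>\<gamma>\<in>multi_indices m. ?w \<gamma> * ?N \<gamma> powr P) \<le> (\<Sum>\<gamma>\<in>(multi_indices m :: ('n \<Rightarrow> nat) set). fact m * B powr P)"
  proof (rule sum_mono)
    fix \<gamma> :: "'n \<Rightarrow> nat" assume \<gamma>: "\<gamma> \<in> multi_indices m"
    have "1 \<le> (\<Prod>i\<in>UNIV. fact (\<gamma> i) :: real)" by (intro prod_ge_1) simp
    then have "?w \<gamma> \<le> fact m" by (simp add: divide_le_eq mult_le_cancel_left1)
    moreover have "?N \<gamma> powr P \<le> B powr P" using le[OF \<gamma>] P by (intro powr_mono2 Lp_norm_nonneg) auto
    ultimately show "?w \<gamma> * ?N \<gamma> powr P \<le> fact m * B powr P" by (intro mult_mono) auto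
  qed
  then have "(\<Sum>\<gamma>\<in>multi_indices m. ?w \<gamma> * ?N \<gamma> powr P) \<le> ?c * B powr P" by simp
  moreover have "?c * B powr P \<le> (1 + ?c) powr P * B powr P"
  proof (rule mult_right_mono)
    have "?c \<le> (1 + ?c) powr 1" by simp
    also have "\<dots> \<le> (1 + ?c) powr P" using P by (intro powr_mono) auto
    finally show "?c \<le> (1 + ?c) powr P" .
  qed simp
  moreover have "(1 + ?c) powr P * B powr P = ((1 + ?c) * B) powr P" by (rule powr_mult[symmetric])
  ultimately have "(\<Sum>\<gamma>\<in>multi_indices m. ?w \<gamma> * ?N \<gamma> powr P) \<le> ((1 + ?c) * B) powr P" by linarith
  then have "(\<Sum>\<gamma>\<in>multi_indices m. ?w \<gamma> * ?N \<gamma> powr P) powr (1 / P) \<le> (((1 + ?c) * B) powr P) powr (1 / P)"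
    using P by (intro powr_mono2 sum_nonneg mult_nonneg_nonneg divide_nonneg_nonneg prod_nonneg) auto
  moreover have "(((1 + ?c) * B) powr P) powr (1 / P) = (1 + ?c) * B" using P B by (simp add: powr_powr)
  ultimately show ?thesis unfolding seminorm_wder_fin[OF p False] P_def by simp
qed

section \<open>Uniform bounds for the interpolation error\<close>

definition simplex_vertices :: "('n::finite \<Rightarrow> real) \<Rightarrow> (real^'n) set" where
  "simplex_vertices \<alpha> = insert 0 (range (\<lambda>i. axis i (\<alpha> i)))"

lemma convex_hull_simplex_vertices: "convex hull (simplex_vertices \<alpha>) = scaled_sx (\<alpha> :: 'n::finite \<Rightarrow> real)"
proof -
  have inj: "inj (\<lambda>i. axis i (1::real) :: real^'n)" by (auto simp: inj_def axis1_eq_iff)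
  have ax: "dmap \<alpha> (axis i 1) = axis i (\<alpha> i)" for i
    by (auto simp: dmap_def axis_def vec_eq_iff)
  have "dmap \<alpha> ` insert 0 Basis = simplex_vertices \<alpha>"
    unfolding Basis_range_axis simplex_vertices_def
    by (simp add: image_image ax linear_0[OF linear_dmap])
  moreover have "convex hull (insert 0 Basis) = (std_sx :: (real^'n) set)"
    unfolding std_simplex std_sx_def unfolding Basis_range_axis sum.reindex[OF inj]
    by (simp add: inner_axis)
  ultimately show ?thesis
    unfolding scaled_sx_def using convex_hull_linear_image[OF linear_dmap, of \<alpha> "insert 0 Basis"] by simp
qed

text \<open>The vertex 0 receives the weight missing to \<open>k\<close>. Positivity of
  \<open>\<alpha>\<close> keeps the vertices distinct, so weights can be prescribed on the others
  through \<open>inv f\<close>.\<close>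

lemma dmap_lat_lagrange:
  fixes \<alpha> :: "'n::finite \<Rightarrow> real"
  assumes \<alpha>: "\<And>i. 0 < \<alpha> i" and x: "x \<in> lat k k"
  shows "dmap \<alpha> x \<in> lagrange_points k (simplex_vertices \<alpha>)"
proof -
  obtain a where a: "x = (\<chi> i. real (a i) / real k)" "(\<Sum>i\<in>UNIV. a i) \<le> k" using x by (auto simp: lat_def)
  define f :: "'n \<Rightarrow> real^'n" where "f i = axis i (\<alpha> i)" for i
  have inj: "inj f"
    using \<alpha> by (auto simp: inj_def f_def axis_eq_axis less_imp_neq[symmetric])
  have f0: "f i \<noteq> 0" for i
    using \<alpha>[of i] by (simp add: f_def)
  define b where "b y = (if y = 0 then k - (\<Sum>i\<in>UNIV. a i) else a (inv f y))" for y
  have bf: "b (f i) = a i" for i using f0 inj by (simp add: b_def)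
  have V: "simplex_vertices \<alpha> = insert 0 (range f)" by (simp add: simplex_vertices_def f_def[abs_def])
  have n: "0 \<notin> range f" using f0 by (metis imageE)
  have "(\<Sum>y\<in>simplex_vertices \<alpha>. b y) = b 0 + (\<Sum>i\<in>UNIV. a i)"
    unfolding V using n by (subst sum.insert) (auto simp: sum.reindex[OF inj] bf)
  then have s: "(\<Sum>y\<in>simplex_vertices \<alpha>. b y) = k" using a(2) by (simp add: b_def)
  have "(\<Sum>y\<in>simplex_vertices \<alpha>. (real (b y) / real k) *\<^sub>R y) = (\<Sum>i\<in>UNIV. (real (a i) / real k) *\<^sub>R f i)"
    unfolding V using n by (subst sum.insert) (auto simp: sum.reindex[OF inj] bf)
  also have "\<dots> = dmap \<alpha> x"
  proof (subst vec_eq_iff, rule allI)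
    fix l
    have "(\<Sum>i\<in>UNIV. (real (a i) / real k) *\<^sub>R f i) $ l = (\<Sum>i\<in>UNIV. if i = l then real (a i) / real k * \<alpha> i else 0)"
      unfolding sum_component by (intro sum.cong) (auto simp: f_def axis_def)
    then show "(\<Sum>i\<in>UNIV. (real (a i) / real k) *\<^sub>R f i) $ l = dmap \<alpha> x $ l" by (simp add: dmap_def a)
  qed
  finally show ?thesis unfolding lagrange_points_def using s by (auto intro!: exI[of _ b])
qed

text \<open>Collects Borel representatives, extended by zero, of all weak derivatives of one
  \<open>v\<close> up to order \<open>k + 1\<close>. They agree with \<open>wder\<close> almost
  everywhere on \<open>U\<close>, so norms can be computed from them.\<close>

lemma sob_data_exists:
  fixes \<alpha> :: "'n::{finite,linorder} \<Rightarrow> real"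
  assumes \<alpha>: "\<And>i. 0 < \<alpha> i" "\<And>i. \<alpha> i \<le> 1" and k: "1 \<le> k" and p: "1 \<le> p"
    and v: "v \<in> vanishing_Sobolev k p (simplex_vertices \<alpha>)" and U: "U = interior (scaled_sx \<alpha>)"
  shows "\<exists>g u. sob_data \<alpha> k g u U \<and> (\<forall>\<gamma>. (\<Sum>i\<in>UNIV. \<gamma> i) \<le> k + 1 \<longrightarrow> g \<gamma> \<in> borel_measurable borel \<and>
    (\<forall>x. x \<notin> U \<longrightarrow> g \<gamma> x = 0) \<and> (AE x in lborel. x \<in> U \<longrightarrow> g \<gamma> x = wder U v \<gamma> x))"
proof -
  have S: "v \<in> Sobolev (k + 1) p U" using v unfolding vanishing_Sobolev_def U convex_hull_simplex_vertices by blast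
  from v have "\<exists>u. continuous_on (scaled_sx \<alpha>) u \<and> (AE x in lebesgue_on U. u x = v x) \<and> (\<forall>x\<in>lagrange_points k (simplex_vertices \<alpha>). u x = 0)"
    unfolding vanishing_Sobolev_def U convex_hull_simplex_vertices by blast
  then obtain u where u: "continuous_on (scaled_sx \<alpha>) u" "AE x in lebesgue_on U. u x = v x" "\<forall>x\<in>lagrange_points k (simplex_vertices \<alpha>). u x = 0"
    by (elim exE conjE)
  have oU: "open U" by (simp add: U)
  have "compact (scaled_sx \<alpha>)"
    unfolding scaled_sx_def by (intro compact_continuous_image continuous_dmap compact_std_sx)
  then have bU: "bounded U" unfolding U by (intro bounded_interior compact_imp_bounded)
  have "\<forall>\<gamma> :: 'n \<Rightarrow> nat. \<exists>h. (\<Sum>i\<in>UNIV. \<gamma> i) \<le> k + 1 \<longrightarrow> h \<in> borel_measurable borel \<and>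
    (\<forall>x. x \<notin> U \<longrightarrow> h x = 0) \<and> (AE x in lborel. x \<in> U \<longrightarrow> h x = wder U v \<gamma> x)"
  proof
    fix \<gamma> :: "'n \<Rightarrow> nat"
    show "\<exists>h. (\<Sum>i\<in>UNIV. \<gamma> i) \<le> k + 1 \<longrightarrow> h \<in> borel_measurable borel \<and>
      (\<forall>x. x \<notin> U \<longrightarrow> h x = 0) \<and> (AE x in lborel. x \<in> U \<longrightarrow> h x = wder U v \<gamma> x)"
    proof (cases "(\<Sum>i\<in>UNIV. \<gamma> i) \<le> k + 1")
      case True
      have "wder U v \<gamma> \<in> borel_measurable (lebesgue_on U)" using wder(2)[OF S oU True] by (simp add: in_Lp_def)
      from borel_representative[OF this oU] show ?thesis by blast
    qed blast
  qed
  from choice[OF this] obtain g where g: "\<forall>\<gamma> :: 'n \<Rightarrow> nat. (\<Sum>i\<in>UNIV. \<gamma> i) \<le> k + 1 \<longrightarrow> g \<gamma> \<in> borel_measurable borel \<and>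
    (\<forall>x. x \<notin> U \<longrightarrow> g \<gamma> x = 0) \<and> (AE x in lborel. x \<in> U \<longrightarrow> g \<gamma> x = wder U v \<gamma> x)"
    by (elim exE)
  have g1: "g \<gamma> \<in> borel_measurable borel" if "(\<Sum>i\<in>UNIV. \<gamma> i) \<le> k + 1" for \<gamma> using g that by blast
  have g2: "g \<gamma> x = 0" if "(\<Sum>i\<in>UNIV. \<gamma> i) \<le> k + 1" "x \<notin> U" for \<gamma> x using g that by blast
  have g3: "AE x in lborel. x \<in> U \<longrightarrow> g \<gamma> x = wder U v \<gamma> x" if "(\<Sum>i\<in>UNIV. \<gamma> i) \<le> k + 1" for \<gamma> using g that by blast
  have z: "(\<Sum>i\<in>UNIV. zmi (i::'n)) \<le> k + 1" by simp
  have wm: "wder U v \<gamma> \<in> borel_measurable (lebesgue_on U)" if "(\<Sum>i\<in>UNIV. \<gamma> i) \<le> k + 1" for \<gamma>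
    using wder(2)[OF S oU that] by (simp add: in_Lp_def)
  have "sob_data \<alpha> k g u U"
  proof
    fix \<gamma> :: "'n \<Rightarrow> nat" assume \<gamma>: "(\<Sum>i\<in>UNIV. \<gamma> i) \<le> k + 1"
    show "integrable lborel (g \<gamma>)"
      by (rule in_Lp_integrable[OF wder(2)[OF S oU \<gamma>] p oU bU g1[OF \<gamma>] g2[OF \<gamma>] g3[OF \<gamma>]])
    fix \<epsilon> r :: real and q x :: "real^'n::{finite,linorder}" assume t: "tjet \<epsilon> q r x zmi \<in> test_functions U"
    have m: "mpartial \<gamma> (tjet \<epsilon> q r x zmi) \<in> borel_measurable borel"
      unfolding jet_mpartial[OF jet_tjet] by (rule tjet_measurable)
    have "(LINT x'|lebesgue_on U. v x' * mpartial \<gamma> (tjet \<epsilon> q r x zmi) x') = (- 1) ^ (\<Sum>i\<in>UNIV. \<gamma> i) * (LINT x'|lebesgue_on U. wder U v \<gamma> x' * tjet \<epsilon> q r x zmi x')"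
      using wder(1)[OF S oU \<gamma>] t unfolding has_weak_deriv_def by blast
    moreover have "(LINT x'|lebesgue_on U. wder U v zmi x' * mpartial \<gamma> (tjet \<epsilon> q r x zmi) x') = (\<integral>y. g zmi y * mpartial \<gamma> (tjet \<epsilon> q r x zmi) y \<partial>lborel)"
      by (rule integral_representative[OF wm[OF z] oU g1[OF z] g2[OF z] g3[OF z] m])
    moreover have "(LINT x'|lebesgue_on U. wder U v \<gamma> x' * tjet \<epsilon> q r x zmi x') = (\<integral>y. g \<gamma> y * tjet \<epsilon> q r x zmi y \<partial>lborel)"
      by (rule integral_representative[OF wm[OF \<gamma>] oU g1[OF \<gamma>] g2[OF \<gamma>] g3[OF \<gamma>] tjet_measurable])
    moreover have "wder U v zmi = v" by (simp add: wder_def)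
    ultimately show "(\<integral>y. g zmi y * mpartial \<gamma> (tjet \<epsilon> q r x zmi) y \<partial>lborel) = (- 1) ^ (\<Sum>i\<in>UNIV. \<gamma> i) * (\<integral>y. g \<gamma> y * tjet \<epsilon> q r x zmi y \<partial>lborel)"
      by (simp only:)
  next
    show "AE x in lborel. x \<in> U \<longrightarrow> u x = g zmi x"
      using u(2)[unfolded AE_lebesgue_on_open[OF oU]] g3[OF z]
      by eventually_elim (simp add: wder_def)
  next
    show "u (dmap \<alpha> x) = 0" if "x \<in> lat k k" for x using u(3) dmap_lat_lagrange[of \<alpha>, OF \<alpha>(1) that] by blast
  qed (use \<alpha> k U u in auto)
  with g show ?thesis by blast
qed

text \<open>Each derivative \<open>\<gamma> + \<eta>\<close> on the right has order
  \<open>k + 1\<close> and is bounded by the seminorm of that order; the cardinality in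
  \<open>D\<close> counts them.\<close>

lemma seminorm_bound_fin:
  fixes \<alpha> :: "'n::{finite,linorder} \<Rightarrow> real"
  assumes \<alpha>: "\<And>i. 0 < \<alpha> i" "\<And>i. \<alpha> i \<le> 1" and k: "1 \<le> k" and m: "m \<le> k" and p: "1 \<le> p" "p \<noteq> \<infinity>"
    and v: "v \<in> vanishing_Sobolev k p (simplex_vertices \<alpha>)" and U: "U = interior (scaled_sx \<alpha>)"
    and C: "jet_bd TYPE('n) (real_of_ereal p) k m C" and D: "D = C * 2 ^ CARD('n) * real (card (multi_indices (k + 1 - m) :: ('n \<Rightarrow> nat) set))"
  shows "Sobolev_seminorm m p U v \<le> (1 + real (card (multi_indices m :: ('n \<Rightarrow> nat) set)) * fact m) * (D * Sobolev_seminorm (k + 1) p U v)"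
proof -
  define P where "P = real_of_ereal p"
  have P: "1 \<le> P" using p by (cases p) (auto simp: P_def)
  have C0: "0 \<le> C" using C by (simp add: jet_bd_def)
  have S: "v \<in> Sobolev (k + 1) p U" using v unfolding vanishing_Sobolev_def U convex_hull_simplex_vertices by blast
  have oU: "open U" by (simp add: U)
  from sob_data_exists[OF \<alpha> k p(1) v U] obtain g u where sd: "sob_data \<alpha> k g u U"
    and g: "\<forall>\<gamma>. (\<Sum>i\<in>UNIV. \<gamma> i) \<le> k + 1 \<longrightarrow> g \<gamma> \<in> borel_measurable borel \<and>
    (\<forall>x. x \<notin> U \<longrightarrow> g \<gamma> x = 0) \<and> (AE x in lborel. x \<in> U \<longrightarrow> g \<gamma> x = wder U v \<gamma> x)" by (elim exE conjE)
  interpret sob_data \<alpha> k g u U by (rule sd)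
  have g1: "g \<gamma> \<in> borel_measurable borel" if "(\<Sum>i\<in>UNIV. \<gamma> i) \<le> k + 1" for \<gamma> using g that by blast
  have g2: "g \<gamma> x = 0" if "(\<Sum>i\<in>UNIV. \<gamma> i) \<le> k + 1" "x \<notin> U" for \<gamma> x using g that by blast
  have g3: "AE x in lborel. x \<in> U \<longrightarrow> g \<gamma> x = wder U v \<gamma> x" if "(\<Sum>i\<in>UNIV. \<gamma> i) \<le> k + 1" for \<gamma> using g that by blast
  have wm: "wder U v \<gamma> \<in> borel_measurable (lebesgue_on U)" if "(\<Sum>i\<in>UNIV. \<gamma> i) \<le> k + 1" for \<gamma>
    using wder(2)[OF S oU that] by (simp add: in_Lp_def)
  have Lp: "integrable lborel (\<lambda>x. \<bar>g \<gamma> x\<bar> powr P)" if s: "(\<Sum>i\<in>UNIV. \<gamma> i) \<le> k + 1" for \<gamma>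
    using wder(2)[OF S oU s] p(2) powr_representative(2)[OF wm[OF s] oU g1[OF s] g2[OF s] g3[OF s]]
    by (simp add: in_Lp_def P_def)
  have LN: "Lp_norm p (lebesgue_on U) (wder U v \<gamma>) = Lg P \<gamma>" if s: "(\<Sum>i\<in>UNIV. \<gamma> i) \<le> k + 1" for \<gamma>
    using p(2) powr_representative(1)[OF wm[OF s] oU g1[OF s] g2[OF s] g3[OF s]]
    by (simp add: Lp_norm_def Lg_def P_def)
  show ?thesis
  proof (rule seminorm_le[OF p(1)])
    show "0 \<le> D * Sobolev_seminorm (k + 1) p U v" unfolding D by (intro mult_nonneg_nonneg C0 seminorm_nonneg p) auto
    fix \<gamma> :: "'n \<Rightarrow> nat" assume "\<gamma> \<in> multi_indices m"
    then have \<gamma>: "(\<Sum>i\<in>UNIV. \<gamma> i) = m" by (simp add: multi_indices_def)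
    then have s: "(\<Sum>i\<in>UNIV. \<gamma> i) \<le> k + 1" using m by simp
    have "Lg P \<gamma> \<le> C * 2 ^ CARD('n) * (\<Sum>\<eta>\<in>multi_indices (k + 1 - m). Lg P (\<lambda>i. \<gamma> i + \<eta> i))"
      by (rule fin_transfer[OF C[folded P_def] P \<gamma> m Lp g2[OF s]])
    moreover have "(\<Sum>\<eta>\<in>multi_indices (k + 1 - m). Lg P (\<lambda>i. \<gamma> i + \<eta> i)) \<le> (\<Sum>\<eta>\<in>(multi_indices (k + 1 - m) :: ('n \<Rightarrow> nat) set). Sobolev_seminorm (k + 1) p U v)"
    proof (rule sum_mono)
      fix \<eta> :: "'n \<Rightarrow> nat" assume \<eta>: "\<eta> \<in> multi_indices (k + 1 - m)"
      have e: "(\<Sum>i\<in>UNIV. \<gamma> i + \<eta> i) = k + 1" using \<eta> \<gamma> m by (simp add: multi_indices_def sum.distrib)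
      then have "(\<lambda>i. \<gamma> i + \<eta> i) \<in> multi_indices (k + 1)" by (simp add: multi_indices_def)
      from Lp_norm_le_seminorm[OF p(1) this, of U v] e show "Lg P (\<lambda>i. \<gamma> i + \<eta> i) \<le> Sobolev_seminorm (k + 1) p U v"
        by (simp add: LN)
    qed
    then have "C * 2 ^ CARD('n) * (\<Sum>\<eta>\<in>multi_indices (k + 1 - m). Lg P (\<lambda>i. \<gamma> i + \<eta> i)) \<le> C * 2 ^ CARD('n) * (\<Sum>\<eta>\<in>(multi_indices (k + 1 - m) :: ('n \<Rightarrow> nat) set). Sobolev_seminorm (k + 1) p U v)"
      using C0 by (intro mult_left_mono) auto
    ultimately show "Lp_norm p (lebesgue_on U) (wder U v \<gamma>) \<le> D * Sobolev_seminorm (k + 1) p U v"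
      unfolding LN[OF s] D by (simp add: mult.assoc)
  qed
qed

lemma seminorm_bound_inf:
  fixes \<alpha> :: "'n::{finite,linorder} \<Rightarrow> real"
  assumes \<alpha>: "\<And>i. 0 < \<alpha> i" "\<And>i. \<alpha> i \<le> 1" and k: "1 \<le> k" and m: "m \<le> k"
    and v: "v \<in> vanishing_Sobolev k \<infinity> (simplex_vertices \<alpha>)" and U: "U = interior (scaled_sx \<alpha>)"
    and C: "0 \<le> C" "\<forall>(\<gamma> :: 'n \<Rightarrow> nat) G E B. (\<Sum>i\<in>UNIV. \<gamma> i) = m \<longrightarrow> jet G \<longrightarrow> (\<forall>x\<in>lat k k. \<bar>G zmi x\<bar> \<le> E) \<longrightarrow>
    (\<forall>\<eta>\<in>multi_indices (k + 1 - m). \<forall>x\<in>std_sx. \<bar>G (\<lambda>i. \<gamma> i + \<eta> i) x\<bar> \<le> B) \<longrightarrow> (\<forall>x\<in>std_sx. \<bar>G \<gamma> x\<bar> \<le> C * (E + B))"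
  shows "Sobolev_seminorm m \<infinity> U v \<le> (1 + real (card (multi_indices m :: ('n \<Rightarrow> nat) set)) * fact m) * (C * Sobolev_seminorm (k + 1) \<infinity> U v)"
proof -
  have p: "1 \<le> (\<infinity> :: ereal)" by simp
  have S: "v \<in> Sobolev (k + 1) \<infinity> U" using v unfolding vanishing_Sobolev_def U convex_hull_simplex_vertices by blast
  have oU: "open U" by (simp add: U)
  from sob_data_exists[OF \<alpha> k p v U] obtain g u where sd: "sob_data \<alpha> k g u U"
    and g: "\<forall>\<gamma>. (\<Sum>i\<in>UNIV. \<gamma> i) \<le> k + 1 \<longrightarrow> g \<gamma> \<in> borel_measurable borel \<and>
    (\<forall>x. x \<notin> U \<longrightarrow> g \<gamma> x = 0) \<and> (AE x in lborel. x \<in> U \<longrightarrow> g \<gamma> x = wder U v \<gamma> x)" by (elim exE conjE)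
  interpret sob_data \<alpha> k g u U by (rule sd)
  have g2: "g \<gamma> x = 0" if "(\<Sum>i\<in>UNIV. \<gamma> i) \<le> k + 1" "x \<notin> U" for \<gamma> x using g that by blast
  have g3: "AE x in lborel. x \<in> U \<longrightarrow> g \<gamma> x = wder U v \<gamma> x" if "(\<Sum>i\<in>UNIV. \<gamma> i) \<le> k + 1" for \<gamma> using g that by blast
  let ?B = "Sobolev_seminorm (k + 1) \<infinity> U v"
  have B0: "0 \<le> ?B" by (rule seminorm_nonneg[OF p])
  show ?thesis
  proof (rule seminorm_le[OF p])
    show "0 \<le> C * ?B" using C B0 by simp
    fix \<gamma> :: "'n \<Rightarrow> nat" assume "\<gamma> \<in> multi_indices m"
    then have \<gamma>: "(\<Sum>i\<in>UNIV. \<gamma> i) = m" by (simp add: multi_indices_def)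
    then have s: "(\<Sum>i\<in>UNIV. \<gamma> i) \<le> k + 1" using m by simp
    have wL: "in_Lp \<infinity> (lebesgue_on U) (wder U v \<gamma>)" by (rule wder(2)[OF S oU s])
    have "AE x in lborel. x \<in> U \<longrightarrow> \<bar>g \<gamma> x\<bar> \<le> C * ?B"
    proof (rule sup_transfer[OF C(1) _ \<gamma> m])
      show "\<bar>G \<gamma> x\<bar> \<le> C * (E + B)" if "jet G" "\<forall>x\<in>lat k k. \<bar>G zmi x\<bar> \<le> E"
        "\<forall>\<eta>\<in>multi_indices (k + 1 - m). \<forall>x\<in>std_sx. \<bar>G (\<lambda>i. \<gamma> i + \<eta> i) x\<bar> \<le> B" "x \<in> std_sx" for G E B x
        using C(2)[rule_format, OF \<gamma> that(1), of E B x] that(2-4) by blast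
      fix \<eta> :: "'n \<Rightarrow> nat" assume \<eta>: "\<eta> \<in> multi_indices (k + 1 - m)"
      let ?\<delta> = "\<lambda>i. \<gamma> i + \<eta> i"
      have e: "(\<Sum>i\<in>UNIV. ?\<delta> i) = k + 1" using \<eta> \<gamma> m by (simp add: multi_indices_def sum.distrib)
      then have e': "(\<Sum>i\<in>UNIV. ?\<delta> i) \<le> k + 1" by simp
      have dm: "?\<delta> \<in> multi_indices (k + 1)" using e by (simp add: multi_indices_def)
      have "AE x in lborel. x \<in> U \<longrightarrow> \<bar>wder U v ?\<delta> x\<bar> \<le> Lp_norm \<infinity> (lebesgue_on U) (wder U v ?\<delta>)"
        using Lp_infinity_AE[OF wder(2)[OF S oU e']] by (simp only: AE_lebesgue_on_open[OF oU])
      with g3[OF e'] show "AE x in lborel. \<bar>g ?\<delta> x\<bar> \<le> ?B"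
      proof eventually_elim
        fix x assume a: "x \<in> U \<longrightarrow> g ?\<delta> x = wder U v ?\<delta> x" "x \<in> U \<longrightarrow> \<bar>wder U v ?\<delta> x\<bar> \<le> Lp_norm \<infinity> (lebesgue_on U) (wder U v ?\<delta>)"
        show "\<bar>g ?\<delta> x\<bar> \<le> ?B"
        proof (cases "x \<in> U")
          case True
          with a have "\<bar>g ?\<delta> x\<bar> \<le> Lp_norm \<infinity> (lebesgue_on U) (wder U v ?\<delta>)" by simp
          also have "\<dots> \<le> ?B" by (rule Lp_norm_le_seminorm[OF p dm])
          finally show ?thesis .
        qed (use g2[OF e'] B0 in simp)
      qed
    qed
    with g3[OF s] have "AE x in lborel. x \<in> U \<longrightarrow> \<bar>wder U v \<gamma> x\<bar> \<le> C * ?B" by eventually_elim auto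
    then have "AE x in lebesgue_on U. \<bar>wder U v \<gamma> x\<bar> \<le> C * ?B" by (simp only: AE_lebesgue_on_open[OF oU])
    then show "Lp_norm \<infinity> (lebesgue_on U) (wder U v \<gamma>) \<le> C * ?B"
      using wL C B0 by (intro Lp_infinity_leI) (auto simp: in_Lp_def)
  qed
qed

text \<open>A vanishing denominator forces the numerator to vanish by the hypothesis, and
  \<open>0 / 0 = 0\<close> in \<open>ereal\<close>, so the quotient obeys the bound in that case
  too.\<close>

lemma interp_error_const_le:
  assumes p: "1 \<le> p" and C: "0 \<le> C"
    and le: "\<And>v. v \<in> vanishing_Sobolev k p V \<Longrightarrow> Sobolev_seminorm m p (interior (convex hull V)) v \<le> C * Sobolev_seminorm (k + 1) p (interior (convex hull V)) v"
  shows "interp_error_const m k p V \<le> ereal C"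
  unfolding interp_error_const_def Let_def
proof (rule SUP_least)
  fix v assume v: "v \<in> {v \<in> vanishing_Sobolev k p V. \<not> (AE x in lebesgue_on (interior (convex hull V)). v x = 0)}"
  define a where "a = Sobolev_seminorm m p (interior (convex hull V)) v"
  define b where "b = Sobolev_seminorm (k + 1) p (interior (convex hull V)) v"
  have ab: "a \<le> C * b" using v le by (simp add: a_def b_def)
  have a0: "0 \<le> a" and b0: "0 \<le> b" unfolding a_def b_def by (rule seminorm_nonneg[OF p])+
  have "ereal a / ereal b \<le> ereal C"
  proof (cases "b = 0")
    case True
    then have "a = 0" using ab a0 by simp
    then show ?thesis using True C by (simp add: zero_ereal_def[symmetric])
  next
    case False
    then have "a / b \<le> C" using ab b0 by (simp add: divide_le_eq)
    then show ?thesis using False by simp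
  qed
  then show "ereal (Sobolev_seminorm m p (interior (convex hull V)) v) / ereal (Sobolev_seminorm (k + 1) p (interior (convex hull V)) v) \<le> ereal C"
    by (simp add: a_def b_def)
qed

text \<open>The constant is fixed before \<open>\<alpha>\<close>: it is made of a constant of the
  reference simplex and of numbers of multi-indices. For \<open>p = \<infinity>\<close> the former
  comes from \<open>jet_sup_bd\<close>, otherwise from the hypothesis on
  \<open>level\<close>.\<close>

lemma uniform_interp_error:
  fixes p :: ereal
  assumes k: "1 \<le> k" and m: "m \<le> k" and p: "1 \<le> p"
    and l: "p \<noteq> \<infinity> \<Longrightarrow> level TYPE('n::{finite,linorder}) (real_of_ereal p) k m"
  shows "\<exists>C. \<forall>\<alpha> :: 'n \<Rightarrow> real. (\<forall>i. 0 < \<alpha> i \<and> \<alpha> i \<le> 1) \<longrightarrow> interp_error_const m k p (simplex_vertices \<alpha>) \<le> ereal C"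
proof -
  let ?c = "1 + real (card (multi_indices m :: ('n \<Rightarrow> nat) set)) * fact m"
  show ?thesis
  proof (cases "p = \<infinity>")
    case True
    have "m \<le> k + 1" using m by simp
    from jet_sup_bd[where ?'n='n, OF this k] obtain C where C: "0 \<le> C" "\<forall>(\<gamma> :: 'n \<Rightarrow> nat) G E B. (\<Sum>i\<in>UNIV. \<gamma> i) = m \<longrightarrow> jet G \<longrightarrow> (\<forall>x\<in>lat k k. \<bar>G zmi x\<bar> \<le> E) \<longrightarrow>
      (\<forall>\<eta>\<in>multi_indices (k + 1 - m). \<forall>x\<in>std_sx. \<bar>G (\<lambda>i. \<gamma> i + \<eta> i) x\<bar> \<le> B) \<longrightarrow> (\<forall>x\<in>std_sx. \<bar>G \<gamma> x\<bar> \<le> C * (E + B))"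
      by (elim exE conjE)
    show ?thesis
    proof (intro exI allI impI)
      fix \<alpha> :: "'n \<Rightarrow> real" assume \<alpha>: "\<forall>i. 0 < \<alpha> i \<and> \<alpha> i \<le> 1"
      have \<alpha>': "0 < \<alpha> i" "\<alpha> i \<le> 1" for i using \<alpha> by auto
      show "interp_error_const m k p (simplex_vertices \<alpha>) \<le> ereal (?c * C)"
      proof (rule interp_error_const_le[OF p])
        fix v assume v: "v \<in> vanishing_Sobolev k p (simplex_vertices \<alpha>)"
        from seminorm_bound_inf[OF \<alpha>' k m v[unfolded True] refl C] show "Sobolev_seminorm m p (interior (convex hull simplex_vertices \<alpha>)) v
          \<le> ?c * C * Sobolev_seminorm (k + 1) p (interior (convex hull simplex_vertices \<alpha>)) v"
          unfolding True convex_hull_simplex_vertices by (simp only: mult.assoc)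
      qed (use C in simp)
    qed
  next
    case False
    from level_jet_bd[OF l[OF False]] obtain C where C: "jet_bd TYPE('n) (real_of_ereal p) k m C" by (elim exE)
    then have C0: "0 \<le> C" by (simp add: jet_bd_def)
    define D where "D = C * 2 ^ CARD('n) * real (card (multi_indices (k + 1 - m) :: ('n \<Rightarrow> nat) set))"
    show ?thesis
    proof (intro exI allI impI)
      fix \<alpha> :: "'n \<Rightarrow> real" assume \<alpha>: "\<forall>i. 0 < \<alpha> i \<and> \<alpha> i \<le> 1"
      have \<alpha>': "0 < \<alpha> i" "\<alpha> i \<le> 1" for i using \<alpha> by auto
      show "interp_error_const m k p (simplex_vertices \<alpha>) \<le> ereal (?c * D)"
      proof (rule interp_error_const_le[OF p])
        fix v assume v: "v \<in> vanishing_Sobolev k p (simplex_vertices \<alpha>)"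
        from seminorm_bound_fin[OF \<alpha>' k m p False v refl C D_def] show "Sobolev_seminorm m p (interior (convex hull simplex_vertices \<alpha>)) v
          \<le> ?c * D * Sobolev_seminorm (k + 1) p (interior (convex hull simplex_vertices \<alpha>)) v"
          unfolding convex_hull_simplex_vertices by (simp only: mult.assoc)
      qed (use C0 in \<open>simp add: D_def\<close>)
    qed
  qed
qed

section \<open>The triangle and the tetrahedron\<close>

lemma triangle_vertices_eq: "triangle_vertices \<alpha> = simplex_vertices (\<lambda>i. if i = 1 then 1 else \<alpha>)"
proof -
  have "vector [0, 0] = (0 :: real^2)" "vector [1, 0] = (axis 1 1 :: real^2)" "vector [0, \<alpha>] = (axis 2 \<alpha> :: real^2)"
    by (auto simp: vec_eq_iff forall_2 axis_def)
  then show ?thesis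
    unfolding triangle_vertices_def simplex_vertices_def by (simp add: UNIV_2)
qed

lemma tetrahedron_vertices_eq:
  "tetrahedron_vertices \<alpha> \<beta> = simplex_vertices (\<lambda>i. if i = 1 then 1 else if i = 2 then \<alpha> else \<beta>)"
proof -
  define f :: "3 \<Rightarrow> real" where "f i = (if i = 1 then 1 else if i = 2 then \<alpha> else \<beta>)" for i
  have ne: "(2::3) \<noteq> 1" "(3::3) \<noteq> 1" "(3::3) \<noteq> 2" by simp_all
  then have f: "f 1 = 1" "f 2 = \<alpha>" "f 3 = \<beta>" by (auto simp: f_def)
  have v: "vector [0, 0, 0] = (0 :: real^3)" "vector [1, 0, 0] = (axis 1 1 :: real^3)"
    "vector [0, \<alpha>, 0] = (axis 2 \<alpha> :: real^3)" "vector [0, 0, \<beta>] = (axis 3 \<beta> :: real^3)"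
    unfolding vec_eq_iff forall_3 using ne ne[symmetric] by (auto simp: axis_def)
  have "tetrahedron_vertices \<alpha> \<beta> = simplex_vertices f"
    unfolding tetrahedron_vertices_def simplex_vertices_def UNIV_3 image_insert image_empty f v ..
  then show ?thesis by (simp only: f_def[abs_def])
qed

theorem theorem1p3:
  shows "(\<forall>(k::nat) (m::nat) (p::ereal). 1 \<le> k \<and> m \<le> k \<and> 1 \<le> p \<longrightarrow>
           (\<exists>C::real. \<forall>\<alpha>::real. 0 < \<alpha> \<and> \<alpha> \<le> 1 \<longrightarrow>
              interp_error_const m k p (triangle_vertices \<alpha>) \<le> ereal C))
       \<and> (\<forall>(k::nat) (m::nat) (p::ereal). 1 \<le> k \<and> m \<le> k \<and>
           (k - m = 0 \<and> 2 < p \<or>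
            k = 1 \<and> m = 0 \<and> ereal (3/2) < p \<or>
            2 \<le> k \<and> 1 \<le> k - m \<and> 1 \<le> p) \<longrightarrow>
           (\<exists>C::real. \<forall>(\<alpha>::real) (\<beta>::real). 0 < \<alpha> \<and> \<alpha> \<le> 1 \<and> 0 < \<beta> \<and> \<beta> \<le> 1 \<longrightarrow>
              interp_error_const m k p (tetrahedron_vertices \<alpha> \<beta>) \<le> ereal C))"
proof (intro conjI allI impI)
  fix k m :: nat and p :: ereal
  assume a: "1 \<le> k \<and> m \<le> k \<and> 1 \<le> p"
  have "level TYPE(2) (real_of_ereal p) k m" if "p \<noteq> \<infinity>"
    using a that by (intro level_2D) (cases p; auto)+
  then obtain C where C: "\<forall>a :: 2 \<Rightarrow> real. (\<forall>i. 0 < a i \<and> a i \<le> 1) \<longrightarrow> interp_error_const m k p (simplex_vertices a) \<le> ereal C"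
    using uniform_interp_error[where ?'n=2, of k m p] a by blast
  show "\<exists>C. \<forall>\<alpha>. 0 < \<alpha> \<and> \<alpha> \<le> 1 \<longrightarrow> interp_error_const m k p (triangle_vertices \<alpha>) \<le> ereal C"
  proof (intro exI allI impI)
    fix \<alpha> :: real assume "0 < \<alpha> \<and> \<alpha> \<le> 1"
    then show "interp_error_const m k p (triangle_vertices \<alpha>) \<le> ereal C"
      unfolding triangle_vertices_eq by (intro C[rule_format]) auto
  qed
next
  fix k m :: nat and p :: ereal
  assume a: "1 \<le> k \<and> m \<le> k \<and>
    (k - m = 0 \<and> 2 < p \<or> k = 1 \<and> m = 0 \<and> ereal (3/2) < p \<or> 2 \<le> k \<and> 1 \<le> k - m \<and> 1 \<le> p)"
  have p: "1 \<le> p" using a by (cases p) auto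
  have "level TYPE(3) (real_of_ereal p) k m" if fin: "p \<noteq> \<infinity>"
  proof -
    obtain P where P: "p = ereal P" using p fin by (cases p) auto
    \<comment> \<open>The three alternatives correspond to the traces that can be afforded: faces
      and edges at the top order, point values at the vertices, and face traces alone.\<close>
    from a consider "k = m" "2 < P" | "k = 1" "m = 0" "3 / 2 < P" | "2 \<le> k" "m \<le> k - 1" "1 \<le> P"
      unfolding P by force
    then show ?thesis
    proof cases
      case 1 then show ?thesis using a by (simp add: P level_3D_top)
    next
      case 2 then show ?thesis by (simp only: P real_of_ereal.simps) (rule level_3D_point, simp_all)
    next
      case 3 then show ?thesis by (simp add: P level_3D_low)
    qed
  qed
  then obtain C where C: "\<forall>a :: 3 \<Rightarrow> real. (\<forall>i. 0 < a i \<and> a i \<le> 1) \<longrightarrow> interp_error_const m k p (simplex_vertices a) \<le> ereal C"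
    using uniform_interp_error[where ?'n=3, of k m p] a p by blast
  show "\<exists>C. \<forall>\<alpha> \<beta>. 0 < \<alpha> \<and> \<alpha> \<le> 1 \<and> 0 < \<beta> \<and> \<beta> \<le> 1 \<longrightarrow> interp_error_const m k p (tetrahedron_vertices \<alpha> \<beta>) \<le> ereal C"
  proof (intro exI allI impI)
    fix \<alpha> \<beta> :: real assume "0 < \<alpha> \<and> \<alpha> \<le> 1 \<and> 0 < \<beta> \<and> \<beta> \<le> 1"
    then show "interp_error_const m k p (tetrahedron_vertices \<alpha> \<beta>) \<le> ereal C"
      unfolding tetrahedron_vertices_eq by (intro C[rule_format]) auto
  qed
qed

end
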